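(* Let $S\in\mathcal U_a'$, and let $I\subset(-a;a)$ be a relatively closed interval such that $I\div\mathrm{ch}\,\mathrm{supp}\,S\neq\emptyset$. Then $W=\ker T_{S,I}$ is a $D$-invariant subspace admitting weak spectral synthesis, with residual interval $I_W=I$; and the sequence of exponents of $\mathrm{Exp}(W)$ equals $\mathcal Z_\varphi$, the zero set of $\varphi=\mathcal F(S)$.
   Context: Weight. $\omega:[0;\infty)\to[0;\infty)$ is a non-decreasing continuous function such that: $\varphi_\omega(t):=\omega(e^t)$ is convex on $[0;\infty)$; $\omega(x)=o(x)$ and $\ln x=o(\omega(x))$ as $x\to\infty$; for every $\sigma>1$ there is $C>0$ with $\omega(x+y)\le\sigma(\omega(x)+\omega(y))+C$ for all $x,y\ge0$; $\int_1^\infty\omega(x)x^{-2}\,dx<\infty$. Fix $0<a\le+\infty$ and a sequence $0<c_k\nearrow a$ such that $\{[-c_k;c_k]\}$ is an increasing sequence of closed intervals exhausting $(-a;a)$. Ultradifferentiable functions. Put $\varphi_\omega^*(s)=\sup_t(st-\varphi_\omega(t))$ and, for $f\in C^\infty(-a;a)$, $q\in(0;1)$, $k\in\mathbb N$, $\|f\|_{\omega,q,k}=\sup_{j\in\mathbb N_0}\sup_{|x|\le c_k}|f^{(j)}(x)|e^{-q\varphi_\omega^*(j/q)}$. $\mathcal U_a$ is the space of all $f\in C^\infty(-a;a)$ with $\|f\|_{\omega,q,k}<\infty$ for all $q\in(0;1)$, $k\in\mathbb N$, with the locally convex topology given by these semi-norms. Its strong dual $\mathcal U_a'$ is the space of all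 ultradistributions with compact supports in $(-a;a)$. The Fourier-Laplace transform of $S\in\mathcal U_a'$ is the entire function $\mathcal F(S)(z)=S(e^{-\mathrm itz})$. $\mathcal Z_\varphi$ denotes the zero set of $\varphi$, with multiplicities. $D=d/dx$. A $D$-invariant subspace is a closed subspace $W\subset\mathcal U_a$ with $D(W)\subset W$. $\mathrm{Exp}(W)$ is the set of all exponential monomials $t^je^{-\mathrm i\lambda t}$ ($j\in\mathbb Z_+$, $\lambda\in\mathbb C$) contained in $W$; its sequence of exponents is the sequence of multiple points $\{(\lambda_k;m_k)\}$ such that $\mathrm{Exp}(W)=\{t^je^{-\mathrm i\lambda_kt}: j=0,1,\dots,m_k-1\}_k$. Weak spectral synthesis. For an interval $I\subset(-a;a)$ relatively closed in $(-a;a)$ put $W_I=\{f\in\mathcal U_a: f=0\text{ on }I\}$. The residual interval $I_W$ of a $D$-invariant subspace $W$ is defined by the requirements: $I_W$ is relatively closed in $(-a;a)$, $W_{I_W}\subset W$, and $W_I\setminus W\ne\emptyset$ for every relatively closed interval $I\subsetneq I_W$. $W$ admits weak spectral synthesis if $W=\overline{\mathrm{span}(\mathrm{Exp}(W))+W_{I_W}}$ (closure in $\mathcal U_a$). Local convolution. $\mathrm{ch}\,\mathrm{supp}\,S$ is the convex hull of the support of $S$. For $A,B\subset\mathbb R$, the geometric difference $A\div B$ consists of all $x\in\mathbb R$ such that $x+B\subset A$. With $\widetilde I=I\div\mathrm{ch}\,\mathrm{supp}\,S$, the local convolution operator $T_{S,I}$ maps $f\in\mathcal U_a$ to the function $g$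 on $\widetilde I$ given by $g(y)=S(f(x+y))$, $y\in\widetilde I$ ($S$ acting in the variable $x$). Thus $\ker T_{S,I}=\{f\in\mathcal U_a: S(f(x+y))=0\ \forall y\in\widetilde I\}$.
   Formalization: The formal statement additionally assumes that S is nonzero and that I ÷ ch supp S is not a single point; for S = 0 the claim I_W = I fails for nonempty I, and if I ÷ ch supp S is one point the kernel is a hyperplane that is not D-invariant. *)

theory Defs
  imports
    "HOL-Complex_Analysis.Complex_Analysis"
    "HOL-Library.Function_Algebras"
    "HOL-Library.Landau_Symbols"
begin

section \<open>Weights\<close>

definition weight :: "(real \<Rightarrow> real) \<Rightarrow> bool" where
  "weight \<omega> \<longleftrightarrow>
     (\<forall>x\<ge>0. 0 \<le> \<omega> x) \<and> mono_on {0..} \<omega> \<and> continuous_on {0..} \<omega> \<and>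
     convex_on {0..} (\<lambda>t. \<omega> (exp t)) \<and>
     \<omega> \<in> o[at_top](\<lambda>x. x) \<and> ln \<in> o[at_top](\<omega>) \<and>
     (\<forall>\<sigma>>1. \<exists>C>0. \<forall>x\<ge>0. \<forall>y\<ge>0. \<omega> (x + y) \<le> \<sigma> * (\<omega> x + \<omega> y) + C) \<and>
     (\<lambda>x. \<omega> x / x\<^sup>2) integrable_on {1..}"

text \<open>The Young conjugate of \<open>t \<mapsto> \<omega> (exp t)\<close>, a function on \<open>[0, \<infinity>)\<close>. For a weight and
  \<open>s \<ge> 0\<close> the supremum is finite, because \<open>ln x = o(\<omega> x)\<close>.\<close>

definition young_conj :: "(real \<Rightarrow> real) \<Rightarrow> real \<Rightarrow> real" where
  "young_conj \<omega> s = (SUP t\<in>{0..}. s * t - \<omega> (exp t))"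

section \<open>Ultradifferentiable functions on \<open>(-a, a)\<close>\<close>

definition sym_ival :: "ereal \<Rightarrow> real set" where
  "sym_ival a = {x. ereal \<bar>x\<bar> < a}"

definition exhausting :: "ereal \<Rightarrow> (nat \<Rightarrow> real) \<Rightarrow> bool" where
  "exhausting a c \<longleftrightarrow>
     (\<forall>k. 0 < c k) \<and> incseq c \<and> (\<lambda>k. ereal (c k)) \<longlonglongrightarrow> a \<and>
     (\<Union>k. {- c k..c k}) = sym_ival a"

text \<open>A function on \<open>(-a, a)\<close> is represented by its extension by zero to the real line.\<close>

definition ext_zero :: "ereal \<Rightarrow> (real \<Rightarrow> complex) \<Rightarrow> real \<Rightarrow> complex" where
  "ext_zero a f = (\<lambda>x. if x \<in> sym_ival a then f x else 0)"

definition nderiv :: "nat \<Rightarrow> (real \<Rightarrow> complex) \<Rightarrow> real \<Rightarrow> complex" where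
  "nderiv j = (\<lambda>g x. vector_derivative g (at x)) ^^ j"

definition smooth_fun :: "ereal \<Rightarrow> (real \<Rightarrow> complex) \<Rightarrow> bool" where
  "smooth_fun a f \<longleftrightarrow>
     (\<forall>x. x \<notin> sym_ival a \<longrightarrow> f x = 0) \<and>
     (\<forall>j. \<forall>x\<in>sym_ival a. nderiv j f differentiable (at x))"

definition useminorm ::
    "(real \<Rightarrow> real) \<Rightarrow> (nat \<Rightarrow> real) \<Rightarrow> real \<Rightarrow> nat \<Rightarrow> (real \<Rightarrow> complex) \<Rightarrow> ennreal" where
  "useminorm \<omega> c q k f =
     (SUP j. SUP x\<in>{- c k..c k}.
        ennreal (norm (nderiv j f x) * exp (- q * young_conj \<omega> (real j / q))))"

definition ultradiff :: "(real \<Rightarrow> real) \<Rightarrow> ereal \<Rightarrow> (nat \<Rightarrow> real) \<Rightarrow> (real \<Rightarrow> complex) set" where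
  "ultradiff \<omega> a c =
     {f. smooth_fun a f \<and> (\<forall>q\<in>{0<..<1}. \<forall>k. useminorm \<omega> c q k f < \<infinity>)}"

definition ultratop ::
    "(real \<Rightarrow> real) \<Rightarrow> ereal \<Rightarrow> (nat \<Rightarrow> real) \<Rightarrow> (real \<Rightarrow> complex) topology" where
  "ultratop \<omega> a c = topology_generated_by
     {{g \<in> ultradiff \<omega> a c. useminorm \<omega> c q k (g - f) < ennreal e} | f q k e.
        f \<in> ultradiff \<omega> a c \<and> 0 < q \<and> q < 1 \<and> 0 < e}"

definition cscale :: "complex \<Rightarrow> (real \<Rightarrow> complex) \<Rightarrow> real \<Rightarrow> complex" where
  "cscale u f = (\<lambda>x. u * f x)"

global_interpretation cfun: vector_space cscale
  defines cfun_subspace = cfun.subspace and cfun_span = cfun.span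
  by unfold_locales (auto simp: cscale_def fun_eq_iff algebra_simps)

section \<open>Ultradistributions with compact support in \<open>(-a, a)\<close>\<close>

text \<open>A functional is a map on all functions of which only the values on \<open>ultradiff \<omega> a c\<close> matter.\<close>

definition ultradual ::
    "(real \<Rightarrow> real) \<Rightarrow> ereal \<Rightarrow> (nat \<Rightarrow> real) \<Rightarrow> ((real \<Rightarrow> complex) \<Rightarrow> complex) set" where
  "ultradual \<omega> a c =
     {S. (\<forall>f\<in>ultradiff \<omega> a c. \<forall>g\<in>ultradiff \<omega> a c. S (f + g) = S f + S g) \<and>
         (\<forall>u. \<forall>f\<in>ultradiff \<omega> a c. S (cscale u f) = u * S f) \<and>
         continuous_map (ultratop \<omega> a c) euclidean S}"

definition usupp ::
    "(real \<Rightarrow> real) \<Rightarrow> ereal \<Rightarrow> (nat \<Rightarrow> real) \<Rightarrow> ((real \<Rightarrow> complex) \<Rightarrow> complex) \<Rightarrow> real set" where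
  "usupp \<omega> a c S =
     sym_ival a - \<Union>{V. open V \<and> V \<subseteq> sym_ival a \<and>
       (\<forall>f\<in>ultradiff \<omega> a c.
          compact (closure {x. f x \<noteq> 0}) \<and> closure {x. f x \<noteq> 0} \<subseteq> V \<longrightarrow> S f = 0)}"

definition ch_supp ::
    "(real \<Rightarrow> real) \<Rightarrow> ereal \<Rightarrow> (nat \<Rightarrow> real) \<Rightarrow> ((real \<Rightarrow> complex) \<Rightarrow> complex) \<Rightarrow> real set" where
  "ch_supp \<omega> a c S = convex hull (usupp \<omega> a c S)"

definition exp_monomial :: "ereal \<Rightarrow> nat \<Rightarrow> complex \<Rightarrow> real \<Rightarrow> complex" where
  "exp_monomial a j \<mu> = ext_zero a (\<lambda>t. of_real t ^ j * exp (- \<i> * \<mu> * of_real t))"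

definition fourier_laplace ::
    "ereal \<Rightarrow> ((real \<Rightarrow> complex) \<Rightarrow> complex) \<Rightarrow> complex \<Rightarrow> complex" where
  "fourier_laplace a S z = S (exp_monomial a 0 z)"

text \<open>Multiple points are pairs of a point and its multiplicity.\<close>

definition zero_set :: "(complex \<Rightarrow> complex) \<Rightarrow> (complex \<times> nat) set" where
  "zero_set \<phi> = {(\<mu>, m). \<phi> \<mu> = 0 \<and> int m = zorder \<phi> \<mu>}"

section \<open>\<open>D\<close>-invariant subspaces\<close>

definition D_invariant ::
    "(real \<Rightarrow> real) \<Rightarrow> ereal \<Rightarrow> (nat \<Rightarrow> real) \<Rightarrow> (real \<Rightarrow> complex) set \<Rightarrow> bool" where
  "D_invariant \<omega> a c W \<longleftrightarrow>
     cfun_subspace W \<and> closedin (ultratop \<omega> a c) W \<and>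
     (\<forall>f\<in>W. ext_zero a (\<lambda>x. vector_derivative f (at x)) \<in> W)"

definition Exp_of :: "ereal \<Rightarrow> (real \<Rightarrow> complex) set \<Rightarrow> (real \<Rightarrow> complex) set" where
  "Exp_of a W = {f \<in> W. \<exists>j \<mu>. f = exp_monomial a j \<mu>}"

text \<open>A sequence of multiple points (finite, empty or infinite) with pairwise distinct \<open>\<mu>\<close>s, up to
  the order of its terms, is encoded as a countable set of pairs.\<close>

definition exponents :: "ereal \<Rightarrow> (real \<Rightarrow> complex) set \<Rightarrow> (complex \<times> nat) set \<Rightarrow> bool" where
  "exponents a W \<Lambda> \<longleftrightarrow>
     countable \<Lambda> \<and> inj_on fst \<Lambda> \<and> (\<forall>(\<mu>, m)\<in>\<Lambda>. 1 \<le> m) \<and>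
     Exp_of a W = {exp_monomial a j \<mu> | j \<mu> m. (\<mu>, m) \<in> \<Lambda> \<and> j < m}"

definition rel_closed_interval :: "ereal \<Rightarrow> real set \<Rightarrow> bool" where
  "rel_closed_interval a I \<longleftrightarrow> is_interval I \<and> closedin (top_of_set (sym_ival a)) I"

definition vanishing_on ::
    "(real \<Rightarrow> real) \<Rightarrow> ereal \<Rightarrow> (nat \<Rightarrow> real) \<Rightarrow> real set \<Rightarrow> (real \<Rightarrow> complex) set" where
  "vanishing_on \<omega> a c I = {f \<in> ultradiff \<omega> a c. \<forall>x\<in>I. f x = 0}"

text \<open>The empty set counts as an interval here; for it the last condition reads
  \<open>W \<noteq> ultradiff \<omega> a c\<close>.\<close>

definition is_residual_interval ::
    "(real \<Rightarrow> real) \<Rightarrow> ereal \<Rightarrow> (nat \<Rightarrow> real) \<Rightarrow> (real \<Rightarrow> complex) set \<Rightarrow> real set \<Rightarrow> bool" where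
  "is_residual_interval \<omega> a c W I \<longleftrightarrow>
     rel_closed_interval a I \<and> vanishing_on \<omega> a c I \<subseteq> W \<and>
     (\<forall>J. rel_closed_interval a J \<and> J \<subset> I \<longrightarrow> vanishing_on \<omega> a c J - W \<noteq> {})"

definition residual_interval ::
    "(real \<Rightarrow> real) \<Rightarrow> ereal \<Rightarrow> (nat \<Rightarrow> real) \<Rightarrow> (real \<Rightarrow> complex) set \<Rightarrow> real set" where
  "residual_interval \<omega> a c W = (THE I. is_residual_interval \<omega> a c W I)"

definition weak_spectral_synthesis ::
    "(real \<Rightarrow> real) \<Rightarrow> ereal \<Rightarrow> (nat \<Rightarrow> real) \<Rightarrow> (real \<Rightarrow> complex) set \<Rightarrow> bool" where
  "weak_spectral_synthesis \<omega> a c W \<longleftrightarrow>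
     W = ultratop \<omega> a c closure_of
           {f + g | f g. f \<in> cfun_span (Exp_of a W) \<and>
                         g \<in> vanishing_on \<omega> a c (residual_interval \<omega> a c W)}"

section \<open>Local convolution operators\<close>

definition geom_diff :: "real set \<Rightarrow> real set \<Rightarrow> real set" where
  "geom_diff A B = {x. (\<lambda>b. x + b) ` B \<subseteq> A}"

text \<open>A translate \<open>f(\<cdot> + y)\<close> is defined near the support of \<open>S\<close> but in general not on all of
  \<open>(-a, a)\<close>. As \<open>S\<close> depends only on its argument near its support, the value of \<open>S\<close> at a function
  \<open>g\<close> given near the support of \<open>S\<close> is that at any element of the space agreeing with \<open>g\<close> there.\<close>

definition apply_near_supp ::
    "(real \<Rightarrow> real) \<Rightarrow> ereal \<Rightarrow> (nat \<Rightarrow> real) \<Rightarrow> ((real \<Rightarrow> complex) \<Rightarrow> complex) \<Rightarrow>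
     (real \<Rightarrow> complex) \<Rightarrow> complex" where
  "apply_near_supp \<omega> a c S g =
     (THE v. \<exists>h\<in>ultradiff \<omega> a c. \<exists>V. open V \<and> usupp \<omega> a c S \<subseteq> V \<and>
               (\<forall>x\<in>V. h x = g x) \<and> v = S h)"

definition local_conv ::
    "(real \<Rightarrow> real) \<Rightarrow> ereal \<Rightarrow> (nat \<Rightarrow> real) \<Rightarrow> ((real \<Rightarrow> complex) \<Rightarrow> complex) \<Rightarrow>
     (real \<Rightarrow> complex) \<Rightarrow> real \<Rightarrow> complex" where
  "local_conv \<omega> a c S f y = apply_near_supp \<omega> a c S (\<lambda>x. f (x + y))"

definition local_conv_kernel ::
    "(real \<Rightarrow> real) \<Rightarrow> ereal \<Rightarrow> (nat \<Rightarrow> real) \<Rightarrow> ((real \<Rightarrow> complex) \<Rightarrow> complex) \<Rightarrow>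
     real set \<Rightarrow> (real \<Rightarrow> complex) set" where
  "local_conv_kernel \<omega> a c S I =
     {f \<in> ultradiff \<omega> a c. \<forall>y\<in>geom_diff I (ch_supp \<omega> a c S). local_conv \<omega> a c S f y = 0}"

end

(*
  Write W for the kernel, K = [sl, sr] for the convex hull of supp S, and phi for the transform of S.

  Applying the local convolution to t^j exp(-i mu t) gives exp(-i mu y) times a polynomial in y whose
  coefficients are the derivatives of phi at mu up to order j, so this monomial lies in W iff mu is a
  zero of phi of order > j. If an interval J' misses a point of I, a function supported near
  a suitable translate of an end point of K vanishes on J' but is not annihilated by S; hence the
  residual interval is I.

  For synthesis, Hahn-Banach reduces the claim to T f = 0 for f in W and T a functional that annihilates
  the monomials in W and the functions vanishing on I. Then T is carried by a compact
  [il, ir] inside I, its transform is theta * phi with theta entire, and gamma(s) = S(f(. + s)) vanishes on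
  [p, r] = [il - sl, ir - sr] once f is cut off near [il, ir]. Let eta(s) = T(f(. + s)). The difference E of
  the transform of eta over [0, oo) and theta times the transform of gamma over [r, oo) equals, up to sign,
  the same expression for the other half lines. Dividing in each half plane shows that E is of
  exponential type zero, and then that E is bounded. The same applies to f' and f'', and
  E[f'] = -eta(0) - i z E[f], so by Liouville eta(0) = T f = 0.
*)
theory Submission
  imports Defs "HOL-Real_Asymp.Real_Asymp"
begin

section \<open>Maximum principles and entire quotients\<close>

text \<open>The obstacle is that nothing is known about \<theta>: \<open>S\<close> is an arbitrary
  nonzero functional, so its transform need not have useful lower bounds near the real axis, and
  dividing by it gives no estimate there. Its growth along the imaginary axis, however, is exactly
  given by the end points of the support. This lower bound controls the quotient in two cones about
  the imaginary axis, and Phragmen-Lindelof arguments fill the two sectors about the real axis; that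
  gives type zero. Boundedness needs the strict inequality p < r: where E is large, it is dominated
  by a shifted \<theta> with an extra factor exp(-b |Im z|), b = (r - p)/2. Liouville is needed for
  two derivatives. Boundedness of E[f'] only shows that the constant E[f] is 0; boundedness of
  E[f''] removes the constant E[f'], which is -eta(0). Cut-offs exist by the integral condition on
  \<omega>: they come from infinite convolutions of indicator functions with summable
  widths.\<close>

lemma max_modulus_unbounded:
  fixes f :: "complex \<Rightarrow> complex"
  assumes op: "open \<Omega>" and hol: "f holomorphic_on \<Omega>" and cont: "continuous_on (closure \<Omega>) f"
    and fr: "\<And>z. z \<in> frontier \<Omega> \<Longrightarrow> norm (f z) \<le> B"
    and inf: "\<And>e. e > 0 \<Longrightarrow> \<exists>R. \<forall>z\<in>closure \<Omega>. norm z \<ge> R \<longrightarrow> norm (f z) \<le> B + e"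
    and z: "z \<in> \<Omega>"
  shows "norm (f z) \<le> B"
proof (rule field_le_epsilon)
  fix e :: real assume "e > 0"
  then obtain R where R: "\<And>w. w \<in> closure \<Omega> \<Longrightarrow> norm w \<ge> R \<Longrightarrow> norm (f w) \<le> B + e"
    using inf by blast
  define R' where "R' = max R (norm z + 1)"
  let ?S = "\<Omega> \<inter> ball 0 R'"
  have cl: "closure ?S \<subseteq> closure \<Omega>" by (rule closure_mono) auto
  have "frontier ?S \<subseteq> frontier \<Omega> \<union> (closure \<Omega> \<inter> sphere 0 R')"
  proof
    fix w assume w: "w \<in> frontier ?S"
    have "w \<in> closure ?S" using w by (simp add: frontier_def)
    hence wc: "w \<in> closure \<Omega>" using cl by auto
    have "closure ?S \<subseteq> cball 0 R'" by (rule closure_minimal) auto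
    hence wb: "norm w \<le> R'" using \<open>w \<in> closure ?S\<close> by auto
    have "w \<notin> ?S" using w op by (simp add: frontier_def open_Int interior_open)
    hence "w \<notin> \<Omega> \<or> norm w = R'" using wb by auto
    thus "w \<in> frontier \<Omega> \<union> (closure \<Omega> \<inter> sphere 0 R')"
      using wc op by (auto simp: frontier_def interior_open)
  qed
  moreover have "norm (f w) \<le> B + e" if "w \<in> frontier \<Omega>" for w using fr[OF that] \<open>e > 0\<close> by simp
  moreover have "norm (f w) \<le> B + e" if "w \<in> closure \<Omega> \<inter> sphere 0 R'" for w
    using R[of w] that by (auto simp: R'_def)
  ultimately have bd: "norm (f w) \<le> B + e" if "w \<in> frontier ?S" for w using that by blast
  show "norm (f z) \<le> B + e"
  proof (rule maximum_modulus_frontier[of f ?S])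
    show "f holomorphic_on interior ?S" using hol op by (auto intro: holomorphic_on_subset simp: interior_open open_Int)
    show "continuous_on (closure ?S) f" using cont cl continuous_on_subset by blast
    show "bounded ?S" by (meson bounded_Int bounded_ball)
    show "z \<in> ?S" using z by (auto simp: R'_def)
  qed (use bd in auto)
qed

text \<open>Taking n-th roots removes the constant \<open>C\<close>. This turns a maximum principle
  with a harmless extra factor into a sharp one.\<close>

lemma le_if_powers_bounded:
  fixes x B C :: real
  assumes "0 \<le> x" "0 < B" and "\<And>n. n \<ge> 1 \<Longrightarrow> x ^ n \<le> C * B ^ n"
  shows "x \<le> B"
proof (rule ccontr)
  assume "\<not> x \<le> B"
  hence "x / B > 1" using assms by simp
  then obtain n where n: "(x/B) ^ n > max C 1" using real_arch_pow by blast
  hence "n \<noteq> 0" by (cases n) auto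
  with assms(3)[of n] have "(x/B)^n \<le> C" using assms(2)
    by (simp add: power_divide divide_le_eq)
  thus False using n by simp
qed

text \<open>\<open>\<Omega>\<close> may be unbounded, and at infinity \<open>f\<close> is only known
  to be bounded by \<open>M\<close>. The plain principle is applied to
  \<open>f w ^ n / (w - w0)\<close>, which tends to 0 at infinity and is controlled on the frontier
  because \<open>w0\<close> has distance at least \<open>\<rho>\<close> from
  \<open>\<Omega>\<close>. The extra factor is removed by letting n grow.\<close>

lemma max_modulus_bounded_fun:
  fixes f :: "complex \<Rightarrow> complex"
  assumes op: "open \<Omega>" and hol: "f holomorphic_on \<Omega>" and cont: "continuous_on (closure \<Omega>) f"
    and fr: "\<And>z. z \<in> frontier \<Omega> \<Longrightarrow> norm (f z) \<le> B"
    and bd: "\<And>z. z \<in> closure \<Omega> \<Longrightarrow> norm (f z) \<le> M"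
    and B: "0 < B" and \<rho>: "0 < \<rho>" "ball w0 \<rho> \<inter> \<Omega> = {}"
    and z: "z \<in> \<Omega>"
  shows "norm (f z) \<le> B"
proof (rule le_if_powers_bounded[where C = "norm (z - w0) / \<rho>"])
  fix n :: nat assume n: "n \<ge> 1"
  have "ball w0 \<rho> \<inter> closure \<Omega> = {}" using \<rho>(2) open_Int_closure_eq_empty[of "ball w0 \<rho>" \<Omega>] by auto
  hence far: "\<rho> \<le> norm (w - w0)" if "w \<in> closure \<Omega>" for w
    using that by (force simp: dist_norm norm_minus_commute)
  hence nz: "w \<noteq> w0" if "w \<in> closure \<Omega>" for w using that \<rho>(1) by force
  have sub: "\<Omega> \<subseteq> closure \<Omega>" by (rule closure_subset)
  define K where "K w = f w ^ n / (w - w0)" for w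
  have M: "M \<ge> 0" using bd[of z] z sub norm_ge_zero[of "f z"] by (meson order_trans subsetD)
  have "norm (K z) \<le> B ^ n / \<rho>"
  proof (rule max_modulus_unbounded[OF op _ _ _ _ z])
    show "K holomorphic_on \<Omega>" unfolding K_def using hol nz sub
      by (intro holomorphic_intros) auto
    show "continuous_on (closure \<Omega>) K" unfolding K_def using cont nz by (intro continuous_intros) auto
    show "norm (K w) \<le> B ^ n / \<rho>" if "w \<in> frontier \<Omega>" for w
      unfolding K_def norm_divide norm_power using that far[of w] fr[of w] \<rho> B
      by (intro frac_le power_mono) (auto simp: frontier_def)
    fix e :: real assume e: "e > 0"
    show "\<exists>R. \<forall>w\<in>closure \<Omega>. norm w \<ge> R \<longrightarrow> norm (K w) \<le> B ^ n / \<rho> + e"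
    proof (intro exI ballI impI)
      fix w assume w: "w \<in> closure \<Omega>" "norm w \<ge> M ^ n / e + norm w0 + 1"
      have p: "norm (w - w0) \<ge> M^n / e + 1" using w(2) norm_triangle_ineq2[of w w0] by linarith
      have Mp: "M^n / e \<ge> 0" using M e by auto
      have "norm (K w) \<le> M ^ n / (M^n / e + 1)" unfolding K_def norm_divide norm_power
        using p M bd[OF w(1)] Mp by (intro frac_le power_mono) auto
      also have "\<dots> \<le> e"
      proof -
        have "M ^ n \<le> e * (M ^ n / e + 1)" using e by (simp add: distrib_left)
        thus ?thesis using Mp by (subst pos_divide_le_eq) auto
      qed
      finally show "norm (K w) \<le> B ^ n / \<rho> + e" using B \<rho> by (smt (verit) divide_nonneg_pos zero_le_power)
    qed
  qed
  thus "norm (f z) ^ n \<le> norm (z - w0) / \<rho> * B ^ n"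
    unfolding K_def norm_divide norm_power using nz[of z] z sub \<rho>(1)
    by (simp add: divide_simps subset_iff mult.commute)
qed (use B in auto)


section \<open>Division of entire functions with prescribed zeros\<close>

lemma entire_factor_at:
  fixes f :: "complex \<Rightarrow> complex"
  assumes hol: "f holomorphic_on UNIV" and nz: "f w \<noteq> 0"
  obtains h where "h holomorphic_on UNIV" "h a \<noteq> 0"
    "\<And>z. f z = (z - a) ^ nat (zorder f a) * h z"
proof -
  define n where "n = nat (zorder f a)"
  define g where "g = zor_poly f a"
  obtain r where r: "r > 0" "g holomorphic_on cball a r"
    "\<And>w. w \<in> cball a r \<Longrightarrow> f w = g w * (w - a) ^ n \<and> g w \<noteq> 0"
  proof -
    have "\<exists>r. r > 0 \<and> cball a r \<subseteq> UNIV \<and> g holomorphic_on cball a r \<and>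
        (\<forall>w\<in>cball a r. f w = g w * (w - a) ^ n \<and> g w \<noteq> 0)"
      using zorder_exist_zero[of f UNIV a] hol nz unfolding n_def g_def by blast
    thus ?thesis using that by blast
  qed
  define h where "h z = (if z = a then g a else f z / (z - a) ^ n)" for z
  have hg: "h z = g z" if "z \<in> ball a r" for z
    using r(3)[of z] that by (auto simp: h_def)
  have "h holomorphic_on ball a r"
    using r(2) hg by (metis ball_subset_cball holomorphic_cong holomorphic_on_subset)
  moreover have "(\<lambda>z. f z / (z - a) ^ n) holomorphic_on UNIV - {a}"
    using hol by (intro holomorphic_intros) (auto intro: holomorphic_on_subset)
  hence "h holomorphic_on UNIV - {a}" by (rule holomorphic_transform) (auto simp: h_def)
  ultimately have "h holomorphic_on ball a r \<union> (UNIV - {a})"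
    by (rule holomorphic_on_Un) auto
  moreover have "ball a r \<union> (UNIV - {a}) = UNIV" using r(1) by auto
  moreover have "h a \<noteq> 0" using r(3)[of a] r(1) by (auto simp: h_def)
  moreover have "f z = (z - a) ^ n * h z" for z
    using r(3)[of a] r(1) by (auto simp: h_def)
  ultimately show ?thesis using that unfolding n_def by metis
qed

text \<open>At each point \<open>a\<close> the factor \<open>(z - a) ^ m\<close>, with m the order
  of \<open>g\<close>, is split off both functions, so that \<open>k a a \<noteq> 0\<close>. The
  quotient at \<open>z\<close> is defined by the factors belonging to \<open>z\<close> itself and
  agrees near \<open>a\<close> with \<open>s a z / k a z\<close>; holomorphy is thus a local matter
  and no singularity has to be removed.\<close>

lemma entire_division:
  fixes f g :: "complex \<Rightarrow> complex"
  assumes f: "f holomorphic_on UNIV" and g: "g holomorphic_on UNIV" and nz: "g w \<noteq> 0"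
    and van: "\<And>a j. g a = 0 \<Longrightarrow> j < nat (zorder g a) \<Longrightarrow> (deriv ^^ j) f a = 0"
  obtains h where "h holomorphic_on UNIV" "\<And>z. f z = g z * h z"
proof (cases "\<forall>z. f z = 0")
  case True
  thus ?thesis using that[of "\<lambda>_. 0"] by auto
next
  case False
  then obtain w' where w': "f w' \<noteq> 0" by auto
  have ex: "\<exists>s k. s holomorphic_on UNIV \<and> k holomorphic_on UNIV \<and> k a \<noteq> 0 \<and>
     (\<exists>m. \<forall>z. f z = (z - a) ^ m * s z \<and> g z = (z - a) ^ m * k z)" for a
  proof -
    obtain k where k: "k holomorphic_on UNIV" "k a \<noteq> 0" "\<And>z. g z = (z - a) ^ nat (zorder g a) * k z"
      using entire_factor_at[OF g nz] by blast
    obtain l where l: "l holomorphic_on UNIV" "\<And>z. f z = (z - a) ^ nat (zorder f a) * l z"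
      using entire_factor_at[OF f w'] by blast
    have "\<exists>n. (deriv ^^ n) f a \<noteq> 0"
      using holomorphic_fun_eq_0_on_connected[OF f, of a w'] w' by auto
    define n where "n = (LEAST n. (deriv ^^ n) f a \<noteq> 0)"
    have n: "(deriv ^^ n) f a \<noteq> 0" "\<And>i. i < n \<Longrightarrow> (deriv ^^ i) f a = 0"
      using LeastI_ex[OF \<open>\<exists>n. _\<close>] not_less_Least unfolding n_def by auto
    have zf: "zorder f a = int n" by (rule zorder_zero_eqI[OF f]) (use n in auto)
    define m where "m = nat (zorder g a)"
    have "m \<le> n"
    proof (cases "g a = 0")
      case True
      thus ?thesis using van[of a n] n(1) unfolding m_def by (meson leI)
    next
      case False
      have "zorder g a = 0"
        using zorder_exist_zero[of g UNIV a] g False by auto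
      thus ?thesis by (simp add: m_def)
    qed
    have "f z = (z - a) ^ m * ((z - a) ^ (n - m) * l z)" for z
      using l(2)[of z] \<open>m \<le> n\<close> zf by (simp add: mult.assoc[symmetric] power_add[symmetric])
    moreover have "(\<lambda>z. (z - a) ^ (n - m) * l z) holomorphic_on UNIV"
      using l(1) by (intro holomorphic_intros)
    ultimately show ?thesis using k unfolding m_def by blast
  qed
  then obtain s k where sk: "\<And>a. s a holomorphic_on UNIV" "\<And>a. k a holomorphic_on UNIV" "\<And>a. k a a \<noteq> 0"
    "\<And>a. \<exists>m. \<forall>z. f z = (z - a) ^ m * s a z \<and> g z = (z - a) ^ m * k a z" by metis
  define h where "h z = s z z / k z z" for z
  have loc: "h z = s a z / k a z" if "k a z \<noteq> 0" for a z
  proof (cases "z = a")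
    case False
    obtain m where m: "\<And>z. f z = (z - a) ^ m * s a z" "\<And>z. g z = (z - a) ^ m * k a z" using sk(4) by blast
    have gz: "g z \<noteq> 0" using m(2)[of z] False that by auto
    obtain m' where m': "\<And>w. f w = (w - z) ^ m' * s z w" "\<And>w. g w = (w - z) ^ m' * k z w" using sk(4) by blast
    have "m' = 0" using m'(2)[of z] gz by (cases m') auto
    hence "h z = f z / g z" using m'(1)[of z] m'(2)[of z] by (simp add: h_def)
    also have "\<dots> = s a z / k a z" using m False by simp
    finally show ?thesis .
  qed (simp add: h_def)
  have "h field_differentiable (at a)" for a
  proof -
    have "continuous_on UNIV (k a)" using sk(2) holomorphic_on_imp_continuous_on by blast
    hence op: "open {z. k a z \<noteq> 0}" by (intro open_Collect_neq) auto
    have "(\<lambda>z. s a z / k a z) holomorphic_on {z. k a z \<noteq> 0}"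
      using sk(1)[of a] sk(2)[of a] by (intro holomorphic_intros) (auto intro: holomorphic_on_subset)
    hence "h holomorphic_on {z. k a z \<noteq> 0}" by (rule holomorphic_transform) (auto simp: loc)
    thus ?thesis using op sk(3)[of a] holomorphic_on_imp_differentiable_at by blast
  qed
  hence "h holomorphic_on UNIV" by (simp add: holomorphic_on_def field_differentiable_at_within)
  moreover have "f z = g z * h z" for z
  proof -
    obtain m where "\<And>w. f w = (w - z) ^ m * s z w" "\<And>w. g w = (w - z) ^ m * k z w" using sk(4) by blast
    thus ?thesis using sk(3)[of z] by (simp add: h_def)
  qed
  ultimately show ?thesis using that by blast
qed

lemma entire_factor_finite:
  fixes f :: "complex \<Rightarrow> complex"
  assumes "finite Z" and f: "f holomorphic_on UNIV" "f w \<noteq> 0"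
  shows "\<exists>as g. set as \<subseteq> Z \<and> g holomorphic_on UNIV \<and>
     (\<forall>z. f z = prod_list (map (\<lambda>a. z - a) as) * g z) \<and> (\<forall>z\<in>Z. g z \<noteq> 0)"
  using assms(1)
proof (induction Z)
  case empty
  show ?case using f by (intro exI[of _ "[]"] exI[of _ f]) auto
next
  case (insert a Z)
  then obtain as g where IH: "set as \<subseteq> Z" "g holomorphic_on UNIV"
    "\<And>z. f z = prod_list (map (\<lambda>a. z - a) as) * g z" "\<And>z. z \<in> Z \<Longrightarrow> g z \<noteq> 0" by blast
  have "g w \<noteq> 0" using IH(3)[of w] f(2) by auto
  then obtain h where h: "h holomorphic_on UNIV" "h a \<noteq> 0" "\<And>z. g z = (z - a) ^ nat (zorder g a) * h z"
    using entire_factor_at[OF IH(2)] by blast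
  let ?as = "replicate (nat (zorder g a)) a @ as"
  have "f z = prod_list (map (\<lambda>a. z - a) ?as) * h z" for z
    using IH(3)[of z] h(3)[of z] by (simp add: prod_list_replicate map_replicate_const)
  moreover have "h z \<noteq> 0" if "z \<in> insert a Z" for z
    using that h(2) h(3)[of z] IH(4)[of z] by auto
  moreover have "set ?as \<subseteq> insert a Z" using IH(1) by (auto split: if_splits)
  ultimately show ?case using h(1) by blast
qed

section \<open>Lower bounds in discs and estimates of quotients\<close>

text \<open>Harnack's inequality for the nonnegative harmonic function \<open>ln (A / |f|)\<close>;
  its constant \<open>(1 + \<kappa>) / (1 - \<kappa>)\<close> becomes the exponent. The proof is
  that of Borel-Caratheodory: a branch of \<open>ln f\<close> minus its value at the centre maps
  into a half plane, which is mapped to the disc so that the Schwarz lemma applies.\<close>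

lemma zero_free_lower_bound:
  fixes f :: "complex \<Rightarrow> complex"
  assumes hol: "f holomorphic_on ball c R" and R: "0 < R"
    and nz: "\<And>z. z \<in> ball c R \<Longrightarrow> f z \<noteq> 0"
    and bd: "\<And>z. z \<in> ball c R \<Longrightarrow> norm (f z) \<le> A"
    and \<kappa>: "0 \<le> \<kappa>" "\<kappa> < 1" "norm (z - c) \<le> \<kappa> * R"
  shows "A * (norm (f c) / A) powr ((1 + \<kappa>) / (1 - \<kappa>)) \<le> norm (f z)"
proof -
  have A: "A > 0" using bd[of c] nz[of c] R by (metis centre_in_ball norm_le_zero_iff not_le order_trans)
  have "simply_connected (ball c R)" by (simp add: convex_imp_simply_connected)
  then obtain g where g: "g holomorphic_on ball c R" "\<And>z. z \<in> ball c R \<Longrightarrow> f z = exp (g z)"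
    using simply_connected_eq_holomorphic_log[of "ball c R"] hol nz by blast
  define a where "a = ln A - Re (g c)"
  have ge: "Re (g w) \<le> ln A" if "w \<in> ball c R" for w
  proof -
    have "exp (Re (g w)) \<le> A" using bd[OF that] g(2)[OF that] by simp
    thus ?thesis using A by (simp add: ln_ge_iff)
  qed
  define p where "p \<zeta> = g (c + of_real R * \<zeta>) - g c" for \<zeta>
  have inb: "c + of_real R * \<zeta> \<in> ball c R" if "norm \<zeta> < 1" for \<zeta>
    using that R by (simp add: dist_norm norm_mult)
  have holp: "p holomorphic_on ball 0 1"
  proof -
    have "(g \<circ> (\<lambda>\<zeta>. c + of_real R * \<zeta>)) holomorphic_on ball 0 1"
      by (rule holomorphic_on_compose_gen[of _ _ g "ball c R"]) (use g(1) inb in \<open>auto intro!: holomorphic_intros\<close>)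
    thus ?thesis unfolding p_def by (auto intro!: holomorphic_intros simp: o_def)
  qed
  have pa: "Re (p \<zeta>) \<le> a" if "norm \<zeta> < 1" for \<zeta>
    using ge[OF inb[OF that]] by (simp add: p_def a_def)
  define \<zeta> where "\<zeta> = (z - c) / of_real R"
  have \<zeta>: "norm \<zeta> \<le> \<kappa>" using \<kappa> R by (simp add: \<zeta>_def norm_divide divide_le_eq)
  have "- Re (p \<zeta>) * (1 - \<kappa>) \<le> 2 * \<kappa> * a"
  proof (rule field_le_epsilon)
    fix e :: real assume e: "e > 0"
    \<comment> \<open>The margin \<open>e / 2\<close> makes \<open>b\<close> positive even if
      \<open>a = 0\<close> and keeps \<open>2 b - p\<close> nonzero, so that \<open>q\<close> maps
      into the open disc.\<close>
    define b where "b = a + e / 2"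
    have a0: "a \<ge> 0" using pa[of 0] by (simp add: p_def)
    have b: "b > 0" using a0 e by (simp add: b_def)
    define q where "q \<xi> = p \<xi> / (2 * of_real b - p \<xi>)" for \<xi>
    have pb: "Re (p \<xi>) < b" if "norm \<xi> < 1" for \<xi> using pa[OF that] e by (simp add: b_def)
    have ne: "2 * of_real b - p \<xi> \<noteq> 0" if "norm \<xi> < 1" for \<xi>
    proof
      assume "2 * of_real b - p \<xi> = 0"
      hence "Re (2 * of_real b - p \<xi>) = 0" by simp
      thus False using pb[OF that] b by simp
    qed
    have lt: "norm (p \<xi>) < norm (2 * of_real b - p \<xi>)" if "norm \<xi> < 1" for \<xi>
    proof -
      have "(Re (p \<xi>))\<^sup>2 + (Im (p \<xi>))\<^sup>2 < (2 * b - Re (p \<xi>))\<^sup>2 + (Im (p \<xi>))\<^sup>2"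
        using mult_strict_left_mono[OF pb[OF that] b] by (simp add: power2_eq_square algebra_simps)
      thus ?thesis by (simp add: cmod_def)
    qed
    have "norm (q \<zeta>) \<le> norm \<zeta>"
    proof (rule Schwarz_Lemma(1))
      show "q holomorphic_on ball 0 1" unfolding q_def
        using holp ne by (intro holomorphic_intros) auto
      show "q 0 = 0" by (simp add: q_def p_def)
      show "norm (q \<xi>) < 1" if "norm \<xi> < 1" for \<xi>
        using lt[OF that] ne[OF that] by (simp add: q_def norm_divide)
      show "norm \<zeta> < 1" using \<zeta> \<kappa> by simp
    qed
    hence q: "norm (q \<zeta>) \<le> \<kappa>" using \<zeta> by simp
    have "norm \<zeta> < 1" using \<zeta> \<kappa> by simp
    hence "p \<zeta> = q \<zeta> * (2 * of_real b - p \<zeta>)" using ne[of \<zeta>] by (simp add: q_def)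
    hence "norm (p \<zeta>) \<le> \<kappa> * norm (2 * of_real b - p \<zeta>)"
      using q by (metis mult_right_mono norm_ge_zero norm_mult)
    also have "\<dots> \<le> \<kappa> * (2 * b + norm (p \<zeta>))"
      using norm_triangle_ineq4[of "2 * of_real b" "p \<zeta>"] b \<kappa> by (intro mult_left_mono) (auto simp: norm_mult)
    finally have "norm (p \<zeta>) * (1 - \<kappa>) \<le> 2 * \<kappa> * b" by (simp add: algebra_simps)
    moreover have "- Re (p \<zeta>) * (1 - \<kappa>) \<le> norm (p \<zeta>) * (1 - \<kappa>)"
      using \<kappa> abs_Re_le_cmod[of "p \<zeta>"] by (intro mult_right_mono) auto
    moreover have "2 * \<kappa> * b \<le> 2 * \<kappa> * a + e" using \<kappa> e by (simp add: b_def algebra_simps mult_left_le_one_le)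
    ultimately show "- Re (p \<zeta>) * (1 - \<kappa>) \<le> 2 * \<kappa> * a + e" by linarith
  qed
  moreover have "p \<zeta> = g z - g c" using R by (simp add: p_def \<zeta>_def)
  ultimately have "(Re (g c) - Re (g z)) * (1 - \<kappa>) \<le> 2 * \<kappa> * a" by simp
  hence "Re (g c) - Re (g z) \<le> 2 * \<kappa> * a / (1 - \<kappa>)" using \<kappa> by (simp add: pos_le_divide_eq)
  moreover have "(1 + \<kappa>) / (1 - \<kappa>) = 1 + 2 * \<kappa> / (1 - \<kappa>)" using \<kappa> by (simp add: divide_simps)
  hence "ln A + (1 + \<kappa>) / (1 - \<kappa>) * (Re (g c) - ln A) = Re (g c) - 2 * \<kappa> * a / (1 - \<kappa>)"
    by (simp add: a_def algebra_simps diff_divide_distrib)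
  ultimately have *: "ln A + (1 + \<kappa>) / (1 - \<kappa>) * (Re (g c) - ln A) \<le> Re (g z)" by simp
  have zb: "z \<in> ball c R" using \<kappa> R by (auto simp: dist_norm norm_minus_commute intro: le_less_trans)
  have fc: "norm (f c) = exp (Re (g c))" and fz: "norm (f z) = exp (Re (g z))"
    using g(2)[of c] g(2)[OF zb] R by auto
  have "A * (norm (f c) / A) powr ((1 + \<kappa>) / (1 - \<kappa>)) = exp (ln A + (1 + \<kappa>) / (1 - \<kappa>) * (Re (g c) - ln A))"
    using A by (simp add: fc powr_def ln_div exp_add)
  thus ?thesis using * fz by simp
qed

text \<open>The first two claims are read off from the identity \<open>|R^2 - cnj b u|^2 = R^2 |u -
  b|^2 + (R^2 - |u|^2) (R^2 - |b|^2)\<close>.\<close>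

lemma Blaschke_factor_bound:
  fixes u b :: complex
  assumes "norm b < R" "norm u \<le> R"
  shows "norm (u - b) \<le> norm (of_real (R\<^sup>2) - cnj b * u) / R"
    and "norm u = R \<Longrightarrow> norm (u - b) = norm (of_real (R\<^sup>2) - cnj b * u) / R"
    and "of_real (R\<^sup>2) - cnj b * u \<noteq> 0"
proof -
  have R: "R > 0" using assms(1) by (meson norm_ge_zero order_le_less_trans)
  have id: "(norm (of_real (R\<^sup>2) - cnj b * u))\<^sup>2 = R\<^sup>2 * (norm (u - b))\<^sup>2 + (R\<^sup>2 - (norm u)\<^sup>2) * (R\<^sup>2 - (norm b)\<^sup>2)"
    unfolding cmod_power2 by (simp add: power2_eq_square algebra_simps)
  have "(norm u)\<^sup>2 \<le> R\<^sup>2" "(norm b)\<^sup>2 < R\<^sup>2" using assms by (auto intro: power_mono power_strict_mono)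
  hence "R\<^sup>2 * (norm (u - b))\<^sup>2 \<le> (norm (of_real (R\<^sup>2) - cnj b * u))\<^sup>2" using id by simp
  hence "(R * norm (u - b))\<^sup>2 \<le> (norm (of_real (R\<^sup>2) - cnj b * u))\<^sup>2"
    by (simp only: power_mult_distrib)
  hence "R * norm (u - b) \<le> norm (of_real (R\<^sup>2) - cnj b * u)"
    by (rule power2_le_imp_le) (rule norm_ge_zero)
  thus "norm (u - b) \<le> norm (of_real (R\<^sup>2) - cnj b * u) / R" using R by (simp add: le_divide_eq mult.commute)
  show "norm (u - b) = norm (of_real (R\<^sup>2) - cnj b * u) / R" if "norm u = R"
  proof -
    have "(norm (of_real (R\<^sup>2) - cnj b * u))\<^sup>2 = (R * norm (u - b))\<^sup>2" using id that by (simp add: power_mult_distrib)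
    hence "norm (of_real (R\<^sup>2) - cnj b * u) = R * norm (u - b)" using R by (simp add: power2_eq_iff_nonneg)
    thus ?thesis using R by simp
  qed
  have "norm (cnj b * u) < R\<^sup>2"
    using assms R by (simp add: norm_mult power2_eq_square) (smt (verit, best) mult_left_mono mult_strict_right_mono norm_ge_zero)
  thus "of_real (R\<^sup>2) - cnj b * u \<noteq> 0" by (metis abs_power2 eq_iff_diff_eq_0 less_irrefl norm_of_real)
qed

lemma prod_list_mono_nonneg:
  fixes u v :: "'a \<Rightarrow> real"
  assumes "\<And>a. a \<in> set xs \<Longrightarrow> 0 \<le> u a \<and> u a \<le> v a"
  shows "prod_list (map u xs) \<le> prod_list (map v xs)"
  using assms
proof (induction xs)
  case (Cons a xs)
  have "0 \<le> prod_list (map u xs)" using Cons.prems by (intro prod_list_nonneg) auto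
  thus ?case using Cons by (auto intro!: mult_mono intro: order_trans)
qed simp

text \<open>The zeros of \<open>f\<close> in the disc are traded for Blaschke denominators. The
  result \<open>f'\<close> is zero-free, has the modulus of \<open>f\<close> on the circle and at
  least the modulus of \<open>f\<close> at the centre. Hence \<open>f' * E\<close> inherits the
  bound \<open>B\<close> of \<open>N\<close> by the maximum principle, and
  \<open>zero_free_lower_bound\<close> applies to \<open>f'\<close> at every point, with no
  exceptional discs about the zeros of \<open>f\<close>.\<close>

lemma entire_quotient_bound:
  fixes f N E :: "complex \<Rightarrow> complex"
  assumes f: "f holomorphic_on UNIV" and E: "E holomorphic_on UNIV"
    and NE: "\<And>z. N z = f z * E z"
    and A: "\<And>z. z \<in> cball c R \<Longrightarrow> norm (f z) \<le> A"
    and B: "\<And>z. z \<in> cball c R \<Longrightarrow> norm (N z) \<le> B"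
    and fc: "f c \<noteq> 0" and R: "0 < R"
    and \<kappa>: "0 \<le> \<kappa>" "\<kappa> < 1" "norm (z - c) \<le> \<kappa> * R"
  shows "norm (E z) \<le> (B / A) * (A / norm (f c)) powr ((1 + \<kappa>) / (1 - \<kappa>))"
proof -
  have A0: "A > 0" using A[of c] fc R by (metis centre_in_cball less_eq_real_def norm_le_zero_iff not_le order_trans)
  define Z where "Z = {z\<in>ball c R. f z = 0}"
  have "finite {z\<in>cball c R. f z = 0}"
  proof (cases "f constant_on UNIV")
    case True
    hence "{z\<in>cball c R. f z = 0} = {}" using fc by (auto simp: constant_on_def)
    thus ?thesis by (metis finite.emptyI)
  next
    case False
    thus ?thesis by (intro holomorphic_compact_finite_zeros[OF f]) auto
  qed
  hence "finite Z" by (rule rev_finite_subset) (auto simp: Z_def)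
  obtain as g where g0: "set as \<subseteq> Z \<and> g holomorphic_on UNIV \<and>
     (\<forall>z. f z = prod_list (map (\<lambda>a. z - a) as) * g z) \<and> (\<forall>z\<in>Z. g z \<noteq> 0)"
    using entire_factor_finite[OF \<open>finite Z\<close> f fc] by (elim exE) (rule that)
  have g: "set as \<subseteq> Z" "g holomorphic_on UNIV"
    "\<And>z. f z = prod_list (map (\<lambda>a. z - a) as) * g z" "\<And>z. z \<in> Z \<Longrightarrow> g z \<noteq> 0"
    using g0 by auto
  define P where "P z = prod_list (map (\<lambda>a. z - a) as)" for z
  define Q where "Q z = prod_list (map (\<lambda>a. (of_real (R\<^sup>2) - cnj (a - c) * (z - c)) / of_real R) as)" for z
  have as: "\<And>a. a \<in> set as \<Longrightarrow> norm (a - c) < R" using g(1) by (auto simp: Z_def dist_norm norm_minus_commute)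
  have normprod: "norm (prod_list (map h as)) = prod_list (map (\<lambda>a. norm (h a)) as)" for h :: "complex \<Rightarrow> complex"
    by (induction as) (auto simp: norm_mult)
  have PQ: "norm (P z) \<le> norm (Q z)" if "norm (z - c) \<le> R" for z
  proof -
    have "norm (z - a) \<le> norm ((of_real (R\<^sup>2) - cnj (a - c) * (z - c)) / of_real R)" if "a \<in> set as" for a
      using Blaschke_factor_bound(1)[of "a - c" R "z - c"] as[OF that] \<open>norm (z - c) \<le> R\<close> R
      by (simp add: norm_divide)
    thus ?thesis unfolding P_def Q_def normprod by (intro prod_list_mono_nonneg) auto
  qed
  have PQ': "norm (P z) = norm (Q z)" if "norm (z - c) = R" for z
  proof -
    have "prod_list (map (\<lambda>a. norm (z - a)) bs) =
        prod_list (map (\<lambda>a. norm ((of_real (R\<^sup>2) - cnj (a - c) * (z - c)) / of_real R)) bs)" if "set bs \<subseteq> set as" for bs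
      using that
    proof (induction bs)
      case (Cons a bs)
      have "norm ((z - c) - (a - c)) = norm (of_real (R\<^sup>2) - cnj (a - c) * (z - c)) / R"
        using Blaschke_factor_bound(2)[of "a - c" R "z - c"] as Cons.prems \<open>norm (z - c) = R\<close> by auto
      thus ?case using Cons R by (auto simp: norm_divide)
    qed auto
    from this[of as] show ?thesis unfolding P_def Q_def normprod by simp
  qed
  have Qnz: "Q z \<noteq> 0" if "norm (z - c) \<le> R" for z
  proof -
    have "(\<Prod>a\<leftarrow>bs. (of_real (R\<^sup>2) - cnj (a - c) * (z - c)) / of_real R) \<noteq> 0" if "set bs \<subseteq> set as" for bs
      using that
    proof (induction bs)
      case (Cons a bs)
      thus ?case using Blaschke_factor_bound(3)[of "a - c" R "z - c"] as \<open>norm (z - c) \<le> R\<close> R by auto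
    qed auto
    thus ?thesis by (auto simp: Q_def)
  qed
  define f' where "f' z = g z * Q z" for z
  have Qhol: "Q holomorphic_on UNIV"
  proof -
    have "(\<lambda>z. \<Prod>a\<leftarrow>bs. (of_real (R\<^sup>2) - cnj (a - c) * (z - c)) / of_real R) holomorphic_on UNIV" for bs
      using R by (induction bs) (auto intro!: holomorphic_intros)
    thus ?thesis unfolding Q_def .
  qed
  have f'hol: "f' holomorphic_on UNIV" unfolding f'_def using g(2) Qhol by (intro holomorphic_intros)
  have f'nz: "f' z \<noteq> 0" if "z \<in> ball c R" for z
    using that Qnz[of z] g(3,4)[of z] by (cases "f z = 0") (auto simp: f'_def Z_def dist_norm norm_minus_commute)
  have max: "norm (h z) \<le> C" if "h holomorphic_on UNIV" "\<And>z. norm (z - c) = R \<Longrightarrow> norm (h z) \<le> C" "norm (z - c) < R" for h C z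
  proof (rule maximum_modulus_frontier[of h "ball c R"])
    show "h holomorphic_on interior (ball c R)" using that(1) holomorphic_on_subset by blast
    show "continuous_on (closure (ball c R)) h" using that(1) holomorphic_on_imp_continuous_on continuous_on_subset by blast
  qed (use that R in \<open>auto simp: dist_norm norm_minus_commute\<close>)
  have on: "norm (f' z) = norm (f z)" if "norm (z - c) = R" for z
    using PQ'[OF that] g(3)[of z] by (simp add: f'_def P_def norm_mult)
  have f'A: "norm (f' w) \<le> A" if "w \<in> ball c R" for w
    by (rule max[OF f'hol]) (use that on A in \<open>auto simp: dist_norm norm_minus_commute\<close>)
  have zb: "norm (z - c) < R" using \<kappa> R by (auto intro: le_less_trans)
  have "norm (f' z * E z) \<le> B"
  proof (rule max[OF _ _ zb])
    show "(\<lambda>z. f' z * E z) holomorphic_on UNIV" using f'hol E by (intro holomorphic_intros)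
    show "norm (f' w * E w) \<le> B" if "norm (w - c) = R" for w
      using on[OF that] B[of w] NE[of w] that by (simp add: norm_mult dist_norm norm_minus_commute)
  qed
  hence 1: "norm (f' z) * norm (E z) \<le> B" by (simp add: norm_mult)
  have "norm (f c) \<le> norm (f' c)"
    using mult_left_mono[OF PQ[of c], of "norm (g c)"] g(3)[of c] R
    by (simp add: f'_def P_def norm_mult mult.commute)
  let ?p = "(1 + \<kappa>) / (1 - \<kappa>)"
  have "A * (norm (f c) / A) powr ?p \<le> A * (norm (f' c) / A) powr ?p"
    using \<open>norm (f c) \<le> norm (f' c)\<close> A0 \<kappa> by (intro mult_left_mono powr_mono2 divide_right_mono) auto
  also have "\<dots> \<le> norm (f' z)"
    by (rule zero_free_lower_bound[OF _ R f'nz f'A \<kappa>]) (use f'hol in \<open>auto intro: holomorphic_on_subset\<close>)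
  finally have 2: "A * (norm (f c) / A) powr ?p \<le> norm (f' z)" .
  have pos: "0 < A * (norm (f c) / A) powr ?p" using A0 fc by simp
  have "norm (E z) * (A * (norm (f c) / A) powr ?p) \<le> B"
    using 1 2 mult_right_mono[OF 2, of "norm (E z)"] by (simp add: mult.commute)
  hence "norm (E z) \<le> B / (A * (norm (f c) / A) powr ?p)" using pos by (simp add: pos_le_divide_eq)
  also have "\<dots> = (B / A) * (A / norm (f c)) powr ?p"
    using A0 fc by (simp add: powr_divide field_simps)
  finally show ?thesis .
qed


section \<open>Growth of quotients of entire functions\<close>

lemma le_if_le_mult_exp:
  fixes a M c :: real
  assumes "\<epsilon>0 > 0" "\<And>\<epsilon>. 0 < \<epsilon> \<Longrightarrow> \<epsilon> \<le> \<epsilon>0 \<Longrightarrow> a \<le> M * exp (\<epsilon> * c)"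
  shows "a \<le> M"
proof (rule tendsto_lowerbound)
  have "((\<lambda>\<epsilon>. M * exp (\<epsilon> * c)) \<longlongrightarrow> M * exp (0 * c)) (at_right 0)"
    by (intro tendsto_intros)
  thus "((\<lambda>\<epsilon>. M * exp (\<epsilon> * c)) \<longlongrightarrow> M) (at_right 0)" by simp
  show "\<forall>\<^sub>F \<epsilon> in at_right 0. a \<le> M * exp (\<epsilon> * c)"
    using assms by (auto simp: eventually_at_right_field intro!: exI[of _ \<epsilon>0])
qed auto

lemma mult_exp_le_iff: "a * exp t \<le> b \<longleftrightarrow> a \<le> b * exp (- t)" for a b t :: real
proof -
  have "b * exp (- t) = b / exp t" by (simp add: exp_minus divide_inverse)
  thus ?thesis by (simp add: pos_le_divide_eq)
qed

lemma bounded_entire_const: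
  fixes h :: "complex \<Rightarrow> complex"
  assumes "h holomorphic_on UNIV" "\<And>z. norm (h z) \<le> C"
  obtains k where "\<And>z. h z = k"
  using Liouville_theorem[OF assms(1)] assms(2) by (auto simp: bounded_iff constant_on_def)

lemma bounded_affine_imp_zero:
  fixes g k c :: complex
  assumes "\<And>z. norm (g + c * z * k) \<le> C" "c \<noteq> 0"
  shows "k = 0"
proof -
  have "(\<lambda>z. g + c * z * k) holomorphic_on UNIV" by (intro holomorphic_intros)
  then obtain k' where k': "\<And>z. g + c * z * k = k'" using bounded_entire_const assms(1) by blast
  show ?thesis using k'[of 0] k'[of 1] assms(2) by simp
qed

text \<open>\<open>h0\<close> is constant by Liouville, and boundedness of
  \<open>h1 = g0 + c z h0\<close> makes this constant 0. In the same way boundedness of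
  \<open>h2\<close> makes the constant \<open>h1\<close> equal to 0, and what remains of the first
  link is \<open>g0 = 0\<close>. A single link would only give \<open>h0 = 0\<close>.\<close>

lemma bounded_chain_imp_zero:
  fixes h0 h1 h2 :: "complex \<Rightarrow> complex" and c :: complex
  assumes "h0 holomorphic_on UNIV" "h1 holomorphic_on UNIV" "c \<noteq> 0"
    and b0: "\<And>z. norm (h0 z) \<le> C0" and b1: "\<And>z. norm (h1 z) \<le> C1" and b2: "\<And>z. norm (h2 z) \<le> C2"
    and h1: "\<And>z. h1 z = g0 + c * z * h0 z" and h2: "\<And>z. h2 z = g1 + c * z * h1 z"
  shows "g0 = 0"
proof -
  obtain k0 where k0: "\<And>z. h0 z = k0" using bounded_entire_const[OF assms(1) b0] by blast
  obtain k1 where k1: "\<And>z. h1 z = k1" using bounded_entire_const[OF assms(2) b1] by blast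
  have "k0 = 0" by (rule bounded_affine_imp_zero[of g0 c _ C1]) (use b1 h1 k0 assms(3) in auto)
  moreover have "k1 = 0" by (rule bounded_affine_imp_zero[of g1 c _ C2]) (use b2 h2 k1 assms(3) in auto)
  ultimately show ?thesis using h1[of 0] k0[of 0] k1[of 0] by simp
qed

text \<open>Each quadrant is treated separately. The factor
  \<open>exp (i \<epsilon> \<sigma> z^2)\<close> has modulus
  \<open>exp (- 2 \<epsilon> |Re z| Im z)\<close>, which is 1 on both axes and beats
  \<open>exp (L Im z)\<close> once \<open>|Re z|\<close> is large. There remains a vertical half
  strip, where a second Gaussian \<open>exp (\<delta> z^2)\<close> takes care of infinity.\<close>

lemma Phragmen_Lindelof_upper:
  fixes f :: "complex \<Rightarrow> complex"
  assumes hol: "f holomorphic_on UNIV" and L: "L > 0"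
    and A: "\<And>z. Im z \<ge> 0 \<Longrightarrow> norm (f z) \<le> A * exp (L * Im z)"
    and B: "\<And>y. y \<ge> 0 \<Longrightarrow> norm (f (\<i> * of_real y)) \<le> A"
    and z: "Im z \<ge> 0"
  shows "norm (f z) \<le> A"
proof -
  have A0: "A \<ge> 0" using B[of 0] by (meson norm_ge_zero order_trans order_refl)
  define \<sigma> :: real where "\<sigma> = (if Re z \<ge> 0 then 1 else -1)"
  have \<sigma>: "\<sigma> = 1 \<or> \<sigma> = -1" "\<sigma> * Re z \<ge> 0" by (auto simp: \<sigma>_def)
  show ?thesis
  proof (rule le_if_le_mult_exp[of 1 _ _ "2 * (\<sigma> * Re z) * Im z"])
    fix \<epsilon> :: real assume \<epsilon>: "\<epsilon> > 0"
    \<comment> \<open>From this abscissa on, \<open>2 \<epsilon> |Re w| Im w\<close> is at least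
      \<open>L Im w\<close>.\<close>
    define X where "X = L / (2 * \<epsilon>)"
    have X: "X > 0" using L \<epsilon> by (simp add: X_def)
    have far: "norm (f w) * exp (- 2 * \<epsilon> * (\<sigma> * Re w) * Im w) \<le> A" if "\<sigma> * Re w \<ge> X" "Im w \<ge> 0" for w
    proof -
      have "L * Im w \<le> 2 * \<epsilon> * (\<sigma> * Re w) * Im w"
        using that \<epsilon> unfolding X_def by (intro mult_right_mono) (auto simp: divide_le_eq mult.commute)
      hence "exp (L * Im w) * exp (- 2 * \<epsilon> * (\<sigma> * Re w) * Im w) \<le> 1" by (simp add: exp_add[symmetric])
      hence "A * (exp (L * Im w) * exp (- 2 * \<epsilon> * (\<sigma> * Re w) * Im w)) \<le> A * 1" using A0 by (intro mult_left_mono) auto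
      moreover have "norm (f w) * exp (- 2 * \<epsilon> * (\<sigma> * Re w) * Im w) \<le> A * (exp (L * Im w) * exp (- 2 * \<epsilon> * (\<sigma> * Re w) * Im w))"
        unfolding mult.assoc[of A, symmetric] using A[OF that(2)] by (intro mult_right_mono) auto
      ultimately show ?thesis by linarith
    qed
    have "norm (f z) * exp (- 2 * \<epsilon> * (\<sigma> * Re z) * Im z) \<le> A"
    proof (cases "\<sigma> * Re z < X \<and> \<sigma> * Re z > 0 \<and> Im z > 0")
      case False
      consider "\<sigma> * Re z \<ge> X" | "Re z = 0" | "Im z = 0" using False \<sigma> z by force
      thus ?thesis
      proof cases
        case 1 thus ?thesis using far z by blast
      next
        case 2
        hence "z = \<i> * of_real (Im z)" by (simp add: complex_eq_iff)
        thus ?thesis using B[OF z] 2 by simp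
      next
        case 3
        thus ?thesis using A[of z] by simp
      qed
    next
      case True
      define \<Omega> where "\<Omega> = {w. \<sigma> * Re w < X \<and> \<sigma> * Re w > 0 \<and> Im w > 0}"
      have op: "open \<Omega>" unfolding \<Omega>_def by (intro open_Collect_conj open_Collect_less continuous_intros)
      have cl: "closure \<Omega> \<subseteq> {w. \<sigma> * Re w \<le> X \<and> \<sigma> * Re w \<ge> 0 \<and> Im w \<ge> 0}"
        unfolding \<Omega>_def by (rule closure_minimal) (auto intro!: closed_Collect_conj closed_Collect_le continuous_intros)
      have fr: "w \<in> frontier \<Omega> \<Longrightarrow> \<sigma> * Re w \<le> X \<and> \<sigma> * Re w \<ge> 0 \<and> Im w \<ge> 0 \<and> (\<sigma> * Re w = X \<or> Re w = 0 \<or> Im w = 0)" for w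
        using cl op \<sigma>(1) by (auto simp: frontier_def interior_open \<Omega>_def)
      show ?thesis
      proof (rule le_if_le_mult_exp[of 1 _ _ "X\<^sup>2 + (Im z)\<^sup>2"])
        fix \<delta> :: real assume \<delta>: "\<delta> > 0"
        define K where "K w = f w * exp (\<i> * of_real (\<epsilon> * \<sigma>) * w\<^sup>2) * exp (of_real \<delta> * w\<^sup>2)" for w
        have nK: "norm (K w) = norm (f w) * exp (- 2 * \<epsilon> * (\<sigma> * Re w) * Im w) * exp (\<delta> * ((Re w)\<^sup>2 - (Im w)\<^sup>2))" for w
          unfolding K_def by (simp add: norm_mult power2_eq_square algebra_simps)
        have sq: "(Re w)\<^sup>2 \<le> X\<^sup>2" if "\<sigma> * Re w \<le> X" "\<sigma> * Re w \<ge> 0" for w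
          using \<sigma>(1) that power_mono[OF that, of 2] by (auto simp: power_mult_distrib)
        have "norm (K z) \<le> A * exp (\<delta> * X\<^sup>2)"
        proof (rule max_modulus_unbounded[OF op, where f = K and z = z])
          have Khol: "K holomorphic_on UNIV" unfolding K_def using hol by (intro holomorphic_intros)
          thus "K holomorphic_on \<Omega>" by (rule holomorphic_on_subset) auto
          show "continuous_on (closure \<Omega>) K"
            by (rule continuous_on_subset[OF holomorphic_on_imp_continuous_on[OF Khol]]) auto
          show "z \<in> \<Omega>" using True by (simp add: \<Omega>_def)
          fix w assume "w \<in> frontier \<Omega>"
          note w = fr[OF this]
          have "norm (f w) * exp (- 2 * \<epsilon> * (\<sigma> * Re w) * Im w) \<le> A"
          proof -
            consider "\<sigma> * Re w = X" | "Re w = 0" | "Im w = 0" using w by blast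
            thus ?thesis
            proof cases
              case 1 thus ?thesis using far w by auto
            next
              case 2
              hence "w = \<i> * of_real (Im w)" by (simp add: complex_eq_iff)
              thus ?thesis using B[of "Im w"] 2 w by simp
            next
              case 3
              thus ?thesis using A[of w] by simp
            qed
          qed
          moreover have "\<delta> * ((Re w)\<^sup>2 - (Im w)\<^sup>2) \<le> \<delta> * X\<^sup>2"
            using sq[of w] w \<delta> by (intro mult_left_mono) (auto intro: order_trans[of _ "(Re w)\<^sup>2"])
          ultimately show "norm (K w) \<le> A * exp (\<delta> * X\<^sup>2)"
            unfolding nK using A0 by (intro mult_mono) auto
        next
          fix e :: real assume e: "e > 0"
          have "((\<lambda>y. A * exp (\<delta> * X\<^sup>2) * exp (L * y - \<delta> * y\<^sup>2)) \<longlongrightarrow> 0) at_top"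
            using \<delta> L by real_asymp
          hence "\<forall>\<^sub>F y in at_top. A * exp (\<delta> * X\<^sup>2) * exp (L * y - \<delta> * y\<^sup>2) < e"
            using e by (auto simp: tendsto_iff dest!: spec[of _ e] elim!: eventually_mono)
          then obtain Y where Y: "\<And>y. y \<ge> Y \<Longrightarrow> A * exp (\<delta> * X\<^sup>2) * exp (L * y - \<delta> * y\<^sup>2) < e"
            by (auto simp: eventually_at_top_linorder)
          show "\<exists>R. \<forall>w\<in>closure \<Omega>. R \<le> norm w \<longrightarrow> norm (K w) \<le> A * exp (\<delta> * X\<^sup>2) + e"
          proof (intro exI ballI impI)
            fix w assume "w \<in> closure \<Omega>" "Y + X \<le> norm w"
            hence w: "\<sigma> * Re w \<le> X" "\<sigma> * Re w \<ge> 0" "Im w \<ge> 0" using cl by auto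
            have "\<bar>Re w\<bar> \<le> X" using w \<sigma>(1) by auto
            hence "Im w \<ge> Y" using \<open>Y + X \<le> norm w\<close> cmod_le[of w] w by linarith
            have "norm (K w) \<le> (A * exp (L * Im w)) * 1 * exp (\<delta> * (X\<^sup>2 - (Im w)\<^sup>2))"
              unfolding nK using A[OF w(3)] w \<epsilon> \<delta> sq[OF w(1,2)] A0
              by (intro mult_mono) (auto intro!: mult_nonneg_nonneg)
            also have "\<dots> = A * exp (\<delta> * X\<^sup>2) * exp (L * Im w - \<delta> * (Im w)\<^sup>2)"
              by (simp add: exp_add[symmetric] exp_diff right_diff_distrib)
            also have "\<dots> \<le> e" using Y[OF \<open>Im w \<ge> Y\<close>] by simp
            finally show "norm (K w) \<le> A * exp (\<delta> * X\<^sup>2) + e" using A0 by (smt (verit) exp_gt_zero mult_nonneg_nonneg)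
          qed
        qed
        hence "norm (f z) * exp (- 2 * \<epsilon> * (\<sigma> * Re z) * Im z) * exp (\<delta> * ((Re z)\<^sup>2 - (Im z)\<^sup>2)) \<le> A * exp (\<delta> * X\<^sup>2)"
          unfolding nK .
        hence "norm (f z) * exp (- 2 * \<epsilon> * (\<sigma> * Re z) * Im z) \<le> A * exp (\<delta> * X\<^sup>2) * exp (- (\<delta> * ((Re z)\<^sup>2 - (Im z)\<^sup>2)))"
          by (simp only: mult_exp_le_iff)
        also have "\<dots> = A * exp (\<delta> * X\<^sup>2 - \<delta> * ((Re z)\<^sup>2 - (Im z)\<^sup>2))" by (simp add: exp_diff exp_minus divide_inverse)
        also have "\<dots> \<le> A * exp (\<delta> * (X\<^sup>2 + (Im z)\<^sup>2))" using A0 \<delta> by (intro mult_left_mono) (auto simp: algebra_simps)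
        finally show "norm (f z) * exp (- 2 * \<epsilon> * (\<sigma> * Re z) * Im z) \<le> A * exp (\<delta> * (X\<^sup>2 + (Im z)\<^sup>2))" .
      qed simp
    qed
    thus "norm (f z) \<le> A * exp (\<epsilon> * (2 * (\<sigma> * Re z) * Im z))"
      by (simp add: mult_exp_le_iff mult_ac)
  qed simp
qed


section \<open>Growth of a quotient in cones about the imaginary axis\<close>

text \<open>\<open>(z + a) / (z - a)\<close> is an inverse Blaschke factor of the half plane:
  modulus 1 on the real line, pole at \<open>a = i r\<close>. The smallness of \<open>G\<close> near
  \<open>a\<close> pays for the pole of its m-th power, which at \<open>i y\<close> gains
  \<open>((r + y) / (r - y)) ^ m\<close>. The base 33 bounds the factor off the disc:
  \<open>|z + a| \<le> |z - a| + 2 r\<close> and \<open>r / 16 \<le> |z - a|\<close> give 1 +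
  32.\<close>

lemma half_plane_decay:
  fixes G :: "complex \<Rightarrow> complex"
  assumes hol: "G holomorphic_on UNIV" and C: "C > 0" "\<And>z. Im z \<ge> 0 \<Longrightarrow> norm (G z) \<le> C"
    and r: "r > 0" and bad: "\<And>z. z \<in> cball (\<i> * of_real r) (r / 16) \<Longrightarrow> norm (G z) \<le> C / 33 ^ m"
    and y: "0 < y" "y \<le> r / 2"
  shows "norm (G (\<i> * of_real y)) \<le> C * exp (- (of_nat m * y / r))"
proof -
  define a where "a = \<i> * of_real r"
  have Ima: "Im a = r" "Re a = 0" by (simp_all add: a_def)
  define \<Omega> where "\<Omega> = {z. Im z > 0} - cball a (r / 16)"
  have op: "open \<Omega>" unfolding \<Omega>_def by (intro open_Diff open_halfspace_Im_gt) auto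
  have cl: "closure \<Omega> \<subseteq> {z. Im z \<ge> 0} - ball a (r / 16)"
    unfolding \<Omega>_def by (rule closure_minimal) (auto intro!: closed_Diff closed_halfspace_Im_ge)
  define K where "K z = G z * ((z + a) / (z - a)) ^ m" for z
  have ra: "norm (z + a) \<le> 33 * norm (z - a)" if "z \<in> closure \<Omega>" for z
  proof -
    have "r / 16 \<le> norm (z - a)" using cl that by (auto simp: dist_norm norm_minus_commute)
    moreover have "norm (z + a) \<le> norm (z - a) + norm (2 * a)"
      using norm_triangle_ineq[of "z - a" "2 * a"] by (simp add: algebra_simps)
    moreover have "norm (2 * a) = 2 * r" using r by (simp add: a_def norm_mult)
    ultimately show ?thesis by linarith
  qed
  have ne: "z - a \<noteq> 0" if "z \<in> closure \<Omega>" for z using cl that r by auto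
  define z where "z = \<i> * of_real y"
  have zO: "z \<in> \<Omega>"
  proof -
    have "a - z = \<i> * of_real (r - y)" by (simp add: z_def a_def right_diff_distrib)
    hence "dist a z = \<bar>r - y\<bar>" unfolding dist_norm by (simp only: norm_mult norm_ii norm_of_real mult_1)
    thus ?thesis using y r by (auto simp: \<Omega>_def z_def)
  qed
  have "norm (K z) \<le> C"
  proof (rule max_modulus_bounded_fun[OF op, where f = K and z = z and M = "C * 33 ^ m" and \<rho> = 1 and ?w0.0 = "- \<i>"])
    have "G holomorphic_on closure \<Omega>" by (rule holomorphic_on_subset[OF hol]) auto
    hence Khol: "K holomorphic_on closure \<Omega>" unfolding K_def using ne by (intro holomorphic_intros) auto
    show "K holomorphic_on \<Omega>" by (rule holomorphic_on_subset[OF Khol closure_subset])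
    show "continuous_on (closure \<Omega>) K" by (rule holomorphic_on_imp_continuous_on[OF Khol])
    show "norm (K w) \<le> C * 33 ^ m" if "w \<in> closure \<Omega>" for w
    proof -
      have "norm ((w + a) / (w - a)) \<le> 33" using ra[OF that] ne[OF that] by (simp add: norm_divide divide_le_eq)
      hence "norm (((w + a) / (w - a)) ^ m) \<le> 33 ^ m" unfolding norm_power by (intro power_mono) auto
      moreover have "norm (G w) \<le> C" using cl that C(2) by blast
      ultimately show ?thesis unfolding K_def norm_mult using C(1) by (intro mult_mono) auto
    qed
    show "norm (K w) \<le> C" if w: "w \<in> frontier \<Omega>" for w
    proof -
      have wc: "w \<in> closure \<Omega>" "w \<notin> \<Omega>" using w op by (auto simp: frontier_def interior_open)
      hence w0: "Im w \<ge> 0" using cl by blast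
      show ?thesis
      proof (cases "Im w = 0")
        case True
        have "norm (w + a) = norm (w - a)" unfolding cmod_def using True Ima by (simp add: power2_eq_square)
        hence "norm ((w + a) / (w - a)) = 1" using ne[OF wc(1)] by (simp add: norm_divide)
        thus ?thesis unfolding K_def norm_mult norm_power using C(2)[OF w0] by simp
      next
        case False
        hence "w \<in> cball a (r / 16)" using wc w0 by (auto simp: \<Omega>_def)
        hence "norm (G w) \<le> C / 33 ^ m" using bad unfolding a_def by blast
        moreover have "norm ((w + a) / (w - a)) \<le> 33" using ra[OF wc(1)] ne[OF wc(1)] by (simp add: norm_divide divide_le_eq)
        hence "norm (((w + a) / (w - a)) ^ m) \<le> 33 ^ m" unfolding norm_power by (intro power_mono) auto
        ultimately have "norm (K w) \<le> (C / 33 ^ m) * 33 ^ m" unfolding K_def norm_mult using C(1) by (intro mult_mono) auto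
        thus ?thesis by simp
      qed
    qed
    show "ball (- \<i>) 1 \<inter> \<Omega> = {}"
    proof -
      have "Im w < 0" if "norm (- \<i> - w) < 1" for w
        using that abs_Im_le_cmod[of "- \<i> - w"] by simp
      thus ?thesis by (force simp: \<Omega>_def dist_norm)
    qed
  qed (use C zO in auto)
  moreover have nz: "norm (z + a) = r + y" "norm (z - a) = r - y"
  proof -
    have "z + a = \<i> * of_real (r + y)" "z - a = - (\<i> * of_real (r - y))" by (simp_all add: z_def a_def algebra_simps)
    thus "norm (z + a) = r + y" "norm (z - a) = r - y"
      using y r by (simp_all add: norm_mult del: of_real_add of_real_diff)
  qed
  ultimately have *: "norm (G z) * ((r + y) / (r - y)) ^ m \<le> C"
    unfolding K_def norm_mult norm_power norm_divide nz by simp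
  have "exp (y / r) \<le> (r + y) / (r - y)"
  proof -
    have "y / r \<le> 2 * y / (r + y)" using y r by (simp add: divide_simps)
    hence "1 - 2 * y / (r + y) \<le> exp (- (y / r))" using exp_ge_add_one_self[of "- (y / r)"] 
      by (smt (verit) exp_ge_add_one_self)
    moreover have "1 - 2 * y / (r + y) = (r - y) / (r + y)" using y r by (simp add: divide_simps)
    ultimately have "(r - y) / (r + y) \<le> exp (- (y / r))" by simp
    thus ?thesis using y r by (simp add: exp_minus divide_simps mult.commute split: if_splits)
  qed
  hence "exp (y / r) ^ m \<le> ((r + y) / (r - y)) ^ m" by (intro power_mono) auto
  hence "norm (G z) * exp (y / r) ^ m \<le> C" using * mult_left_mono[of "exp (y / r) ^ m" _ "norm (G z)"]
    by (meson norm_ge_zero order_trans)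
  hence "norm (G z) * exp (of_nat m * y / r) \<le> C" by (simp add: exp_of_nat_mult[symmetric])
  thus ?thesis by (simp add: z_def mult_exp_le_iff)
qed

text \<open>\<open>G\<close> cannot be small on the whole disc about \<open>\<i> r\<close>, as this would force too small values at a fixed
  \<open>\<i> y\<close>; from a point of the disc where \<open>G\<close> is not small the bound for quotients reaches the cone.\<close>

lemma quotient_growth_in_cone:
  fixes G N E :: "complex \<Rightarrow> complex"
  assumes G: "G holomorphic_on UNIV" and E: "E holomorphic_on UNIV" and NE: "\<And>z. N z = G z * E z"
    and C: "\<And>z. Im z \<ge> 0 \<Longrightarrow> norm (G z) \<le> C" "\<And>z. Im z \<ge> 0 \<Longrightarrow> norm (N z) \<le> C" "C > 0"
    and \<delta>: "\<delta> > 0" and big: "\<And>C'. \<exists>y>0. C' * exp (- (\<delta> * y)) < norm (G (\<i> * of_real y))"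
  shows "\<exists>R. \<forall>z. R \<le> norm z \<longrightarrow> 3/5 * norm z \<le> Im z \<longrightarrow> norm (E z) \<le> 33 ^ 24 * exp (320 * \<delta> * norm z)"
proof -
  \<comment> \<open>Large enough for the rate \<open>m r / r\<close> of
    \<open>half_plane_decay\<close> to exceed the rate \<open>\<delta>\<close> that
    \<open>big\<close> rules out, yet linear in \<open>r\<close>, so that \<open>33 ^ m r\<close>
    has exponential growth of small type.\<close>
  define m where "m r = nat \<lceil>2 * \<delta> * r\<rceil>" for r :: real
  have "\<exists>r0>0. \<forall>r\<ge>r0. \<exists>z0\<in>cball (\<i> * of_real r) (r / 16). C / 33 ^ m r < norm (G z0)"
  proof (rule ccontr)
    assume "\<not> ?thesis"
    hence *: "\<exists>r\<ge>r0. \<forall>z0\<in>cball (\<i> * of_real r) (r / 16). norm (G z0) \<le> C / 33 ^ m r" if "r0 > 0" for r0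
      using that by (meson not_le)
    obtain y where y: "y > 0" "C * exp (- (\<delta> * y)) < norm (G (\<i> * of_real y))" using big by blast
    obtain r where r: "r \<ge> 2 * y" "\<And>z. z \<in> cball (\<i> * of_real r) (r / 16) \<Longrightarrow> norm (G z) \<le> C / 33 ^ m r"
      using *[of "2 * y"] y by auto
    have r0: "r > 0" using r y by simp
    have "norm (G (\<i> * of_real y)) \<le> C * exp (- (of_nat (m r) * y / r))"
      by (rule half_plane_decay[OF G C(3) C(1) r0 r(2)]) (use r y in auto)
    also have "\<dots> \<le> C * exp (- (\<delta> * y))"
    proof -
      have "\<delta> * r \<le> 2 * \<delta> * r" using \<delta> r0 by simp
      also have "\<dots> \<le> of_nat (m r)" unfolding m_def by linarith
      finally have "\<delta> * r * y \<le> of_nat (m r) * y" using y by (intro mult_right_mono) auto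
      hence "\<delta> * y \<le> of_nat (m r) * y / r" using r0 by (simp add: pos_le_divide_eq mult_ac)
      thus ?thesis using C(3) by simp
    qed
    finally show False using y(2) by simp
  qed
  then obtain r0 where r0: "r0 > 0"
    "\<And>r. r \<ge> r0 \<Longrightarrow> \<exists>z0\<in>cball (\<i> * of_real r) (r / 16). C / 33 ^ m r < norm (G z0)" by blast
  show ?thesis
  proof (intro exI allI impI)
    fix z :: complex assume z: "r0 \<le> norm z" "3/5 * norm z \<le> Im z"
    \<comment> \<open>With this \<open>r\<close> the cone condition gives
      \<open>|z - i r| \<le> 4/5 r\<close> (the triple 3, 4, 5). As \<open>z0\<close> is within
      \<open>r / 16\<close> of \<open>i r\<close>, the disc about \<open>z0\<close> of radius
      \<open>15/16 r\<close> stays in the closed half plane and contains \<open>z\<close> at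
      relative distance at most \<open>(4/5 + 1/16) / (15/16) = 23/25\<close>. Hence the exponent
      \<open>(1 + 23/25) / (1 - 23/25) = 24\<close>, and \<open>24 * 8 * 5/3 = 320\<close>, where 8
      comes from \<open>33 \<le> exp 4\<close> and
      \<open>m r \<le> 2 \<delta> r + 1\<close>.\<close>
    define r where "r = 5/3 * norm z"
    have r: "r \<ge> r0" "r > 0" using z r0 by (auto simp: r_def)
    then obtain z0 where z0: "z0 \<in> cball (\<i> * of_real r) (r / 16)" "C / 33 ^ m r < norm (G z0)" using r0(2) by blast
    have nz0: "G z0 \<noteq> 0" using z0(2) C(3) by (metis divide_pos_pos less_asym norm_zero zero_less_numeral zero_less_power)
    have dz0: "norm (z0 - \<i> * of_real r) \<le> r / 16" using z0(1) by (simp add: dist_norm norm_minus_commute)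
    define R where "R = 15/16 * r"
    have sub: "Im w \<ge> 0" if "w \<in> cball z0 R" for w
    proof -
      have "norm (w - \<i> * of_real r) \<le> norm (w - z0) + norm (z0 - \<i> * of_real r)"
        using norm_triangle_ineq[of "w - z0" "z0 - \<i> * of_real r"] by simp
      also have "\<dots> \<le> r" using that dz0 by (simp add: R_def dist_norm norm_minus_commute)
      finally show ?thesis using abs_Im_le_cmod[of "w - \<i> * of_real r"] by simp
    qed
    have "norm (z - \<i> * of_real r) \<le> 4/5 * r"
    proof (rule power2_le_imp_le)
      have "(norm (z - \<i> * of_real r))\<^sup>2 = (norm z)\<^sup>2 + r\<^sup>2 - 2 * r * Im z"
        unfolding cmod_power2 by (simp add: power2_eq_square algebra_simps)
      also have "\<dots> \<le> (norm z)\<^sup>2 + r\<^sup>2 - 2 * r * (3/5 * norm z)" using z(2) r by simp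
      also have "\<dots> = (4/5 * r)\<^sup>2" by (simp add: r_def power2_eq_square)
      finally show "(norm (z - \<i> * of_real r))\<^sup>2 \<le> (4/5 * r)\<^sup>2" .
    qed (use r in auto)
    hence zz0: "norm (z - z0) \<le> 23/25 * R"
      using dz0 norm_triangle_ineq[of "z - \<i> * of_real r" "\<i> * of_real r - z0"] r
      by (simp add: R_def norm_minus_commute)
    have "norm (E z) \<le> C / C * (C / norm (G z0)) powr ((1 + 23/25) / (1 - 23/25))"
      by (rule entire_quotient_bound[OF G E NE, of z0 R C C "23/25" z]) (use sub C nz0 r zz0 in \<open>auto simp: R_def\<close>)
    also have "\<dots> = (C / norm (G z0)) powr 24" using C(3) by simp
    also have "\<dots> \<le> (33 * exp (8 * \<delta> * r)) powr 24"
    proof (rule powr_mono2)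
      have "C < norm (G z0) * 33 ^ m r" using z0(2) by (simp add: divide_less_eq)
      hence "C / norm (G z0) \<le> 33 ^ m r" using nz0 by (simp add: divide_le_eq mult.commute)
      also have "33 ^ m r = (33::real) powr (real (m r))" by (simp add: powr_realpow)
      also have "\<dots> \<le> 33 powr (2 * \<delta> * r + 1)"
      proof (rule powr_mono)
        have "2 * \<delta> * r \<ge> 0" using \<delta> r by simp
        thus "real (m r) \<le> 2 * \<delta> * r + 1" unfolding m_def by linarith
      qed simp
      also have "\<dots> = 33 * 33 powr (2 * \<delta> * r)" by (simp add: powr_add)
      also have "33 powr (2 * \<delta> * r) \<le> exp 4 powr (2 * \<delta> * r)"
      proof (rule powr_mono2)
        have "(33::real) \<le> (1 + 1 + 1/2) ^ 4" by (simp add: power_divide)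
        also have "\<dots> \<le> exp 1 ^ 4" using exp_lower_Taylor_quadratic[of 1] by (intro power_mono) auto
        also have "\<dots> = exp 4" using exp_of_nat_mult[of 4 "1::real"] by simp
        finally show "(33::real) \<le> exp 4" .
      qed (use \<delta> r in auto)
      also have "exp 4 powr (2 * \<delta> * r) = exp (8 * \<delta> * r)" by (simp add: powr_def mult_ac)
      finally show "C / norm (G z0) \<le> 33 * exp (8 * \<delta> * r)" by simp
    qed (use C nz0 in auto)
    also have "\<dots> = (33 * exp (8 * \<delta> * r)) ^ 24" by (rule powr_numeral) simp
    also have "\<dots> = 33 ^ 24 * exp (24 * (8 * \<delta> * r))" 
      using exp_of_nat_mult[of 24 "8 * \<delta> * r"] by (simp add: power_mult_distrib)
    also have "\<dots> = 33 ^ 24 * exp (320 * \<delta> * norm z)" by (simp add: r_def)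
    finally show "norm (E z) \<le> 33 ^ 24 * exp (320 * \<delta> * norm z)" .
  qed
qed

text \<open>The disc bound is used about the fixed point \<open>w\<close> with radius
  \<open>2 |z - w| + 1\<close>. The relative distance is at most 1/2, so the exponent is 3 and the
  type becomes \<open>3 * 2 * \<tau>\<close>; the added 1 only makes it positive.\<close>

lemma quotient_exponential_type:
  fixes f N E :: "complex \<Rightarrow> complex"
  assumes f: "f holomorphic_on UNIV" and E: "E holomorphic_on UNIV" and NE: "\<And>z. N z = f z * E z"
    and C: "\<And>z. norm (f z) \<le> C * exp (\<tau> * norm z)" "\<And>z. norm (N z) \<le> C * exp (\<tau> * norm z)" "C > 0" "\<tau> \<ge> 0"
    and w: "f w \<noteq> 0"
  shows "\<exists>C' \<tau>'. C' > 0 \<and> \<tau>' > 0 \<and> (\<forall>z. norm (E z) \<le> C' * exp (\<tau>' * norm z))"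
proof (intro exI conjI allI)
  let ?C = "(C * exp (\<tau> * (3 * norm w + 1)) / norm (f w)) ^ 3"
  show "?C > 0" using C w by simp
  show "0 < 6 * \<tau> + 1" using C by simp
  fix z
  define R where "R = 2 * norm (z - w) + 1"
  define A where "A = C * exp (\<tau> * (norm w + R))"
  have bd: "C * exp (\<tau> * norm u) \<le> A" if "u \<in> cball w R" for u
  proof -
    have "norm u \<le> norm w + norm (u - w)" by (rule norm_triangle_sub)
    thus ?thesis using that C unfolding A_def by (auto simp: dist_norm norm_minus_commute intro!: mult_left_mono)
  qed
  have A0: "A > 0" using C by (simp add: A_def)
  have "norm (E z) \<le> A / A * (A / norm (f w)) powr ((1 + 1/2) / (1 - 1/2))"
    by (rule entire_quotient_bound[OF f E NE, of w R A A "1/2" z])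
       (use bd C w in \<open>auto intro: order_trans add_nonneg_pos simp: R_def\<close>)
  also have "\<dots> = (A / norm (f w)) ^ 3" using A0 w powr_numeral[of "A / norm (f w)" "num.Bit1 num.One"] by simp
  also have "\<dots> \<le> (C * exp (\<tau> * (3 * norm w + 1)) * exp (2 * \<tau> * norm z) / norm (f w)) ^ 3"
  proof (intro power_mono divide_right_mono)
    have "norm w + R \<le> 3 * norm w + 1 + 2 * norm z" using norm_triangle_ineq4[of z w] by (simp add: R_def)
    hence "\<tau> * (norm w + R) \<le> \<tau> * (3 * norm w + 1) + 2 * \<tau> * norm z"
      using mult_left_mono[of "norm w + R" "3 * norm w + 1 + 2 * norm z" \<tau>] C(4) by (simp add: algebra_simps)
    thus "A \<le> C * exp (\<tau> * (3 * norm w + 1)) * exp (2 * \<tau> * norm z)"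
      using C(3) by (simp add: A_def mult.assoc flip: exp_add)
  qed (use A0 in auto)
  also have "\<dots> = ?C * exp (3 * (2 * \<tau> * norm z))"
    using exp_of_nat_mult[of 3 "2 * \<tau> * norm z"] by (simp add: power_mult_distrib power_divide)
  also have "\<dots> \<le> ?C * exp ((6 * \<tau> + 1) * norm z)"
    using C w by (intro mult_left_mono) (auto simp: algebra_simps)
  finally show "norm (E z) \<le> ?C * exp ((6 * \<tau> + 1) * norm z)" .
qed


section \<open>From the cones to the whole plane\<close>

text \<open>The sector \<open>|Im z| < 3/4 Re z\<close> has an opening below a right angle, so
  \<open>Re (z^2) \<ge> 7/16 (Re z)^2\<close> there and a Gaussian beats any exponential type. On
  the bounding rays \<open>|z| = 5/4 Re z\<close>, which is why
  \<open>exp (- 5/4 \<epsilon> z)\<close> compensates the growth known on them.\<close>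

lemma sector_growth:
  fixes E :: "complex \<Rightarrow> complex"
  assumes E: "E holomorphic_on UNIV" and C: "C > 0" "\<tau> > 0" "\<And>z. norm (E z) \<le> C * exp (\<tau> * norm z)"
    and K: "\<And>z. 3/5 * norm z \<le> \<bar>Im z\<bar> \<Longrightarrow> norm (E z) \<le> K * exp (\<epsilon> * norm z)" "K > 0" "\<epsilon> > 0"
    and z: "\<bar>Im z\<bar> < 3/5 * norm z" "Re z > 0"
  shows "norm (E z) \<le> K * exp (2 * \<epsilon> * norm z)"
proof -
  have sq: "\<bar>Im w\<bar> < 3/5 * norm w \<longleftrightarrow> \<bar>Im w\<bar> < 3/4 * \<bar>Re w\<bar>" for w
  proof -
    have ab: "\<bar>x\<bar> < \<bar>y\<bar> \<longleftrightarrow> x\<^sup>2 < y\<^sup>2" for x y :: real by (metis abs_le_square_iff not_le)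
    have "\<bar>Im w\<bar> < 3/5 * norm w \<longleftrightarrow> (Im w)\<^sup>2 < (3/5 * norm w)\<^sup>2"
      using ab[of "Im w" "3/5 * norm w"] by (simp add: abs_mult)
    also have "\<dots> \<longleftrightarrow> (Im w)\<^sup>2 < (3/4 * Re w)\<^sup>2"
      unfolding power_mult_distrib cmod_power2 by (auto simp: power2_eq_square)
    also have "\<dots> \<longleftrightarrow> \<bar>Im w\<bar> < \<bar>3/4 * Re w\<bar>" using ab by blast
    finally show ?thesis by (simp add: abs_mult)
  qed
  define \<Omega> where "\<Omega> = {w. \<bar>Im w\<bar> < 3/4 * Re w}"
  have op: "open \<Omega>" unfolding \<Omega>_def by (intro open_Collect_less continuous_intros)
  have cl: "closure \<Omega> \<subseteq> {w. \<bar>Im w\<bar> \<le> 3/4 * Re w}"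
    unfolding \<Omega>_def by (rule closure_minimal) (auto intro!: closed_Collect_le continuous_intros)
  have zO: "z \<in> \<Omega>" using z sq[of z] by (simp add: \<Omega>_def)
  have cl': "Re w \<ge> 0 \<and> norm w \<le> 7/4 * Re w \<and> 7/16 * (Re w)\<^sup>2 \<le> (Re w)\<^sup>2 - (Im w)\<^sup>2" if "w \<in> closure \<Omega>" for w
  proof -
    have w: "\<bar>Im w\<bar> \<le> 3/4 * Re w" using cl that by auto
    hence "(Im w)\<^sup>2 \<le> (3/4 * Re w)\<^sup>2" by (metis abs_ge_zero power2_abs power_mono)
    thus ?thesis using w cmod_le[of w] by (auto simp: power2_eq_square)
  qed
  have "norm (E z) \<le> K * exp (5/4 * \<epsilon> * Re z)"
  proof (rule le_if_le_mult_exp[of 1 _ _ "(norm z)\<^sup>2"])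
    fix \<delta> :: real assume \<delta>: "\<delta> > 0"
    define F where "F w = E w * exp (of_real (- 5/4 * \<epsilon>) * w) * exp (of_real (- \<delta>) * w\<^sup>2)" for w
    have nF: "norm (F w) = norm (E w) * exp (- 5/4 * \<epsilon> * Re w) * exp (- \<delta> * ((Re w)\<^sup>2 - (Im w)\<^sup>2))" for w
      unfolding F_def norm_mult norm_exp_eq_Re by (simp add: power2_eq_square)
    have Fhol: "F holomorphic_on UNIV" unfolding F_def using E by (intro holomorphic_intros)
    have "norm (F z) \<le> K"
    proof (rule max_modulus_unbounded[OF op, where f = F and z = z])
      show "F holomorphic_on \<Omega>" by (rule holomorphic_on_subset[OF Fhol]) auto
      show "continuous_on (closure \<Omega>) F" by (rule continuous_on_subset[OF holomorphic_on_imp_continuous_on[OF Fhol]]) auto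
      show "norm (F w) \<le> K" if w: "w \<in> frontier \<Omega>" for w
      proof -
        have wc: "w \<in> closure \<Omega>" "w \<notin> \<Omega>" using w op by (auto simp: frontier_def interior_open)
        hence w: "\<bar>Im w\<bar> = 3/4 * Re w" using cl by (force simp: \<Omega>_def)
        have r: "Re w \<ge> 0" using cl' wc by blast
        have n5: "norm w = 5/4 * Re w"
        proof (rule power2_eq_imp_eq)
          have "(Im w)\<^sup>2 = (3/4 * Re w)\<^sup>2" using w by (metis power2_abs)
          thus "(norm w)\<^sup>2 = (5/4 * Re w)\<^sup>2" unfolding cmod_power2 by (simp add: power2_eq_square)
        qed (use r in auto)
        have "norm (E w) \<le> K * exp (\<epsilon> * norm w)"
          using K(1)[of w] sq[of w] w r by force
        moreover have "\<epsilon> * norm w = - (- 5/4 * \<epsilon> * Re w)" unfolding n5 by simp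
        ultimately have "norm (E w) * exp (- 5/4 * \<epsilon> * Re w) \<le> K" by (simp only: mult_exp_le_iff)
        moreover have "exp (- \<delta> * ((Re w)\<^sup>2 - (Im w)\<^sup>2)) \<le> 1"
        proof -
          have "0 \<le> (Re w)\<^sup>2 - (Im w)\<^sup>2" using cl'[OF wc(1)] zero_le_power2[of "Re w"] by linarith
          thus ?thesis using \<delta> by (simp add: mult_nonneg_nonneg)
        qed
        ultimately have "norm (F w) \<le> K * 1" unfolding nF using K(2) by (intro mult_mono) auto
        thus ?thesis by simp
      qed
      show "\<exists>R. \<forall>w\<in>closure \<Omega>. R \<le> norm w \<longrightarrow> norm (F w) \<le> K + e" if e: "e > 0" for e
      proof -
        have "((\<lambda>x. C * exp (7/4 * \<tau> * x - \<delta> * (7/16 * x\<^sup>2))) \<longlongrightarrow> 0) at_top"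
          using \<delta> C(2) by real_asymp
        hence "\<forall>\<^sub>F x in at_top. C * exp (7/4 * \<tau> * x - \<delta> * (7/16 * x\<^sup>2)) < e"
          using e C(1) by (auto simp: tendsto_iff dest!: spec[of _ e] elim!: eventually_mono)
        then obtain X where X: "\<And>x. x \<ge> X \<Longrightarrow> C * exp (7/4 * \<tau> * x - \<delta> * (7/16 * x\<^sup>2)) < e"
          by (auto simp: eventually_at_top_linorder)
        show ?thesis
        proof (intro exI ballI impI)
          fix w assume w: "w \<in> closure \<Omega>" "7/4 * X \<le> norm w"
          note c = cl'[OF w(1)]
          have "- \<delta> * ((Re w)\<^sup>2 - (Im w)\<^sup>2) \<le> - \<delta> * (7/16 * (Re w)\<^sup>2)"
            using c \<delta> by (intro mult_left_mono_neg) auto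
          hence e2: "exp (- \<delta> * ((Re w)\<^sup>2 - (Im w)\<^sup>2)) \<le> exp (- \<delta> * (7/16 * (Re w)\<^sup>2))"
            by (simp only: exp_le_cancel_iff)
          have "- 5/4 * \<epsilon> * Re w \<le> 0" using c K(3) by (simp add: mult_nonneg_nonneg)
          hence e1: "exp (- 5/4 * \<epsilon> * Re w) \<le> 1" by (simp only: exp_le_one_iff)
          have "norm (F w) \<le> (C * exp (\<tau> * norm w)) * 1 * exp (- \<delta> * (7/16 * (Re w)\<^sup>2))"
            unfolding nF by (intro mult_mono C(3) e1 e2) (use C(1) in simp_all)
          also have "\<dots> \<le> (C * exp (\<tau> * (7/4 * Re w))) * 1 * exp (- \<delta> * (7/16 * (Re w)\<^sup>2))"
          proof -
            have "\<tau> * norm w \<le> \<tau> * (7/4 * Re w)" by (rule mult_left_mono) (use c C(2) in linarith)+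
            hence "exp (\<tau> * norm w) \<le> exp (\<tau> * (7/4 * Re w))" by (simp only: exp_le_cancel_iff)
            thus ?thesis by (intro mult_right_mono mult_left_mono) (use C(1) in simp_all)
          qed
          also have "\<dots> = C * exp (7/4 * \<tau> * Re w - \<delta> * (7/16 * (Re w)\<^sup>2))"
          proof -
            have "\<tau> * (7/4 * Re w) + - \<delta> * (7/16 * (Re w)\<^sup>2) = 7/4 * \<tau> * Re w - \<delta> * (7/16 * (Re w)\<^sup>2)"
              by simp
            thus ?thesis by (simp only: mult_1_right mult.assoc exp_add[symmetric])
          qed
          also have "\<dots> < e" by (rule X) (use c w(2) in linarith)
          finally show "norm (F w) \<le> K + e" using K(2) by simp
        qed
      qed
    qed (use zO in auto)
    hence "norm (E z) * exp (- 5/4 * \<epsilon> * Re z) \<le> K * exp (\<delta> * ((Re z)\<^sup>2 - (Im z)\<^sup>2))"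
      unfolding nF by (simp only: mult_exp_le_iff) simp
    also have "\<dots> \<le> K * exp (\<delta> * (norm z)\<^sup>2)" using K(2) \<delta> unfolding cmod_power2 by (intro mult_left_mono) auto
    finally have "norm (E z) \<le> K * exp (\<delta> * (norm z)\<^sup>2) * exp (5/4 * \<epsilon> * Re z)" by (simp only: mult_exp_le_iff) simp
    thus "norm (E z) \<le> K * exp (5/4 * \<epsilon> * Re z) * exp (\<delta> * (norm z)\<^sup>2)" by (simp add: mult_ac)
  qed simp
  also have "5/4 * \<epsilon> * Re z \<le> 2 * \<epsilon> * norm z"
    using mult_mono[of "5/4 * \<epsilon>" "2 * \<epsilon>" "Re z" "norm z"] complex_Re_le_cmod[of z] K(3) z by simp
  finally show ?thesis using K(2) by simp
qed

text \<open>Near the real axis there is no direct estimate of \<open>E\<close>; the two sectors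
  there are filled in from their bounding rays by \<open>sector_growth\<close>, the left one after
  the reflection \<open>z \<mapsto> - z\<close>.\<close>

lemma entire_type_zero:
  fixes E :: "complex \<Rightarrow> complex"
  assumes E: "E holomorphic_on UNIV" and C: "C > 0" "\<tau> > 0" "\<And>z. norm (E z) \<le> C * exp (\<tau> * norm z)"
    and cone: "\<And>\<epsilon>. \<epsilon> > 0 \<Longrightarrow> \<exists>K R. \<forall>z. R \<le> norm z \<longrightarrow> 3/5 * norm z \<le> \<bar>Im z\<bar> \<longrightarrow> norm (E z) \<le> K * exp (\<epsilon> * norm z)"
    and \<epsilon>: "\<epsilon> > 0"
  shows "\<exists>K>0. \<forall>z. norm (E z) \<le> K * exp (\<epsilon> * norm z)"
proof -
  obtain K R where KR: "\<And>z. R \<le> norm z \<Longrightarrow> 3/5 * norm z \<le> \<bar>Im z\<bar> \<Longrightarrow> norm (E z) \<le> K * exp (\<epsilon>/2 * norm z)"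
    using cone[of "\<epsilon>/2"] \<epsilon> by auto
  define K' where "K' = max K (C * exp (\<tau> * R))"
  have K': "K' > 0" using C by (auto simp: K'_def less_max_iff_disj)
  have inc: "norm (E z) \<le> K' * exp (\<epsilon>/2 * norm z)" if "3/5 * norm z \<le> \<bar>Im z\<bar>" for z
  proof (cases "R \<le> norm z")
    case True
    have "K * exp (\<epsilon>/2 * norm z) \<le> K' * exp (\<epsilon>/2 * norm z)" by (intro mult_right_mono) (auto simp: K'_def)
    thus ?thesis using KR[OF True that] by linarith
  next
    case False
    have "norm (E z) \<le> C * exp (\<tau> * norm z)" by (rule C)
    also have "\<dots> \<le> C * exp (\<tau> * R)" using False C by auto
    also have "\<dots> \<le> K' * 1" by (simp add: K'_def)
    also have "\<dots> \<le> K' * exp (\<epsilon>/2 * norm z)" using K' \<epsilon> by (intro mult_left_mono) auto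
    finally show ?thesis .
  qed
  have "norm (E z) \<le> K' * exp (\<epsilon> * norm z)" for z
  proof -
    consider "3/5 * norm z \<le> \<bar>Im z\<bar>" | "\<bar>Im z\<bar> < 3/5 * norm z" "Re z > 0"
      | "\<bar>Im z\<bar> < 3/5 * norm z" "Re z < 0" | "\<bar>Im z\<bar> < 3/5 * norm z" "Re z = 0" by linarith
    thus ?thesis
    proof cases
      case 1
      have "K' * exp (\<epsilon>/2 * norm z) \<le> K' * exp (\<epsilon> * norm z)" using K' \<epsilon> by (intro mult_left_mono) auto
      thus ?thesis using inc[OF 1] by linarith
    next
      case 2
      have "norm (E z) \<le> K' * exp (2 * (\<epsilon>/2) * norm z)"
        by (rule sector_growth[OF E C inc K' _ 2]) (use \<epsilon> in auto)
      thus ?thesis by simp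
    next
      case 3
      have "norm (E (- (- z))) \<le> K' * exp (2 * (\<epsilon>/2) * norm (- z))"
      proof (rule sector_growth[of "\<lambda>z. E (- z)", OF _ C(1,2) _ _ K'])
        have "(E \<circ> uminus) holomorphic_on UNIV"
          by (rule holomorphic_on_compose_gen[of _ _ E UNIV]) (auto intro!: holomorphic_intros E)
        thus "(\<lambda>z. E (- z)) holomorphic_on UNIV" by (simp add: o_def)
        show "norm (E (- w)) \<le> C * exp (\<tau> * norm w)" for w using C(3)[of "- w"] by simp
        show "norm (E (- w)) \<le> K' * exp (\<epsilon>/2 * norm w)" if "3/5 * norm w \<le> \<bar>Im w\<bar>" for w using inc[of "- w"] that by simp
      qed (use \<epsilon> 3 in auto)
      thus ?thesis by simp
    next
      case 4
      hence "norm z = \<bar>Im z\<bar>" by (simp add: cmod_def)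
      thus ?thesis using 4 by simp
    qed
  qed
  thus ?thesis using K' by blast
qed

text \<open>On the set where \<open>\<bar>E\<bar> > K\<close> the quotient \<open>E / \<theta>\<close> is holomorphic, so \<open>E ^ n * (E / \<theta>)\<close> obeys a
  maximum principle there; let \<open>n\<close> tend to infinity.\<close>

lemma type_zero_bounded:
  fixes E \<theta> :: "complex \<Rightarrow> complex"
  assumes E: "E holomorphic_on UNIV" and \<theta>: "\<theta> holomorphic_on UNIV"
    and tz: "\<And>\<epsilon>. \<epsilon> > 0 \<Longrightarrow> \<exists>C>0. \<forall>z. norm (E z) \<le> C * exp (\<epsilon> * norm z)"
    and K: "K > 0" and b: "b > 0"
    and dom: "\<And>z. norm (E z) \<ge> K \<Longrightarrow> norm (E z) \<le> K * exp (- b * \<bar>Im z\<bar>) * norm (\<theta> z)"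
  shows "\<exists>C. \<forall>z. norm (E z) \<le> C"
\<comment> \<open>A point with \<open>|E| < K\<close> supplies the ball outside
  \<open>\<Omega>\<close> that \<open>max_modulus_bounded_fun\<close> needs. If there is none,
  \<open>1 / E\<close> is bounded and entire.\<close>
proof (cases "\<exists>w0. norm (E w0) < K")
  case False
  hence ge: "norm (E z) \<ge> K" for z by (simp add: not_less)
  hence nz: "E z \<noteq> 0" for z using K by (metis norm_zero not_le)
  have "(\<lambda>z. 1 / E z) holomorphic_on UNIV" using E nz by (intro holomorphic_intros) auto
  moreover have "norm (1 / E z) \<le> 1 / K" for z using ge[of z] K by (simp add: norm_divide frac_le)
  ultimately obtain k where "\<And>z. 1 / E z = k" using bounded_entire_const by blast
  hence "E z = 1 / k" for z by (metis divide_divide_eq_right mult_1 nonzero_mult_div_cancel_left nz div_by_1 mult.commute)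
  thus ?thesis by auto
next
  case True
  then obtain w0 where w0: "norm (E w0) < K" by blast
  have contE: "continuous_on UNIV E" using E holomorphic_on_imp_continuous_on by blast
  define \<Omega> where "\<Omega> = {z. norm (E z) > K}"
  have op: "open \<Omega>" unfolding \<Omega>_def by (intro open_Collect_less continuous_intros contE)
  have cl: "norm (E z) \<ge> K" if "z \<in> closure \<Omega>" for z
  proof -
    have "closure \<Omega> \<subseteq> {z. norm (E z) \<ge> K}"
      unfolding \<Omega>_def by (rule closure_minimal) (auto intro!: closed_Collect_le continuous_intros contE)
    thus ?thesis using that by auto
  qed
  have fr: "norm (E z) = K" if "z \<in> frontier \<Omega>" for z
    using that cl[of z] op by (auto simp: frontier_def interior_open \<Omega>_def)
  have \<theta>nz: "\<theta> z \<noteq> 0" if "z \<in> closure \<Omega>" for z using dom[OF cl[OF that]] cl[OF that] K by auto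
  have "open {z. norm (E z) < K}" by (intro open_Collect_less continuous_intros contE)
  then obtain \<rho> where \<rho>: "\<rho> > 0" "ball w0 \<rho> \<subseteq> {z. norm (E z) < K}" using w0 openE by blast
  have dis: "ball w0 \<rho> \<inter> \<Omega> = {}" using \<rho>(2) by (force simp: \<Omega>_def)
  define J where "J z = E z / \<theta> z" for z
  have J: "norm (J z) \<le> K * exp (- b * \<bar>Im z\<bar>)" if "z \<in> closure \<Omega>" for z
    using dom[OF cl[OF that]] \<theta>nz[OF that] by (simp add: J_def norm_divide divide_le_eq)
  have out: "z \<notin> \<Omega>" for z
  proof
    assume z: "z \<in> \<Omega>"
    hence zc: "z \<in> closure \<Omega>" using closure_subset by blast
    have Jz: "norm (J z) > 0" using \<theta>nz[OF zc] cl[OF zc] K by (auto simp: J_def)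
    have "norm (E z) \<le> K"
    proof (rule le_if_powers_bounded[where C = "K / norm (J z)"])
      fix n :: nat assume n: "n \<ge> 1"
      define F where "F w = E w ^ n * J w" for w
      have Fhol: "F holomorphic_on closure \<Omega>" unfolding F_def J_def using \<theta>nz
        by (intro holomorphic_intros holomorphic_on_subset[OF E] holomorphic_on_subset[OF \<theta>]) auto
      \<comment> \<open>Type zero is used with \<open>\<delta> / n\<close>, so that the n-th power
        costs only \<open>\<delta>\<close>; for \<open>\<delta> < b\<close> the decay of
        \<open>J\<close> in \<open>|Im w|\<close> survives.\<close>
      have growth: "\<exists>C>0. \<forall>w\<in>closure \<Omega>. norm (F w) \<le> C * exp (\<delta> * \<bar>Re w\<bar> - (b - \<delta>) * \<bar>Im w\<bar>)" if "\<delta> > 0" for \<delta>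
      proof -
        obtain C where C: "C > 0" "\<And>z. norm (E z) \<le> C * exp (\<delta> / n * norm z)" 
        proof -
          have "\<delta> / n > 0" using \<open>\<delta> > 0\<close> n by simp
          from tz[OF this] show ?thesis using that by blast
        qed
        show ?thesis
        proof (intro exI conjI ballI)
          show "C ^ n * K > 0" using C K by simp
          fix w assume w: "w \<in> closure \<Omega>"
          have "norm (E w) ^ n \<le> (C * exp (\<delta> / n * norm w)) ^ n" by (intro power_mono C) auto
          also have "\<dots> = C ^ n * exp (\<delta> * norm w)"
            using n by (simp add: power_mult_distrib flip: exp_of_nat_mult)
          also have "\<dots> \<le> C ^ n * exp (\<delta> * (\<bar>Re w\<bar> + \<bar>Im w\<bar>))"
            using cmod_le[of w] C that by (intro mult_left_mono) auto
          finally have "norm (F w) \<le> (C ^ n * exp (\<delta> * (\<bar>Re w\<bar> + \<bar>Im w\<bar>))) * (K * exp (- b * \<bar>Im w\<bar>))"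
            unfolding F_def norm_mult norm_power using J[OF w] C by (intro mult_mono) auto
          also have "\<dots> = C ^ n * K * exp (\<delta> * \<bar>Re w\<bar> - (b - \<delta>) * \<bar>Im w\<bar>)"
            by (simp add: algebra_simps flip: exp_add)
          finally show "norm (F w) \<le> C ^ n * K * exp (\<delta> * \<bar>Re w\<bar> - (b - \<delta>) * \<bar>Im w\<bar>)" .
        qed
      qed
      have Ffr: "norm (F w) \<le> K ^ (n + 1)" if "w \<in> frontier \<Omega>" for w
      proof -
        have wc: "w \<in> closure \<Omega>" using that by (simp add: frontier_def)
        have "K * exp (- b * \<bar>Im w\<bar>) \<le> K * 1" using K b by (intro mult_left_mono) auto
        hence "norm (J w) \<le> K * 1" using J[OF wc] by linarith
        thus ?thesis unfolding F_def norm_mult norm_power fr[OF that] using K by (simp add: mult.commute)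
      qed
      obtain C1 where C1: "C1 > 0" "\<And>w. w \<in> closure \<Omega> \<Longrightarrow> norm (F w) \<le> C1 * exp (b/2 * \<bar>Re w\<bar> - (b - b/2) * \<bar>Im w\<bar>)"
        using growth[of "b/2"] b by auto
      define B where "B = max C1 (K ^ (n + 1))"
      have B: "B > 0" using C1 by (auto simp: B_def)
      have onim: "norm (F w) \<le> B" if "w \<in> closure \<Omega>" "Re w = 0" for w
      proof -
        have "norm (F w) \<le> C1 * exp (- (b/2) * \<bar>Im w\<bar>)" using C1(2)[OF that(1)] that(2) by simp
        also have "\<dots> \<le> C1 * 1" using C1(1) b by (intro mult_left_mono) auto
        finally show ?thesis by (simp add: B_def)
      qed
      \<comment> \<open>The imaginary axis is already covered by \<open>growth\<close> with
        \<open>b/2\<close>. In each half plane the factor \<open>exp (- 2 \<delta> |Re u|)\<close>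
        forces decay at infinity, and since \<open>B\<close> does not depend on
        \<open>\<delta>\<close>, one can let \<open>\<delta>\<close> tend to 0.\<close>
      have side: "norm (F w) \<le> B" if w: "w \<in> \<Omega>" "\<sigma> * Re w > 0" and \<sigma>: "\<sigma> = 1 \<or> \<sigma> = (-1::real)" for w \<sigma>
      proof (rule le_if_le_mult_exp[of "b/2" _ _ "2 * (\<sigma> * Re w)"])
        fix \<delta> :: real assume \<delta>: "\<delta> > 0" "\<delta> \<le> b/2"
        obtain C where C: "C > 0" "\<And>w. w \<in> closure \<Omega> \<Longrightarrow> norm (F w) \<le> C * exp (\<delta> * \<bar>Re w\<bar> - (b - \<delta>) * \<bar>Im w\<bar>)"
          using growth[of \<delta>] \<delta> by auto
        define H where "H u = F u * exp (of_real (- 2 * \<delta> * \<sigma>) * u)" for u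
        have nH: "norm (H u) = norm (F u) * exp (- 2 * \<delta> * (\<sigma> * Re u))" for u
          unfolding H_def norm_mult norm_exp_eq_Re by simp
        define \<Omega>' where "\<Omega>' = \<Omega> \<inter> {u. \<sigma> * Re u > 0}"
        have op': "open \<Omega>'" unfolding \<Omega>'_def by (intro open_Int op open_Collect_less continuous_intros)
        have "closure {u. \<sigma> * Re u > 0} \<subseteq> {u. \<sigma> * Re u \<ge> 0}"
          by (rule closure_minimal) (auto intro!: closed_Collect_le continuous_intros)
        moreover have "closure \<Omega>' \<subseteq> closure \<Omega> \<inter> closure {u. \<sigma> * Re u > 0}"
          unfolding \<Omega>'_def by (auto intro: closure_mono[THEN subsetD, rotated])
        ultimately have cl': "closure \<Omega>' \<subseteq> closure \<Omega> \<inter> {u. \<sigma> * Re u \<ge> 0}" by blast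
        have Hhol: "H holomorphic_on closure \<Omega>'" unfolding H_def using cl'
          by (intro holomorphic_intros holomorphic_on_subset[OF Fhol]) auto
        have "norm (H w) \<le> B"
        proof (rule max_modulus_unbounded[OF op', where f = H and z = w])
          show "H holomorphic_on \<Omega>'" by (rule holomorphic_on_subset[OF Hhol closure_subset])
          show "continuous_on (closure \<Omega>') H" by (rule holomorphic_on_imp_continuous_on[OF Hhol])
          show "norm (H u) \<le> B" if "u \<in> frontier \<Omega>'" for u
          proof -
            have u: "u \<in> closure \<Omega>'" "u \<notin> \<Omega>'" using that op' by (auto simp: frontier_def interior_open)
            hence uc: "u \<in> closure \<Omega>" "\<sigma> * Re u \<ge> 0" using cl' by auto
            have "norm (F u) \<le> B"
            proof (cases "Re u = 0")
              case False
              hence "\<sigma> * Re u > 0" using uc(2) \<sigma> by auto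
              hence "u \<in> frontier \<Omega>" using u uc op by (auto simp: \<Omega>'_def frontier_def interior_open)
              thus ?thesis using Ffr by (auto simp: B_def le_max_iff_disj)
            qed (use onim uc in auto)
            moreover have "exp (- 2 * \<delta> * (\<sigma> * Re u)) \<le> 1" using uc(2) \<delta> by (simp add: mult_nonneg_nonneg)
            ultimately have "norm (H u) \<le> B * 1" unfolding nH using B by (intro mult_mono) auto
            thus ?thesis by simp
          qed
          show "\<exists>R. \<forall>u\<in>closure \<Omega>'. R \<le> norm u \<longrightarrow> norm (H u) \<le> B + e" if e: "e > 0" for e
          proof -
            have "((\<lambda>x. C * exp (- \<delta> * x)) \<longlongrightarrow> 0) at_top" using \<delta> by real_asymp
            hence "\<forall>\<^sub>F x in at_top. C * exp (- \<delta> * x) < e"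
              using e C(1) by (auto simp: tendsto_iff dest!: spec[of _ e] elim!: eventually_mono)
            then obtain X where X: "\<And>x. x \<ge> X \<Longrightarrow> C * exp (- \<delta> * x) < e"
              by (auto simp: eventually_at_top_linorder)
            show ?thesis
            proof (intro exI ballI impI)
              fix u assume u: "u \<in> closure \<Omega>'" "X \<le> norm u"
              hence uc: "u \<in> closure \<Omega>" "\<sigma> * Re u = \<bar>Re u\<bar>" using cl' \<sigma> by auto
              have "norm (H u) \<le> C * exp (\<delta> * \<bar>Re u\<bar> - (b - \<delta>) * \<bar>Im u\<bar>) * exp (- 2 * \<delta> * \<bar>Re u\<bar>)"
                unfolding nH uc(2) using C(2)[OF uc(1)] by (intro mult_right_mono) auto
              also have "\<dots> = C * exp (- \<delta> * \<bar>Re u\<bar> - (b - \<delta>) * \<bar>Im u\<bar>)"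
                by (simp add: algebra_simps flip: exp_add)
              also have "\<dots> \<le> C * exp (- \<delta> * norm u)"
              proof -
                have "\<delta> * norm u \<le> \<delta> * (\<bar>Re u\<bar> + \<bar>Im u\<bar>)" using cmod_le[of u] \<delta> by (intro mult_left_mono) auto
                moreover have "\<delta> * \<bar>Im u\<bar> \<le> (b - \<delta>) * \<bar>Im u\<bar>" using \<delta> by (intro mult_right_mono) auto
                ultimately show ?thesis using C(1) by (simp add: algebra_simps)
              qed
              also have "\<dots> < e" using X u(2) by blast
              finally show "norm (H u) \<le> B + e" using B by simp
            qed
          qed
          show "w \<in> \<Omega>'" using w by (simp add: \<Omega>'_def)
        qed
        thus "norm (F w) \<le> B * exp (\<delta> * (2 * (\<sigma> * Re w)))" unfolding nH by (simp add: mult_exp_le_iff mult_ac)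
      qed (use b in auto)
      have Fbd: "norm (F w) \<le> B" if "w \<in> closure \<Omega>" for w
      proof (cases "w \<in> \<Omega>")
        case True
        consider "Re w > 0" | "Re w < 0" | "Re w = 0" by linarith
        thus ?thesis
        proof cases
          case 1 thus ?thesis using side[of w 1] True by simp
        next
          case 2 thus ?thesis using side[of w "-1"] True by simp
        next
          case 3 thus ?thesis using onim that by simp
        qed
      next
        case False
        hence "w \<in> frontier \<Omega>" using that op by (simp add: frontier_def interior_open)
        thus ?thesis using Ffr by (auto simp: B_def le_max_iff_disj)
      qed
      \<comment> \<open>\<open>B\<close> depends on \<open>n\<close> in an uncontrolled way; it only
        serves to make \<open>F\<close> bounded. The maximum principle then replaces it by the
        frontier bound, for which n-th roots are useful.\<close>
      have "norm (F z) \<le> K ^ (n + 1)"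
      proof (rule max_modulus_bounded_fun[OF op, where f = F and z = z and M = B])
        show "F holomorphic_on \<Omega>" by (rule holomorphic_on_subset[OF Fhol closure_subset])
        show "continuous_on (closure \<Omega>) F" by (rule holomorphic_on_imp_continuous_on[OF Fhol])
      qed (use Ffr Fbd K \<rho>(1) dis z in auto)
      thus "norm (E z) ^ n \<le> K / norm (J z) * K ^ n"
        using Jz by (simp add: F_def norm_mult norm_power pos_le_divide_eq)
    qed (use K in auto)
    thus False using z by (simp add: \<Omega>_def)
  qed
  have "norm (E z) \<le> K" for z using out[of z] by (simp add: \<Omega>_def not_less)
  thus ?thesis by blast
qed


text \<open>Here \<open>hp\<close>, \<open>hm\<close> and \<open>gp\<close>, \<open>gm\<close> are transforms over complementary half lines. The multipliers \<open>M\<close>,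
  transforms of bump functions, make up for the fact that \<open>\<phi>\<close> and \<open>\<phi> \<theta>\<close> are transforms of
  functionals and need not be bounded on the real line.\<close>

lemma bounded_of_quotient:
  fixes \<phi> \<theta> hp hm gp gm :: "complex \<Rightarrow> complex" and p q s t :: real
  assumes hol: "\<phi> holomorphic_on UNIV" "\<theta> holomorphic_on UNIV" "hp holomorphic_on UNIV" "gp holomorphic_on UNIV"
    and id: "\<And>z. hp z + hm z = \<theta> z * (gp z + gm z)"
    and C0: "C0 > 0" and pq: "p < q"
    and up: "\<And>z. Im z \<ge> 0 \<Longrightarrow> norm (hp z) \<le> C0" "\<And>z. Im z \<ge> 0 \<Longrightarrow> norm (gp z) \<le> C0 * exp (- q * Im z)"
    and lo: "\<And>z. Im z \<le> 0 \<Longrightarrow> norm (hm z) \<le> C0" "\<And>z. Im z \<le> 0 \<Longrightarrow> norm (gm z) \<le> C0 * exp (- p * Im z)"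
    and mult: "\<And>\<delta>. \<delta> > 0 \<Longrightarrow> \<exists>M C. M holomorphic_on UNIV \<and> C > 0 \<and>
       (\<forall>y. exp (- \<delta> * \<bar>y\<bar>) \<le> C * norm (M (\<i> * of_real y))) \<and>
       (\<forall>z. Im z \<ge> 0 \<longrightarrow> norm (\<phi> z * M z) \<le> C * exp ((t + \<delta>) * Im z) \<and>
                         norm (\<phi> z * \<theta> z * M z) \<le> C * exp ((t + q + \<delta>) * Im z)) \<and>
       (\<forall>z. Im z \<le> 0 \<longrightarrow> norm (\<phi> z * M z) \<le> C * exp ((s - \<delta>) * Im z) \<and>
                         norm (\<phi> z * \<theta> z * M z) \<le> C * exp ((s + p - \<delta>) * Im z))"
    and ind_up: "\<And>\<delta> C. \<delta> > 0 \<Longrightarrow> \<exists>y>0. C * exp ((t - \<delta>) * y) < norm (\<phi> (\<i> * of_real y))"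
    and ind_lo: "\<And>\<delta> C. \<delta> > 0 \<Longrightarrow> \<exists>y>0. C * exp ((- s - \<delta>) * y) < norm (\<phi> (- (\<i> * of_real y)))"
  shows "\<exists>C. \<forall>z. norm (hp z - \<theta> z * gp z) \<le> C"
proof -
  define E where "E z = hp z - \<theta> z * gp z" for z
  have E: "E holomorphic_on UNIV" unfolding E_def using hol by (intro holomorphic_intros)
  have E': "E z = - (hm z - \<theta> z * gm z)" for z using id[of z] by (simp add: E_def algebra_simps)
  \<comment> \<open>\<open>\<phi> M E\<close> is a difference of two products in which the exponents
    combine: \<open>t + q + \<delta>\<close> with \<open>- q\<close> above,
    \<open>s + p - \<delta>\<close> with \<open>- p\<close> below. So numerator and denominator of
    \<open>E\<close> obey the same bound.\<close>
  have bounds: "\<exists>M C. M holomorphic_on UNIV \<and> C > 0 \<and>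
       (\<forall>y. exp (- \<delta> * \<bar>y\<bar>) \<le> C * norm (M (\<i> * of_real y))) \<and>
       (\<forall>z. Im z \<ge> 0 \<longrightarrow> norm (\<phi> z * M z) \<le> C * exp ((t + \<delta>) * Im z) \<and>
                         norm (\<phi> z * M z * E z) \<le> C * exp ((t + \<delta>) * Im z)) \<and>
       (\<forall>z. Im z \<le> 0 \<longrightarrow> norm (\<phi> z * M z) \<le> C * exp ((s - \<delta>) * Im z) \<and>
                         norm (\<phi> z * M z * E z) \<le> C * exp ((s - \<delta>) * Im z))" if \<delta>: "\<delta> > 0" for \<delta>
  proof -
    obtain M C where M: "M holomorphic_on UNIV" "C > 0"
      "\<And>y. exp (- \<delta> * \<bar>y\<bar>) \<le> C * norm (M (\<i> * of_real y))"
      "\<And>z. Im z \<ge> 0 \<Longrightarrow> norm (\<phi> z * M z) \<le> C * exp ((t + \<delta>) * Im z)"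
      "\<And>z. Im z \<ge> 0 \<Longrightarrow> norm (\<phi> z * \<theta> z * M z) \<le> C * exp ((t + q + \<delta>) * Im z)"
      "\<And>z. Im z \<le> 0 \<Longrightarrow> norm (\<phi> z * M z) \<le> C * exp ((s - \<delta>) * Im z)"
      "\<And>z. Im z \<le> 0 \<Longrightarrow> norm (\<phi> z * \<theta> z * M z) \<le> C * exp ((s + p - \<delta>) * Im z)"
      using mult[OF \<delta>] by metis
    define C' where "C' = C + 2 * C * C0"
    have C': "C' > 0" "C \<le> C'" "2 * C * C0 \<le> C'" using M(2) C0 by (auto simp: C'_def intro!: add_pos_pos)
    have cc: "norm (\<phi> z * M z * E z) \<le> C' * exp e"
      if h: "norm (\<phi> z * M z) \<le> C * exp e" "norm h \<le> C0" "norm (\<phi> z * \<theta> z * M z) \<le> C * exp (e + d)"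
        "norm g \<le> C0 * exp (- d)" "norm (E z) = norm (h - \<theta> z * g)" for z h g e d
    proof -
      have "norm (\<phi> z * M z * E z) = norm ((\<phi> z * M z) * h - (\<phi> z * \<theta> z * M z) * g)"
        unfolding norm_mult[of _ "E z"] h(5) norm_mult[symmetric] by (simp add: algebra_simps)
      also have "\<dots> \<le> norm (\<phi> z * M z) * norm h + norm (\<phi> z * \<theta> z * M z) * norm g"
        by (metis norm_mult norm_triangle_ineq4)
      also have "\<dots> \<le> (C * exp e) * C0 + (C * exp (e + d)) * (C0 * exp (- d))"
        by (intro add_mono mult_mono h) (use M(2) in simp_all)
      also have "\<dots> = (2 * C * C0) * exp e" by (simp add: exp_add exp_minus)
      also have "\<dots> \<le> C' * exp e" using C' by (intro mult_right_mono) auto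
      finally show ?thesis .
    qed
    show ?thesis
    proof (rule exI[of _ M], rule exI[of _ C'], intro conjI allI impI)
      show "exp (- \<delta> * \<bar>y\<bar>) \<le> C' * norm (M (\<i> * of_real y))" for y
        using M(3)[of y] C' mult_right_mono[OF C'(2), of "norm (M (\<i> * of_real y))", OF norm_ge_zero] by linarith
      fix z :: complex
      show "norm (\<phi> z * M z) \<le> C' * exp ((t + \<delta>) * Im z)" if "0 \<le> Im z"
        using M(4)[OF that] mult_right_mono[OF C'(2), of "exp ((t + \<delta>) * Im z)", OF exp_ge_zero] by linarith
      show "norm (\<phi> z * M z) \<le> C' * exp ((s - \<delta>) * Im z)" if "Im z \<le> 0"
        using M(6)[OF that] mult_right_mono[OF C'(2), of "exp ((s - \<delta>) * Im z)", OF exp_ge_zero] by linarith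
      show "norm (\<phi> z * M z * E z) \<le> C' * exp ((t + \<delta>) * Im z)" if "0 \<le> Im z"
        by (rule cc[of z _ "hp z" "q * Im z" "gp z"]) (use M(4,5)[OF that] up that in \<open>auto simp: E_def algebra_simps\<close>)
      show "norm (\<phi> z * M z * E z) \<le> C' * exp ((s - \<delta>) * Im z)" if "Im z \<le> 0"
        by (rule cc[of z _ "hm z" "p * Im z" "gm z"]) (use M(6,7)[OF that] lo that in \<open>auto simp: E' norm_minus_commute algebra_simps\<close>)
    qed (use M C' in auto)
  qed
  \<comment> \<open>Multiplication by \<open>exp (i (a + \<delta>) z)\<close> makes \<open>f\<close>
    and \<open>f E'\<close> bounded in the upper half plane; \<open>3 * \<delta>\<close> is the gap
    between the upper exponent \<open>a + \<delta>\<close> and the lower one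
    \<open>a - 2 * \<delta>\<close>.\<close>
  have cone_gen: "\<exists>R. \<forall>z. R \<le> norm z \<longrightarrow> 3/5 * norm z \<le> Im z \<longrightarrow> norm (E' z) \<le> 33 ^ 24 * exp (320 * (3 * \<delta>) * norm z)"
    if \<delta>: "\<delta> > 0" and h: "f holomorphic_on UNIV" "E' holomorphic_on UNIV" "C > 0"
      "\<And>z. Im z \<ge> 0 \<Longrightarrow> norm (f z) \<le> C * exp ((a + \<delta>) * Im z)"
      "\<And>z. Im z \<ge> 0 \<Longrightarrow> norm (f z * E' z) \<le> C * exp ((a + \<delta>) * Im z)"
      and big: "\<And>C'. \<exists>y>0. C' * exp ((a - 2 * \<delta>) * y) < norm (f (\<i> * of_real y))" for f E' C a \<delta>
  proof -
    define G where "G z = f z * exp (\<i> * of_real (a + \<delta>) * z)" for z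
    have nG: "norm (G z) = norm (f z) * exp (- ((a + \<delta>) * Im z))" for z
      by (simp add: G_def norm_mult)
    show ?thesis
    proof (rule quotient_growth_in_cone[of G E' "\<lambda>z. G z * E' z" C])
      show "G holomorphic_on UNIV" unfolding G_def using h(1) by (intro holomorphic_intros)
      show "norm (G z) \<le> C" if "0 \<le> Im z" for z
        unfolding nG mult_exp_le_iff using h(4)[OF that] by simp
      show "norm (G z * E' z) \<le> C" if "0 \<le> Im z" for z
      proof -
        have "norm (G z * E' z) = norm (f z * E' z) * exp (- ((a + \<delta>) * Im z))" by (simp add: norm_mult nG)
        thus ?thesis using h(5)[OF that] by (simp add: mult_exp_le_iff)
      qed
      fix C'
      obtain y where y: "y > 0" "C' * exp ((a - 2 * \<delta>) * y) < norm (f (\<i> * of_real y))" using big by blast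
      have "C' * exp (- (3 * \<delta> * y)) = C' * exp ((a - 2 * \<delta>) * y) * exp (- ((a + \<delta>) * y))"
        by (simp add: algebra_simps flip: exp_add)
      also have "\<dots> < norm (f (\<i> * of_real y)) * exp (- ((a + \<delta>) * y))" using y(2) by (rule mult_strict_right_mono) simp
      finally show "\<exists>y>0. C' * exp (- (3 * \<delta> * y)) < norm (G (\<i> * of_real y))" using y(1) by (auto simp: nG)
    qed (use h \<delta> in auto)
  qed
  have cone: "\<exists>K R. \<forall>z. R \<le> norm z \<longrightarrow> 3/5 * norm z \<le> \<bar>Im z\<bar> \<longrightarrow> norm (E z) \<le> K * exp (\<epsilon> * norm z)" if \<epsilon>: "\<epsilon> > 0" for \<epsilon>
  proof -
    \<comment> \<open>Chosen so that \<open>320 * (3 * \<delta>) = \<epsilon>\<close>.\<close>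
    define \<delta> where "\<delta> = \<epsilon> / 960"
    have \<delta>: "\<delta> > 0" using \<epsilon> by (simp add: \<delta>_def)
    obtain M C where M: "M holomorphic_on UNIV" "C > 0"
      "\<And>y. exp (- \<delta> * \<bar>y\<bar>) \<le> C * norm (M (\<i> * of_real y))"
      "\<And>z. Im z \<ge> 0 \<Longrightarrow> norm (\<phi> z * M z) \<le> C * exp ((t + \<delta>) * Im z)"
      "\<And>z. Im z \<ge> 0 \<Longrightarrow> norm (\<phi> z * M z * E z) \<le> C * exp ((t + \<delta>) * Im z)"
      "\<And>z. Im z \<le> 0 \<Longrightarrow> norm (\<phi> z * M z) \<le> C * exp ((s - \<delta>) * Im z)"
      "\<And>z. Im z \<le> 0 \<Longrightarrow> norm (\<phi> z * M z * E z) \<le> C * exp ((s - \<delta>) * Im z)"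
      using bounds[OF \<delta>] by metis
    have low: "C' * exp ((a - 2 * \<delta>) * \<bar>y\<bar>) < norm (\<phi> (\<i> * of_real y) * M (\<i> * of_real y))"
      if "\<bar>C'\<bar> * C * exp ((a - \<delta>) * \<bar>y\<bar>) < norm (\<phi> (\<i> * of_real y))" for a y C'
    proof -
      have "C' * C * exp ((a - 2 * \<delta>) * \<bar>y\<bar>) \<le> \<bar>C'\<bar> * C * exp ((a - 2 * \<delta>) * \<bar>y\<bar>)"
        using M(2) by (intro mult_right_mono) auto
      also have "\<dots> = \<bar>C'\<bar> * C * exp ((a - \<delta>) * \<bar>y\<bar>) * exp (- \<delta> * \<bar>y\<bar>)" by (simp add: algebra_simps flip: exp_add)
      also have "\<dots> < norm (\<phi> (\<i> * of_real y)) * exp (- \<delta> * \<bar>y\<bar>)" using that by (rule mult_strict_right_mono) simp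
      also have "\<dots> \<le> norm (\<phi> (\<i> * of_real y)) * (C * norm (M (\<i> * of_real y)))" by (intro mult_left_mono M) auto
      finally have "C * (C' * exp ((a - 2 * \<delta>) * \<bar>y\<bar>)) < C * norm (\<phi> (\<i> * of_real y) * M (\<i> * of_real y))"
        by (simp add: norm_mult mult_ac)
      thus ?thesis using M(2) by simp
    qed
    have "\<exists>R. \<forall>z. R \<le> norm z \<longrightarrow> 3/5 * norm z \<le> Im z \<longrightarrow> norm (E z) \<le> 33 ^ 24 * exp (320 * (3 * \<delta>) * norm z)"
    proof (rule cone_gen[of \<delta> "\<lambda>z. \<phi> z * M z" E C t])
      fix C'
      obtain y where "y > 0" "\<bar>C'\<bar> * C * exp ((t - \<delta>) * y) < norm (\<phi> (\<i> * of_real y))" using ind_up[OF \<delta>] by blast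
      thus "\<exists>y>0. C' * exp ((t - 2 * \<delta>) * y) < norm (\<phi> (\<i> * of_real y) * M (\<i> * of_real y))"
        using low[of C' t y] by auto
    qed (use M E \<delta> hol in \<open>auto intro!: holomorphic_intros\<close>)
    then obtain R1 where R1: "\<And>z. R1 \<le> norm z \<Longrightarrow> 3/5 * norm z \<le> Im z \<Longrightarrow> norm (E z) \<le> 33 ^ 24 * exp (\<epsilon> * norm z)"
      by (auto simp: \<delta>_def)
    have refl: "(\<lambda>z. f (- z)) holomorphic_on UNIV" if "f holomorphic_on UNIV" for f :: "complex \<Rightarrow> complex"
    proof -
      have "(f \<circ> uminus) holomorphic_on UNIV"
        by (rule holomorphic_on_compose_gen[of _ _ f UNIV]) (auto intro!: holomorphic_intros that)
      thus ?thesis by (simp add: o_def)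
    qed
    have "\<exists>R. \<forall>z. R \<le> norm z \<longrightarrow> 3/5 * norm z \<le> Im z \<longrightarrow> norm (E (- z)) \<le> 33 ^ 24 * exp (320 * (3 * \<delta>) * norm z)"
    proof (rule cone_gen[of \<delta> "\<lambda>z. \<phi> (- z) * M (- z)" "\<lambda>z. E (- z)" C "- s"])
      show "norm (\<phi> (- z) * M (- z)) \<le> C * exp ((- s + \<delta>) * Im z)" if "0 \<le> Im z" for z
        using M(6)[of "- z"] that by (simp add: algebra_simps)
      show "norm (\<phi> (- z) * M (- z) * E (- z)) \<le> C * exp ((- s + \<delta>) * Im z)" if "0 \<le> Im z" for z
        using M(7)[of "- z"] that by (simp add: algebra_simps)
      fix C'
      obtain y where y: "y > 0" "\<bar>C'\<bar> * C * exp ((- s - \<delta>) * y) < norm (\<phi> (- (\<i> * of_real y)))" using ind_lo[OF \<delta>] by blast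
      thus "\<exists>y>0. C' * exp ((- s - 2 * \<delta>) * y) < norm (\<phi> (- (\<i> * of_real y)) * M (- (\<i> * of_real y)))"
        using low[of C' "- s" "- y"] by auto
    qed (use M E \<delta> hol refl in \<open>auto intro!: holomorphic_intros\<close>)
    then obtain R2 where R2: "\<And>z. R2 \<le> norm z \<Longrightarrow> 3/5 * norm z \<le> Im z \<Longrightarrow> norm (E (- z)) \<le> 33 ^ 24 * exp (\<epsilon> * norm z)"
      by (auto simp: \<delta>_def)
    have "norm (E z) \<le> 33 ^ 24 * exp (\<epsilon> * norm z)" if "max R1 R2 \<le> norm z" "3/5 * norm z \<le> \<bar>Im z\<bar>" for z
      using R1[of z] R2[of "- z"] that by (cases "Im z \<ge> 0") auto
    thus ?thesis by blast
  qed
  have type: "\<exists>C \<tau>. C > 0 \<and> \<tau> > 0 \<and> (\<forall>z. norm (E z) \<le> C * exp (\<tau> * norm z))"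
  proof -
    obtain M C where M: "M holomorphic_on UNIV" "C > 0"
      "\<And>y. exp (- 1 * \<bar>y\<bar>) \<le> C * norm (M (\<i> * of_real y))"
      "\<And>z. Im z \<ge> 0 \<Longrightarrow> norm (\<phi> z * M z) \<le> C * exp ((t + 1) * Im z)"
      "\<And>z. Im z \<ge> 0 \<Longrightarrow> norm (\<phi> z * M z * E z) \<le> C * exp ((t + 1) * Im z)"
      "\<And>z. Im z \<le> 0 \<Longrightarrow> norm (\<phi> z * M z) \<le> C * exp ((s - 1) * Im z)"
      "\<And>z. Im z \<le> 0 \<Longrightarrow> norm (\<phi> z * M z * E z) \<le> C * exp ((s - 1) * Im z)"
      using bounds[OF zero_less_one] by metis
    define \<tau> where "\<tau> = \<bar>t + 1\<bar> + \<bar>s - 1\<bar>"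
    have b: "C * exp (r * Im z) \<le> C * exp (\<tau> * norm z)" if "\<bar>r\<bar> \<le> \<tau>" for r z
    proof -
      have "r * Im z \<le> \<bar>r\<bar> * \<bar>Im z\<bar>" by (metis abs_ge_self abs_mult)
      also have "\<dots> \<le> \<tau> * norm z" using that abs_Im_le_cmod[of z] by (intro mult_mono) auto
      finally show ?thesis using M(2) by simp
    qed
    obtain y where y: "0 * exp ((t - 1) * y) < norm (\<phi> (\<i> * of_real y))" using ind_up[of 1 0] by auto
    have Mnz: "M (\<i> * of_real y) \<noteq> 0" using M(3)[of y] by (metis exp_gt_zero mult_zero_right norm_zero not_le)
    show ?thesis
    proof (rule quotient_exponential_type[of "\<lambda>z. \<phi> z * M z" E "\<lambda>z. \<phi> z * M z * E z" C \<tau> "\<i> * of_real y"])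
      show "norm (\<phi> z * M z) \<le> C * exp (\<tau> * norm z)" for z
        using M(4)[of z] M(6)[of z] b[of "t + 1" z] b[of "s - 1" z] by (cases "Im z \<ge> 0") (auto simp: \<tau>_def)
      show "norm (\<phi> z * M z * E z) \<le> C * exp (\<tau> * norm z)" for z
        using M(5)[of z] M(7)[of z] b[of "t + 1" z] b[of "s - 1" z] by (cases "Im z \<ge> 0") (auto simp: \<tau>_def)
    qed (use M E hol y Mnz in \<open>auto intro!: holomorphic_intros simp: \<tau>_def\<close>)
  qed
  then obtain C1 \<tau> where C1: "C1 > 0" "\<tau> > 0" "\<And>z. norm (E z) \<le> C1 * exp (\<tau> * norm z)" by blast
  \<comment> \<open>Shifting \<open>\<theta>\<close> by the midpoint of \<open>[p, q]\<close> makes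
    the decay symmetric. Where \<open>|E| \<ge> 2 C0\<close>, the term with \<open>\<theta>\<close>
    accounts for at least half of \<open>E\<close>, and both \<open>- q Im z\<close> above and
    \<open>- p Im z\<close> below the real axis equal \<open>- b |Im z| - m Im z\<close>.\<close>
  define m where "m = (p + q) / 2"
  define b where "b = (q - p) / 2"
  define \<Theta> where "\<Theta> z = \<theta> z * exp (\<i> * of_real m * z)" for z
  have n\<Theta>: "norm (\<Theta> z) = norm (\<theta> z) * exp (- (m * Im z))" for z by (simp add: \<Theta>_def norm_mult)
  have "\<exists>C. \<forall>z. norm (E z) \<le> C"
  proof (rule type_zero_bounded[OF E])
    show "\<Theta> holomorphic_on UNIV" unfolding \<Theta>_def using hol by (intro holomorphic_intros)
    show "\<exists>C>0. \<forall>z. norm (E z) \<le> C * exp (\<epsilon> * norm z)" if "\<epsilon> > 0" for \<epsilon>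
      by (rule entire_type_zero[OF E C1 cone that])
    show "2 * C0 > 0" using C0 by simp
    show "b > 0" using pq by (simp add: b_def)
    fix z assume Ez: "2 * C0 \<le> norm (E z)"
    have half: "norm (E z) \<le> 2 * (norm (\<theta> z) * norm g)" if "norm h \<le> C0" "norm (E z) = norm (h - \<theta> z * g)" for h g
    proof -
      have "norm (E z) \<le> norm h + norm (\<theta> z) * norm g" unfolding that(2) by (metis norm_mult norm_triangle_ineq4)
      thus ?thesis using that(1) Ez by linarith
    qed
    show "norm (E z) \<le> 2 * C0 * exp (- b * \<bar>Im z\<bar>) * norm (\<Theta> z)"
    proof (cases "Im z \<ge> 0")
      case True
      have "norm (E z) \<le> 2 * (norm (\<theta> z) * norm (gp z))" by (rule half[of "hp z"]) (use up True in \<open>auto simp: E_def\<close>)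
      also have "\<dots> \<le> 2 * (norm (\<theta> z) * (C0 * exp (- q * Im z)))" using up(2)[OF True] by (intro mult_left_mono) auto
      also have "- q * Im z = - b * \<bar>Im z\<bar> + - (m * Im z)" using True by (simp add: b_def m_def field_simps)
      finally show ?thesis by (simp only: n\<Theta> exp_add mult_ac)
    next
      case False
      have "norm (E z) \<le> 2 * (norm (\<theta> z) * norm (gm z))"
        by (rule half[of "hm z"]) (use lo False in \<open>auto simp: E' norm_minus_commute\<close>)
      also have "\<dots> \<le> 2 * (norm (\<theta> z) * (C0 * exp (- p * Im z)))" using lo(2)[of z] False by (intro mult_left_mono) auto
      also have "- p * Im z = - b * \<bar>Im z\<bar> + - (m * Im z)" using False by (simp add: b_def m_def field_simps)
      finally show ?thesis by (simp only: n\<Theta> exp_add mult_ac)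
    qed
  qed
  thus ?thesis by (simp add: E_def)
qed


section \<open>Weights and their Young conjugates\<close>

text \<open>For a weight and \<open>q > 0\<close> this is the supremum of
  \<open>x ^ j * exp (- q * \<omega> x)\<close> over \<open>x \<ge> 1\<close>: put
  \<open>x = exp t\<close> in the Young conjugate. The estimates below work with that form
  (\<open>power_le_ywt\<close>, \<open>ywt_le\<close>). It decreases in \<open>q\<close>.\<close>

definition ywt :: "(real \<Rightarrow> real) \<Rightarrow> real \<Rightarrow> nat \<Rightarrow> real" where
  "ywt \<omega> q j = exp (q * young_conj \<omega> (real j / q))"

lemma ywt_pos [simp]: "ywt \<omega> q j > 0" "ywt \<omega> q j \<noteq> 0" "ywt \<omega> q j \<ge> 0" by (auto simp: ywt_def)

locale weight_fun =
  fixes \<omega> :: "real \<Rightarrow> real"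
  assumes weight: "weight \<omega>"
begin

lemma \<omega>_nonneg: "x \<ge> 0 \<Longrightarrow> \<omega> x \<ge> 0" using weight by (auto simp: weight_def)

lemma \<omega>_mono: "0 \<le> x \<Longrightarrow> x \<le> y \<Longrightarrow> \<omega> x \<le> \<omega> y"
  using weight by (auto simp: weight_def mono_on_def)

lemma \<omega>_cont: "continuous_on {0..} \<omega>" using weight by (auto simp: weight_def)

lemma \<omega>_subadd: "\<sigma> > 1 \<Longrightarrow> \<exists>C>0. \<forall>x\<ge>0. \<forall>y\<ge>0. \<omega> (x + y) \<le> \<sigma> * (\<omega> x + \<omega> y) + C"
  using weight by (auto simp: weight_def)

lemma ln_le_\<omega>: "c > 0 \<Longrightarrow> \<exists>X\<ge>1. \<forall>x\<ge>X. ln x \<le> c * \<omega> x"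
proof -
  assume c: "c > 0"
  have "ln \<in> o[at_top](\<omega>)" using weight by (auto simp: weight_def)
  from landau_o.smallD[OF this c] have "\<forall>\<^sub>F x in at_top. norm (ln x) \<le> c * norm (\<omega> x)" .
  then obtain X where X: "\<And>x. x \<ge> X \<Longrightarrow> norm (ln x) \<le> c * norm (\<omega> x)" by (auto simp: eventually_at_top_linorder)
  show ?thesis
  proof (intro exI[of _ "max X 1"] conjI allI impI)
    fix x assume "max X 1 \<le> x"
    thus "ln x \<le> c * \<omega> x" using X[of x] \<omega>_nonneg[of x] by simp
  qed simp
qed

lemma le_exp_\<omega>:
  assumes "c > 0" shows "\<exists>C>0. \<forall>x\<ge>1. x \<le> C * exp (c * \<omega> x)"
proof -
  obtain X where X: "X \<ge> 1" "\<And>x. x \<ge> X \<Longrightarrow> ln x \<le> c * \<omega> x" using ln_le_\<omega>[OF assms] by blast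
  have "x \<le> X * exp (c * \<omega> x)" if "x \<ge> 1" for x
  proof (cases "x \<ge> X")
    case True
    have "x = exp (ln x)" using that by simp
    also have "\<dots> \<le> 1 * exp (c * \<omega> x)" using X(2)[OF True] by simp
    also have "\<dots> \<le> X * exp (c * \<omega> x)" using X(1) by (intro mult_right_mono) auto
    finally show ?thesis .
  next
    case False
    have "x \<le> X * 1" using False by simp
    also have "\<dots> \<le> X * exp (c * \<omega> x)" using X(1) assms \<omega>_nonneg[of x] that by (intro mult_left_mono) auto
    finally show ?thesis .
  qed
  thus ?thesis using X(1) by (intro exI[of _ X]) auto
qed

lemma young_bdd: "s \<ge> 0 \<Longrightarrow> bdd_above ((\<lambda>t. s * t - \<omega> (exp t)) ` {0..})"
proof -
  assume s: "s \<ge> 0"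
  obtain X where X: "X \<ge> 1" "\<And>x. x \<ge> X \<Longrightarrow> ln x \<le> 1 / (s + 1) * \<omega> x" using ln_le_\<omega>[of "1 / (s + 1)"] s by auto
  show ?thesis
  proof (intro bdd_aboveI2[of _ _ "s * ln X"])
    fix t :: real assume t: "t \<in> {0..}"
    show "s * t - \<omega> (exp t) \<le> s * ln X"
    proof (cases "exp t \<ge> X")
      case True
      have "(s + 1) * t \<le> \<omega> (exp t)" using X(2)[OF True] s by (simp add: pos_le_divide_eq mult.commute)
      hence "s * t - \<omega> (exp t) \<le> 0" using t by (simp add: algebra_simps)
      also have "0 \<le> s * ln X" using s X by simp
      finally show ?thesis .
    next
      case False
      hence "t \<le> ln X" using X(1) by (simp add: ln_ge_iff)
      hence "s * t \<le> s * ln X" using s by (intro mult_left_mono) auto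
      thus ?thesis using \<omega>_nonneg[of "exp t"] by simp
    qed
  qed
qed

lemma power_le_ywt:
  assumes "q > 0" "x \<ge> 1" shows "x ^ j \<le> ywt \<omega> q j * exp (q * \<omega> x)"
proof -
  have "real j / q * ln x - \<omega> (exp (ln x)) \<le> young_conj \<omega> (real j / q)"
    unfolding young_conj_def using young_bdd[of "real j / q"] assms by (intro cSUP_upper) auto
  hence "q * (real j / q * ln x - \<omega> x) \<le> q * young_conj \<omega> (real j / q)"
    using assms by (intro mult_left_mono) auto
  hence "real j * ln x \<le> q * young_conj \<omega> (real j / q) + q * \<omega> x"
    using assms by (simp add: right_diff_distrib)
  hence "exp (real j * ln x) \<le> exp (q * young_conj \<omega> (real j / q) + q * \<omega> x)" by (simp only: exp_le_cancel_iff)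
  moreover have "exp (real j * ln x) = x ^ j" using assms by (simp add: exp_of_nat_mult)
  ultimately show ?thesis by (simp add: ywt_def exp_add)
qed

lemma ywt_le:
  assumes "q > 0" "B > 0" "\<And>x. x \<ge> 1 \<Longrightarrow> x ^ j * exp (- q * \<omega> x) \<le> B"
  shows "ywt \<omega> q j \<le> B"
proof -
  have "young_conj \<omega> (real j / q) \<le> ln B / q" unfolding young_conj_def
  proof (rule cSUP_least)
    fix t :: real assume "t \<in> {0..}"
    hence "exp t ^ j * exp (- q * \<omega> (exp t)) \<le> B" by (intro assms) auto
    hence "exp (real j * t + - q * \<omega> (exp t)) \<le> B" by (simp only: exp_of_nat_mult exp_add)
    hence "real j * t - q * \<omega> (exp t) \<le> ln B" using assms(2) by (simp add: ln_ge_iff)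
    hence "(real j * t - q * \<omega> (exp t)) / q \<le> ln B / q" using assms(1) by (intro divide_right_mono) auto
    thus "real j / q * t - \<omega> (exp t) \<le> ln B / q" using assms(1) by (simp add: diff_divide_distrib)
  qed auto
  hence "q * young_conj \<omega> (real j / q) \<le> ln B" using assms(1) by (simp add: pos_le_divide_eq mult.commute)
  thus ?thesis using assms(2) by (simp add: ywt_def ln_ge_iff)
qed

lemma ywt_antimono:
  assumes "0 < q'" "q' \<le> q" shows "ywt \<omega> q j \<le> ywt \<omega> q' j"
proof (rule ywt_le)
  fix x :: real assume x: "x \<ge> 1"
  have "x ^ j * exp (- q * \<omega> x) \<le> x ^ j * exp (- q' * \<omega> x)"
    using assms x \<omega>_nonneg[of x] by (intro mult_left_mono) (auto intro: mult_right_mono)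
  also have "\<dots> \<le> ywt \<omega> q' j" using power_le_ywt[of q' x j] assms x by (simp add: exp_minus divide_simps)
  finally show "x ^ j * exp (- q * \<omega> x) \<le> ywt \<omega> q' j" .
qed (use assms in auto)

text \<open>One more derivative costs a factor \<open>x\<close>, which
  \<open>exp ((q1 - q) * \<omega> x)\<close> absorbs because ln x = o(\<omega>(x)).\<close>

lemma ywt_Suc:
  assumes "0 < q" "q < q1" shows "\<exists>C>0. \<forall>j. ywt \<omega> q1 (Suc j) \<le> C * ywt \<omega> q j"
proof -
  obtain C where C: "C > 0" "\<And>x. x \<ge> 1 \<Longrightarrow> x \<le> C * exp ((q1 - q) * \<omega> x)" using le_exp_\<omega>[of "q1 - q"] assms by auto
  have "ywt \<omega> q1 (Suc j) \<le> C * ywt \<omega> q j" for j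
  proof (rule ywt_le)
    fix x :: real assume x: "x \<ge> 1"
    have "x ^ Suc j * exp (- q1 * \<omega> x) = x * x ^ j * exp (- q1 * \<omega> x)" by simp
    also have "\<dots> \<le> (C * exp ((q1 - q) * \<omega> x)) * (ywt \<omega> q j * exp (q * \<omega> x)) * exp (- q1 * \<omega> x)"
      using C x power_le_ywt[of q x j] assms by (intro mult_mono) auto
    also have "\<dots> = C * ywt \<omega> q j * (exp ((q1 - q) * \<omega> x) * exp (q * \<omega> x) * exp (- q1 * \<omega> x))" by (simp only: mult_ac)
    also have "\<dots> = C * ywt \<omega> q j" by (simp add: algebra_simps flip: exp_add)
    finally show "x ^ Suc j * exp (- q1 * \<omega> x) \<le> C * ywt \<omega> q j" .
  qed (use assms C in auto)
  thus ?thesis using C by blast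
qed

lemma power_le_ywt':
  assumes "q > 0" "x \<ge> 0" shows "x ^ j \<le> ywt \<omega> q j * exp (q * \<omega> (max 1 x))"
proof -
  have "x ^ j \<le> (max 1 x) ^ j" using assms by (intro power_mono) auto
  also have "\<dots> \<le> ywt \<omega> q j * exp (q * \<omega> (max 1 x))" by (rule power_le_ywt) (use assms in auto)
  finally show ?thesis .
qed

lemma one_le_ywt: "q > 0 \<Longrightarrow> 1 \<le> ywt \<omega> q j * exp (q * \<omega> 1)"
  using power_le_ywt[of q 1 j] by simp

text \<open>\<omega> dominates every multiple of the logarithm, so the terms are bounded by a
  multiple of \<open>1 / n^2\<close>. Uniformity over finite sets is asked for because
  \<open>ywt_product\<close> sums over sets that vary with \<open>j\<close>.\<close>

lemma sum_exp_\<omega>_bounded: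
  assumes "c > 0" shows "\<exists>D>0. \<forall>A. finite A \<longrightarrow> 0 \<notin> A \<longrightarrow> (\<Sum>n\<in>A. exp (- c * \<omega> (real n))) \<le> D"
proof -
  obtain C where C: "C > 0" "\<And>x. x \<ge> 1 \<Longrightarrow> x \<le> C * exp (c / 2 * \<omega> x)" using le_exp_\<omega>[of "c / 2"] assms by auto
  have le: "exp (- c * \<omega> (real n)) \<le> C\<^sup>2 * inverse (real n ^ 2)" if "n \<noteq> 0" for n
  proof -
    have "real n ^ 2 \<le> (C * exp (c / 2 * \<omega> n)) ^ 2" using C(2)[of "real n"] that by (intro power_mono) auto
    also have "\<dots> = C\<^sup>2 * exp (c * \<omega> n)" by (simp add: power_mult_distrib flip: exp_of_nat_mult)
    finally have "real n ^ 2 * exp (- c * \<omega> n) \<le> C\<^sup>2" by (simp add: exp_minus divide_simps)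
    thus ?thesis using that by (simp add: divide_simps mult.commute)
  qed
  have sm: "summable (\<lambda>n. C\<^sup>2 * inverse (real n ^ 2))" by (intro summable_mult inverse_power_summable) auto
  show ?thesis
  proof (intro exI[of _ "(\<Sum>n. C\<^sup>2 * inverse (real n ^ 2)) + 1"] conjI allI impI)
    show "(\<Sum>n. C\<^sup>2 * inverse (real n ^ 2)) + 1 > 0" using suminf_nonneg[OF sm] by (simp add: add_nonneg_pos)
    fix A :: "nat set" assume A: "finite A" "0 \<notin> A"
    have "(\<Sum>n\<in>A. exp (- c * \<omega> (real n))) \<le> (\<Sum>n\<in>A. C\<^sup>2 * inverse (real n ^ 2))"
      using A by (intro sum_mono le) metis
    also have "\<dots> \<le> (\<Sum>n. C\<^sup>2 * inverse (real n ^ 2))" by (rule sum_le_suminf[OF sm A(1)]) auto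
    finally show "(\<Sum>n\<in>A. exp (- c * \<omega> (real n))) \<le> (\<Sum>n. C\<^sup>2 * inverse (real n ^ 2)) + 1" by simp
  qed
qed

text \<open>A nearly maximal \<open>x\<close> is rounded up to an integer. By quasi-subadditivity
  this raises \<omega> by at most the factor \<open>q1 / q\<close> and a constant, paid for by
  lowering \<open>q1\<close> to \<open>q\<close>. Integer points are what makes the sums in
  \<open>ywt_product\<close> converge.\<close>

lemma ywt_attained:
  assumes "0 < q" "q < q1"
  shows "\<exists>C>0. \<forall>i. \<exists>n::nat. n \<ge> 1 \<and> ywt \<omega> q1 i \<le> C * (real n ^ i * exp (- q * \<omega> (real n)))"
proof -
  obtain C where C: "C > 0" "\<And>x y. x \<ge> 0 \<Longrightarrow> y \<ge> 0 \<Longrightarrow> \<omega> (x + y) \<le> q1 / q * (\<omega> x + \<omega> y) + C"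
    using \<omega>_subadd[of "q1 / q"] assms by auto
  define K where "K = 2 * exp (q1 * \<omega> 1 + q * C)"
  have "\<exists>n::nat. n \<ge> 1 \<and> ywt \<omega> q1 i \<le> K * (real n ^ i * exp (- q * \<omega> (real n)))" for i
  proof -
    have "\<exists>x\<ge>1. ywt \<omega> q1 i / 2 < x ^ i * exp (- q1 * \<omega> x)"
    proof (rule ccontr)
      assume "\<not> ?thesis"
      hence "ywt \<omega> q1 i \<le> ywt \<omega> q1 i / 2" using assms by (intro ywt_le) (auto simp: not_less)
      thus False using ywt_pos(1)[of \<omega> q1 i] by linarith
    qed
    then obtain x where x: "x \<ge> 1" "ywt \<omega> q1 i / 2 < x ^ i * exp (- q1 * \<omega> x)" by blast
    define n where "n = nat \<lceil>x\<rceil>"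
    have n: "x \<le> real n" "real n \<le> x + 1" "n \<ge> 1" using x(1) unfolding n_def by linarith+
    have "\<omega> n \<le> \<omega> (x + 1)" using n x by (intro \<omega>_mono) auto
    also have "\<dots> \<le> q1 / q * (\<omega> x + \<omega> 1) + C" using C(2)[of x 1] x by simp
    finally have "q * \<omega> n \<le> q * (q1 / q * (\<omega> x + \<omega> 1) + C)" using assms by (intro mult_left_mono) auto
    also have "\<dots> = q1 * \<omega> x + (q1 * \<omega> 1 + q * C)" using assms by (simp add: algebra_simps)
    finally have e: "exp (- q1 * \<omega> x) \<le> exp (q1 * \<omega> 1 + q * C) * exp (- q * \<omega> n)" by (simp flip: exp_add)
    have "ywt \<omega> q1 i \<le> 2 * (x ^ i * exp (- q1 * \<omega> x))" using x(2) by simp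
    also have "\<dots> \<le> 2 * (real n ^ i * (exp (q1 * \<omega> 1 + q * C) * exp (- q * \<omega> n)))"
      using n x e by (intro mult_left_mono mult_mono power_mono) auto
    also have "\<dots> = K * (real n ^ i * exp (- q * \<omega> (real n)))" by (simp add: K_def)
    finally show ?thesis using n(3) by blast
  qed
  moreover have "K > 0" by (simp add: K_def)
  ultimately show ?thesis by blast
qed

text \<open>This estimate makes the space an algebra under the Leibniz rule. Each
  \<open>ywt \<omega> q1 i\<close> is replaced by a value \<open>n^i exp (- q2 \<omega> n)\<close>
  at an integer \<open>n\<close>, and each product by the sum over all pairs of integers that occur.
  For a fixed pair (k, m) the sum over \<open>i\<close> is binomial and gives
  \<open>(k + m)^j\<close>, to which quasi-subadditivity of \<omega> applies; the sum over the pairs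
  is bounded uniformly in \<open>j\<close>.\<close>

lemma ywt_product:
  assumes "0 < q" "q < q1"
  shows "\<exists>C>0. \<forall>j. (\<Sum>i\<le>j. of_nat (j choose i) * (ywt \<omega> q1 i * ywt \<omega> q1 (j - i))) \<le> C * ywt \<omega> q j"
proof -
  \<comment> \<open>The loss from \<open>q1\<close> to \<open>q\<close> is shared out:
    \<open>q1\<close> to \<open>q2\<close> for the integer points, \<open>q2\<close> to
    \<open>q3\<close> for the convergent sums, \<open>q3\<close> to \<open>q\<close> for
    quasi-subadditivity.\<close>
  define q2 q3 where "q2 = (q + q1) / 2" and "q3 = (q + q2) / 2"
  have q: "q < q3" "q3 < q2" "q2 < q1" "0 < q2" using assms by (auto simp: q2_def q3_def)
  obtain K n where K: "K > 0" "\<And>i. n i \<ge> (1::nat)" "\<And>i. ywt \<omega> q1 i \<le> K * (real (n i) ^ i * exp (- q2 * \<omega> (real (n i))))"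
    using ywt_attained[OF q(4,3)] by metis
  obtain C where C: "C > 0" "\<And>x y. x \<ge> 0 \<Longrightarrow> y \<ge> 0 \<Longrightarrow> \<omega> (x + y) \<le> q3 / q * (\<omega> x + \<omega> y) + C"
    using \<omega>_subadd[of "q3 / q"] assms q by auto
  obtain D where D: "D > 0" "\<And>A. finite A \<Longrightarrow> 0 \<notin> A \<Longrightarrow> (\<Sum>n\<in>A. exp (- (q2 - q3) * \<omega> (real n))) \<le> D"
    using sum_exp_\<omega>_bounded[of "q2 - q3"] q by auto
  define B where "B = K\<^sup>2 * exp (q * C) * D\<^sup>2"
  have "(\<Sum>i\<le>j. of_nat (j choose i) * (ywt \<omega> q1 i * ywt \<omega> q1 (j - i))) \<le> B * ywt \<omega> q j" for j
  proof -
    define A where "A = n ` {..j}"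
    have "n i \<noteq> 0" for i using K(2)[of i] by linarith
    hence A: "finite A" "0 \<notin> A" unfolding A_def by (auto, metis)
    define e where "e m = exp (- q2 * \<omega> (real m))" for m
    have e0: "e m \<ge> 0" for m by (simp add: e_def)
    have "(\<Sum>i\<le>j. of_nat (j choose i) * (ywt \<omega> q1 i * ywt \<omega> q1 (j - i)))
       \<le> (\<Sum>i\<le>j. \<Sum>(k, m)\<in>A \<times> A. of_nat (j choose i) * (K\<^sup>2 * (real k ^ i * e k * (real m ^ (j - i) * e m))))"
    proof (rule sum_mono)
      fix i assume i: "i \<in> {..j}"
      have "of_nat (j choose i) * (ywt \<omega> q1 i * ywt \<omega> q1 (j - i))
         \<le> of_nat (j choose i) * ((K * (real (n i) ^ i * e (n i))) * (K * (real (n (j - i)) ^ (j - i) * e (n (j - i)))))"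
        unfolding e_def using K by (intro mult_left_mono mult_mono) auto
      also have "\<dots> = (\<lambda>(k, m). of_nat (j choose i) * (K\<^sup>2 * (real k ^ i * e k * (real m ^ (j - i) * e m)))) (n i, n (j - i))"
        by (simp add: power2_eq_square mult_ac)
      also have "\<dots> \<le> (\<Sum>(k, m)\<in>A \<times> A. of_nat (j choose i) * (K\<^sup>2 * (real k ^ i * e k * (real m ^ (j - i) * e m))))"
        by (rule member_le_sum) (use i A e0 in \<open>auto simp: A_def intro!: mult_nonneg_nonneg\<close>)
      finally show "of_nat (j choose i) * (ywt \<omega> q1 i * ywt \<omega> q1 (j - i))
         \<le> (\<Sum>(k, m)\<in>A \<times> A. of_nat (j choose i) * (K\<^sup>2 * (real k ^ i * e k * (real m ^ (j - i) * e m))))" .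
    qed
    also have "\<dots> = (\<Sum>(k, m)\<in>A \<times> A. K\<^sup>2 * (e k * e m) * (real k + real m) ^ j)"
      by (subst sum.swap) (auto simp: binomial_ring sum_distrib_left intro!: sum.cong simp: mult_ac)
    also have "\<dots> \<le> (\<Sum>(k, m)\<in>A \<times> A. K\<^sup>2 * exp (q * C) * ywt \<omega> q j * (exp (- (q2 - q3) * \<omega> k) * exp (- (q2 - q3) * \<omega> m)))"
    proof (intro sum_mono, clarify)
      fix k m assume km: "k \<in> A" "m \<in> A"
      have 1: "real k + real m \<ge> 1" using km A by (cases k) auto
      have "q * \<omega> (real k + real m) \<le> q * (q3 / q * (\<omega> k + \<omega> m) + C)"
        using C(2)[of "real k" "real m"] assms by (intro mult_left_mono) auto
      also have "\<dots> = q3 * (\<omega> k + \<omega> m) + q * C" using assms by (simp add: distrib_left)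
      finally have "e k * e m * exp (q * \<omega> (real k + real m)) \<le>
           exp (q * C) * (exp (- (q2 - q3) * \<omega> k) * exp (- (q2 - q3) * \<omega> m))"
        unfolding e_def by (simp add: algebra_simps flip: exp_add)
      moreover have "(e k * e m) * (real k + real m) ^ j \<le> (e k * e m) * (ywt \<omega> q j * exp (q * \<omega> (real k + real m)))"
        using power_le_ywt[OF assms(1) 1] e0 by (intro mult_left_mono) auto
      ultimately have "(e k * e m) * (real k + real m) ^ j \<le> ywt \<omega> q j * (exp (q * C) * (exp (- (q2 - q3) * \<omega> k) * exp (- (q2 - q3) * \<omega> m)))"
        using mult_left_mono[of _ _ "ywt \<omega> q j", OF _ ywt_pos(3)] by (smt (verit, best) mult.assoc mult.left_commute)
      hence "K\<^sup>2 * ((e k * e m) * (real k + real m) ^ j) \<le> K\<^sup>2 * (ywt \<omega> q j * (exp (q * C) * (exp (- (q2 - q3) * \<omega> k) * exp (- (q2 - q3) * \<omega> m))))"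
        by (rule mult_left_mono) simp
      thus "K\<^sup>2 * (e k * e m) * (real k + real m) ^ j \<le>
        K\<^sup>2 * exp (q * C) * ywt \<omega> q j * (exp (- (q2 - q3) * \<omega> k) * exp (- (q2 - q3) * \<omega> m))" by (simp only: mult_ac)
    qed
    also have "\<dots> = K\<^sup>2 * exp (q * C) * ywt \<omega> q j * ((\<Sum>k\<in>A. exp (- (q2 - q3) * \<omega> k)) * (\<Sum>m\<in>A. exp (- (q2 - q3) * \<omega> m)))"
      by (simp only: sum_product sum.cartesian_product) (simp only: sum_distrib_left prod.case_distrib[of "\<lambda>x. _ * x"])
    also have "\<dots> \<le> K\<^sup>2 * exp (q * C) * ywt \<omega> q j * (D * D)"
      using D(1) D(2)[OF A] by (intro mult_left_mono mult_mono) (auto intro!: sum_nonneg)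
    also have "\<dots> = B * ywt \<omega> q j" by (simp add: B_def power2_eq_square)
    finally show ?thesis .
  qed
  moreover have "B > 0" using K D by (simp add: B_def)
  ultimately show ?thesis by blast
qed


section \<open>Levels of the weight and non-quasianalyticity\<close>

lemma \<omega>_level: "\<exists>X. \<omega> X = real k \<and> X \<ge> exp 1" if "real k \<ge> \<omega> (exp 1)"
proof -
  obtain X0 where X0: "X0 \<ge> 1" "\<And>x. x \<ge> X0 \<Longrightarrow> ln x \<le> 1 * \<omega> x" using ln_le_\<omega>[of 1] by auto
  define Z where "Z = max (max X0 (exp (real k))) (exp 1)"
  have "real k \<le> ln Z" using X0(1) by (simp add: Z_def ln_ge_iff)
  also have "ln Z \<le> \<omega> Z" using X0(2)[of Z] by (simp add: Z_def)
  finally have "real k \<le> \<omega> Z" .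
  moreover have "continuous_on {exp 1..Z} \<omega>" by (rule continuous_on_subset[OF \<omega>_cont]) (auto intro: order_trans[OF exp_ge_zero])
  ultimately have "\<exists>X. exp 1 \<le> X \<and> X \<le> Z \<and> \<omega> X = real k"
    using that by (intro IVT') (auto simp: Z_def)
  thus ?thesis by blast
qed

text \<open>Convergence of \<open>\<Sum>k. 1 / X k\<close> where \<open>\<omega> (X k) = k\<close>, from \<open>\<integral> \<omega> x / x\<^sup>2 dx < \<infinity>\<close> by Abel summation.\<close>

lemma sum_inverse_levels_bounded:
  fixes X :: "nat \<Rightarrow> real"
  assumes X: "\<And>k. k \<ge> K \<Longrightarrow> \<omega> (X k) = real k \<and> X k \<ge> 1"
  shows "\<exists>B. \<forall>N\<ge>K. (\<Sum>k=K..<N. 1 / X (Suc k)) \<le> B"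
proof -
  define g where "g x = \<omega> x / x\<^sup>2" for x
  have gint: "g integrable_on {1..}" unfolding g_def using weight by (simp add: weight_def)
  have X1: "X k \<ge> 1" if "k \<ge> K" for k using X that by blast
  have Xlt: "X k < X (Suc k)" if "k \<ge> K" for k
  proof (rule ccontr)
    assume "\<not> X k < X (Suc k)"
    hence "\<omega> (X (Suc k)) \<le> \<omega> (X k)" using X1[of k] X1[of "Suc k"] that by (intro \<omega>_mono) auto
    thus False using X[of k] X[of "Suc k"] that by simp
  qed
  have Xmono: "X K \<le> X N" if "N \<ge> K" for N
    using that by (induction N rule: dec_induct) (use Xlt in \<open>auto intro: order_trans less_imp_le\<close>)
  have gcont: "continuous_on {a..b} g" if "a \<ge> 1" for a b
    unfolding g_def using that
    by (intro continuous_intros continuous_on_subset[OF \<omega>_cont]) auto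
  have gi: "g integrable_on {a..b}" if "a \<ge> 1" for a b
    using integrable_continuous_real[OF gcont[OF that]] .
  have piece: "real k * (1 / X k - 1 / X (Suc k)) \<le> integral {X k..X (Suc k)} g" if k: "k \<ge> K" for k
  proof -
    have "((\<lambda>x. real k / x\<^sup>2) has_integral (- (real k / X (Suc k)) - - (real k / X k))) {X k..X (Suc k)}"
    proof (rule fundamental_theorem_of_calculus)
      show "X k \<le> X (Suc k)" using Xlt[OF k] by simp
      fix x assume "x \<in> {X k..X (Suc k)}"
      hence "x > 0" using X1[OF k] by auto
      thus "((\<lambda>x. - (real k / x)) has_vector_derivative real k / x\<^sup>2) (at x within {X k..X (Suc k)})"
        unfolding has_real_derivative_iff_has_vector_derivative[symmetric]
        by (auto intro!: derivative_eq_intros simp: power2_eq_square)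
    qed
    hence "integral {X k..X (Suc k)} (\<lambda>x. real k / x\<^sup>2) = real k * (1 / X k - 1 / X (Suc k))"
      "(\<lambda>x. real k / x\<^sup>2) integrable_on {X k..X (Suc k)}"
      by (auto simp: integral_unique algebra_simps dest: has_integral_integrable)
    moreover have "integral {X k..X (Suc k)} (\<lambda>x. real k / x\<^sup>2) \<le> integral {X k..X (Suc k)} g"
    proof (rule integral_le)
      fix x assume x: "x \<in> {X k..X (Suc k)}"
      have "\<omega> (X k) \<le> \<omega> x" using x X1[OF k] by (intro \<omega>_mono) auto
      thus "real k / x\<^sup>2 \<le> g x" using X[OF k] unfolding g_def by (intro divide_right_mono) auto
    qed (use gi X1[OF k] calculation in auto)
    ultimately show ?thesis by simp
  qed
  have tot: "(\<Sum>k=K..<N. real k * (1 / X k - 1 / X (Suc k))) \<le> integral {X K..X N} g" if "N \<ge> K" for N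
    using that
  proof (induction N rule: dec_induct)
    case (step n)
    have "integral {X K..X n} g + integral {X n..X (Suc n)} g = integral {X K..X (Suc n)} g"
      by (rule Henstock_Kurzweil_Integration.integral_combine) (use Xmono Xlt step X1 gi in \<open>auto intro: less_imp_le\<close>)
    thus ?case using step piece[of n] by simp
  qed simp
  have abel: "(\<Sum>k=K..<N. real k * (1 / X k - 1 / X (Suc k))) = real K / X K - real N / X N + (\<Sum>k=K..<N. 1 / X (Suc k))" if "N \<ge> K" for N
    using that
  proof (induction N rule: dec_induct)
    case (step n)
    thus ?case by (simp add: algebra_simps add_divide_distrib)
  qed simp
  have "\<omega> \<in> o[at_top](\<lambda>x. x)" using weight by (simp add: weight_def)
  from landau_o.smallD[OF this, of 1] obtain Z where Z: "\<And>x. x \<ge> Z \<Longrightarrow> \<bar>\<omega> x\<bar> \<le> \<bar>x\<bar>"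
    by (auto simp: eventually_at_top_linorder)
  \<comment> \<open>The boundary term of the Abel summation stays bounded because \<omega>(x) =
    o(x).\<close>
  have ratio: "real N / X N \<le> 1 + \<omega> (max Z 1)" if "N \<ge> K" for N
  proof (cases "X N \<ge> Z")
    case True
    have "real N / X N \<le> 1" using Z[OF True] X[OF that] by (simp add: divide_le_eq)
    moreover have "0 \<le> \<omega> (max Z 1)" by (rule \<omega>_nonneg) simp
    ultimately show ?thesis by linarith
  next
    case False
    have "real N / X N \<le> real N" 
      using X1[OF that] mult_left_mono[of 1 "X N" "real N"] by (simp add: divide_le_eq)
    also have "real N = \<omega> (X N)" using X[OF that] by simp
    also have "\<dots> \<le> \<omega> (max Z 1)" using False X1[OF that] by (intro \<omega>_mono) auto
    finally show ?thesis by linarith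
  qed
  have "(\<Sum>k=K..<N. 1 / X (Suc k)) \<le> integral {1..} g + (1 + \<omega> (max Z 1))" if "N \<ge> K" for N
  proof -
    have "integral {X K..X N} g \<le> integral {1..} g"
      by (rule integral_subset_le) (use X1[of K] gi gint \<omega>_nonneg in \<open>auto simp: g_def\<close>)
    moreover have "real K / X K \<ge> 0" using X1[of K] by simp
    ultimately show ?thesis using tot[OF that] abel[OF that] ratio[OF that] by linarith
  qed
  thus ?thesis by blast
qed

text \<open>The widths of the successive averages from which a bump function is built: a tail of the series
  of the \<open>1 / X k\<close> with \<open>\<omega> (X k) = k\<close>, preceded by finitely many small widths.\<close>

lemma bump_widths:
  assumes "\<eta> > 0"
  shows "\<exists>a :: nat \<Rightarrow> real. (\<forall>i. a i > 0) \<and> (\<forall>N. (\<Sum>i<N. a i) \<le> \<eta>) \<and>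
    (\<exists>C>0. \<forall>j. (\<Prod>i<j. 1 / a i) \<le> C * ywt \<omega> 1 j)"
proof -
  obtain K :: nat where K: "\<omega> (exp 1) \<le> real K" using real_arch_simple by blast
  have "\<exists>X. \<omega> X = real k \<and> X \<ge> exp 1" if "k \<ge> K" for k using \<omega>_level[of k] K that by simp
  then obtain X where X: "\<And>k. k \<ge> K \<Longrightarrow> \<omega> (X k) = real k \<and> X k \<ge> exp 1" by metis
  have e1: "exp 1 \<ge> (1::real)" by simp
  have X1: "X k \<ge> 1" "X k > 0" if "k \<ge> K" for k using X[OF that] e1 by linarith+
  obtain B where B: "\<And>N. N \<ge> K \<Longrightarrow> (\<Sum>k=K..<N. 1 / X (Suc k)) \<le> B"
    using sum_inverse_levels_bounded[of K X] X X1 by blast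
  have sm: "summable (\<lambda>i. 1 / X (Suc (i + K)))"
  proof (rule summableI_nonneg_bounded)
    show "0 \<le> 1 / X (Suc (n + K))" for n using X1[of "Suc (n + K)"] by simp
    fix n
    have "(\<Sum>i<n. 1 / X (Suc (i + K))) = (\<Sum>k=K..<n+K. 1 / X (Suc k))"
      using sum.shift_bounds_nat_ivl[of "\<lambda>k. 1 / X (Suc k)" 0 K n] by (simp add: atLeast0LessThan)
    also have "\<dots> \<le> B" by (rule B) simp
    finally show "(\<Sum>i<n. 1 / X (Suc (i + K))) \<le> B" .
  qed
  have "\<exists>M. norm (\<Sum>i. 1 / X (Suc ((i + M) + K))) < \<eta> / (2 * exp 1)"
    using suminf_exist_split[OF _ sm, of "\<eta> / (2 * exp 1)"] assms by auto
  then obtain M where M: "norm (\<Sum>i. 1 / X (Suc ((i + M) + K))) < \<eta> / (2 * exp 1)" by blast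
  define L where "L = Suc (M + K)"
  have LK: "L \<ge> K" by (simp add: L_def)
  \<comment> \<open>The factor e matters: as \<open>\<omega> (X j) = j\<close>, the bound
    \<open>X j ^ j \<le> ywt \<omega> 1 j * exp (\<omega> (X j))\<close> carries
    \<open>e ^ j\<close>, which the use of \<open>X j / e\<close> cancels. The first
    \<open>L\<close> widths affect only the constant.\<close>
  define a where "a i = (if i < L then \<eta> / (2 * L) else exp 1 / X i)" for i
  have apos: "a i > 0" for i using assms X1[of i] LK by (auto simp: a_def L_def)
  have tail: "(\<Sum>i<N. exp 1 / X (i + L)) \<le> \<eta> / 2" for N
  proof -
    have sm': "summable (\<lambda>i. 1 / X (Suc ((i + M) + K)))" using summable_ignore_initial_segment[OF sm, of M] by simp
    have "(\<Sum>i<N. 1 / X (i + L)) = (\<Sum>i<N. 1 / X (Suc ((i + M) + K)))" by (simp add: L_def add.assoc)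
    also have "\<dots> \<le> (\<Sum>i. 1 / X (Suc ((i + M) + K)))"
      by (rule sum_le_suminf[OF sm']) (use X1 in \<open>auto intro: less_imp_le\<close>)
    also have "\<dots> \<le> \<eta> / (2 * exp 1)" using M by simp
    finally have "exp 1 * (\<Sum>i<N. 1 / X (i + L)) \<le> \<eta> / 2" by (simp add: field_simps)
    thus ?thesis by (simp add: sum_distrib_left)
  qed
  have "(\<Sum>i<N. a i) \<le> \<eta>" for N
  proof -
    have "(\<Sum>i<N. a i) \<le> (\<Sum>i<L+N. a i)" by (rule sum_mono2) (use apos in \<open>auto intro: less_imp_le\<close>)
    also have "\<dots> = (\<Sum>i<L. a i) + (\<Sum>i<N. a (i + L))"
      by (induction N) (auto simp: add.commute)
    also have "(\<Sum>i<L. a i) = (\<Sum>i<L. \<eta> / (2 * L))" by (intro sum.cong) (auto simp: a_def)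
    also have "\<dots> = \<eta> / 2" by (simp add: L_def field_simps)
    also have "(\<Sum>i<N. a (i + L)) = (\<Sum>i<N. exp 1 / X (i + L))" by (simp add: a_def)
    also have "\<eta> / 2 + \<dots> \<le> \<eta>" using tail[of N] by simp
    finally show ?thesis by simp
  qed
  moreover have "\<exists>C>0. \<forall>j. (\<Prod>i<j. 1 / a i) \<le> C * ywt \<omega> 1 j"
  proof -
    define A where "A = max 1 (2 * L / \<eta>)"
    have A: "A \<ge> 1" by (simp add: A_def)
    have Xmono: "X i \<le> X j" if "K \<le> i" "i < j" for i j
    proof (rule ccontr)
      assume "\<not> X i \<le> X j"
      hence "\<omega> (X j) \<le> \<omega> (X i)" using X1[of j] that by (intro \<omega>_mono) auto
      thus False using X[of i] X[of j] that by simp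
    qed
    have big: "(\<Prod>i<j. 1 / a i) \<le> A ^ L * ywt \<omega> 1 j" if j: "j \<ge> L" for j
    proof -
      define x where "x = X j / exp 1"
      have x1: "x \<ge> 1" using X[of j] j LK by (simp add: x_def)
      have "(\<Prod>i<j. 1 / a i) \<le> (\<Prod>i<j. if i < L then A else x)"
      proof (rule prod_mono, safe)
        fix i assume i: "i < j"
        show "0 \<le> 1 / a i" using apos[of i] by simp
        show "1 / a i \<le> (if i < L then A else x)"
        proof (cases "i < L")
          case True thus ?thesis by (simp add: a_def A_def)
        next
          case False
          hence "X i \<le> X j" using Xmono[of i j] i LK by simp
          thus ?thesis using False by (simp add: a_def x_def divide_right_mono)
        qed
      qed
      also have "\<dots> = (\<Prod>i<L. A) * (\<Prod>i=L..<j. x)"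
      proof -
        have "{..<j} = {..<L} \<union> {L..<j}" "{..<L} \<inter> {L..<j} = {}" using j by auto
        thus ?thesis by (subst \<open>{..<j} = _\<close>, subst prod.union_disjoint) auto
      qed
      also have "\<dots> = A ^ L * x ^ (j - L)" by simp
      also have "\<dots> \<le> A ^ L * x ^ j" using A x1 by (intro mult_left_mono power_increasing) auto
      also have "x ^ j \<le> ywt \<omega> 1 j"
      proof -
        have "X j ^ j \<le> ywt \<omega> 1 j * exp (1 * \<omega> (X j))" by (rule power_le_ywt) (use X1[of j] j LK in auto)
        also have "\<dots> = ywt \<omega> 1 j * exp 1 ^ j" using X[of j] j LK by (simp flip: exp_of_nat_mult)
        finally show ?thesis by (simp add: x_def power_divide divide_le_eq)
      qed
      finally show ?thesis using A by (simp add: mult_left_mono)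
    qed
    define P where "P j = (\<Prod>i<j. 1 / a i)" for j
    have Ppos: "P j > 0" for j unfolding P_def using apos by (intro prod_pos) auto
    define C where "C = A ^ L + (\<Sum>j<L. P j * exp (1 * \<omega> 1))"
    have C: "C \<ge> A ^ L" "C > 0"
    proof -
      have "(\<Sum>j<L. P j * exp (1 * \<omega> 1)) \<ge> 0" using Ppos by (intro sum_nonneg) (auto intro: less_imp_le)
      thus "C \<ge> A ^ L" by (simp add: C_def)
      moreover have "A ^ L > 0" using A by simp
      ultimately show "C > 0" by linarith
    qed
    have "P j \<le> C * ywt \<omega> 1 j" for j
    proof (cases "j \<ge> L")
      case True
      have "A ^ L * ywt \<omega> 1 j \<le> C * ywt \<omega> 1 j" using C by (intro mult_right_mono) auto
      thus ?thesis using big[OF True] unfolding P_def by linarith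
    next
      case False
      have "P j * exp (1 * \<omega> 1) \<le> (\<Sum>j<L. P j * exp (1 * \<omega> 1))"
        by (rule member_le_sum) (use False Ppos in \<open>auto intro: less_imp_le\<close>)
      also have "\<dots> \<le> C" using A by (simp add: C_def)
      finally have 1: "P j * exp (1 * \<omega> 1) \<le> C" .
      have "P j * 1 \<le> P j * (ywt \<omega> 1 j * exp (1 * \<omega> 1))" using one_le_ywt[of 1 j] Ppos[of j] by (intro mult_left_mono) auto
      also have "\<dots> = (P j * exp (1 * \<omega> 1)) * ywt \<omega> 1 j" by simp
      also have "\<dots> \<le> C * ywt \<omega> 1 j" using 1 by (intro mult_right_mono) auto
      finally show ?thesis by simp
    qed
    thus ?thesis using C(2) unfolding P_def by blast
  qed
  ultimately show ?thesis using apos by blast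
qed

end


section \<open>Iterated derivatives\<close>

text \<open>A candidate sequence of derivatives. Since \<open>nderiv\<close> iterates an operator
  that is meaningful only where derivatives exist, the rules for sums, products, translates and
  exponentials are proved by exhibiting such a sequence and applying
  \<open>nderiv_dfam\<close>.\<close>

definition dfam :: "real set \<Rightarrow> (nat \<Rightarrow> real \<Rightarrow> complex) \<Rightarrow> bool" where
  "dfam X G \<longleftrightarrow> (\<forall>j. \<forall>x\<in>X. (G j has_vector_derivative G (Suc j) x) (at x))"

definition smooth_on_set :: "real set \<Rightarrow> (real \<Rightarrow> complex) \<Rightarrow> bool" where
  "smooth_on_set X f \<longleftrightarrow> (\<forall>j. \<forall>x\<in>X. nderiv j f differentiable (at x))"

lemma nderiv_0 [simp]: "nderiv 0 f = f" by (simp add: nderiv_def)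

lemma nderiv_Suc: "nderiv (Suc j) f x = vector_derivative (nderiv j f) (at x)"
  by (simp add: nderiv_def)

lemma nderiv_dfam:
  assumes X: "open X" and G: "dfam X G" and f: "\<And>x. x \<in> X \<Longrightarrow> f x = G 0 x" and x: "x \<in> X"
  shows "nderiv j f x = G j x" "(nderiv j f has_vector_derivative G (Suc j) x) (at x)"
proof -
  have *: "\<forall>x\<in>X. nderiv j f x = G j x" for j
  proof (induction j)
    case (Suc j)
    show ?case
    proof
      fix x assume x: "x \<in> X"
      have "(G j has_vector_derivative G (Suc j) x) (at x)" using G x by (simp add: dfam_def)
      hence "(nderiv j f has_vector_derivative G (Suc j) x) (at x)"
        by (rule has_vector_derivative_transform_within_open[OF _ X x]) (use Suc in auto)
      thus "nderiv (Suc j) f x = G (Suc j) x" by (simp add: nderiv_Suc vector_derivative_at)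
    qed
  qed (use f in auto)
  show "nderiv j f x = G j x" using * x by blast
  have "(G j has_vector_derivative G (Suc j) x) (at x)" using G x by (simp add: dfam_def)
  thus "(nderiv j f has_vector_derivative G (Suc j) x) (at x)"
    by (rule has_vector_derivative_transform_within_open[OF _ X x]) (use * in auto)
qed

lemma smooth_dfam:
  assumes "open X" "dfam X G" "\<And>x. x \<in> X \<Longrightarrow> f x = G 0 x"
  shows "smooth_on_set X f"
  unfolding smooth_on_set_def using nderiv_dfam(2)[OF assms] differentiableI_vector by blast

lemma dfam_nderiv: "smooth_on_set X f \<Longrightarrow> dfam X (\<lambda>j. nderiv j f)"
  unfolding dfam_def smooth_on_set_def nderiv_Suc
  using vector_derivative_works by blast

lemma smooth_on_set_subset: "smooth_on_set X f \<Longrightarrow> Y \<subseteq> X \<Longrightarrow> smooth_on_set Y f" by (auto simp: smooth_on_set_def)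

lemma smooth_on_set_Un: "smooth_on_set X f \<Longrightarrow> smooth_on_set Y f \<Longrightarrow> smooth_on_set (X \<union> Y) f"
  by (auto simp: smooth_on_set_def)

lemma smooth_cong:
  assumes "open X" "smooth_on_set X f" "\<And>x. x \<in> X \<Longrightarrow> g x = f x"
  shows "smooth_on_set X g" "x \<in> X \<Longrightarrow> nderiv j g x = nderiv j f x"
proof -
  note d = dfam_nderiv[OF assms(2)]
  show "smooth_on_set X g" by (rule smooth_dfam[OF assms(1) d]) (simp add: assms(3))
  show "nderiv j g x = nderiv j f x" if "x \<in> X"
    by (rule nderiv_dfam(1)[OF assms(1) d _ that]) (simp add: assms(3))
qed

lemma smooth_has_derivative:
  "smooth_on_set X f \<Longrightarrow> x \<in> X \<Longrightarrow> (nderiv j f has_vector_derivative nderiv (Suc j) f x) (at x)"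
  using dfam_nderiv[of X f] unfolding dfam_def by blast

lemma dfam_add: "dfam X F \<Longrightarrow> dfam X G \<Longrightarrow> dfam X (\<lambda>j x. F j x + G j x)"
  unfolding dfam_def by (intro allI ballI has_vector_derivative_add) auto

lemma dfam_diff: "dfam X F \<Longrightarrow> dfam X G \<Longrightarrow> dfam X (\<lambda>j x. F j x - G j x)"
  unfolding dfam_def by (intro allI ballI has_vector_derivative_diff) auto

lemma dfam_cmult: "dfam X F \<Longrightarrow> dfam X (\<lambda>j x. u * F j x)"
  unfolding dfam_def by (intro allI ballI has_vector_derivative_mult_right) auto

lemma dfam_zero: "dfam X (\<lambda>j x. 0)" by (auto simp: dfam_def)

lemma dfam_shift: "dfam ((\<lambda>x. x + s) ` X) F \<Longrightarrow> dfam X (\<lambda>j x. F j (x + s))"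
  unfolding dfam_def
proof (intro allI ballI)
  fix j x assume F: "\<forall>j. \<forall>x\<in>(\<lambda>x. x + s) ` X. (F j has_vector_derivative F (Suc j) x) (at x)" and x: "x \<in> X"
  have "(F j has_vector_derivative F (Suc j) (x + s)) (at (x + s))" using F x by blast
  hence "((F j \<circ> (\<lambda>x. x + s)) has_vector_derivative (1 *\<^sub>R F (Suc j) (x + s))) (at x)"
    by (intro vector_diff_chain_at) (auto intro!: derivative_eq_intros)
  thus "((\<lambda>x. F j (x + s)) has_vector_derivative F (Suc j) (x + s)) (at x)" by (simp add: o_def)
qed

lemma dfam_mult:
  assumes F: "dfam X F" and G: "dfam X G"
  shows "dfam X (\<lambda>j x. \<Sum>i\<le>j. of_nat (j choose i) * (F i x * G (j - i) x))"
  unfolding dfam_def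
proof (intro allI ballI)
  fix j x assume x: "x \<in> X"
  have "((\<lambda>x. \<Sum>i\<le>j. of_nat (j choose i) * (F i x * G (j - i) x)) has_vector_derivative
     (\<Sum>i\<le>j. of_nat (j choose i) * (F i x * G (Suc (j - i)) x + F (Suc i) x * G (j - i) x))) (at x)"
    using F G x by (intro has_vector_derivative_sum has_vector_derivative_mult_right has_vector_derivative_mult)
      (auto simp: dfam_def)
  also have "(\<Sum>i\<le>j. of_nat (j choose i) * (F i x * G (Suc (j - i)) x + F (Suc i) x * G (j - i) x))
     = (\<Sum>i\<le>j. of_nat (j choose i) * (F i x * G (Suc j - i) x)) + (\<Sum>i\<le>j. of_nat (j choose i) * (F (Suc i) x * G (j - i) x))"
    by (simp add: sum.distrib distrib_left Suc_diff_le)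
  also have "\<dots> = (\<Sum>i\<le>Suc j. of_nat (Suc j choose i) * (F i x * G (Suc j - i) x))"
  proof -
    let ?T = "\<lambda>k i. of_nat (k choose i) * (F i x * G (Suc j - i) x)"
    let ?S = "\<lambda>k i. of_nat k * (F (Suc i) x * G (j - i) x)"
    have 1: "(\<Sum>i\<le>Suc j. ?T (Suc j) i) = F 0 x * G (Suc j) x + (\<Sum>i\<le>j. ?S (Suc j choose Suc i) i)"
      by (subst sum.atMost_Suc_shift) simp
    have 2: "(\<Sum>i\<le>j. ?S (Suc j choose Suc i) i) = (\<Sum>i\<le>j. ?S (j choose i) i) + (\<Sum>i\<le>j. ?S (j choose Suc i) i)"
      by (simp add: distrib_right flip: sum.distrib)
    have 3: "(\<Sum>i\<le>Suc j. ?T j i) = F 0 x * G (Suc j) x + (\<Sum>i\<le>j. ?S (j choose Suc i) i)"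
      by (subst sum.atMost_Suc_shift) simp
    have 4: "(\<Sum>i\<le>Suc j. ?T j i) = (\<Sum>i\<le>j. ?T j i)"
      by (subst sum.atMost_Suc) (simp only: binomial_eq_0[OF lessI] of_nat_0 mult_zero_left add_0_right)
    show ?thesis unfolding 1 2 4[symmetric] 3 by (simp only: add_ac)
  qed
  finally show "((\<lambda>x. \<Sum>i\<le>j. of_nat (j choose i) * (F i x * G (j - i) x)) has_vector_derivative
     (\<Sum>i\<le>Suc j. of_nat (Suc j choose i) * (F i x * G (Suc j - i) x))) (at x)" .
qed

lemma nderiv_mult:
  assumes "open X" "smooth_on_set X f" "smooth_on_set X g"
  shows "smooth_on_set X (\<lambda>x. f x * g x)"
    "x \<in> X \<Longrightarrow> nderiv j (\<lambda>x. f x * g x) x = (\<Sum>i\<le>j. of_nat (j choose i) * (nderiv i f x * nderiv (j - i) g x))"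
proof -
  note d = dfam_mult[OF assms(2,3)[THEN dfam_nderiv]]
  show "smooth_on_set X (\<lambda>x. f x * g x)" by (rule smooth_dfam[OF assms(1) d]) simp
  show "nderiv j (\<lambda>x. f x * g x) x = (\<Sum>i\<le>j. of_nat (j choose i) * (nderiv i f x * nderiv (j - i) g x))" if "x \<in> X" by (rule nderiv_dfam(1)[OF assms(1) d _ that]) simp
qed

lemma nderiv_add:
  assumes "open X" "smooth_on_set X f" "smooth_on_set X g"
  shows "smooth_on_set X (\<lambda>x. f x + g x)" "x \<in> X \<Longrightarrow> nderiv j (\<lambda>x. f x + g x) x = nderiv j f x + nderiv j g x"
proof -
  note d = dfam_add[OF assms(2,3)[THEN dfam_nderiv]]
  show "smooth_on_set X (\<lambda>x. f x + g x)" by (rule smooth_dfam[OF assms(1) d]) simp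
  show "nderiv j (\<lambda>x. f x + g x) x = nderiv j f x + nderiv j g x" if "x \<in> X" by (rule nderiv_dfam(1)[OF assms(1) d _ that]) simp
qed

lemma nderiv_diff:
  assumes "open X" "smooth_on_set X f" "smooth_on_set X g"
  shows "smooth_on_set X (\<lambda>x. f x - g x)" "x \<in> X \<Longrightarrow> nderiv j (\<lambda>x. f x - g x) x = nderiv j f x - nderiv j g x"
proof -
  note d = dfam_diff[OF assms(2,3)[THEN dfam_nderiv]]
  show "smooth_on_set X (\<lambda>x. f x - g x)" by (rule smooth_dfam[OF assms(1) d]) simp
  show "nderiv j (\<lambda>x. f x - g x) x = nderiv j f x - nderiv j g x" if "x \<in> X" by (rule nderiv_dfam(1)[OF assms(1) d _ that]) simp
qed

lemma nderiv_cmult: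
  assumes "open X" "smooth_on_set X f"
  shows "smooth_on_set X (\<lambda>x. u * f x)" "x \<in> X \<Longrightarrow> nderiv j (\<lambda>x. u * f x) x = u * nderiv j f x"
proof -
  note d = dfam_cmult[where u = u, OF assms(2)[THEN dfam_nderiv]]
  show "smooth_on_set X (\<lambda>x. u * f x)" by (rule smooth_dfam[OF assms(1) d]) simp
  show "nderiv j (\<lambda>x. u * f x) x = u * nderiv j f x" if "x \<in> X" by (rule nderiv_dfam(1)[OF assms(1) d _ that]) simp
qed

lemma nderiv_shift:
  assumes "open X" "smooth_on_set ((\<lambda>x. x + s) ` X) f"
  shows "smooth_on_set X (\<lambda>x. f (x + s))" "x \<in> X \<Longrightarrow> nderiv j (\<lambda>x. f (x + s)) x = nderiv j f (x + s)"
proof -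
  note d = dfam_shift[OF assms(2)[THEN dfam_nderiv]]
  show "smooth_on_set X (\<lambda>x. f (x + s))" by (rule smooth_dfam[OF assms(1) d]) simp
  show "nderiv j (\<lambda>x. f (x + s)) x = nderiv j f (x + s)" if "x \<in> X" by (rule nderiv_dfam(1)[OF assms(1) d _ that]) simp
qed

lemma nderiv_deriv: "nderiv j (nderiv 1 f) = nderiv (Suc j) f"
  unfolding nderiv_def Suc_eq_plus1 by (simp only: funpow_add o_apply)

lemma smooth_nderiv1: "smooth_on_set X f \<Longrightarrow> smooth_on_set X (nderiv 1 f)"
  unfolding smooth_on_set_def nderiv_deriv by blast

lemma smooth_zero: "open X \<Longrightarrow> (\<And>x. x \<in> X \<Longrightarrow> f x = 0) \<Longrightarrow> smooth_on_set X f"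
  by (rule smooth_dfam[OF _ dfam_zero]) blast+

lemma nderiv_zero: "open X \<Longrightarrow> (\<And>x. x \<in> X \<Longrightarrow> f x = 0) \<Longrightarrow> x \<in> X \<Longrightarrow> nderiv j f x = 0"
  by (rule nderiv_dfam(1)[OF _ dfam_zero]) blast+

lemma nderiv_exp:
  fixes \<mu> :: complex
  shows "nderiv j (\<lambda>x. exp (\<mu> * of_real x)) x = \<mu> ^ j * exp (\<mu> * of_real x)"
    "smooth_on_set UNIV (\<lambda>x. exp (\<mu> * of_real x))"
proof -
  have df: "dfam UNIV (\<lambda>j x. \<mu> ^ j * exp (\<mu> * of_real x))" unfolding dfam_def
  proof (intro allI ballI)
    fix j and x :: real
    have "((\<lambda>z. \<mu> ^ j * exp (\<mu> * z)) has_field_derivative \<mu> ^ Suc j * exp (\<mu> * of_real x)) (at (of_real x))"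
      by (auto intro!: derivative_eq_intros)
    hence "(((\<lambda>z. \<mu> ^ j * exp (\<mu> * z)) \<circ> of_real) has_vector_derivative 1 * (\<mu> ^ Suc j * exp (\<mu> * of_real x))) (at x)"
      by (intro field_vector_diff_chain_at) (auto intro!: derivative_eq_intros)
    thus "((\<lambda>x. \<mu> ^ j * exp (\<mu> * of_real x)) has_vector_derivative \<mu> ^ Suc j * exp (\<mu> * of_real x)) (at x)"
      by (simp add: o_def)
  qed
  show "nderiv j (\<lambda>x. exp (\<mu> * of_real x)) x = \<mu> ^ j * exp (\<mu> * of_real x)" for j x
    by (rule nderiv_dfam(1)[OF open_UNIV df]) auto
  show "smooth_on_set UNIV (\<lambda>x. exp (\<mu> * of_real x))" by (rule smooth_dfam[OF open_UNIV df]) auto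
qed

section \<open>Ultradifferentiable functions on the line\<close>

context weight_fun
begin

definition bdd_seminorm :: "real \<Rightarrow> real set \<Rightarrow> real \<Rightarrow> (real \<Rightarrow> complex) \<Rightarrow> bool" where
  "bdd_seminorm q X B f \<longleftrightarrow> (\<forall>j. \<forall>x\<in>X. norm (nderiv j f x) \<le> B * ywt \<omega> q j)"

text \<open>Elements of the space on \<open>(-a, a)\<close> cannot be translated freely. Cutting
  them off leads into this space on the whole line, which is closed under products, translations,
  derivatives and antiderivatives.\<close>

definition ultra_line :: "(real \<Rightarrow> complex) set" where
  "ultra_line = {F. smooth_on_set UNIV F \<and> (\<forall>q\<in>{0<..<1}. \<forall>R. \<exists>B\<ge>0. bdd_seminorm q {-R..R} B F)}"

lemma bdd_seminorm_subset: "bdd_seminorm q X B f \<Longrightarrow> Y \<subseteq> X \<Longrightarrow> bdd_seminorm q Y B f"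
  by (auto simp: bdd_seminorm_def)

lemma bdd_seminorm_mono:
  assumes "bdd_seminorm q X B f" "B \<le> B'" "0 < q'" "q' \<le> q" "0 \<le> B"
  shows "bdd_seminorm q' X B' f"
  unfolding bdd_seminorm_def
proof (intro allI ballI)
  fix j x assume "x \<in> X"
  hence "norm (nderiv j f x) \<le> B * ywt \<omega> q j" using assms by (simp add: bdd_seminorm_def)
  also have "\<dots> \<le> B' * ywt \<omega> q' j" using assms ywt_antimono[of q' q j] by (intro mult_mono) auto
  finally show "norm (nderiv j f x) \<le> B' * ywt \<omega> q' j" .
qed

text \<open>Functions, sets and bounds are quantified after \<open>C\<close>, so that one constant,
  depending on \<open>q\<close> and \<open>q1\<close> only, serves all products.\<close>

lemma bdd_seminorm_mult:
  assumes "0 < q" "q < q1"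
  obtains C where "C > 0" "\<And>X Y f g A B. open X \<Longrightarrow> smooth_on_set X f \<Longrightarrow> smooth_on_set X g \<Longrightarrow> Y \<subseteq> X \<Longrightarrow>
     A \<ge> 0 \<Longrightarrow> B \<ge> 0 \<Longrightarrow>
     bdd_seminorm q1 Y A f \<Longrightarrow> bdd_seminorm q1 Y B g \<Longrightarrow> bdd_seminorm q Y (C * (A * B)) (\<lambda>x. f x * g x)"
proof -
  obtain C where C: "C > 0" "\<And>j. (\<Sum>i\<le>j. of_nat (j choose i) * (ywt \<omega> q1 i * ywt \<omega> q1 (j - i))) \<le> C * ywt \<omega> q j"
    using ywt_product[OF assms] by blast
  have *: "bdd_seminorm q Y (C * (A * B)) (\<lambda>x. f x * g x)"
    if h: "open X" "smooth_on_set X f" "smooth_on_set X g" "Y \<subseteq> X" "A \<ge> 0" "B \<ge> 0"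
      "bdd_seminorm q1 Y A f" "bdd_seminorm q1 Y B g" for X Y f g A B
    unfolding bdd_seminorm_def
  proof (intro allI ballI)
    fix j x assume x: "x \<in> Y"
    have "norm (nderiv j (\<lambda>x. f x * g x) x) \<le> (\<Sum>i\<le>j. norm (of_nat (j choose i) * (nderiv i f x * nderiv (j - i) g x)))"
      unfolding nderiv_mult(2)[OF h(1-3) subsetD[OF h(4) x]] by (rule norm_sum)
    also have "\<dots> \<le> (\<Sum>i\<le>j. of_nat (j choose i) * ((A * ywt \<omega> q1 i) * (B * ywt \<omega> q1 (j - i))))"
      unfolding norm_mult norm_of_nat using h(5-8) x
      by (intro sum_mono mult_left_mono mult_mono) (auto simp: bdd_seminorm_def)
    also have "\<dots> = (A * B) * (\<Sum>i\<le>j. of_nat (j choose i) * (ywt \<omega> q1 i * ywt \<omega> q1 (j - i)))"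
      by (simp add: sum_distrib_left mult_ac)
    also have "\<dots> \<le> (A * B) * (C * ywt \<omega> q j)" using C h by (intro mult_left_mono) auto
    finally show "norm (nderiv j (\<lambda>x. f x * g x) x) \<le> C * (A * B) * ywt \<omega> q j" by (simp add: mult_ac)
  qed
  show ?thesis by (rule that[OF C(1)]) (rule *)
qed

lemma bdd_seminorm_add:
  assumes "open X" "smooth_on_set X f" "smooth_on_set X g" "Y \<subseteq> X" "bdd_seminorm q Y A f" "bdd_seminorm q Y B g"
  shows "bdd_seminorm q Y (A + B) (\<lambda>x. f x + g x)"
  unfolding bdd_seminorm_def
proof (intro allI ballI)
  fix j x assume x: "x \<in> Y"
  have "nderiv j (\<lambda>x. f x + g x) x = nderiv j f x + nderiv j g x" using nderiv_add(2)[OF assms(1-3)] x assms(4) by auto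
  hence "norm (nderiv j (\<lambda>x. f x + g x) x) \<le> norm (nderiv j f x) + norm (nderiv j g x)" by (simp add: norm_triangle_ineq)
  also have "\<dots> \<le> A * ywt \<omega> q j + B * ywt \<omega> q j" using assms x by (intro add_mono) (auto simp: bdd_seminorm_def)
  finally show "norm (nderiv j (\<lambda>x. f x + g x) x) \<le> (A + B) * ywt \<omega> q j" by (simp add: distrib_right)
qed

lemma bdd_seminorm_cmult:
  assumes "open X" "smooth_on_set X f" "Y \<subseteq> X" "bdd_seminorm q Y A f"
  shows "bdd_seminorm q Y (norm u * A) (\<lambda>x. u * f x)"
  unfolding bdd_seminorm_def
proof (intro allI ballI)
  fix j x assume x: "x \<in> Y"
  have "norm (nderiv j (\<lambda>x. u * f x) x) = norm u * norm (nderiv j f x)" using nderiv_cmult(2)[OF assms(1-2)] x assms(3) by (auto simp: norm_mult)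
  also have "\<dots> \<le> norm u * (A * ywt \<omega> q j)" using assms x by (intro mult_left_mono) (auto simp: bdd_seminorm_def)
  finally show "norm (nderiv j (\<lambda>x. u * f x) x) \<le> norm u * A * ywt \<omega> q j" by simp
qed

lemma bdd_seminorm_nderiv1:
  assumes "0 < q" "q < q1"
  obtains C where "C > 0" "\<And>X f B. B \<ge> 0 \<Longrightarrow> bdd_seminorm q1 X B f \<Longrightarrow> bdd_seminorm q X (C * B) (nderiv 1 f)"
proof -
  obtain C where C: "C > 0" "\<And>j. ywt \<omega> q1 (Suc j) \<le> C * ywt \<omega> q j" using ywt_Suc[OF assms] by blast
  have *: "bdd_seminorm q X (C * B) (nderiv 1 f)" if h: "B \<ge> 0" "bdd_seminorm q1 X B f" for X f B
    unfolding bdd_seminorm_def nderiv_deriv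
  proof (intro allI ballI)
    fix j x assume x: "x \<in> X"
    have "norm (nderiv (Suc j) f x) \<le> B * ywt \<omega> q1 (Suc j)" using h x by (simp add: bdd_seminorm_def)
    also have "\<dots> \<le> B * (C * ywt \<omega> q j)" using h C by (intro mult_left_mono) auto
    finally show "norm (nderiv (Suc j) f x) \<le> C * B * ywt \<omega> q j" by (simp add: mult_ac)
  qed
  show ?thesis by (rule that[OF C(1)]) (rule *)
qed

lemma exponent_midpoint: "q \<in> {0<..<1} \<Longrightarrow> (q + 1) / 2 \<in> {0<..<(1::real)} \<and> q < (q + 1) / 2" by auto

lemma ultra_lineD:
  assumes "F \<in> ultra_line"
  shows "smooth_on_set X F" "q \<in> {0<..<1} \<Longrightarrow> \<exists>B\<ge>0. bdd_seminorm q {-R..R} B F"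
  using assms unfolding ultra_line_def smooth_on_set_def by blast+

lemma ultra_line_bdd_on:
  assumes "F \<in> ultra_line" "q \<in> {0<..<1}" "bounded X"
  obtains B where "B \<ge> 0" "bdd_seminorm q X B F"
proof -
  obtain R where "\<And>x. x \<in> X \<Longrightarrow> norm x \<le> R" using assms(3) by (auto simp: bounded_iff)
  hence "X \<subseteq> {-R..R}" by force
  thus ?thesis using ultra_lineD(2)[OF assms(1,2), of R] bdd_seminorm_subset that by blast
qed

lemma ultra_line_mult:
  assumes "F \<in> ultra_line" "G \<in> ultra_line" shows "(\<lambda>x. F x * G x) \<in> ultra_line"
proof -
  have "\<exists>B\<ge>0. bdd_seminorm q {-R..R} B (\<lambda>x. F x * G x)" if q: "q \<in> {0<..<1}" for q R
  proof -
    obtain C where C: "C > 0" "\<And>X Y f g A B. open X \<Longrightarrow> smooth_on_set X f \<Longrightarrow> smooth_on_set X g \<Longrightarrow> Y \<subseteq> X \<Longrightarrow>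
     A \<ge> 0 \<Longrightarrow> B \<ge> 0 \<Longrightarrow>
     bdd_seminorm ((q + 1) / 2) Y A f \<Longrightarrow> bdd_seminorm ((q + 1) / 2) Y B g \<Longrightarrow> bdd_seminorm q Y (C * (A * B)) (\<lambda>x. f x * g x)"
      using bdd_seminorm_mult[of q "(q + 1) / 2"] exponent_midpoint[OF q] q by auto
    obtain A B where "A \<ge> 0" "bdd_seminorm ((q + 1) / 2) {-R..R} A F" "B \<ge> 0" "bdd_seminorm ((q + 1) / 2) {-R..R} B G"
      using ultra_lineD(2)[OF assms(1), of "(q + 1) / 2" R] ultra_lineD(2)[OF assms(2), of "(q + 1) / 2" R] exponent_midpoint[OF q] by auto
    thus ?thesis using C(2)[of UNIV F G "{-R..R}" A B] ultra_lineD(1)[OF assms(1), of UNIV] ultra_lineD(1)[OF assms(2), of UNIV] C(1)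
      by (intro exI[of _ "C * (A * B)"]) auto
  qed
  thus ?thesis using nderiv_mult(1)[of UNIV F G] assms by (auto simp: ultra_line_def)
qed

lemma ultra_line_add:
  assumes "F \<in> ultra_line" "G \<in> ultra_line" shows "(\<lambda>x. F x + G x) \<in> ultra_line"
proof -
  have "\<exists>B\<ge>0. bdd_seminorm q {-R..R} B (\<lambda>x. F x + G x)" if q: "q \<in> {0<..<1}" for q R
  proof -
    obtain A B where "A \<ge> 0" "bdd_seminorm q {-R..R} A F" "B \<ge> 0" "bdd_seminorm q {-R..R} B G"
      using ultra_lineD(2)[OF assms(1) q] ultra_lineD(2)[OF assms(2) q] by meson
    thus ?thesis using bdd_seminorm_add[of UNIV F G "{-R..R}" q A B] ultra_lineD(1)[OF assms(1), of UNIV] ultra_lineD(1)[OF assms(2), of UNIV]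
      by (intro exI[of _ "A + B"]) auto
  qed
  thus ?thesis using nderiv_add(1)[of UNIV F G] assms by (auto simp: ultra_line_def)
qed

lemma ultra_line_cmult:
  assumes "F \<in> ultra_line" shows "(\<lambda>x. u * F x) \<in> ultra_line"
proof -
  have "\<exists>B\<ge>0. bdd_seminorm q {-R..R} B (\<lambda>x. u * F x)" if q: "q \<in> {0<..<1}" for q R
  proof -
    obtain A where "A \<ge> 0" "bdd_seminorm q {-R..R} A F"
      using ultra_lineD(2)[OF assms(1) q] by meson
    thus ?thesis using bdd_seminorm_cmult[of UNIV F "{-R..R}" q A u] ultra_lineD(1)[OF assms(1), of UNIV]
      by (intro exI[of _ "norm u * A"]) auto
  qed
  thus ?thesis using nderiv_cmult(1)[of UNIV F] assms by (auto simp: ultra_line_def)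
qed

lemma ultra_line_diff:
  assumes "F \<in> ultra_line" "G \<in> ultra_line" shows "(\<lambda>x. F x - G x) \<in> ultra_line"
  using ultra_line_add[OF assms(1) ultra_line_cmult[OF assms(2), where u = "-1"]] by simp

lemma ultra_line_shift:
  assumes "F \<in> ultra_line" shows "(\<lambda>x. F (x + s)) \<in> ultra_line"
proof -
  have sm: "smooth_on_set ((\<lambda>x. x + s) ` UNIV) F" using ultra_lineD(1)[OF assms] .
  have "\<exists>B\<ge>0. bdd_seminorm q {-R..R} B (\<lambda>x. F (x + s))" if q: "q \<in> {0<..<1}" for q R
  proof -
    obtain B where B: "B \<ge> 0" "bdd_seminorm q {-R+s..R+s} B F"
      by (rule ultra_line_bdd_on[OF assms q bounded_closed_interval])
    hence "bdd_seminorm q {-R..R} B (\<lambda>x. F (x + s))"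
      unfolding bdd_seminorm_def using nderiv_shift(2)[OF open_UNIV sm] by auto
    thus ?thesis using B by blast
  qed
  thus ?thesis using nderiv_shift(1)[OF open_UNIV sm] assms by (auto simp: ultra_line_def)
qed

lemma ultra_line_nderiv1:
  assumes "F \<in> ultra_line" shows "nderiv 1 F \<in> ultra_line"
proof -
  have "\<exists>B\<ge>0. bdd_seminorm q {-R..R} B (nderiv 1 F)" if q: "q \<in> {0<..<1}" for q R
  proof -
    obtain C where C: "C > 0" "\<And>X f B. B \<ge> 0 \<Longrightarrow> bdd_seminorm ((q+1)/2) X B f \<Longrightarrow> bdd_seminorm q X (C * B) (nderiv 1 f)"
      using bdd_seminorm_nderiv1[of q "(q + 1) / 2"] exponent_midpoint[OF q] q by auto
    obtain A where "A \<ge> 0" "bdd_seminorm ((q+1)/2) {-R..R} A F"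
      using ultra_lineD(2)[OF assms(1), of "(q + 1) / 2"] exponent_midpoint[OF q] by meson
    thus ?thesis using C by (intro exI[of _ "C * A"]) auto
  qed
  thus ?thesis using smooth_nderiv1 assms by (auto simp: ultra_line_def)
qed

text \<open>The derivatives of \<open>Q\<close> are those of \<open>F\<close> one order later, and
  this shift costs nothing in \<open>q\<close>: \<open>x ^ j \<le> x ^ Suc j\<close> for
  \<open>x \<ge> 1\<close> gives
  \<open>ywt \<omega> q j \<le> C * ywt \<omega> q (Suc j)\<close>.\<close>

lemma ultra_line_antideriv:
  assumes F: "F \<in> ultra_line" and Q: "\<And>x. (Q has_vector_derivative F x) (at x)"
  shows "Q \<in> ultra_line" "nderiv 1 Q = F"
proof -
  define G where "G j = (if j = 0 then Q else nderiv (j - 1) F)" for j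
  have G: "dfam UNIV G" unfolding dfam_def
  proof (intro allI ballI)
    fix j x
    show "(G j has_vector_derivative G (Suc j) x) (at x)"
      using Q smooth_has_derivative[OF ultra_lineD(1)[OF F, of UNIV], of x "j - 1"] by (cases j) (auto simp: G_def)
  qed
  have nd: "nderiv j Q x = G j x" for j x by (rule nderiv_dfam(1)[OF open_UNIV G]) (auto simp: G_def)
  have sm: "smooth_on_set UNIV Q" by (rule smooth_dfam[OF open_UNIV G]) (auto simp: G_def)
  show "nderiv 1 Q = F" by (auto simp: nd G_def)
  have "\<exists>B\<ge>0. bdd_seminorm q {-R..R} B Q" if q: "q \<in> {0<..<1}" for q R
  proof -
    obtain A where A: "A \<ge> 0" "bdd_seminorm q {-R..R} A F"
      using ultra_lineD(2)[OF assms(1) q] by meson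
    have "continuous_on {-R..R} Q"
      using Q by (meson continuous_at_imp_continuous_on has_vector_derivative_continuous)
    hence "bounded (Q ` {-R..R})" by (intro compact_imp_bounded compact_continuous_image) auto
    then obtain M where "\<forall>y\<in>Q ` {-R..R}. norm y \<le> M" unfolding bounded_iff by blast
    hence M: "\<And>x. x \<in> {-R..R} \<Longrightarrow> norm (Q x) \<le> M" by blast
    show ?thesis
    proof (intro exI conjI)
      define C where "C = exp (q * \<omega> 1)"
      have "C > 0" by (simp add: C_def)
      moreover have "ywt \<omega> q j \<le> C * ywt \<omega> q (Suc j)" for j
      proof -
        have "ywt \<omega> q j \<le> exp (q * \<omega> 1) * ywt \<omega> q (Suc j)"
        proof (rule ywt_le)
          fix x :: real assume x: "x \<ge> 1"
          have "x ^ j * exp (- q * \<omega> x) \<le> x ^ Suc j * exp (- q * \<omega> x)" using x by simp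
          also have "\<dots> \<le> ywt \<omega> q (Suc j)" using power_le_ywt[of q x "Suc j"] q x by (simp add: exp_minus divide_simps)
          also have "\<dots> \<le> exp (q * \<omega> 1) * ywt \<omega> q (Suc j)" using \<omega>_nonneg[of 1] q by simp
          finally show "x ^ j * exp (- q * \<omega> x) \<le> exp (q * \<omega> 1) * ywt \<omega> q (Suc j)" .
        qed (use q in auto)
        thus ?thesis by (simp add: C_def)
      qed
      ultimately have C: "C > 0" "\<And>j. ywt \<omega> q j \<le> C * ywt \<omega> q (Suc j)" by blast+
      show "A * C + \<bar>M\<bar> * exp (q * \<omega> 1) \<ge> 0" using A C by simp
      show "bdd_seminorm q {-R..R} (A * C + \<bar>M\<bar> * exp (q * \<omega> 1)) Q"
        unfolding bdd_seminorm_def nd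
      proof (intro allI ballI)
        fix j x assume x: "x \<in> {-R..R}"
        show "norm (G j x) \<le> (A * C + \<bar>M\<bar> * exp (q * \<omega> 1)) * ywt \<omega> q j"
        proof (cases j)
          case 0
          have "norm (G j x) \<le> \<bar>M\<bar> * 1" using M[OF x] 0 by (simp add: G_def)
          also have "\<dots> \<le> \<bar>M\<bar> * (ywt \<omega> q j * exp (q * \<omega> 1))" using one_le_ywt[of q j] q by (intro mult_left_mono) auto
          also have "\<dots> \<le> (A * C + \<bar>M\<bar> * exp (q * \<omega> 1)) * ywt \<omega> q j" using A C by (simp add: algebra_simps)
          finally show ?thesis .
        next
          case (Suc i)
          have "norm (G j x) \<le> A * ywt \<omega> q i" using A(2) x Suc by (simp add: G_def bdd_seminorm_def)
          also have "\<dots> \<le> A * (C * ywt \<omega> q (Suc i))" using A C by (intro mult_left_mono) auto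
          also have "\<dots> \<le> (A * C + \<bar>M\<bar> * exp (q * \<omega> 1)) * ywt \<omega> q j" using Suc by (simp add: algebra_simps)
          finally show ?thesis .
        qed
      qed
    qed
  qed
  thus "Q \<in> ultra_line" using sm by (auto simp: ultra_line_def)
qed

lemma exp_bdd_seminorm:
  assumes "q > 0" "\<And>x. x \<in> X \<Longrightarrow> norm (exp (\<mu> * of_real x)) \<le> M"
  shows "bdd_seminorm q X (M * exp (q * \<omega> (max 1 (norm \<mu>)))) (\<lambda>x. exp (\<mu> * of_real x))"
  unfolding bdd_seminorm_def nderiv_exp
proof (intro allI ballI)
    fix j x assume x: "x \<in> X"
    have "norm (\<mu> ^ j * exp (\<mu> * of_real x)) = norm \<mu> ^ j * norm (exp (\<mu> * of_real x))" by (simp add: norm_mult norm_power)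
    also have "\<dots> \<le> (ywt \<omega> q j * exp (q * \<omega> (max 1 (norm \<mu>)))) * M"
      using assms(2)[OF x] power_le_ywt'[of q "norm \<mu>" j] assms(1) by (intro mult_mono) auto
    finally show "norm (\<mu> ^ j * exp (\<mu> * of_real x)) \<le> M * exp (q * \<omega> (max 1 (norm \<mu>))) * ywt \<omega> q j" by (simp add: mult_ac)
qed

lemma ultra_line_exp: "(\<lambda>x. exp (\<mu> * of_real x)) \<in> ultra_line"
proof -
  have "\<exists>B\<ge>0. bdd_seminorm q {-R..R} B (\<lambda>x. exp (\<mu> * of_real x))" if q: "q \<in> {0<..<1}" for q R
  proof (intro exI conjI)
    show "bdd_seminorm q {-R..R} (exp (norm \<mu> * \<bar>R\<bar>) * exp (q * \<omega> (max 1 (norm \<mu>)))) (\<lambda>x. exp (\<mu> * of_real x))"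
    proof (rule exp_bdd_seminorm)
      fix x assume "x \<in> {-R..R}"
      hence "norm (\<mu> * of_real x) \<le> norm \<mu> * \<bar>R\<bar>" unfolding norm_mult by (intro mult_left_mono) auto
      thus "norm (exp (\<mu> * of_real x)) \<le> exp (norm \<mu> * \<bar>R\<bar>)" using norm_exp[of "\<mu> * of_real x"] by (meson exp_le_cancel_iff order_trans)
    qed (use q in auto)
  qed auto
  thus ?thesis using nderiv_exp(2) by (auto simp: ultra_line_def)
qed

lemma ultra_line_1: "(\<lambda>x. 1) \<in> ultra_line" using ultra_line_exp[of 0] by simp

lemma ultra_line_const: "(\<lambda>x. u) \<in> ultra_line" using ultra_line_cmult[OF ultra_line_1, of u] by simp

lemma ultra_line_id: "(\<lambda>x. of_real x) \<in> ultra_line"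
proof (rule ultra_line_antideriv(1)[OF ultra_line_1])
  show "(complex_of_real has_vector_derivative 1) (at x)" for x
    using has_vector_derivative_of_real[OF DERIV_ident[of "at x"]] by simp
qed

lemma ultra_line_power:
  assumes "F \<in> ultra_line" shows "(\<lambda>x. F x ^ n) \<in> ultra_line"
proof (induction n)
  case (Suc n)
  show ?case using ultra_line_mult[OF assms Suc] by simp
qed (simp add: ultra_line_1)

end


section \<open>Cut-off functions\<close>

lemma antiderivative_exists:
  fixes v :: "real \<Rightarrow> 'a::banach"
  assumes v: "continuous_on UNIV v"
  obtains Q where "\<And>x. (Q has_vector_derivative v x) (at x)"
proof -
  have vc: "continuous_on S v" for S using v continuous_on_subset by blast
  have vi: "v integrable_on {a..b}" for a b by (rule integrable_continuous_real[OF vc])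
  \<comment> \<open>For either sign of \<open>x\<close> one of the two intervals is empty or a
    point, and its integral is 0.\<close>
  define Q where "Q x = integral {0..x} v - integral {x..0} v" for x
  have "(Q has_vector_derivative v x) (at x)" for x
  proof -
    define c where "c = min x 0 - 1"
    have "((\<lambda>u. integral {c..u} v) has_vector_derivative v x) (at x within {c..x+1})"
      by (rule integral_has_vector_derivative[OF vc]) (auto simp: c_def)
    hence "((\<lambda>u. integral {c..u} v) has_vector_derivative v x) (at x)"
      by (subst (asm) at_within_interior) (auto simp: c_def)
    hence "((\<lambda>u. integral {c..u} v - integral {c..0} v) has_vector_derivative v x) (at x)"
      by (auto intro: derivative_eq_intros)
    thus ?thesis
    proof (rule has_vector_derivative_transform_within_open)
      show "open {c<..}" "x \<in> {c<..}" by (auto simp: c_def)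
      fix u assume u: "u \<in> {c<..}"
      show "integral {c..u} v - integral {c..0} v = Q u"
      proof (cases "u \<ge> 0")
        case True
        have "integral {c..0} v + integral {0..u} v = integral {c..u} v"
          by (rule Henstock_Kurzweil_Integration.integral_combine) (use True vi in \<open>auto simp: c_def\<close>)
        moreover have "integral {u..0} v = 0" using True by (cases "u = 0") auto
        ultimately show ?thesis by (simp add: Q_def algebra_simps)
      next
        case False
        have "integral {c..u} v + integral {u..0} v = integral {c..0} v"
          by (rule Henstock_Kurzweil_Integration.integral_combine) (use False u vi in auto)
        moreover have "integral {0..u} v = 0" using False by auto
        ultimately show ?thesis by (simp add: Q_def algebra_simps)
      qed
    qed
  qed
  thus ?thesis using that by blast
qed

section \<open>Bump functions by repeated averaging\<close>

text \<open>For \<open>a > 0\<close>, convolution with the normalised indicator function of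
  \<open>[-a, a]\<close>.\<close>

definition avg :: "real \<Rightarrow> (real \<Rightarrow> real) \<Rightarrow> real \<Rightarrow> real" where
  "avg a v x = integral {x - a..x + a} v / (2 * a)"

lemma avg_eq:
  assumes "a > 0" "\<And>x. (Q has_vector_derivative v x) (at x)"
  shows "avg a v x = (Q (x + a) - Q (x - a)) / (2 * a)"
proof -
  have "(v has_integral (Q (x + a) - Q (x - a))) {x - a..x + a}"
    by (rule fundamental_theorem_of_calculus) (use assms in \<open>auto intro: has_vector_derivative_at_within\<close>)
  thus ?thesis by (simp add: avg_def integral_unique)
qed

lemma avg_mean_value:
  assumes a: "a > 0" and v: "continuous_on UNIV v"
  shows "\<exists>\<xi>. \<bar>\<xi> - x\<bar> \<le> a \<and> avg a v x = v \<xi>"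
proof -
  obtain Q where Q: "\<And>x. (Q has_vector_derivative v x) (at x)" using antiderivative_exists[OF v] by blast
  have "\<exists>\<xi>>x - a. \<xi> < x + a \<and> Q (x + a) - Q (x - a) = (x + a - (x - a)) * v \<xi>"
    by (rule MVT2) (use a Q in \<open>auto simp: has_real_derivative_iff_has_vector_derivative\<close>)
  then obtain \<xi> where \<xi>: "x - a < \<xi>" "\<xi> < x + a" "Q (x + a) - Q (x - a) = 2 * a * v \<xi>" by auto
  hence "avg a v x = v \<xi>" using a by (simp add: avg_eq[OF a Q])
  thus ?thesis using \<xi> by (intro exI[of _ \<xi>]) auto
qed

lemma avg_diff:
  assumes a: "a > 0" and v: "continuous_on UNIV v" "continuous_on UNIV w"
  shows "avg a (\<lambda>t. v t - w t) x = avg a v x - avg a w x"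
proof -
  have "v integrable_on {x - a..x + a}" "w integrable_on {x - a..x + a}"
    using v by (auto intro!: integrable_continuous_real elim: continuous_on_subset)
  thus ?thesis by (simp add: avg_def integral_diff diff_divide_distrib)
qed

lemma avg_dist:
  assumes a: "a > 0" and v: "continuous_on UNIV v" "continuous_on UNIV w" and e: "\<And>t. \<bar>v t - w t\<bar> \<le> e"
  shows "\<bar>avg a v x - avg a w x\<bar> \<le> e"
proof -
  have "continuous_on UNIV (\<lambda>t. v t - w t)" using v by (intro continuous_intros)
  from avg_mean_value[OF a this] obtain \<xi> where "avg a (\<lambda>t. v t - w t) x = v \<xi> - w \<xi>" by blast
  thus ?thesis using e[of \<xi>] avg_diff[OF a v] by simp
qed

definition lip1 :: "(real \<Rightarrow> real) \<Rightarrow> bool" where "lip1 v \<longleftrightarrow> (\<forall>x y. \<bar>v x - v y\<bar> \<le> \<bar>x - y\<bar>)"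

lemma lip1_continuous: "lip1 v \<Longrightarrow> continuous_on S v"
proof -
  assume "lip1 v"
  hence "1-lipschitz_on UNIV v" by (intro lipschitz_onI) (auto simp: lip1_def dist_real_def)
  hence "continuous_on UNIV v" by (rule lipschitz_on_continuous_on)
  thus ?thesis by (rule continuous_on_subset) auto
qed

lemma avg_lip1:
  assumes a: "a > 0" and v: "lip1 v" shows "lip1 (avg a v)"
  unfolding lip1_def
proof (intro allI)
  fix x y
  have c: "continuous_on UNIV v" using lip1_continuous[OF v] .
  have c': "continuous_on UNIV (\<lambda>t. v (t + (y - x)))"
    by (rule continuous_on_compose2[OF c]) (auto intro!: continuous_intros)
  obtain Q where Q: "\<And>x. (Q has_vector_derivative v x) (at x)" using antiderivative_exists[OF c] by blast
  have Q': "((\<lambda>t. Q (t + (y - x))) has_vector_derivative v (t + (y - x))) (at t)" for t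
  proof -
    have "((Q \<circ> (\<lambda>t. t + (y - x))) has_vector_derivative (1 *\<^sub>R v (t + (y - x)))) (at t)"
      by (intro vector_diff_chain_at Q) (auto intro!: derivative_eq_intros)
    thus ?thesis by (simp add: o_def)
  qed
  have "avg a v y = avg a (\<lambda>t. v (t + (y - x))) x"
    unfolding avg_eq[OF a Q] avg_eq[OF a Q'] by (simp add: algebra_simps)
  moreover have "\<bar>avg a v x - avg a (\<lambda>t. v (t + (y - x))) x\<bar> \<le> \<bar>x - y\<bar>"
  proof (rule avg_dist[OF a c c'])
    fix t
    have "\<bar>v t - v (t + (y - x))\<bar> \<le> \<bar>t - (t + (y - x))\<bar>" using v unfolding lip1_def by blast
    thus "\<bar>v t - v (t + (y - x))\<bar> \<le> \<bar>x - y\<bar>" by simp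
  qed
  ultimately show "\<bar>avg a v x - avg a v y\<bar> \<le> \<bar>x - y\<bar>" by simp
qed

lemma avg_near: "a > 0 \<Longrightarrow> lip1 v \<Longrightarrow> \<bar>avg a v x - v x\<bar> \<le> a"
proof -
  assume a: "a > 0" and v: "lip1 v"
  obtain \<xi> where \<xi>: "\<bar>\<xi> - x\<bar> \<le> a" "avg a v x = v \<xi>" using avg_mean_value[OF a lip1_continuous[OF v]] by blast
  have "\<bar>v \<xi> - v x\<bar> \<le> \<bar>\<xi> - x\<bar>" using v unfolding lip1_def by blast
  thus ?thesis using \<xi> by simp
qed

lemma DERIV_plus_minus:
  fixes f :: "real \<Rightarrow> real"
  assumes "\<And>x. (f has_real_derivative g x) (at x)"
  shows "((\<lambda>x. f (x + c)) has_real_derivative g (x + c)) (at x)"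
    "((\<lambda>x. f (x - c)) has_real_derivative g (x - c)) (at x)"
  using assms DERIV_shift[of f _ x c] DERIV_shift[of f _ x "- c"] by auto

context
  fixes a :: "nat \<Rightarrow> real" and s :: real
  assumes apos: "\<And>i. a i > 0" and asum: "\<And>N. (\<Sum>i<N. a i) \<le> s / 2" and s: "s > 0"
begin

text \<open>A tent of half width \<open>s\<close> is convolved with the normalised indicators of
  half widths \<open>a m, ..., a (m + n - 1)\<close>; \<open>alim m\<close> is the infinite
  convolution. The start index is carried along because differentiation removes the outermost
  indicator, which therefore has to be the one with index \<open>m\<close>. The tent is 1-Lipschitz,
  a property that averaging keeps and that yields convergence.\<close>

primrec avgs :: "nat \<Rightarrow> nat \<Rightarrow> real \<Rightarrow> real" where
  "avgs 0 m = (\<lambda>x. max 0 (s - \<bar>x\<bar>))"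
| "avgs (Suc n) m = avg (a m) (avgs n (Suc m))"

lemma avgs_lip: "lip1 (avgs n m)"
  by (induction n arbitrary: m) (auto simp: lip1_def intro: avg_lip1[OF apos, unfolded lip1_def, rule_format])

lemma avgs_range: "0 \<le> avgs n m x \<and> avgs n m x \<le> s"
proof (induction n arbitrary: m x)
  case (Suc n)
  obtain \<xi> where "avg (a m) (avgs n (Suc m)) x = avgs n (Suc m) \<xi>"
    using avg_mean_value[OF apos lip1_continuous[OF avgs_lip]] by blast
  thus ?case using Suc by simp
qed (use s in auto)

lemma avgs_supp: "\<bar>x\<bar> \<ge> s + (\<Sum>i<n. a (m + i)) \<Longrightarrow> avgs n m x = 0"
proof (induction n arbitrary: m x)
  case (Suc n)
  obtain \<xi> where \<xi>: "\<bar>\<xi> - x\<bar> \<le> a m" "avg (a m) (avgs n (Suc m)) x = avgs n (Suc m) \<xi>"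
    using avg_mean_value[OF apos lip1_continuous[OF avgs_lip]] by blast
  have "(\<Sum>i<Suc n. a (m + i)) = a m + (\<Sum>i<n. a (Suc m + i))" by (subst sum.lessThan_Suc_shift) simp
  hence "\<bar>\<xi>\<bar> \<ge> s + (\<Sum>i<n. a (Suc m + i))" using Suc.prems \<xi>(1) by linarith
  thus ?case using \<xi>(2) Suc.IH by simp
qed simp

text \<open>The additional average sits innermost, where it moves the tent by at most its half
  width; the outer averages are contractions in the sup norm.\<close>

lemma avgs_step: "\<bar>avgs (Suc n) m x - avgs n m x\<bar> \<le> a (m + n)"
proof (induction n arbitrary: m x)
  case 0
  show ?case using avg_near[OF apos avgs_lip, of m 0 "Suc m" x] by (simp only: avgs.simps add_0_right)
next
  case (Suc n)
  have "\<bar>avg (a m) (avgs (Suc n) (Suc m)) x - avg (a m) (avgs n (Suc m)) x\<bar> \<le> a (Suc m + n)"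
    by (rule avg_dist[OF apos lip1_continuous[OF avgs_lip] lip1_continuous[OF avgs_lip] Suc])
  thus ?case by (simp only: avgs.simps add_Suc add_Suc_right)
qed

lemma a_summable: "summable (\<lambda>i. a (m + i))"
proof -
  have "summable a" by (rule summableI_nonneg_bounded[of _ "s / 2"]) (use apos asum in \<open>auto intro: less_imp_le\<close>)
  from summable_ignore_initial_segment[OF this, of m] show ?thesis by (simp add: add.commute)
qed

definition "alim m x = lim (\<lambda>n. avgs n m x)"

lemma alim: "(\<lambda>n. avgs n m x) \<longlonglongrightarrow> alim m x"
proof -
  have "summable (\<lambda>n. avgs (Suc n) m x - avgs n m x)"
    by (rule summable_comparison_test'[OF a_summable[of m]]) (use avgs_step in auto)
  hence "convergent (\<lambda>N. \<Sum>n<N. avgs (Suc n) m x - avgs n m x)" by (simp add: summable_iff_convergent)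
  hence "convergent (\<lambda>N. avgs N m x - avgs 0 m x)" 
    by (simp only: sum_lessThan_telescope[of "\<lambda>n. avgs n m x"])
  hence "convergent (\<lambda>N. (avgs N m x - avgs 0 m x) + avgs 0 m x)" by (intro convergent_add convergent_const)
  thus ?thesis by (simp add: alim_def convergent_LIMSEQ_iff)
qed

lemma alim_dist: "\<bar>avgs n m x - alim m x\<bar> \<le> (\<Sum>i. a (m + n + i))"
proof -
  have "\<bar>avgs (n + k) m x - avgs n m x\<bar> \<le> (\<Sum>i<k. a (m + n + i))" for k
  proof (induction k)
    case (Suc k)
    have "\<bar>avgs (Suc (n + k)) m x - avgs (n + k) m x\<bar> \<le> a (m + n + k)"
      using avgs_step[of "n + k" m x] by (simp add: add.assoc)
    thus ?case using Suc by simp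
  qed simp
  moreover have "(\<Sum>i<k. a (m + n + i)) \<le> (\<Sum>i. a (m + n + i))" for k
    by (rule sum_le_suminf[OF a_summable]) (use apos in \<open>auto intro: less_imp_le\<close>)
  ultimately have le: "\<bar>avgs (n + k) m x - avgs n m x\<bar> \<le> (\<Sum>i. a (m + n + i))" for k by (meson order_trans)
  have "(\<lambda>k. \<bar>avgs (k + n) m x - avgs n m x\<bar>) \<longlonglongrightarrow> \<bar>alim m x - avgs n m x\<bar>"
    by (intro tendsto_intros LIMSEQ_ignore_initial_segment alim)
  hence "\<bar>alim m x - avgs n m x\<bar> \<le> (\<Sum>i. a (m + n + i))"
    by (rule tendsto_upperbound) (use le in \<open>auto simp: add.commute\<close>)
  thus ?thesis by (simp add: abs_minus_commute)
qed

lemma alim_lip: "lip1 (alim m)"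
  unfolding lip1_def
proof (intro allI)
  fix x y
  have "(\<lambda>n. \<bar>avgs n m x - avgs n m y\<bar>) \<longlonglongrightarrow> \<bar>alim m x - alim m y\<bar>"
    by (intro tendsto_intros alim)
  thus "\<bar>alim m x - alim m y\<bar> \<le> \<bar>x - y\<bar>"
    by (rule tendsto_upperbound) (use avgs_lip in \<open>auto simp: lip1_def\<close>)
qed

text \<open>This self-similarity drives the construction: as an average of
  \<open>alim (Suc m)\<close>, the function \<open>alim m\<close> has a difference quotient of
  \<open>alim (Suc m)\<close> with step \<open>2 * a m\<close> as its derivative.\<close>

lemma alim_avg: "alim m x = avg (a m) (alim (Suc m)) x"
proof -
  have "(\<lambda>n. avg (a m) (avgs n (Suc m)) x) \<longlonglongrightarrow> avg (a m) (alim (Suc m)) x"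
  proof (rule Lim_null_comparison[where g = "\<lambda>n. \<Sum>i. a (Suc m + n + i)", THEN LIM_zero_cancel])
    show "\<forall>\<^sub>F n in sequentially. norm (avg (a m) (avgs n (Suc m)) x - avg (a m) (alim (Suc m)) x) \<le> (\<Sum>i. a (Suc m + n + i))"
      unfolding real_norm_def
      by (intro always_eventually allI avg_dist[OF apos] lip1_continuous avgs_lip alim_lip alim_dist)
    have "(\<lambda>n. \<Sum>i. a (Suc m + (i + n))) \<longlonglongrightarrow> 0"
      by (rule suminf_exist_split2[OF a_summable])
    thus "(\<lambda>n. \<Sum>i. a (Suc m + n + i)) \<longlonglongrightarrow> 0" by (simp add: add_ac)
  qed
  moreover have "(\<lambda>n. avgs (Suc n) m x) \<longlonglongrightarrow> alim m x" by (rule LIMSEQ_Suc[OF alim])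
  ultimately show ?thesis using LIMSEQ_unique by fastforce
qed

lemma alim_range: "0 \<le> alim m x" "alim m x \<le> s"
  by (rule tendsto_lowerbound[OF alim], use avgs_range in auto)
     (rule tendsto_upperbound[OF alim], use avgs_range in auto)

lemma alim_supp: "\<bar>x\<bar> \<ge> 2 * s \<Longrightarrow> alim 0 x = 0"
proof -
  assume x: "\<bar>x\<bar> \<ge> 2 * s"
  have "avgs n 0 x = 0" for n by (rule avgs_supp) (use x asum[of n] s in auto)
  hence "(\<lambda>n. avgs n 0 x) = (\<lambda>n. 0)" by auto
  thus ?thesis using alim[of 0 x] LIMSEQ_unique tendsto_const by metis
qed

lemma alim_pos: "alim 0 0 > 0"
proof -
  have "(\<Sum>i. a i) \<le> s / 2" using a_summable[of 0] asum by (intro suminf_le_const) auto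
  thus ?thesis using alim_dist[of 0 0 0] s by simp
qed

text \<open>The k-th derivative of \<open>alim m\<close>, written as an iterated difference quotient
  of \<open>alim (m + k)\<close>. Each level costs a factor \<open>1 / a (m + i)\<close>, and only
  the size of the innermost function enters the bound.\<close>

primrec adiff :: "nat \<Rightarrow> nat \<Rightarrow> real \<Rightarrow> real" where
  "adiff 0 m = alim m"
| "adiff (Suc k) m = (\<lambda>x. (adiff k (Suc m) (x + a m) - adiff k (Suc m) (x - a m)) / (2 * a m))"

lemma adiff_deriv: "(adiff k m has_real_derivative adiff (Suc k) m x) (at x)"
proof (induction k arbitrary: m x)
  case 0
  obtain Q where Q: "\<And>x. (Q has_vector_derivative alim (Suc m) x) (at x)"
    using antiderivative_exists[OF lip1_continuous[OF alim_lip]] by blast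
  have eq: "alim m = (\<lambda>x. (Q (x + a m) - Q (x - a m)) / (2 * a m))"
    by (rule ext, rule trans[OF alim_avg avg_eq[OF apos Q]])
  have Q': "(Q has_real_derivative alim (Suc m) x) (at x)" for x
    using Q by (simp add: has_real_derivative_iff_has_vector_derivative)
  show ?case unfolding adiff.simps eq
    by (intro DERIV_cdivide DERIV_diff DERIV_plus_minus Q')
next
  case (Suc k)
  show ?case
    unfolding adiff.simps(2)[of k m] adiff.simps(2)[of "Suc k" m]
    by (intro DERIV_cdivide DERIV_diff DERIV_plus_minus Suc)
qed

lemma adiff_bound: "\<bar>adiff k m x\<bar> \<le> s * (\<Prod>i<k. 1 / a (m + i))"
proof (induction k arbitrary: m x)
  case 0
  show ?case using alim_range[of m x] by simp
next
  case (Suc k)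
  let ?P = "s * (\<Prod>i<k. 1 / a (Suc m + i))"
  have "\<bar>adiff (Suc k) m x\<bar> \<le> (\<bar>adiff k (Suc m) (x + a m)\<bar> + \<bar>adiff k (Suc m) (x - a m)\<bar>) / (2 * a m)"
    using apos[of m] by (simp add: divide_right_mono)
  also have "\<dots> \<le> (?P + ?P) / (2 * a m)"
    by (intro divide_right_mono add_mono Suc.IH) (use apos[of m] in linarith)
  also have "\<dots> = s * (1 / a m * (\<Prod>i<k. 1 / a (Suc m + i)))" by simp
  also have "1 / a m * (\<Prod>i<k. 1 / a (Suc m + i)) = (\<Prod>i<Suc k. 1 / a (m + i))"
    by (subst prod.lessThan_Suc_shift) simp
  finally show ?case .
qed

end

context weight_fun
begin

text \<open>The widths are chosen for \<open>q = 1\<close>; as \<open>ywt\<close> decreases in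
  \<open>q\<close>, one bump serves all \<open>q < 1\<close>. Their sum is kept below
  \<open>s / 2\<close> so that the support has half width at most
  \<open>s + s / 2 < \<delta>\<close> and the value at 0 is at least
  \<open>s - s / 2 > 0\<close>.\<close>

lemma bump_exists:
  assumes "\<delta> > 0"
  obtains f :: "real \<Rightarrow> real" where "\<And>x. f x \<ge> 0" "\<And>x. \<bar>x\<bar> \<ge> \<delta> \<Longrightarrow> f x = 0" "f 0 > 0"
    "continuous_on UNIV f" "(\<lambda>x. of_real (f x)) \<in> ultra_line"
proof -
  define s where "s = \<delta> / 2"
  have s: "s > 0" using assms by (simp add: s_def)
  obtain a C where a: "\<And>i. a i > 0" "\<And>N. (\<Sum>i<N. a i) \<le> s / 2" "C > 0" "\<And>j. (\<Prod>i<j. 1 / a i) \<le> C * ywt \<omega> 1 j"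
    using bump_widths[of "s / 2"] s by auto
  note A = a(1,2) s
  define f where "f = alim a s 0"
  define G where "G k x = complex_of_real (adiff a s k 0 x)" for k x
  have ad0: "adiff a s 0 0 = f" unfolding f_def by (rule adiff.simps(1)[OF A])
  have df: "dfam UNIV G" unfolding dfam_def G_def
    by (intro allI ballI has_vector_derivative_of_real adiff_deriv[OF A])
  have nd: "nderiv j (\<lambda>x. of_real (f x)) x = G j x" for j x
  proof (rule nderiv_dfam(1)[OF open_UNIV df])
    show "of_real (f x) = G 0 x" for x unfolding G_def ad0 ..
  qed (rule UNIV_I)
  have sm: "smooth_on_set UNIV (\<lambda>x. of_real (f x))"
  proof (rule smooth_dfam[OF open_UNIV df])
    show "of_real (f x) = G 0 x" for x unfolding G_def ad0 ..
  qed
  have bd: "bdd_seminorm q X (s * C) (\<lambda>x. of_real (f x))" if q: "q \<in> {0<..<1}" for q X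
    unfolding bdd_seminorm_def nd
  proof (intro allI ballI)
    fix j x
    have "norm (G j x) \<le> s * (\<Prod>i<j. 1 / a i)" 
      using adiff_bound[OF A, of j 0 x] unfolding G_def norm_of_real by (simp only: add_0)
    also have "\<dots> \<le> s * (C * ywt \<omega> 1 j)" using a s by (intro mult_left_mono) auto
    also have "\<dots> \<le> s * (C * ywt \<omega> q j)" using a s q ywt_antimono[of q 1 j] by (intro mult_left_mono) auto
    finally show "norm (G j x) \<le> s * C * ywt \<omega> q j" by simp
  qed
  show ?thesis
  proof (rule that[of f])
    show "f x \<ge> 0" for x using alim_range[OF A] by (simp add: f_def)
    show "f x = 0" if "\<bar>x\<bar> \<ge> \<delta>" for x using alim_supp[OF A] that by (simp add: f_def s_def)
    show "f 0 > 0" using alim_pos[OF A] by (simp add: f_def)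
    show "continuous_on UNIV f" using lip1_continuous[OF alim_lip[OF A]] by (simp add: f_def)
    have "s * C \<ge> 0" using s a by simp
    thus "(\<lambda>x. of_real (f x)) \<in> ultra_line" using sm bd by (auto simp: ultra_line_def)
  qed
qed

lemma step_exists:
  assumes "\<delta> > 0"
  obtains \<theta> where "\<theta> \<in> ultra_line" "\<And>x. x \<le> - \<delta> \<Longrightarrow> \<theta> x = 0" "\<And>x. x \<ge> \<delta> \<Longrightarrow> \<theta> x = 1"
proof -
  obtain f :: "real \<Rightarrow> real" where f: "\<And>x. f x \<ge> 0" "\<And>x. \<bar>x\<bar> \<ge> \<delta> \<Longrightarrow> f x = 0" "f 0 > 0"
    "continuous_on UNIV f" "(\<lambda>x. of_real (f x)) \<in> ultra_line" using bump_exists[OF assms] by blast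
  obtain Q where Q: "\<And>x. (Q has_vector_derivative f x) (at x)" using antiderivative_exists[OF f(4)] by blast
  hence Q': "(Q has_real_derivative f x) (at x)" for x by (simp add: has_real_derivative_iff_has_vector_derivative)
  have mono: "Q x \<le> Q y" if "x \<le> y" for x y
    by (rule DERIV_nonneg_imp_nondecreasing[OF that]) (use Q' f(1) in blast)
  have left: "Q x = Q (- \<delta>)" if "x \<le> - \<delta>" for x
  proof (cases "x = - \<delta>")
    case False
    hence lt: "x < - \<delta>" using that by simp
    have "\<exists>\<xi>>x. \<xi> < - \<delta> \<and> Q (- \<delta>) - Q x = (- \<delta> - x) * f \<xi>" by (rule MVT2[OF lt]) (use Q' in blast)
    thus ?thesis using f(2) by force
  qed simp
  have right: "Q x = Q \<delta>" if "x \<ge> \<delta>" for x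
  proof (cases "x = \<delta>")
    case False
    hence lt: "\<delta> < x" using that by simp
    have "\<exists>\<xi>>\<delta>. \<xi> < x \<and> Q x - Q \<delta> = (x - \<delta>) * f \<xi>" by (rule MVT2[OF lt]) (use Q' in blast)
    thus ?thesis using f(2) by force
  qed simp
  have ne: "Q \<delta> \<noteq> Q (- \<delta>)"
  proof
    assume eq: "Q \<delta> = Q (- \<delta>)"
    have c: "Q x = Q 0" if "x \<in> {- \<delta><..<\<delta>}" for x
      using mono[of "- \<delta>" x] mono[of x \<delta>] mono[of "- \<delta>" 0] mono[of 0 \<delta>] eq that assms by auto
    have "(Q has_real_derivative 0) (at 0)"

    proof (rule has_field_derivative_transform_within_open)
      show "((\<lambda>_. Q 0) has_real_derivative 0) (at 0)" by simp
      show "open {- \<delta><..<\<delta>}" "0 \<in> {- \<delta><..<\<delta>}" using assms by auto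
      show "Q 0 = Q x" if "x \<in> {- \<delta><..<\<delta>}" for x using c[OF that] by (rule sym)
    qed
    hence "f 0 = 0" using Q'[of 0] DERIV_unique by blast
    thus False using f(3) by simp
  qed
  define \<theta> where "\<theta> x = complex_of_real ((Q x - Q (- \<delta>)) / (Q \<delta> - Q (- \<delta>)))" for x
  have Qc: "(\<lambda>x. complex_of_real (Q x)) \<in> ultra_line"
    by (rule ultra_line_antideriv(1)[OF f(5)]) (intro has_vector_derivative_of_real Q')
  have "(\<lambda>x. of_real (1 / (Q \<delta> - Q (- \<delta>))) * (of_real (Q x) - of_real (Q (- \<delta>)))) \<in> ultra_line"
    by (rule ultra_line_cmult[OF ultra_line_diff[OF Qc ultra_line_const]])
  also have "(\<lambda>x. of_real (1 / (Q \<delta> - Q (- \<delta>))) * (of_real (Q x) - of_real (Q (- \<delta>)))) = \<theta>"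
    by (simp add: \<theta>_def fun_eq_iff)
  finally have "\<theta> \<in> ultra_line" .
  thus ?thesis
  proof (rule that)
    show "\<theta> x = 0" if "x \<le> - \<delta>" for x unfolding \<theta>_def left[OF that] by simp
    show "\<theta> x = 1" if "x \<ge> \<delta>" for x unfolding \<theta>_def right[OF that] using ne by simp
  qed
qed

lemma cutoff_interval:
  assumes "\<epsilon> > 0"
  obtains \<kappa> where "\<kappa> \<in> ultra_line" "\<And>x. l - \<epsilon> \<le> x \<Longrightarrow> x \<le> r + \<epsilon> \<Longrightarrow> \<kappa> x = 1"
    "\<And>x. x \<le> l - 3 * \<epsilon> \<or> r + 3 * \<epsilon> \<le> x \<Longrightarrow> \<kappa> x = 0"
proof -
  obtain \<theta> where \<theta>: "\<theta> \<in> ultra_line" "\<And>x. x \<le> - \<epsilon> \<Longrightarrow> \<theta> x = 0" "\<And>x. x \<ge> \<epsilon> \<Longrightarrow> \<theta> x = 1"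
    using step_exists[OF assms] by blast
  define \<kappa> where "\<kappa> x = \<theta> (x + (2 * \<epsilon> - l)) * (1 - \<theta> (x + (- r - 2 * \<epsilon>)))" for x
  have "\<kappa> \<in> ultra_line" unfolding \<kappa>_def
    by (rule ultra_line_mult[OF ultra_line_shift[OF \<theta>(1)] ultra_line_diff[OF ultra_line_const ultra_line_shift[OF \<theta>(1)]]])
  thus ?thesis
  proof (rule that)
    show "\<kappa> x = 1" if "l - \<epsilon> \<le> x" "x \<le> r + \<epsilon>" for x
      unfolding \<kappa>_def using \<theta>(3)[of "x + (2 * \<epsilon> - l)"] \<theta>(2)[of "x + (- r - 2 * \<epsilon>)"] that by simp
    show "\<kappa> x = 0" if "x \<le> l - 3 * \<epsilon> \<or> r + 3 * \<epsilon> \<le> x" for x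
      unfolding \<kappa>_def using \<theta>(2)[of "x + (2 * \<epsilon> - l)"] \<theta>(3)[of "x + (- r - 2 * \<epsilon>)"] that by auto
  qed
qed

text \<open>\<open>1 - prod (1 - \<kappa> x)\<close> over a finite subcover is 1 wherever some
  \<open>\<kappa> x\<close> is 1, and 0 where all of them vanish; it replaces a partition of
  unity.\<close>

lemma cutoff_compact:
  assumes K: "compact K" and V: "open V" "K \<subseteq> V"
  obtains \<kappa> N L where "\<kappa> \<in> ultra_line" "open N" "K \<subseteq> N" "\<And>x. x \<in> N \<Longrightarrow> \<kappa> x = 1"
    "compact L" "L \<subseteq> V" "\<And>x. x \<notin> L \<Longrightarrow> \<kappa> x = 0"
proof -
  have "\<exists>\<epsilon>>0. cball x (3 * \<epsilon>) \<subseteq> V" if "x \<in> K" for x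
  proof -
    have "x \<in> V" using that V(2) by blast
    then obtain e where "e > 0" "cball x e \<subseteq> V" using V(1) by (meson open_contains_cball)
    moreover have "3 * (e / 3) = e" by simp
    ultimately show ?thesis by (metis divide_pos_pos zero_less_numeral)
  qed
  then obtain \<epsilon> where \<epsilon>: "\<And>x. x \<in> K \<Longrightarrow> \<epsilon> x > 0" "\<And>x. x \<in> K \<Longrightarrow> cball x (3 * \<epsilon> x) \<subseteq> V" by metis
  have "K \<subseteq> (\<Union>x\<in>K. ball x (\<epsilon> x))" using \<epsilon>(1) by force
  then obtain D where D: "D \<subseteq> K" "finite D" "K \<subseteq> (\<Union>x\<in>D. ball x (\<epsilon> x))"
    by (rule compactE_image[OF K, of K "\<lambda>x. ball x (\<epsilon> x)", rotated]) auto
  have "\<exists>\<kappa>. \<kappa> \<in> ultra_line \<and> (\<forall>y\<in>ball x (\<epsilon> x). \<kappa> y = 1) \<and> (\<forall>y. y \<notin> cball x (3 * \<epsilon> x) \<longrightarrow> \<kappa> y = 0)" if "x \<in> K" for x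
  proof -
    obtain \<kappa> where "\<kappa> \<in> ultra_line" "\<And>y. x - \<epsilon> x \<le> y \<Longrightarrow> y \<le> x + \<epsilon> x \<Longrightarrow> \<kappa> y = 1"
      "\<And>y. y \<le> x - 3 * \<epsilon> x \<or> x + 3 * \<epsilon> x \<le> y \<Longrightarrow> \<kappa> y = 0" using cutoff_interval[OF \<epsilon>(1)[OF \<open>x \<in> K\<close>], of x x] by blast
    thus ?thesis by (intro exI[of _ \<kappa>]) (auto simp: dist_real_def abs_le_iff abs_less_iff)
  qed
  then obtain \<kappa> where \<kappa>: "\<And>x. x \<in> K \<Longrightarrow> \<kappa> x \<in> ultra_line" "\<And>x y. x \<in> K \<Longrightarrow> y \<in> ball x (\<epsilon> x) \<Longrightarrow> \<kappa> x y = 1"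
    "\<And>x y. x \<in> K \<Longrightarrow> y \<notin> cball x (3 * \<epsilon> x) \<Longrightarrow> \<kappa> x y = 0" by metis
  define \<psi> where "\<psi> y = 1 - (\<Prod>x\<in>D. 1 - \<kappa> x y)" for y
  have prod: "(\<lambda>y. \<Prod>x\<in>D'. 1 - \<kappa> x y) \<in> ultra_line" if "finite D'" "D' \<subseteq> K" for D'
    using that
  proof (induction D' rule: finite_induct)
    case (insert x D')
    have "(\<lambda>y. (1 - \<kappa> x y) * (\<Prod>x\<in>D'. 1 - \<kappa> x y)) \<in> ultra_line"
      by (rule ultra_line_mult[OF ultra_line_diff[OF ultra_line_const \<kappa>(1)]]) (use insert in blast)+
    thus ?case using insert by simp
  qed (simp add: ultra_line_1)
  show ?thesis
  proof (rule that[of \<psi> "\<Union>x\<in>D. ball x (\<epsilon> x)" "\<Union>x\<in>D. cball x (3 * \<epsilon> x)"])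
    show "\<psi> \<in> ultra_line" unfolding \<psi>_def by (rule ultra_line_diff[OF ultra_line_const prod[OF D(2,1)]])
    show "\<psi> y = 1" if y: "y \<in> (\<Union>x\<in>D. ball x (\<epsilon> x))" for y
    proof -
      obtain x where "x \<in> D" "y \<in> ball x (\<epsilon> x)" using y by blast
      hence "(\<Prod>x\<in>D. 1 - \<kappa> x y) = 0" using \<kappa>(2)[of x y] D by (intro prod_zero) auto
      thus ?thesis by (simp add: \<psi>_def)
    qed
    show "\<psi> y = 0" if "y \<notin> (\<Union>x\<in>D. cball x (3 * \<epsilon> x))" for y
    proof -
      have "(\<Prod>x\<in>D. 1 - \<kappa> x y) = (\<Prod>x\<in>D. 1)" by (rule prod.cong) (use that \<kappa>(3) D in auto)
      thus ?thesis by (simp add: \<psi>_def)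
    qed
    show "compact (\<Union>x\<in>D. cball x (3 * \<epsilon> x))" using D by (intro compact_UN) auto
    show "(\<Union>x\<in>D. cball x (3 * \<epsilon> x)) \<subseteq> V" using D \<epsilon>(2) by blast
  qed (use D in auto)
qed

end


section \<open>The space of ultradifferentiable functions and its dual\<close>

locale ultra_space = weight_fun +
  fixes a :: ereal and c :: "nat \<Rightarrow> real"
  assumes exh: "exhausting a c"
begin

abbreviation "U \<equiv> ultradiff \<omega> a c"
abbreviation "X \<equiv> sym_ival a"
abbreviation "I k \<equiv> {- c k..c k}"

lemma X_open: "open X"
  unfolding sym_ival_def by (intro open_Collect_less continuous_intros) 

text \<open>The sequence \<open>c\<close> is only weakly increasing, so the strict inequality is
  taken from its limit \<open>a\<close>, which exceeds \<open>|x|\<close>. It provides the room that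
  cut-offs need.\<close>

lemma X_dominated: "x \<in> X \<Longrightarrow> \<exists>k. \<bar>x\<bar> < c k"
proof -
  assume "x \<in> X"
  hence "ereal \<bar>x\<bar> < a" by (simp add: sym_ival_def)
  moreover have "(\<lambda>k. ereal (c k)) \<longlonglongrightarrow> a" using exh by (simp add: exhausting_def)
  ultimately have "\<forall>\<^sub>F k in sequentially. ereal \<bar>x\<bar> < ereal (c k)" by (intro order_tendstoD(1))
  then obtain k where "ereal \<bar>x\<bar> < ereal (c k)" by (meson eventually_sequentially order_refl)
  thus ?thesis by auto
qed

lemma I_subset: "I k \<subseteq> X" using exh by (auto simp: exhausting_def)

lemma c_pos: "c k > 0" using exh by (simp add: exhausting_def)

lemma c_mono: "k \<le> l \<Longrightarrow> c k \<le> c l" using exh by (auto simp: exhausting_def incseq_def)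

lemma compact_in_I: "compact L \<Longrightarrow> L \<subseteq> X \<Longrightarrow> \<exists>k. L \<subseteq> {- c k<..<c k}"
proof (cases "L = {}")
  case False
  assume L: "compact L" "L \<subseteq> X"
  have "continuous_on L (\<lambda>x. \<bar>x\<bar>)" by (intro continuous_intros)
  then obtain x where x: "x \<in> L" "\<And>y. y \<in> L \<Longrightarrow> \<bar>y\<bar> \<le> \<bar>x\<bar>"
    using continuous_attains_sup[OF L(1) False] by blast
  then obtain k where k: "\<bar>x\<bar> < c k" using X_dominated L(2) by blast
  have "L \<subseteq> {- c k<..<c k}"
  proof
    fix y assume "y \<in> L"
    hence "\<bar>y\<bar> < c k" using x(2) k by (meson le_less_trans)
    thus "y \<in> {- c k<..<c k}" by auto
  qed
  thus ?thesis ..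
qed auto

lemma useminorm_le_iff:
  assumes "B \<ge> 0"
  shows "useminorm \<omega> c q k f \<le> ennreal B \<longleftrightarrow> bdd_seminorm q (I k) B f"
proof -
  have *: "ennreal (norm y * exp (- q * young_conj \<omega> (real j / q))) \<le> ennreal B \<longleftrightarrow> norm y \<le> B * ywt \<omega> q j"
    for y :: complex and j
    using assms by (simp add: ywt_def mult_exp_le_iff)
  show ?thesis unfolding useminorm_def SUP_le_iff * bdd_seminorm_def by auto
qed

lemma useminorm_finite_iff: "useminorm \<omega> c q k f < \<infinity> \<longleftrightarrow> (\<exists>B\<ge>0. bdd_seminorm q (I k) B f)"
proof
  assume "useminorm \<omega> c q k f < \<infinity>"
  then obtain B where "B \<ge> 0" "useminorm \<omega> c q k f = ennreal B" by (cases "useminorm \<omega> c q k f") auto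
  thus "\<exists>B\<ge>0. bdd_seminorm q (I k) B f" using useminorm_le_iff[of B q k f] by auto
next
  assume "\<exists>B\<ge>0. bdd_seminorm q (I k) B f"
  then obtain B where "B \<ge> 0" "useminorm \<omega> c q k f \<le> ennreal B" using useminorm_le_iff by blast
  thus "useminorm \<omega> c q k f < \<infinity>" by (simp add: le_less_trans)
qed

lemma U_iff: "f \<in> U \<longleftrightarrow> (\<forall>x. x \<notin> X \<longrightarrow> f x = 0) \<and> smooth_on_set X f \<and>
   (\<forall>q\<in>{0<..<1}. \<forall>k. \<exists>B\<ge>0. bdd_seminorm q (I k) B f)"
  unfolding ultradiff_def smooth_fun_def smooth_on_set_def useminorm_finite_iff by auto

lemma U_D:
  assumes "f \<in> U"
  shows "x \<notin> X \<Longrightarrow> f x = 0" "smooth_on_set X f" "q \<in> {0<..<1} \<Longrightarrow> \<exists>B\<ge>0. bdd_seminorm q (I k) B f"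
  using assms unfolding U_iff by blast+

lemma U_add: assumes "f \<in> U" "g \<in> U" shows "(\<lambda>x. f x + g x) \<in> U"
  unfolding U_iff
proof (intro conjI ballI allI impI)
  show "f x + g x = 0" if "x \<notin> X" for x using U_D(1)[OF assms(1) that] U_D(1)[OF assms(2) that] by simp
  show "smooth_on_set X (\<lambda>x. f x + g x)" using nderiv_add(1)[OF X_open] assms U_D(2) by blast
  fix q k assume q: "q \<in> {0<..<(1::real)}"
  obtain A where A: "A \<ge> 0" "bdd_seminorm q (I k) A f" using U_D(3)[OF assms(1) q] by blast
  obtain B where B: "B \<ge> 0" "bdd_seminorm q (I k) B g" using U_D(3)[OF assms(2) q] by blast
  have "bdd_seminorm q (I k) (A + B) (\<lambda>x. f x + g x)"
    by (rule bdd_seminorm_add[OF X_open U_D(2)[OF assms(1)] U_D(2)[OF assms(2)] I_subset A(2) B(2)])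
  thus "\<exists>B\<ge>0. bdd_seminorm q (I k) B (\<lambda>x. f x + g x)" using A B by (intro exI[of _ "A + B"]) auto
qed

lemma U_cmult: assumes "f \<in> U" shows "(\<lambda>x. u * f x) \<in> U"
  unfolding U_iff
proof (intro conjI ballI allI impI)
  show "u * f x = 0" if "x \<notin> X" for x using U_D(1)[OF assms(1) that] by simp
  show "smooth_on_set X (\<lambda>x. u * f x)" using nderiv_cmult(1)[OF X_open] assms U_D(2) by blast
  fix q k assume q: "q \<in> {0<..<(1::real)}"
  obtain A where A: "A \<ge> 0" "bdd_seminorm q (I k) A f" using U_D(3)[OF assms(1) q] by blast
  have "bdd_seminorm q (I k) (norm u * A) (\<lambda>x. u * f x)"
    by (rule bdd_seminorm_cmult[OF X_open U_D(2)[OF assms(1)] I_subset A(2)])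
  thus "\<exists>B\<ge>0. bdd_seminorm q (I k) B (\<lambda>x. u * f x)" using A by (intro exI[of _ "norm u * A"]) auto
qed

lemma U_diff: assumes "f \<in> U" "g \<in> U" shows "(\<lambda>x. f x - g x) \<in> U"
  using U_add[OF assms(1) U_cmult[OF assms(2), of "-1"]] by simp

lemma U_zero: "(\<lambda>x. 0) \<in> U"
proof -
  have "bdd_seminorm q (I k) 0 (\<lambda>x. 0)" for q k
    unfolding bdd_seminorm_def using nderiv_zero[OF open_UNIV, of "\<lambda>x. 0"] by simp
  thus ?thesis unfolding U_iff using smooth_zero[OF X_open, of "\<lambda>x. 0"] by auto
qed

lemma U_fun_ops: "f \<in> U \<Longrightarrow> g \<in> U \<Longrightarrow> f + g \<in> U" "f \<in> U \<Longrightarrow> cscale u f \<in> U" "f \<in> U \<Longrightarrow> g \<in> U \<Longrightarrow> f - g \<in> U" "0 \<in> U"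
  using U_add[of f g] U_cmult[of f u] U_diff[of f g] U_zero
  by (simp_all add: plus_fun_def cscale_def fun_diff_def zero_fun_def)

lemma U_subspace: "cfun_subspace U"
  unfolding cfun.subspace_def using U_fun_ops by blast

lemma nderiv_ext_zero:
  assumes "smooth_on_set X F"
  shows "smooth_on_set X (ext_zero a F)" "x \<in> X \<Longrightarrow> nderiv j (ext_zero a F) x = nderiv j F x"
  by (rule smooth_cong[OF X_open assms], simp add: ext_zero_def)+

lemma bdd_ext_zero:
  assumes "smooth_on_set X F" "Y \<subseteq> X"
  shows "bdd_seminorm q Y B (ext_zero a F) \<longleftrightarrow> bdd_seminorm q Y B F"
  unfolding bdd_seminorm_def using nderiv_ext_zero(2)[OF assms(1)] assms(2) by (metis subsetD)

lemma ext_zero_line: assumes "F \<in> ultra_line" shows "ext_zero a F \<in> U"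
  unfolding U_iff
proof (intro conjI ballI allI impI)
  have sm: "smooth_on_set X F" by (rule ultra_lineD(1)[OF assms])
  show "ext_zero a F x = 0" if "x \<notin> X" for x using that by (simp add: ext_zero_def)
  show "smooth_on_set X (ext_zero a F)" by (rule nderiv_ext_zero[OF sm])
  fix q k assume q: "q \<in> {0<..<(1::real)}"
  obtain B where "B \<ge> 0" "bdd_seminorm q (I k) B F"
    by (rule ultra_line_bdd_on[OF assms q bounded_closed_interval])
  thus "\<exists>B\<ge>0. bdd_seminorm q (I k) B (ext_zero a F)" using bdd_ext_zero[OF sm I_subset] by blast
qed

lemma U_line_mult:
  assumes f: "f \<in> U" and F: "F \<in> ultra_line" shows "(\<lambda>x. F x * f x) \<in> U"
  unfolding U_iff
proof (intro conjI ballI allI impI)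
  show "F x * f x = 0" if "x \<notin> X" for x using U_D(1)[OF f that] by simp
  note sm = ultra_lineD(1)[OF F, of X] U_D(2)[OF f]
  show "smooth_on_set X (\<lambda>x. F x * f x)" by (rule nderiv_mult(1)[OF X_open sm])
  fix q k assume q: "q \<in> {0<..<(1::real)}"
  note q' = exponent_midpoint[OF q]
  obtain C where C: "C > 0" "\<And>X Y f g A B. open X \<Longrightarrow> smooth_on_set X f \<Longrightarrow> smooth_on_set X g \<Longrightarrow> Y \<subseteq> X \<Longrightarrow>
     A \<ge> 0 \<Longrightarrow> B \<ge> 0 \<Longrightarrow>
     bdd_seminorm ((q + 1) / 2) Y A f \<Longrightarrow> bdd_seminorm ((q + 1) / 2) Y B g \<Longrightarrow> bdd_seminorm q Y (C * (A * B)) (\<lambda>x. f x * g x)"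
    by (rule bdd_seminorm_mult[of q "(q + 1) / 2"]) (use q q' in auto)
  obtain A where A: "A \<ge> 0" "bdd_seminorm ((q + 1) / 2) (I k) A F"
    by (rule ultra_line_bdd_on[OF F conjunct1[OF q'] bounded_closed_interval])
  obtain B where B: "B \<ge> 0" "bdd_seminorm ((q + 1) / 2) (I k) B f" using U_D(3)[OF f conjunct1[OF q']] by blast
  have "bdd_seminorm q (I k) (C * (A * B)) (\<lambda>x. F x * f x)"
    by (rule C(2)[OF X_open sm I_subset A(1) B(1) A(2) B(2)])
  thus "\<exists>B\<ge>0. bdd_seminorm q (I k) B (\<lambda>x. F x * f x)" using A B C by (intro exI[of _ "C * (A * B)"]) auto
qed

lemma U_bdd_on_compact:
  assumes f: "f \<in> U" and L: "compact L" "L \<subseteq> X" and q: "q \<in> {0<..<1}"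
  obtains B where "B \<ge> 0" "bdd_seminorm q L B f"
proof -
  obtain k where k: "L \<subseteq> {- c k<..<c k}" using compact_in_I[OF L] by blast
  obtain B where B: "B \<ge> 0" "bdd_seminorm q (I k) B f" using U_D(3)[OF f q] by blast
  show ?thesis
  proof (rule that[OF B(1)])
    show "bdd_seminorm q L B f" by (rule bdd_seminorm_subset[OF B(2)]) (use k in auto)
  qed
qed

text \<open>Extension by zero is smooth because \<open>X\<close> and the complement of
  \<open>L\<close> cover the line; off \<open>L\<close> all derivatives vanish, so the bound on
  \<open>L\<close> is a bound on every interval.\<close>

lemma U_compact_support:
  assumes f: "f \<in> U" and L: "compact L" "L \<subseteq> X" "\<And>x. x \<notin> L \<Longrightarrow> f x = 0"
  shows "f \<in> ultra_line"
proof -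
  have opn: "open (- L)" using L(1) by (simp add: compact_imp_closed open_Compl)
  have smz: "smooth_on_set (- L) f" by (rule smooth_zero[OF opn]) (use L(3) in auto)
  have "smooth_on_set (X \<union> - L) f" by (rule smooth_on_set_Un[OF U_D(2)[OF f] smz])
  moreover have "X \<union> - L = UNIV" using L(2) by auto
  ultimately have sm: "smooth_on_set UNIV f" by simp
  have "\<exists>B\<ge>0. bdd_seminorm q {-R..R} B f" if q: "q \<in> {0<..<1}" for q R
  proof -
    obtain B where B: "B \<ge> 0" "bdd_seminorm q L B f" by (rule U_bdd_on_compact[OF f L(1,2) q])
    have "bdd_seminorm q {-R..R} B f" unfolding bdd_seminorm_def
    proof (intro allI ballI)
      fix j x
      show "norm (nderiv j f x) \<le> B * ywt \<omega> q j"
      proof (cases "x \<in> L")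
        case False
        hence "nderiv j f x = 0" using nderiv_zero[OF opn, of f x j] L(3) by auto
        thus ?thesis using B(1) by simp
      qed (use B(2) in \<open>simp add: bdd_seminorm_def\<close>)
    qed
    thus ?thesis using B by blast
  qed
  thus ?thesis using sm by (auto simp: ultra_line_def)
qed

lemma cut_line:
  assumes f: "f \<in> U" and F: "F \<in> ultra_line" and L: "compact L" "L \<subseteq> X" "\<And>x. x \<notin> L \<Longrightarrow> F x = 0"
  shows "(\<lambda>x. F x * f x) \<in> ultra_line"
  by (rule U_compact_support[OF U_line_mult[OF f F] L(1,2)]) (simp add: L(3))

lemma ext_zero_id: "(\<And>x. x \<notin> X \<Longrightarrow> F x = 0) \<Longrightarrow> ext_zero a F = F"
  by (auto simp: ext_zero_def)

lemma deriv_U: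
  assumes f: "f \<in> U" shows "ext_zero a (nderiv 1 f) \<in> U"
  unfolding U_iff
proof (intro conjI ballI allI impI)
  have sm: "smooth_on_set X (nderiv 1 f)" by (rule smooth_nderiv1[OF U_D(2)[OF f]])
  show "ext_zero a (nderiv 1 f) x = 0" if "x \<notin> X" for x using that by (simp add: ext_zero_def)
  show "smooth_on_set X (ext_zero a (nderiv 1 f))" by (rule nderiv_ext_zero[OF sm])
  fix q k assume q: "q \<in> {0<..<(1::real)}"
  note q' = exponent_midpoint[OF q]
  obtain C where C: "C > 0" "\<And>X f B. B \<ge> 0 \<Longrightarrow> bdd_seminorm ((q+1)/2) X B f \<Longrightarrow> bdd_seminorm q X (C * B) (nderiv 1 f)"
    by (rule bdd_seminorm_nderiv1[of q "(q + 1) / 2"]) (use q q' in auto)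
  obtain B where B: "B \<ge> 0" "bdd_seminorm ((q + 1) / 2) (I k) B f" using U_D(3)[OF f conjunct1[OF q']] by blast
  have "bdd_seminorm q (I k) (C * B) (ext_zero a (nderiv 1 f))"
    unfolding bdd_ext_zero[OF sm I_subset] by (rule C(2)[OF B])
  thus "\<exists>B\<ge>0. bdd_seminorm q (I k) B (ext_zero a (nderiv 1 f))" using B C by (intro exI[of _ "C * B"]) auto
qed

section \<open>The topology generated by the seminorms\<close>

lemma useminorm_mono:
  assumes "0 < q" "q \<le> q'" "k \<le> k'" shows "useminorm \<omega> c q k f \<le> useminorm \<omega> c q' k' f"
proof (cases "useminorm \<omega> c q' k' f")
  case (real B)
  hence "bdd_seminorm q' (I k') B f" using useminorm_le_iff[of B q' k' f] by simp
  hence "bdd_seminorm q' (I k) B f" by (rule bdd_seminorm_subset) (use c_mono[OF assms(3)] in auto)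
  hence "bdd_seminorm q (I k) B f" by (rule bdd_seminorm_mono) (use assms real in auto)
  thus ?thesis using useminorm_le_iff[of B q k f] real by simp
qed simp

lemma useminorm_triangle:
  assumes "f \<in> U" "g \<in> U" "q \<in> {0<..<1}"
  shows "useminorm \<omega> c q k (f + g) \<le> useminorm \<omega> c q k f + useminorm \<omega> c q k g"
proof (cases "useminorm \<omega> c q k f"; cases "useminorm \<omega> c q k g")
  fix A B assume h: "0 \<le> A" "useminorm \<omega> c q k f = ennreal A" "0 \<le> B" "useminorm \<omega> c q k g = ennreal B"
  have "bdd_seminorm q (I k) A f" "bdd_seminorm q (I k) B g"
    using h useminorm_le_iff[of A q k f] useminorm_le_iff[of B q k g] by simp_all
  hence "bdd_seminorm q (I k) (A + B) (\<lambda>x. f x + g x)"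
    by (rule bdd_seminorm_add[OF X_open U_D(2)[OF assms(1)] U_D(2)[OF assms(2)] I_subset])
  hence "bdd_seminorm q (I k) (A + B) (f + g)" by (simp add: plus_fun_def)
  thus ?thesis using h useminorm_le_iff[of "A + B" q k "f + g"] by simp
qed auto

lemma topspace_ultratop: "topspace (ultratop \<omega> a c) = U"
proof -
  let ?S = "{{g \<in> U. useminorm \<omega> c q k (g - f) < ennreal e} | f q k e. f \<in> U \<and> 0 < q \<and> q < 1 \<and> 0 < e}"
  have "f \<in> \<Union>?S" if "f \<in> U" for f
  proof -
    have "bdd_seminorm (1/2) (I 0) 0 (f - f)"
      unfolding bdd_seminorm_def using nderiv_zero[OF open_UNIV, of "\<lambda>x. 0"] by (simp add: zero_fun_def)
    hence "useminorm \<omega> c (1/2) 0 (f - f) \<le> ennreal 0" using useminorm_le_iff[of 0] by blast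
    hence "f \<in> {g \<in> U. useminorm \<omega> c (1/2) 0 (g - f) < ennreal 1}" using that by simp
    moreover have "{g \<in> U. useminorm \<omega> c (1/2) 0 (g - f) < ennreal 1} \<in> ?S"
    proof -
      have "(0::real) < 1/2" "(1/2::real) < 1" "(0::real) < 1" by simp_all
      thus ?thesis using that by blast
    qed
    ultimately show ?thesis by (rule UnionI[rotated])
  qed
  thus ?thesis unfolding ultratop_def topology_generated_by_topspace by blast
qed

lemma ball_open:
  "f \<in> U \<Longrightarrow> q \<in> {0<..<1} \<Longrightarrow> 0 < e \<Longrightarrow> openin (ultratop \<omega> a c) {g \<in> U. useminorm \<omega> c q k (g - f) < ennreal e}"
  unfolding ultratop_def by (rule topology_generated_by_Basis) auto

text \<open>The seminorm balls generate the topology only as a subbasis. Finite intersections still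
  contain a ball because the seminorms are directed: they increase with \<open>q\<close> and with
  \<open>k\<close>.\<close>

lemma open_contains_ball_ultratop:
  assumes "openin (ultratop \<omega> a c) O1" "g \<in> O1"
  shows "\<exists>q k e. q \<in> {0<..<1} \<and> 0 < e \<and> (\<forall>h\<in>U. useminorm \<omega> c q k (h - g) < ennreal e \<longrightarrow> h \<in> O1)"
proof -
  have gU: "g \<in> U" using assms openin_subset topspace_ultratop by blast
  have "generate_topology_on {{g \<in> U. useminorm \<omega> c q k (g - f) < ennreal e} | f q k e.
        f \<in> U \<and> 0 < q \<and> q < 1 \<and> 0 < e} O1"
    using assms(1) unfolding ultratop_def openin_topology_generated_by_iff .
  thus ?thesis using assms(2)
  proof (induction rule: generate_topology_on.induct)
    case (Int A B)
    obtain q k e where 1: "q \<in> {0<..<1}" "0 < e" "\<And>h. h \<in> U \<Longrightarrow> useminorm \<omega> c q k (h - g) < ennreal e \<Longrightarrow> h \<in> A"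
      using Int by blast
    obtain q' k' e' where 2: "q' \<in> {0<..<1}" "0 < e'" "\<And>h. h \<in> U \<Longrightarrow> useminorm \<omega> c q' k' (h - g) < ennreal e' \<Longrightarrow> h \<in> B"
      using Int by blast
    show ?case
    proof (intro exI conjI ballI impI)
      show "max q q' \<in> {0<..<1}" "0 < min e e'" using 1 2 by auto
      fix h assume h: "h \<in> U" "useminorm \<omega> c (max q q') (max k k') (h - g) < ennreal (min e e')"
      have "useminorm \<omega> c q k (h - g) \<le> useminorm \<omega> c (max q q') (max k k') (h - g)"
        by (rule useminorm_mono) (use 1 in auto)
      moreover have "useminorm \<omega> c q' k' (h - g) \<le> useminorm \<omega> c (max q q') (max k k') (h - g)"
        by (rule useminorm_mono) (use 2 in auto)
      moreover have "ennreal (min e e') \<le> ennreal e" "ennreal (min e e') \<le> ennreal e'" by (auto intro: ennreal_leI)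
      ultimately have "useminorm \<omega> c q k (h - g) < ennreal e" "useminorm \<omega> c q' k' (h - g) < ennreal e'"
        using h(2) by (meson le_less_trans less_le_trans)+
      thus "h \<in> A \<inter> B" using 1 2 h(1) by blast
    qed
  next
    case (UN K)
    then obtain k where "k \<in> K" "g \<in> k" by blast
    thus ?case using UN.IH[of k] by blast
  next
    case (Basis s)
    then obtain f q k e where s: "s = {g \<in> U. useminorm \<omega> c q k (g - f) < ennreal e}" "f \<in> U" "q \<in> {0<..<1}" "0 < e" by auto
    have lt: "useminorm \<omega> c q k (g - f) < ennreal e" using Basis.prems s by blast
    then obtain r where r: "r \<ge> 0" "useminorm \<omega> c q k (g - f) = ennreal r" by (cases "useminorm \<omega> c q k (g - f)") auto
    hence re: "r < e" using lt by (simp add: ennreal_less_iff)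
    show ?case
    proof (intro exI conjI ballI impI)
      show "q \<in> {0<..<1}" "0 < e - r" using s re by auto
      fix h assume h: "h \<in> U" "useminorm \<omega> c q k (h - g) < ennreal (e - r)"
      have eq: "h - f = (h - g) + (g - f)" by simp
      have "useminorm \<omega> c q k (h - f) \<le> useminorm \<omega> c q k (h - g) + useminorm \<omega> c q k (g - f)"
        unfolding eq by (rule useminorm_triangle) (use h gU s U_fun_ops in auto)
      also have "\<dots> < ennreal e"
      proof -
        obtain r' where r': "r' \<ge> 0" "useminorm \<omega> c q k (h - g) = ennreal r'"
          using h(2) by (cases "useminorm \<omega> c q k (h - g)") auto
        hence "r' < e - r" using h(2) by (simp add: ennreal_less_iff)
        hence "ennreal (r' + r) < ennreal e" using r r' by (intro ennreal_lessI) auto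
        thus ?thesis unfolding r r' using r(1) r'(1) by (simp only: ennreal_plus)
      qed
      finally show "h \<in> s" using h s by blast
    qed
  qed simp
qed

lemma in_closure_iff:
  "f \<in> ultratop \<omega> a c closure_of M \<longleftrightarrow> f \<in> U \<and>
     (\<forall>q\<in>{0<..<1}. \<forall>k. \<forall>e>0. \<exists>m\<in>M \<inter> U. useminorm \<omega> c q k (m - f) < ennreal e)" (is "?l \<longleftrightarrow> ?r")
proof
  assume ?l
  hence fU: "f \<in> U" and T: "\<And>T. f \<in> T \<Longrightarrow> openin (ultratop \<omega> a c) T \<Longrightarrow> \<exists>y. y \<in> M \<and> y \<in> T"
    by (auto simp: in_closure_of topspace_ultratop)
  show ?r
  proof (intro conjI fU ballI allI impI)
    fix q k and e :: real assume q: "q \<in> {0<..<(1::real)}" and e: "e > 0"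
    have "bdd_seminorm q (I k) 0 (f - f)"
      unfolding bdd_seminorm_def using nderiv_zero[OF open_UNIV, of "\<lambda>x. 0"] by (simp add: zero_fun_def)
    hence "useminorm \<omega> c q k (f - f) \<le> ennreal 0" using useminorm_le_iff[of 0] by blast
    hence "f \<in> {g \<in> U. useminorm \<omega> c q k (g - f) < ennreal e}" using fU e by simp
    from T[OF this ball_open[OF fU q e]]
    show "\<exists>m\<in>M \<inter> U. useminorm \<omega> c q k (m - f) < ennreal e" by blast
  qed
next
  assume r: ?r
  show ?l unfolding in_closure_of topspace_ultratop
  proof (intro conjI allI impI)
    show "f \<in> U" using r by blast
    fix T assume "f \<in> T \<and> openin (ultratop \<omega> a c) T"
    then obtain q k e where "q \<in> {0<..<1}" "0 < e" "\<And>h. h \<in> U \<Longrightarrow> useminorm \<omega> c q k (h - f) < ennreal e \<Longrightarrow> h \<in> T"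
      using open_contains_ball_ultratop by meson
    thus "\<exists>y. y \<in> M \<and> y \<in> T" using r by (meson IntE)
  qed
qed

section \<open>Continuous functionals\<close>

text \<open>Continuity in quantitative form: domination by a single seminorm. Hahn-Banach
  functionals and values of the local convolution at a point arise directly in this form, and its
  constants can be computed with.\<close>

definition bfunctional :: "((real \<Rightarrow> complex) \<Rightarrow> complex) \<Rightarrow> real \<Rightarrow> nat \<Rightarrow> real \<Rightarrow> bool" where
  "bfunctional L q k C \<longleftrightarrow> q \<in> {0<..<1} \<and> C \<ge> 0 \<and>
     (\<forall>f\<in>U. \<forall>g\<in>U. L (f + g) = L f + L g) \<and> (\<forall>u. \<forall>f\<in>U. L (cscale u f) = u * L f) \<and>
     (\<forall>f\<in>U. \<forall>B\<ge>0. bdd_seminorm q (I k) B f \<longrightarrow> norm (L f) \<le> C * B)"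

text \<open>The neighbourhood of 0 where \<open>|S| < 1\<close> contains a seminorm ball of radius
  \<open>e\<close>; scaling into the ball gives the constant \<open>2 / e\<close>.\<close>

lemma ultradual_bounded:
  assumes "S \<in> ultradual \<omega> a c"
  obtains q k C where "bfunctional S q k C"
proof -
  have add: "\<And>f g. f \<in> U \<Longrightarrow> g \<in> U \<Longrightarrow> S (f + g) = S f + S g" and sc: "\<And>u f. f \<in> U \<Longrightarrow> S (cscale u f) = u * S f"
    and cont: "continuous_map (ultratop \<omega> a c) euclidean S" using assms by (auto simp: ultradual_def)
  have "S (cscale 0 0) = 0" using sc[of 0 0] U_fun_ops(4) by simp
  hence S0: "S 0 = 0" by (simp add: cscale_def zero_fun_def)
  have "openin (ultratop \<omega> a c) {f \<in> topspace (ultratop \<omega> a c). S f \<in> ball 0 1}"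
    by (rule openin_continuous_map_preimage[OF cont]) simp
  moreover have "0 \<in> {f \<in> topspace (ultratop \<omega> a c). S f \<in> ball 0 1}" using U_fun_ops(4) S0 by (simp add: topspace_ultratop)
  ultimately obtain q k e where q: "q \<in> {0<..<1}" "0 < e"
    "\<And>h. h \<in> U \<Longrightarrow> useminorm \<omega> c q k (h - 0) < ennreal e \<Longrightarrow> h \<in> {f \<in> topspace (ultratop \<omega> a c). S f \<in> ball 0 1}"
    using open_contains_ball_ultratop by meson
  have bd: "norm (S f) \<le> 2 / e * B" if f: "f \<in> U" "B \<ge> 0" "bdd_seminorm q (I k) B f" for f B
  proof (rule field_le_epsilon)
    fix \<eta> :: real assume \<eta>: "\<eta> > 0"
    \<comment> \<open>\<open>B\<close> may be 0, so it is enlarged before being divided by.\<close>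
    define B' where "B' = B + \<eta> * e / 2"
    have B': "B' > 0" "B \<le> B'" using f \<eta> q(2) by (auto simp: B'_def add_nonneg_pos)
    define u where "u = complex_of_real (e / (2 * B'))"
    have nu: "norm u = e / (2 * B')" unfolding u_def norm_of_real using q(2) B' by (simp add: abs_of_pos)
    have "bdd_seminorm q (I k) (norm u * B) (\<lambda>x. u * f x)"
      by (rule bdd_seminorm_cmult[OF X_open U_D(2)[OF f(1)] I_subset f(3)])
    hence "useminorm \<omega> c q k (cscale u f) \<le> ennreal (norm u * B)"
      using useminorm_le_iff[of "norm u * B" q k "cscale u f"] f by (simp add: cscale_def)
    also have "norm u * B < e"
    proof -
      have "norm u * B \<le> norm u * B'" using B' by (intro mult_left_mono) auto
      also have "\<dots> = e / 2" using B' by (simp add: nu)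
      finally show ?thesis using q(2) by simp
    qed
    hence "ennreal (norm u * B) < ennreal e" using q(2) by (intro ennreal_lessI)
    finally have "norm (S (cscale u f)) < 1" using q(3)[of "cscale u f"] U_fun_ops(2)[OF f(1), of u] by simp
    hence "norm u * norm (S f) < 1" using sc[OF f(1)] by (simp add: norm_mult)
    hence "norm (S f) < 2 * B' / e" using B' q(2) by (simp add: nu field_simps)
    also have "2 * B' / e = 2 / e * B + \<eta>" using q(2) by (simp add: B'_def field_simps)
    finally show "norm (S f) \<le> 2 / e * B + \<eta>" by simp
  qed
  show ?thesis
  proof (rule that)
    show "bfunctional S q k (2 / e)" unfolding bfunctional_def using q(1,2) add sc bd by auto
  qed
qed

lemma bfunctional_linear:
  assumes "bfunctional L q k C"
  shows "f \<in> U \<Longrightarrow> g \<in> U \<Longrightarrow> L (\<lambda>x. f x + g x) = L f + L g"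
    "f \<in> U \<Longrightarrow> L (\<lambda>x. u * f x) = u * L f" "f \<in> U \<Longrightarrow> g \<in> U \<Longrightarrow> L (\<lambda>x. f x - g x) = L f - L g" "L (\<lambda>x. 0) = 0"
    "f \<in> U \<Longrightarrow> B \<ge> 0 \<Longrightarrow> bdd_seminorm q (I k) B f \<Longrightarrow> norm (L f) \<le> C * B"
proof -
  have add: "L (\<lambda>x. f x + g x) = L f + L g" if "f \<in> U" "g \<in> U" for f g
    using assms that by (auto simp: bfunctional_def plus_fun_def)
  have sc: "L (\<lambda>x. u * f x) = u * L f" if "f \<in> U" for f u
    using assms that by (auto simp: bfunctional_def cscale_def)
  show "f \<in> U \<Longrightarrow> g \<in> U \<Longrightarrow> L (\<lambda>x. f x + g x) = L f + L g" "f \<in> U \<Longrightarrow> L (\<lambda>x. u * f x) = u * L f" by (fact add sc)+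
  show "L (\<lambda>x. f x - g x) = L f - L g" if "f \<in> U" "g \<in> U"
    using add[OF that(1) U_cmult[OF that(2), of "-1"]] sc[OF that(2), of "-1"] by simp
  show "L (\<lambda>x. 0) = 0" using sc[OF U_zero, of 0] by simp
  show "f \<in> U \<Longrightarrow> B \<ge> 0 \<Longrightarrow> bdd_seminorm q (I k) B f \<Longrightarrow> norm (L f) \<le> C * B" using assms by (auto simp: bfunctional_def)
qed

lemma bfunctional_sum:
  assumes L: "bfunctional L q k C" and "finite A" "\<And>i. i \<in> A \<Longrightarrow> f i \<in> U"
  shows "(\<lambda>x. \<Sum>i\<in>A. f i x) \<in> U \<and> L (\<lambda>x. \<Sum>i\<in>A. f i x) = (\<Sum>i\<in>A. L (f i))"
  using assms(2,3)
proof (induction A rule: finite_induct)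
  case (insert i A)
  hence IH: "(\<lambda>x. \<Sum>i\<in>A. f i x) \<in> U" "L (\<lambda>x. \<Sum>i\<in>A. f i x) = (\<Sum>i\<in>A. L (f i))" by auto
  have "L (\<lambda>x. f i x + (\<Sum>i\<in>A. f i x)) = L (f i) + L (\<lambda>x. \<Sum>i\<in>A. f i x)"
    by (rule bfunctional_linear(1)[OF L]) (use insert IH in auto)
  moreover have "(\<lambda>x. f i x + (\<Sum>i\<in>A. f i x)) \<in> U" by (rule U_add) (use insert IH in auto)
  ultimately show ?case using insert IH by simp
qed (use U_zero bfunctional_linear(4)[OF L] in auto)

lemma bfunctional_local:
  assumes L: "bfunctional L q k C" and f: "f \<in> U" and V: "open V" "I k \<subseteq> V" "\<And>x. x \<in> V \<Longrightarrow> f x = 0"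
  shows "L f = 0"
proof -
  have "bdd_seminorm q (I k) 0 f" unfolding bdd_seminorm_def
    using nderiv_zero[OF V(1), of f] V(2,3) by (auto simp: subset_iff)
  hence "norm (L f) \<le> C * 0" by (rule bfunctional_linear(5)[OF L f order_refl])
  thus ?thesis by simp
qed

end


section \<open>A Hahn--Banach theorem\<close>


locale complex_vector_space = vector_space scale
  for scale :: "complex \<Rightarrow> 'a::ab_group_add \<Rightarrow> 'a" (infixr \<open>*C\<close> 75) +
  fixes V :: "'a set"
  assumes V: "subspace V"
begin

text \<open>The value 0 is prescribed off \<open>V\<close> so that functions that matter only on
  \<open>V\<close> can be ordered pointwise as total functions, with antisymmetry.\<close>

definition sublinear :: "('a \<Rightarrow> real) \<Rightarrow> bool" where
  "sublinear r \<longleftrightarrow> (\<forall>x. x \<notin> V \<longrightarrow> r x = 0) \<and> (\<forall>x\<in>V. \<forall>y\<in>V. r (x + y) \<le> r x + r y) \<and>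
     (\<forall>x\<in>V. \<forall>t>0. r (of_real t *C x) = t * r x)"

lemma V_closed: "x \<in> V \<Longrightarrow> y \<in> V \<Longrightarrow> x + y \<in> V" "x \<in> V \<Longrightarrow> u *C x \<in> V" "0 \<in> V" "x \<in> V \<Longrightarrow> - x \<in> V"
  "x \<in> V \<Longrightarrow> y \<in> V \<Longrightarrow> x - y \<in> V"
  by (fact subspace_add[OF V] subspace_scale[OF V] subspace_0[OF V] subspace_neg[OF V] subspace_diff[OF V])+

lemma sublinearD:
  assumes "sublinear r"
  shows "x \<notin> V \<Longrightarrow> r x = 0" "x \<in> V \<Longrightarrow> y \<in> V \<Longrightarrow> r (x + y) \<le> r x + r y"
    "x \<in> V \<Longrightarrow> t > 0 \<Longrightarrow> r (of_real t *C x) = t * r x" "r 0 = 0" "x \<in> V \<Longrightarrow> - r (- x) \<le> r x"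
    "x \<in> V \<Longrightarrow> t \<ge> 0 \<Longrightarrow> r (of_real t *C x) = t * r x"
proof -
  show 1: "x \<notin> V \<Longrightarrow> r x = 0" "x \<in> V \<Longrightarrow> y \<in> V \<Longrightarrow> r (x + y) \<le> r x + r y"
    "x \<in> V \<Longrightarrow> t > 0 \<Longrightarrow> r (of_real t *C x) = t * r x" for x y t using assms by (auto simp: sublinear_def)
  have "r (of_real 2 *C 0) = 2 * r 0" by (rule 1(3)) (auto simp: V_closed)
  thus 0: "r 0 = 0" by simp
  show "- r (- x) \<le> r x" if "x \<in> V" using 1(2)[OF that V_closed(4)[OF that]] 0 by simp
  show "x \<in> V \<Longrightarrow> t \<ge> 0 \<Longrightarrow> r (of_real t *C x) = t * r x" using 1(3)[of x t] 0 by (cases "t = 0") auto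
qed

text \<open>A device that lowers a sublinear function in the direction \<open>- b\<close>: it lies
  below \<open>r\<close>, and at \<open>- b\<close> it is at most \<open>- r b\<close> (take
  \<open>t = 1\<close>). With it, linear functionals appear as minimal sublinear functions, and no
  functional has to be extended one dimension at a time.\<close>

definition shrink :: "('a \<Rightarrow> real) \<Rightarrow> 'a \<Rightarrow> 'a \<Rightarrow> real" where
  "shrink r b x = (if x \<in> V then INF t\<in>{0..}. r (x + of_real t *C b) - t * r b else 0)"

lemma shrink_bdd:
  assumes r: "sublinear r" and b: "b \<in> V" and x: "x \<in> V" and t: "t \<ge> 0"
  shows "- r (- x) \<le> r (x + of_real t *C b) - t * r b"
proof -
  have "t * r b = r (of_real t *C b)" using sublinearD(6)[OF r b t] by simp
  also have "of_real t *C b = (x + of_real t *C b) + - x" by simp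
  also have "r \<dots> \<le> r (x + of_real t *C b) + r (- x)"
    by (rule sublinearD(2)[OF r V_closed(1)[OF x V_closed(2)[OF b]] V_closed(4)[OF x]])
  finally show ?thesis by simp
qed

lemma shrink_le:
  assumes r: "sublinear r" and b: "b \<in> V" and x: "x \<in> V" and t: "t \<ge> 0"
  shows "shrink r b x \<le> r (x + of_real t *C b) - t * r b"
proof -
  have "(INF t\<in>{0..}. r (x + of_real t *C b) - t * r b) \<le> r (x + of_real t *C b) - t * r b"
    by (rule cINF_lower) (use t shrink_bdd[OF r b x] in \<open>auto intro!: bdd_belowI2\<close>)
  thus ?thesis using x by (simp add: shrink_def)
qed

lemma shrink_greatest:
  assumes x: "x \<in> V" and "\<And>t. t \<ge> 0 \<Longrightarrow> B \<le> r (x + of_real t *C b) - t * r b"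
  shows "B \<le> shrink r b x"
proof -
  have "B \<le> (INF t\<in>{0..}. r (x + of_real t *C b) - t * r b)"
    by (rule cINF_greatest) (use assms in auto)
  thus ?thesis using x by (simp add: shrink_def)
qed

lemma shrink_sublinear:
  assumes r: "sublinear r" and b: "b \<in> V"
  shows "sublinear (shrink r b)"
proof -
  have add: "shrink r b (x + y) \<le> shrink r b x + shrink r b y" if x: "x \<in> V" and y: "y \<in> V" for x y
  proof -
    have *: "shrink r b (x + y) \<le> (r (x + of_real s *C b) - s * r b) + (r (y + of_real t *C b) - t * r b)"
      if st: "s \<ge> 0" "t \<ge> 0" for s t
    proof -
      have "s + t \<ge> 0" using st by linarith
      note shrink_le[OF r b V_closed(1)[OF x y] this]
      also have "(x + y) + of_real (s + t) *C b = (x + of_real s *C b) + (y + of_real t *C b)"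
        by (simp only: of_real_add scale_left_distrib add_ac)
      also have "r \<dots> \<le> r (x + of_real s *C b) + r (y + of_real t *C b)"
        by (rule sublinearD(2)[OF r V_closed(1)[OF x V_closed(2)[OF b]] V_closed(1)[OF y V_closed(2)[OF b]]])
      finally show ?thesis by (simp add: distrib_right)
    qed
    have "shrink r b (x + y) - shrink r b y \<le> shrink r b x"
    proof (rule shrink_greatest[OF x])
      fix s :: real assume s: "s \<ge> 0"
      have "shrink r b (x + y) - (r (x + of_real s *C b) - s * r b) \<le> shrink r b y"
      proof (rule shrink_greatest[OF y])
        fix t :: real assume "t \<ge> 0"
        from *[OF s this]
        show "shrink r b (x + y) - (r (x + of_real s *C b) - s * r b) \<le> r (y + of_real t *C b) - t * r b"
          by linarith
      qed
      thus "shrink r b (x + y) - shrink r b y \<le> r (x + of_real s *C b) - s * r b" by linarith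
    qed
    thus ?thesis by linarith
  qed
  have hom1: "shrink r b (of_real u *C x) \<le> u * shrink r b x" if x: "x \<in> V" and u: "u > 0" for x u
  proof -
    have "shrink r b (of_real u *C x) / u \<le> shrink r b x"
    proof (rule shrink_greatest[OF x])
      fix t :: real assume t: "t \<ge> 0"
      have "u * t \<ge> 0" using t u by simp
      note shrink_le[OF r b V_closed(2)[OF x] this]
      also have "of_real u *C x + of_real (u * t) *C b = of_real u *C (x + of_real t *C b)"
        by (simp only: of_real_mult scale_right_distrib scale_scale)
      also have "r \<dots> = u * r (x + of_real t *C b)"
        by (rule sublinearD(3)[OF r V_closed(1)[OF x V_closed(2)[OF b]] u])
      also have "u * \<alpha> - u * t * \<beta> = (\<alpha> - t * \<beta>) * u" for \<alpha> \<beta> :: real by (simp add: algebra_simps)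
      finally have "shrink r b (of_real u *C x) \<le> (r (x + of_real t *C b) - t * r b) * u" .
      thus "shrink r b (of_real u *C x) / u \<le> r (x + of_real t *C b) - t * r b"
        using u by (simp add: pos_divide_le_eq)
    qed
    thus ?thesis using u by (simp add: pos_divide_le_eq mult.commute)
  qed
  have hom: "shrink r b (of_real u *C x) = u * shrink r b x" if x: "x \<in> V" and u: "u > 0" for x u
  proof (rule antisym[OF hom1[OF x u]])
    have "shrink r b (of_real (1/u) *C (of_real u *C x)) \<le> 1/u * shrink r b (of_real u *C x)"
      by (rule hom1[OF V_closed(2)[OF x]]) (use u in simp)
    moreover have "of_real (1/u) *C (of_real u *C x) = x" using u by simp
    ultimately have "shrink r b x \<le> shrink r b (of_real u *C x) / u" by simp
    thus "u * shrink r b x \<le> shrink r b (of_real u *C x)" using u by (simp add: pos_le_divide_eq mult.commute)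
  qed
  show ?thesis unfolding sublinear_def using add hom by (simp add: shrink_def)
qed

text \<open>Minimality forces \<open>shrink m y = m\<close>; the choice \<open>t = 1\<close> then
  reads \<open>m x \<le> m (x + y) - m y\<close>.\<close>

lemma minimal_sublinear_additive:
  assumes m: "sublinear m" and min: "\<And>r. sublinear r \<Longrightarrow> (\<And>x. r x \<le> m x) \<Longrightarrow> r = m"
    and x: "x \<in> V" and y: "y \<in> V"
  shows "m (x + y) = m x + m y"
proof -
  have "shrink m y z \<le> m z" for z
  proof (cases "z \<in> V")
    case True
    thus ?thesis using shrink_le[OF m y True, of 0] by simp
  qed (use m in \<open>simp add: shrink_def sublinear_def\<close>)
  hence "shrink m y = m" by (intro min shrink_sublinear m y)
  hence "m x \<le> m (x + of_real 1 *C y) - 1 * m y" using shrink_le[OF m y x, of 1] by simp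
  thus ?thesis using sublinearD(2)[OF m x y] by simp
qed

text \<open>The common upper bound \<open>p\<close> keeps the infimum finite, since
  \<open>- p (- x) \<le> - r (- x) \<le> r x\<close>. Subadditivity uses that of two members of the
  chain one lies below the other.\<close>

lemma chain_inf_sublinear:
  assumes C: "C \<noteq> {}" "\<And>r. r \<in> C \<Longrightarrow> sublinear r"
    and lin: "\<And>r s. r \<in> C \<Longrightarrow> s \<in> C \<Longrightarrow> (\<forall>x. r x \<le> s x) \<or> (\<forall>x. s x \<le> r x)"
    and top: "\<And>r x. r \<in> C \<Longrightarrow> r x \<le> p x"
  shows "sublinear (\<lambda>x. INF r\<in>C. r x)" "\<And>r x. r \<in> C \<Longrightarrow> (INF r\<in>C. r x) \<le> r x"
proof -
  have bdd: "bdd_below ((\<lambda>r. r x) ` C)" for x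
  proof (cases "x \<in> V")
    case True
    have "- p (- x) \<le> r x" if "r \<in> C" for r using sublinearD(5)[OF C(2)[OF that] True] top[OF that, of "- x"] by simp
    thus ?thesis by (intro bdd_belowI2)
  next
    case False
    have "0 \<le> r x" if "r \<in> C" for r using sublinearD(1)[OF C(2)[OF that] False] by simp
    thus ?thesis by (intro bdd_belowI2)
  qed
  show low: "(INF r\<in>C. r x) \<le> r x" if "r \<in> C" for r x by (rule cINF_lower[OF bdd that])
  let ?u = "\<lambda>x. INF r\<in>C. r x"
  show "sublinear ?u" unfolding sublinear_def
  proof (intro conjI allI impI ballI)
    fix x assume "x \<notin> V"
    hence "?u x = (INF r\<in>C. 0)" using sublinearD(1)[OF C(2)] by (intro INF_cong) auto
    thus "?u x = 0" using C(1) by simp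
  next
    fix x y assume x: "x \<in> V" and y: "y \<in> V"
    have *: "?u (x + y) \<le> r x + s y" if rs: "r \<in> C" "s \<in> C" for r s
    proof -
      obtain v where v: "v \<in> C" "\<And>x. v x \<le> r x" "\<And>x. v x \<le> s x" 
        using lin[OF rs] rs by blast
      have "?u (x + y) \<le> v (x + y)" by (rule low[OF v(1)])
      also have "\<dots> \<le> v x + v y" by (rule sublinearD(2)[OF C(2)[OF v(1)] x y])
      also have "\<dots> \<le> r x + s y" using v by (intro add_mono)
      finally show ?thesis .
    qed
    have "?u (x + y) - ?u y \<le> ?u x"
    proof (rule cINF_greatest[OF C(1)])
      fix r assume r: "r \<in> C"
      have "?u (x + y) - r x \<le> ?u y"
      proof (rule cINF_greatest[OF C(1)])
        fix s assume "s \<in> C"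
        from *[OF r this] show "?u (x + y) - r x \<le> s y" by simp
      qed
      thus "?u (x + y) - ?u y \<le> r x" by simp
    qed
    thus "?u (x + y) \<le> ?u x + ?u y" by simp
  next
    fix x and t :: real assume x: "x \<in> V" and t: "t > 0"
    have "?u (of_real t *C x) / t \<le> ?u x"
    proof (rule cINF_greatest[OF C(1)])
      fix r assume r: "r \<in> C"
      have "?u (of_real t *C x) \<le> r (of_real t *C x)" by (rule low[OF r])
      thus "?u (of_real t *C x) / t \<le> r x" using sublinearD(3)[OF C(2)[OF r] x t] t by (simp add: pos_divide_le_eq mult.commute)
    qed
    moreover have "t * ?u x \<le> ?u (of_real t *C x)"
    proof (rule cINF_greatest[OF C(1)])
      fix r assume r: "r \<in> C"
      show "t * ?u x \<le> r (of_real t *C x)" using sublinearD(3)[OF C(2)[OF r] x t] t low[OF r, of x] by simp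
    qed
    ultimately show "?u (of_real t *C x) = t * ?u x" using t by (simp add: pos_divide_le_eq mult.commute)
  qed
qed

lemma linear_below_sublinear:
  assumes p: "sublinear p"
  obtains l where "sublinear l" "\<And>x. l x \<le> p x" "\<And>x y. x \<in> V \<Longrightarrow> y \<in> V \<Longrightarrow> l (x + y) = l x + l y"
proof -
  define A where "A = {r. sublinear r \<and> (\<forall>x. r x \<le> p x)}"
  \<comment> \<open>The order is reversed because Zorn's lemma yields maximal elements.\<close>
  define P where "P r s \<longleftrightarrow> (\<forall>x. s x \<le> r x)" for r s :: "'a \<Rightarrow> real"
  have "\<exists>m\<in>A. \<forall>r\<in>A. P m r \<longrightarrow> r = m"
  proof (rule predicate_Zorn)
    show "partial_order_on A (relation_of P A)"
      by (rule partial_order_on_relation_ofI) (auto simp: P_def fun_eq_iff intro: order_trans antisym)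
    fix C assume "C \<in> Chains (relation_of P A)"
    hence C: "C \<subseteq> A" "\<And>r s. r \<in> C \<Longrightarrow> s \<in> C \<Longrightarrow> P r s \<or> P s r"
      by (auto simp: Chains_def relation_of_def)
    show "\<exists>u\<in>A. \<forall>r\<in>C. P r u"
    proof (cases "C = {}")
      case True
      thus ?thesis using p by (auto simp: A_def)
    next
      case False
      have 1: "sublinear r" "r x \<le> p x" if "r \<in> C" for r x using C(1) that by (auto simp: A_def)
      have 2: "(\<forall>x. r x \<le> s x) \<or> (\<forall>x. s x \<le> r x)" if "r \<in> C" "s \<in> C" for r s
        using C(2)[OF that] by (auto simp: P_def)
      have inf: "sublinear (\<lambda>x. INF r\<in>C. r x)" "\<And>r x. r \<in> C \<Longrightarrow> (INF r\<in>C. r x) \<le> r x"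
        by (rule chain_inf_sublinear[where C = C and p = p]; (rule False 1(1) 2 1(2); assumption)?)+
      obtain r0 where "r0 \<in> C" using False by blast
      hence "(INF r\<in>C. r x) \<le> p x" for x using inf(2) 1(2) by (meson order_trans)
      hence "(\<lambda>x. INF r\<in>C. r x) \<in> A" using inf(1) by (simp add: A_def)
      moreover have "P r (\<lambda>x. INF r\<in>C. r x)" if "r \<in> C" for r using inf(2)[OF that] by (simp add: P_def)
      ultimately show ?thesis by blast
    qed
  qed
  then obtain m where m: "sublinear m" "\<And>x. m x \<le> p x" "\<And>r. r \<in> A \<Longrightarrow> P m r \<Longrightarrow> r = m" by (auto simp: A_def)
  have min: "r = m" if "sublinear r" "\<And>x. r x \<le> m x" for r
  proof (rule m(3))
    show "r \<in> A" using that m(2) by (auto simp: A_def intro: order_trans)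
  qed (use that in \<open>simp add: P_def\<close>)
  show ?thesis
  proof (rule that[OF m(1,2)])
    show "m (x + y) = m x + m y" if "x \<in> V" "y \<in> V" for x y
      by (rule minimal_sublinear_additive[OF m(1) min that])
  qed
qed

text \<open>\<open>d\<close> is the distance to \<open>M\<close> measured by \<open>p\<close>. A
  linear function below \<open>shrink d f\<close>, and not merely below \<open>d\<close>, satisfies
  \<open>l (- f) \<le> - d f\<close>, hence \<open>l f \<ge> e\<close>; it vanishes on
  \<open>M\<close> because \<open>d\<close> does. The complex functional is recovered from its real
  part as \<open>l x - i l (i x)\<close>.\<close>

theorem Hahn_Banach_separation:
  assumes p: "\<And>x. x \<in> V \<Longrightarrow> p x \<ge> (0::real)" "\<And>x y. x \<in> V \<Longrightarrow> y \<in> V \<Longrightarrow> p (x + y) \<le> p x + p y"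
    "\<And>x u. x \<in> V \<Longrightarrow> p (u *C x) = norm u * p x"
    and M: "subspace M" "M \<subseteq> V" and f: "f \<in> V" and e: "e > 0" "\<And>m. m \<in> M \<Longrightarrow> p (m - f) \<ge> e"
  obtains T :: "'a \<Rightarrow> complex" where "\<And>x y. x \<in> V \<Longrightarrow> y \<in> V \<Longrightarrow> T (x + y) = T x + T y"
    "\<And>x u. x \<in> V \<Longrightarrow> T (u *C x) = u * T x" "\<And>x. x \<in> V \<Longrightarrow> norm (T x) \<le> p x"
    "\<And>x. x \<in> M \<Longrightarrow> T x = 0" "T f \<noteq> 0"
proof -
  have M_closed: "x \<in> M \<Longrightarrow> y \<in> M \<Longrightarrow> x + y \<in> M" "x \<in> M \<Longrightarrow> u *C x \<in> M" "0 \<in> M" "x \<in> M \<Longrightarrow> - x \<in> M" for x y u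
    by (fact subspace_add[OF M(1)] subspace_scale[OF M(1)] subspace_0[OF M(1)] subspace_neg[OF M(1)])+
  define d where "d x = (if x \<in> V then INF m\<in>M. p (x + m) else 0)" for x
  have inV: "x + m \<in> V" if "x \<in> V" "m \<in> M" for x m using that M(2) V_closed by blast
  have d_le: "d x \<le> p (x + m)" if "x \<in> V" "m \<in> M" for x m
  proof -
    have "(INF m\<in>M. p (x + m)) \<le> p (x + m)"
      by (rule cINF_lower) (use that inV p(1) in \<open>auto intro!: bdd_belowI2[of _ 0]\<close>)
    thus ?thesis using that by (simp add: d_def)
  qed
  have d_ge: "B \<le> d x" if "x \<in> V" "\<And>m. m \<in> M \<Longrightarrow> B \<le> p (x + m)" for x B
  proof -
    have "B \<le> (INF m\<in>M. p (x + m))" by (rule cINF_greatest) (use that M_closed in auto)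
    thus ?thesis using that by (simp add: d_def)
  qed
  have d: "sublinear d" unfolding sublinear_def
  proof (intro conjI allI impI ballI)
    show "d x = 0" if "x \<notin> V" for x using that by (simp add: d_def)
    show "d (x + y) \<le> d x + d y" if x: "x \<in> V" and y: "y \<in> V" for x y
    proof -
      have *: "d (x + y) \<le> p (x + m) + p (y + n)" if "m \<in> M" "n \<in> M" for m n
      proof -
        have "d (x + y) \<le> p ((x + y) + (m + n))" by (rule d_le[OF V_closed(1)[OF x y] M_closed(1)[OF that]])
        also have "(x + y) + (m + n) = (x + m) + (y + n)" by (simp add: algebra_simps)
        also have "p \<dots> \<le> p (x + m) + p (y + n)" by (rule p(2)[OF inV[OF x that(1)] inV[OF y that(2)]])
        finally show ?thesis .
      qed
      have "d (x + y) - d y \<le> d x"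
      proof (rule d_ge[OF x])
        fix m assume m: "m \<in> M"
        have "d (x + y) - p (x + m) \<le> d y"
        proof (rule d_ge[OF y])
          fix n assume "n \<in> M"
          from *[OF m this] show "d (x + y) - p (x + m) \<le> p (y + n)" by simp
        qed
        thus "d (x + y) - d y \<le> p (x + m)" by simp
      qed
      thus ?thesis by simp
    qed
    have le: "d (of_real t *C x) \<le> t * d x" if x: "x \<in> V" and t: "t > 0" for x t
    proof -
      have "d (of_real t *C x) / t \<le> d x"
      proof (rule d_ge[OF x])
        fix m assume m: "m \<in> M"
        have "d (of_real t *C x) \<le> p (of_real t *C x + of_real t *C m)" by (rule d_le[OF V_closed(2)[OF x] M_closed(2)[OF m]])
        also have "of_real t *C x + of_real t *C m = of_real t *C (x + m)" by (simp add: scale_right_distrib)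
        also have "p \<dots> = t * p (x + m)" using p(3)[OF inV[OF x m], of "of_real t"] t by simp
        finally show "d (of_real t *C x) / t \<le> p (x + m)" using t by (simp add: pos_divide_le_eq mult.commute)
      qed
      thus ?thesis using t by (simp add: pos_divide_le_eq mult.commute)
    qed
    show "d (of_real t *C x) = t * d x" if x: "x \<in> V" and t: "t > 0" for x t
    proof (rule antisym[OF le[OF x t]])
      have "d (of_real (1/t) *C (of_real t *C x)) \<le> 1/t * d (of_real t *C x)"
        by (rule le[OF V_closed(2)[OF x]]) (use t in simp)
      moreover have "of_real (1/t) *C (of_real t *C x) = x" using t by simp
      ultimately have "d x \<le> d (of_real t *C x) / t" by simp
      thus "t * d x \<le> d (of_real t *C x)" using t by (simp add: pos_le_divide_eq mult.commute)
    qed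
  qed
  obtain l where l: "sublinear l" "\<And>x. l x \<le> shrink d f x" "\<And>x y. x \<in> V \<Longrightarrow> y \<in> V \<Longrightarrow> l (x + y) = l x + l y"
    by (rule linear_below_sublinear[OF shrink_sublinear[OF d f]]) blast
  have ld: "l x \<le> d x" if "x \<in> V" for x
    using l(2)[of x] shrink_le[OF d f that, of 0] by simp
  have lp: "l x \<le> p x" if "x \<in> V" for x using ld[OF that] d_le[OF that M_closed(3)] by simp
  have lneg: "l (- x) = - l x" if "x \<in> V" for x
    using l(3)[OF that V_closed(4)[OF that]] sublinearD(4)[OF l(1)] by simp
  have lsc: "l (of_real t *C x) = t * l x" if "x \<in> V" for x t
  proof (cases "t \<ge> 0")
    case True
    thus ?thesis using sublinearD(6)[OF l(1) that] by simp
  next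
    case False
    have "of_real t *C x = - (of_real (- t) *C x)" by simp
    hence "l (of_real t *C x) = - l (of_real (- t) *C x)" using lneg[OF V_closed(2)[OF that]] by metis
    also have "l (of_real (- t) *C x) = - t * l x" by (rule sublinearD(6)[OF l(1) that]) (use False in simp)
    finally show ?thesis by simp
  qed
  have lM: "l m = 0" if m: "m \<in> M" for m
  proof -
    have mV: "m \<in> V" using m M(2) by blast
    have p0: "p 0 = 0" using p(3)[of 0 0] V_closed(3) by simp
    have "l m \<le> p (m + - m)" using ld[OF mV] d_le[OF mV M_closed(4)[OF m]] by simp
    moreover have "l (- m) \<le> p (- m + m)" using ld[OF V_closed(4)[OF mV]] d_le[OF V_closed(4)[OF mV] m] by simp
    ultimately show ?thesis using lneg[OF mV] p0 by simp
  qed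
  have "e \<le> d f"
  proof (rule d_ge[OF f])
    fix m assume m: "m \<in> M"
    have "p (f + m) = p (- 1 *C (- m - f))" by (simp add: add.commute)
    also have "\<dots> = p (- m - f)" using p(3)[of "- m - f" "- 1"] V_closed(5)[OF V_closed(4)] M(2) m f by auto
    finally show "e \<le> p (f + m)" using e(2)[OF M_closed(4)[OF m]] by simp
  qed
  have "l (- f) \<le> - d f"
  proof -
    have "l (- f) \<le> d (- f + of_real 1 *C f) - 1 * d f"
      using l(2)[of "- f"] shrink_le[OF d f V_closed(4)[OF f], of 1] by simp
    thus ?thesis using sublinearD(4)[OF d] by simp
  qed
  hence lf: "l f > 0" using lneg[OF f] \<open>e \<le> d f\<close> e(1) by simp
  define T where "T x = complex_of_real (l x) - \<i> * complex_of_real (l (\<i> *C x))" for x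
  have Tadd: "T (x + y) = T x + T y" if "x \<in> V" "y \<in> V" for x y
    using l(3)[OF that] l(3)[OF V_closed(2)[OF that(1), of \<i>] V_closed(2)[OF that(2), of \<i>]]
    by (simp add: T_def scale_right_distrib algebra_simps)
  have Tre: "T (of_real t *C x) = of_real t * T x" if "x \<in> V" for x t
    using lsc[OF that, of t] lsc[OF V_closed(2)[OF that, of \<i>], of t]
    by (simp add: T_def algebra_simps)
  have Ti: "T (\<i> *C x) = \<i> * T x" if "x \<in> V" for x
    using lneg[OF that] by (simp add: T_def algebra_simps)
  have Tsc: "T (u *C x) = u * T x" if x: "x \<in> V" for x u
  proof -
    have "u *C x = (of_real (Re u) + \<i> * of_real (Im u)) *C x" using complex_eq[of u] by simp
    also have "\<dots> = of_real (Re u) *C x + \<i> *C (of_real (Im u) *C x)" by (simp add: scale_left_distrib)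
    also have "T \<dots> = of_real (Re u) * T x + \<i> * (of_real (Im u) * T x)"
      using Tadd[OF V_closed(2)[OF x] V_closed(2)[OF V_closed(2)[OF x]]] Tre[OF x] Ti[OF V_closed(2)[OF x]] by simp
    also have "\<dots> = (of_real (Re u) + \<i> * of_real (Im u)) * T x" by (simp add: algebra_simps)
    finally show ?thesis using complex_eq[of u] by simp
  qed
  show ?thesis
  proof (rule that[OF Tadd Tsc])
    fix x assume x: "x \<in> V"
    show "norm (T x) \<le> p x"
    proof (cases "T x = 0")
      case False
      define u where "u = of_real (norm (T x)) / T x"
      have nu: "norm u = 1" using False by (simp add: u_def norm_divide)
      have "T (u *C x) = of_real (norm (T x))" using Tsc[OF x] False by (simp add: u_def)
      hence "norm (T x) = Re (T (u *C x))" by simp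
      also have "\<dots> = l (u *C x)" by (simp add: T_def)
      also have "\<dots> \<le> p (u *C x)" by (rule lp[OF V_closed(2)[OF x]])
      also have "\<dots> = p x" using p(3)[OF x] nu by simp
      finally show ?thesis .
    qed (use p(1)[OF x] in simp)
  next
    show "T x = 0" if "x \<in> M" for x using lM[OF that] lM[OF M_closed(2)[OF that]] by (simp add: T_def)
    have "Re (T f) > 0" using lf by (simp add: T_def)
    thus "T f \<noteq> 0" by auto
  qed
qed

end


section \<open>Differentiation under a functional\<close>

lemma has_derivative_quadratic:
  fixes g :: "'a::real_normed_vector \<Rightarrow> 'b::real_normed_vector"
  assumes D: "bounded_linear D" and K: "\<And>h. norm h \<le> 1 \<Longrightarrow> norm (g (x + h) - g x - D h) \<le> K * (norm h)\<^sup>2"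
  shows "(g has_derivative D) (at x)"
  unfolding has_derivative_at
proof (intro conjI D)
  show "(\<lambda>h. norm (g (x + h) - g x - D h) / norm h) \<midarrow>0\<rightarrow> 0"
  proof (rule tendsto_sandwich)
    show "\<forall>\<^sub>F h in at 0. 0 \<le> norm (g (x + h) - g x - D h) / norm h" by simp
    have "\<forall>\<^sub>F h in at (0::'a). norm h < 1"
      unfolding eventually_at by (intro exI[of _ 1]) auto
    thus "\<forall>\<^sub>F h in at 0. norm (g (x + h) - g x - D h) / norm h \<le> K * norm h"
    proof eventually_elim
      case (elim h)
      thus ?case using K[of h] by (cases "h = 0") (auto simp: divide_le_eq power2_eq_square mult.assoc)
    qed
    show "((\<lambda>h. 0) \<longlongrightarrow> (0::real)) (at (0::'a))" by simp
    have "((\<lambda>h::'a. K * norm h) \<longlongrightarrow> K * norm (0::'a)) (at 0)" by (intro tendsto_intros)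
    thus "((\<lambda>h::'a. K * norm h) \<longlongrightarrow> 0) (at 0)" by simp
  qed
qed

lemma second_order_bound:
  fixes f :: "real \<Rightarrow> complex"
  assumes f1: "\<And>x. (f has_vector_derivative f1 x) (at x)" and f2: "\<And>x. (f1 has_vector_derivative f2 x) (at x)"
    and B: "\<And>t. \<bar>t - x\<bar> \<le> \<bar>h\<bar> \<Longrightarrow> norm (f2 t) \<le> B"
  shows "norm (f (x + h) - f x - of_real h * f1 x) \<le> B * h\<^sup>2"
proof -
  let ?S = "{x - \<bar>h\<bar>..x + \<bar>h\<bar>}"
  have d1: "norm (f1 t - f1 x) \<le> B * \<bar>h\<bar>" if t: "t \<in> ?S" for t
  proof -
    have "norm (f1 t - f1 x) \<le> B * norm (t - x)"
    proof (rule differentiable_bound[of ?S f1 "\<lambda>t u. u *\<^sub>R f2 t"])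
      show "(f1 has_derivative (\<lambda>u. u *\<^sub>R f2 s)) (at s within ?S)" if "s \<in> ?S" for s
        using f2[of s] unfolding has_vector_derivative_def by (rule has_derivative_at_withinI)
      show "onorm (\<lambda>u. u *\<^sub>R f2 s) \<le> B" if "s \<in> ?S" for s
      proof (rule onorm_le)
        fix u :: real
        have "norm (f2 s) \<le> B" by (rule B) (use that in auto)
        hence "\<bar>u\<bar> * norm (f2 s) \<le> \<bar>u\<bar> * B" by (intro mult_left_mono) auto
        thus "norm (u *\<^sub>R f2 s) \<le> B * norm u" by (simp only: norm_scaleR real_norm_def mult.commute)
      qed
    qed (use t in auto)
    also have "\<dots> \<le> B * \<bar>h\<bar>"
    proof (rule mult_left_mono)
      have "norm (f2 x) \<le> B" by (rule B) simp
      thus "0 \<le> B" by (rule order_trans[OF norm_ge_zero])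
    qed (use t in auto)
    finally show ?thesis .
  qed
  have "norm (f (x + h) - f x - (x + h - x) *\<^sub>R f1 x) \<le> norm (x + h - x) * (B * \<bar>h\<bar>)"
  proof (rule vector_differentiable_bound_linearization[of ?S])
    show "(f has_vector_derivative f1 s) (at s within ?S)" if "s \<in> ?S" for s
      using f1[of s] by (rule has_vector_derivative_at_within)
    show "closed_segment x (x + h) \<subseteq> ?S" by (auto simp: closed_segment_eq_real_ivl)
  qed (use d1 in auto)
  moreover have "norm (x + h - x) * (B * \<bar>h\<bar>) = B * h\<^sup>2"
    by (simp add: power2_eq_square mult.left_commute[of "\<bar>h\<bar>" B])
  ultimately show ?thesis unfolding scaleR_conv_of_real by (metis add_diff_cancel_left')
qed

lemma nderiv_exp_minus_affine:
  "nderiv j (\<lambda>t. exp (\<mu> * of_real t) - (1 + \<mu> * of_real t)) x =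
     \<mu> ^ j * exp (\<mu> * of_real x) - (if j = 0 then 1 + \<mu> * of_real x else if j = 1 then \<mu> else 0)" (is ?A)
  "smooth_on_set UNIV (\<lambda>t. exp (\<mu> * of_real t) - (1 + \<mu> * of_real t))" (is ?B)
proof -
  define G where "G j x = \<mu> ^ j * exp (\<mu> * of_real x) - (if j = 0 then 1 + \<mu> * of_real x else if j = 1 then \<mu> else 0)"
    for j and x :: real
  have "dfam UNIV G" unfolding dfam_def
  proof (intro allI ballI)
    fix j and x :: real
    have 1: "((\<lambda>x. exp (\<mu> * of_real x)) has_vector_derivative \<mu> * exp (\<mu> * of_real x)) (at x)"
    proof -
      have "((\<lambda>z. exp (\<mu> * z)) has_field_derivative \<mu> * exp (\<mu> * of_real x)) (at (of_real x))"
        by (auto intro!: derivative_eq_intros)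
      from has_vector_derivative_real_field[OF this] show ?thesis by simp
    qed
    have 2: "((\<lambda>x. \<mu> * of_real x) has_vector_derivative \<mu>) (at x)"
    proof -
      have "((\<lambda>z. \<mu> * z) has_field_derivative \<mu>) (at (of_real x))" by (auto intro!: derivative_eq_intros)
      from has_vector_derivative_real_field[OF this] show ?thesis by simp
    qed
    have 3: "((\<lambda>x. \<mu> ^ j * exp (\<mu> * of_real x)) has_vector_derivative \<mu> ^ j * (\<mu> * exp (\<mu> * of_real x))) (at x)"
      by (rule has_vector_derivative_mult_right[OF 1])
    consider "j = 0" | "j = 1" | "j > 1" by linarith
    thus "(G j has_vector_derivative G (Suc j) x) (at x)"
    proof cases
      case 1
      have "((\<lambda>x. exp (\<mu> * of_real x) - (1 + \<mu> * of_real x)) has_vector_derivative \<mu> * exp (\<mu> * of_real x) - (0 + \<mu>)) (at x)"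
        by (intro has_vector_derivative_diff has_vector_derivative_add has_vector_derivative_const \<open>((\<lambda>x. exp (\<mu> * of_real x)) has_vector_derivative \<mu> * exp (\<mu> * of_real x)) (at x)\<close> 2)
      thus ?thesis using 1 by (simp add: G_def[abs_def])
    next
      case 2
      have "((\<lambda>x. \<mu> ^ j * exp (\<mu> * of_real x) - \<mu>) has_vector_derivative \<mu> ^ j * (\<mu> * exp (\<mu> * of_real x)) - 0) (at x)"
        by (intro has_vector_derivative_diff 3 has_vector_derivative_const)
      thus ?thesis using 2 by (simp add: G_def[abs_def] mult_ac)
    next
      case 3
      thus ?thesis using \<open>((\<lambda>x. \<mu> ^ j * exp (\<mu> * of_real x)) has_vector_derivative \<mu> ^ j * (\<mu> * exp (\<mu> * of_real x))) (at x)\<close>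
        by (simp add: G_def[abs_def] mult_ac)
    qed
  qed
  thus ?A ?B using nderiv_dfam(1)[OF open_UNIV, of G "\<lambda>t. exp (\<mu> * of_real t) - (1 + \<mu> * of_real t)" x j]
      smooth_dfam[OF open_UNIV, of G] by (auto simp: G_def)
qed

text \<open>The bound is uniform in the order \<open>j\<close>: for \<open>j = 0, 1\<close> it is
  Taylor's formula, and for \<open>j \<ge> 2\<close> the affine part is gone and
  \<open>|\<mu>|^j \<le> |\<mu>|^2\<close>. So the remainder is small in the seminorms and not only
  pointwise.\<close>

lemma exp_minus_affine_bound:
  fixes \<mu> :: complex
  assumes \<mu>: "norm \<mu> \<le> 1" and x: "\<bar>x\<bar> \<le> R" "R \<ge> 1"
  shows "norm (nderiv j (\<lambda>t. exp (\<mu> * of_real t) - (1 + \<mu> * of_real t)) x) \<le> R\<^sup>2 * exp R * (norm \<mu>)\<^sup>2"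
proof -
  have nx: "norm (\<mu> * of_real x) \<le> norm \<mu> * R" by (simp add: norm_mult mult_left_mono x)
  have "norm \<mu> * R \<le> 1 * R" using \<mu> x by (intro mult_right_mono) auto
  hence "\<bar>Re (\<mu> * of_real x)\<bar> \<le> R" using nx abs_Re_le_cmod order_trans by (metis mult_1)
  hence e: "exp \<bar>Re (\<mu> * of_real x)\<bar> \<le> exp R" by simp
  consider "j = 0" | "j = 1" | "j > 1" by linarith
  thus ?thesis
  proof cases
    case 1
    have "norm (exp (\<mu> * of_real x) - (\<Sum>k\<le>1. (\<mu> * of_real x) ^ k / fact k))
        \<le> exp \<bar>Re (\<mu> * of_real x)\<bar> * norm (\<mu> * of_real x) ^ Suc 1 / fact 1" by (rule Taylor_exp)
    also have "\<dots> \<le> exp R * (norm \<mu> * R) ^ 2"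
      using e nx by (simp add: power2_eq_square del: norm_mult) (intro mult_mono; simp)
    finally show ?thesis using 1 by (simp add: nderiv_exp_minus_affine power_mult_distrib mult_ac)
  next
    case 2
    have "norm (exp (\<mu> * of_real x) - (\<Sum>k\<le>0. (\<mu> * of_real x) ^ k / fact k))
        \<le> exp \<bar>Re (\<mu> * of_real x)\<bar> * norm (\<mu> * of_real x) ^ Suc 0 / fact 0" by (rule Taylor_exp)
    also have "\<dots> \<le> exp R * (norm \<mu> * R)" using e nx by simp (intro mult_mono; simp add: norm_mult)
    finally have *: "norm (exp (\<mu> * of_real x) - 1) \<le> exp R * (norm \<mu> * R)" by simp
    have "norm (\<mu> * (exp (\<mu> * of_real x) - 1)) \<le> norm \<mu> * (exp R * (norm \<mu> * R))"
      unfolding norm_mult by (rule mult_left_mono[OF *]) simp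
    also have "\<dots> = R * (exp R * (norm \<mu>)\<^sup>2)" by (simp add: power2_eq_square mult_ac)
    also have "\<dots> \<le> R\<^sup>2 * (exp R * (norm \<mu>)\<^sup>2)" using x by (intro mult_right_mono) (auto simp: power2_eq_square)
    finally show ?thesis using 2 by (simp add: nderiv_exp_minus_affine right_diff_distrib mult_ac)
  next
    case 3
    have "exp (Re (\<mu> * of_real x)) \<le> exp \<bar>Re (\<mu> * of_real x)\<bar>" by simp
    hence "exp (Re (\<mu> * of_real x)) \<le> exp R" using e by (rule order_trans)
    moreover have "norm \<mu> ^ j \<le> (norm \<mu>)\<^sup>2" using \<mu> 3 by (intro power_decreasing) auto
    ultimately have "norm (\<mu> ^ j * exp (\<mu> * of_real x)) \<le> (norm \<mu>)\<^sup>2 * exp R"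
      unfolding norm_mult norm_power norm_exp_eq_Re by (intro mult_mono) auto
    also have "\<dots> = 1 * ((norm \<mu>)\<^sup>2 * exp R)" by simp
    also have "\<dots> \<le> R\<^sup>2 * ((norm \<mu>)\<^sup>2 * exp R)"
      using x by (intro mult_right_mono one_le_power) auto
    finally show ?thesis using 3 by (simp add: nderiv_exp_minus_affine mult_ac)
  qed
qed

context ultra_space
begin

lemma line_functional:
  assumes L: "bfunctional L q k C" and F: "F \<in> ultra_line"
  shows "G \<in> ultra_line \<Longrightarrow> L (ext_zero a (\<lambda>x. F x + G x)) = L (ext_zero a F) + L (ext_zero a G)"
    "G \<in> ultra_line \<Longrightarrow> L (ext_zero a (\<lambda>x. F x - G x)) = L (ext_zero a F) - L (ext_zero a G)"
    "L (ext_zero a (\<lambda>x. u * F x)) = u * L (ext_zero a F)"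
    "B \<ge> 0 \<Longrightarrow> bdd_seminorm q (I k) B F \<Longrightarrow> norm (L (ext_zero a F)) \<le> C * B"
proof -
  have eq: "ext_zero a (\<lambda>x. F x + G x) = (\<lambda>x. ext_zero a F x + ext_zero a G x)"
    "ext_zero a (\<lambda>x. F x - G x) = (\<lambda>x. ext_zero a F x - ext_zero a G x)"
    "ext_zero a (\<lambda>x. u * F x) = (\<lambda>x. u * ext_zero a F x)" for G u by (auto simp: ext_zero_def)
  note lin = bfunctional_linear[OF L]
  show "G \<in> ultra_line \<Longrightarrow> L (ext_zero a (\<lambda>x. F x + G x)) = L (ext_zero a F) + L (ext_zero a G)"
    unfolding eq by (intro lin(1) ext_zero_line F)
  show "G \<in> ultra_line \<Longrightarrow> L (ext_zero a (\<lambda>x. F x - G x)) = L (ext_zero a F) - L (ext_zero a G)"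
    unfolding eq by (intro lin(3) ext_zero_line F)
  show "L (ext_zero a (\<lambda>x. u * F x)) = u * L (ext_zero a F)"
    unfolding eq by (intro lin(2) ext_zero_line F)
  show "norm (L (ext_zero a F)) \<le> C * B" if "B \<ge> 0" "bdd_seminorm q (I k) B F"
    by (rule lin(5)[OF ext_zero_line[OF F] that(1)])
      (use bdd_ext_zero[OF ultra_lineD(1)[OF F] I_subset] that in blast)
qed

lemma line_mult_bound:
  assumes L: "bfunctional L q k C" and M: "M \<in> ultra_line"
  shows "\<exists>q1 K. q1 \<in> {0<..<1} \<and> K \<ge> 0 \<and> (\<forall>F B. F \<in> ultra_line \<longrightarrow> B \<ge> 0 \<longrightarrow> bdd_seminorm q1 (I k) B F \<longrightarrow>
    norm (L (ext_zero a (\<lambda>x. M x * F x))) \<le> K * B)"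
proof -
  have q: "q \<in> {0<..<1}" and C0: "C \<ge> 0" using L by (auto simp: bfunctional_def)
  note q' = exponent_midpoint[OF q]
  obtain C' where C': "C' > 0" "\<And>X Y f g A B. open X \<Longrightarrow> smooth_on_set X f \<Longrightarrow> smooth_on_set X g \<Longrightarrow> Y \<subseteq> X \<Longrightarrow>
     A \<ge> 0 \<Longrightarrow> B \<ge> 0 \<Longrightarrow>
     bdd_seminorm ((q + 1) / 2) Y A f \<Longrightarrow> bdd_seminorm ((q + 1) / 2) Y B g \<Longrightarrow> bdd_seminorm q Y (C' * (A * B)) (\<lambda>x. f x * g x)"
    by (rule bdd_seminorm_mult[of q "(q + 1) / 2"]) (use q q' in auto)
  obtain A where A: "A \<ge> 0" "bdd_seminorm ((q + 1) / 2) (I k) A M"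
    by (rule ultra_line_bdd_on[OF M conjunct1[OF q'] bounded_closed_interval])
  show ?thesis
  proof (rule exI[of _ "(q + 1) / 2"], rule exI[of _ "C * (C' * A)"], intro conjI allI impI)
    show "(q + 1) / 2 \<in> {0<..<1}" using q' by blast
    show "0 \<le> C * (C' * A)" using C0 C' A by simp
    fix F B assume F: "F \<in> ultra_line" "B \<ge> 0" "bdd_seminorm ((q + 1) / 2) (I k) B F"
    have "bdd_seminorm q (I k) (C' * (A * B)) (\<lambda>x. M x * F x)"
      by (rule C'(2)[OF open_UNIV ultra_lineD(1)[OF M] ultra_lineD(1)[OF F(1)] subset_UNIV A(1) F(2) A(2) F(3)])
    hence "norm (L (ext_zero a (\<lambda>x. M x * F x))) \<le> C * (C' * (A * B))"
      by (intro line_functional(4)[OF L ultra_line_mult[OF M F(1)]]) (use C' A F in auto)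
    thus "norm (L (ext_zero a (\<lambda>x. M x * F x))) \<le> C * (C' * A) * B" by (simp only: mult.assoc)
  qed
qed

text \<open>The difference quotient must converge in the seminorm that dominates \<open>L\<close>,
  that is, in all derivatives at once. Second-order Taylor estimates for every derivative of
  \<open>Q\<close> give a remainder of size \<open>h^2\<close>, weighted as the second derivative of
  \<open>Q\<close> is. The multiplier \<open>M\<close> is 1 for \<open>conv_derivative\<close> and
  an exponential in \<open>conv_transform\<close>.\<close>

lemma functional_translate_derivative:
  assumes L: "bfunctional L q k C" and M: "M \<in> ultra_line" and Q: "Q \<in> ultra_line"
  shows "((\<lambda>x. L (ext_zero a (\<lambda>t. M t * Q (t + x)))) has_vector_derivative
     L (ext_zero a (\<lambda>t. M t * nderiv 1 Q (t + x)))) (at x)"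
  unfolding has_vector_derivative_def
proof -
  obtain q1 K where K: "q1 \<in> {0<..<1}" "K \<ge> 0"
    "\<forall>F B. F \<in> ultra_line \<longrightarrow> B \<ge> 0 \<longrightarrow> bdd_seminorm q1 (I k) B F \<longrightarrow> norm (L (ext_zero a (\<lambda>x. M x * F x))) \<le> K * B"
    using line_mult_bound[OF L M] by (elim exE conjE) (rule that)
  define Y where "Y = {x - c k - 1..x + c k + 1}"
  have Q1: "nderiv 1 Q \<in> ultra_line" by (rule ultra_line_nderiv1[OF Q])
  obtain B where B: "B \<ge> 0" "bdd_seminorm q1 Y B (nderiv 1 (nderiv 1 Q))"
    by (rule ultra_line_bdd_on[OF ultra_line_nderiv1[OF Q1] K(1), of Y]) (simp add: Y_def)
  have Q2: "norm (nderiv (Suc (Suc j)) Q t) \<le> B * ywt \<omega> q1 j" if "t \<in> Y" for t j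
    using B(2) that 
    unfolding bdd_seminorm_def nderiv_deriv[of _ "nderiv 1 Q"] nderiv_deriv[of "Suc _" Q] by blast
  have D: "(nderiv j Q has_vector_derivative nderiv (Suc j) Q t) (at t)" for j t
    by (rule smooth_has_derivative[OF ultra_lineD(1)[OF Q, of UNIV]]) simp
  let ?g = "\<lambda>x. L (ext_zero a (\<lambda>t. M t * Q (t + x)))"
  let ?D = "L (ext_zero a (\<lambda>t. M t * nderiv 1 Q (t + x)))"
  show "(?g has_derivative (\<lambda>h. h *\<^sub>R ?D)) (at x)"
  proof (rule has_derivative_quadratic[of _ _ _ "K * B"])
    show "bounded_linear (\<lambda>h. h *\<^sub>R ?D)" by (rule bounded_linear_scaleR_left)
    fix h :: real assume h: "norm h \<le> 1"
    define r where "r t = (Q (t + (x + h)) - Q (t + x)) - of_real h * nderiv 1 Q (t + x)" for t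
    have lines: "(\<lambda>t. Q (t + (x + h))) \<in> ultra_line" "(\<lambda>t. Q (t + x)) \<in> ultra_line" "(\<lambda>t. nderiv 1 Q (t + x)) \<in> ultra_line"
      using ultra_line_shift[OF Q] ultra_line_shift[OF Q1] by blast+
    have rl: "r \<in> ultra_line" unfolding r_def[abs_def]
      by (rule ultra_line_diff[OF ultra_line_diff[OF lines(1,2)] ultra_line_cmult[OF lines(3)]])
    have ext: "(\<lambda>t. M t * r t) = (\<lambda>t. (M t * Q (t + (x + h)) - M t * Q (t + x)) - of_real h * (M t * nderiv 1 Q (t + x)))"
      by (simp add: r_def fun_eq_iff right_diff_distrib mult_ac)
    have M3: "(\<lambda>t. M t * Q (t + (x + h))) \<in> ultra_line" "(\<lambda>t. M t * Q (t + x)) \<in> ultra_line"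
       "(\<lambda>t. M t * nderiv 1 Q (t + x)) \<in> ultra_line"
      by (rule ultra_line_mult[OF M lines(1)] ultra_line_mult[OF M lines(2)] ultra_line_mult[OF M lines(3)])+
    have "L (ext_zero a (\<lambda>t. M t * r t)) = ?g (x + h) - ?g x - of_real h * ?D"
      unfolding ext line_functional(2)[OF L ultra_line_diff[OF M3(1,2)] ultra_line_cmult[OF M3(3)]]
        line_functional(2)[OF L M3(1,2)] line_functional(3)[OF L M3(3)] ..
    moreover have "norm (L (ext_zero a (\<lambda>t. M t * r t))) \<le> K * (B * h\<^sup>2)"
    proof (rule K(3)[rule_format, OF rl])
      show "0 \<le> B * h\<^sup>2" using B by simp
      show "bdd_seminorm q1 (I k) (B * h\<^sup>2) r" unfolding bdd_seminorm_def
      proof (intro allI ballI)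
        fix j t assume t: "t \<in> I k"
        note sm = ultra_lineD(1)[where X = UNIV]
        have "nderiv j r t = (nderiv j (\<lambda>t. Q (t + (x + h))) t - nderiv j (\<lambda>t. Q (t + x)) t) - of_real h * nderiv j (\<lambda>t. nderiv 1 Q (t + x)) t"
          unfolding r_def[abs_def] using nderiv_diff(2)[OF open_UNIV sm[OF ultra_line_diff[OF lines(1,2)]] sm[OF ultra_line_cmult[OF lines(3)]] UNIV_I]
            nderiv_diff(2)[OF open_UNIV sm[OF lines(1)] sm[OF lines(2)] UNIV_I] nderiv_cmult(2)[OF open_UNIV sm[OF lines(3)] UNIV_I] by simp
        also have "\<dots> = nderiv j Q (t + x + h) - nderiv j Q (t + x) - of_real h * nderiv (Suc j) Q (t + x)"
          using nderiv_shift(2)[OF open_UNIV ultra_lineD(1)[OF Q], of t] nderiv_shift(2)[OF open_UNIV ultra_lineD(1)[OF Q1], of t]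
          by (simp only: nderiv_deriv UNIV_I) (simp only: add.assoc)
        finally have eq: "nderiv j r t = nderiv j Q (t + x + h) - nderiv j Q (t + x) - of_real h * nderiv (Suc j) Q (t + x)" .
        have "norm (nderiv j r t) \<le> B * ywt \<omega> q1 j * h\<^sup>2" unfolding eq
        proof (rule second_order_bound[OF D D])
          fix s assume "\<bar>s - (t + x)\<bar> \<le> \<bar>h\<bar>"
          hence "s \<in> Y" using h t by (auto simp: Y_def)
          thus "norm (nderiv (Suc (Suc j)) Q s) \<le> B * ywt \<omega> q1 j" by (rule Q2)
        qed
        thus "norm (nderiv j r t) \<le> B * h\<^sup>2 * ywt \<omega> q1 j" by (simp only: mult_ac)
      qed
    qed
    ultimately show "norm (?g (x + h) - ?g x - h *\<^sub>R ?D) \<le> K * B * (norm h)\<^sup>2"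
      by (simp add: scaleR_conv_of_real mult.assoc)
  qed
qed

text \<open>The multiplier \<open>M\<close> allows iteration: differentiation turns
  \<open>M t\<close> into \<open>t * M t\<close>, which produces all moments.\<close>

lemma functional_exp_derivative:
  assumes L: "bfunctional L q k C" and M: "M \<in> ultra_line"
  shows "((\<lambda>z. L (ext_zero a (\<lambda>t. M t * exp (z * of_real t)))) has_field_derivative
     L (ext_zero a (\<lambda>t. (of_real t * M t) * exp (z * of_real t)))) (at z)"
  unfolding has_field_derivative_def
proof -
  let ?e = "\<lambda>z t. exp (z * of_real t) :: complex"
  have Me: "(\<lambda>t. M t * ?e z t) \<in> ultra_line" for z by (rule ultra_line_mult[OF M ultra_line_exp])
  obtain q1 K where K: "q1 \<in> {0<..<1}" "K \<ge> 0"
    "\<forall>F B. F \<in> ultra_line \<longrightarrow> B \<ge> 0 \<longrightarrow> bdd_seminorm q1 (I k) B F \<longrightarrow> norm (L (ext_zero a (\<lambda>x. M x * ?e z x * F x))) \<le> K * B"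
    using line_mult_bound[OF L Me[of z]] by (elim exE conjE) (rule that)
  define R where "R = max 1 (c k)"
  let ?g = "\<lambda>z. L (ext_zero a (\<lambda>t. M t * ?e z t))"
  let ?D = "L (ext_zero a (\<lambda>t. (of_real t * M t) * ?e z t))"
  define B where "B = exp (q1 * \<omega> 1)"
  have B: "B > 0" "\<And>j. 1 \<le> B * ywt \<omega> q1 j" using one_le_ywt[of q1] K(1) by (simp_all add: B_def mult.commute)
  show "(?g has_derivative (\<lambda>h. ?D * h)) (at z)"
  proof (rule has_derivative_quadratic[of _ _ _ "K * (R\<^sup>2 * exp R * B)"])
    show "bounded_linear (\<lambda>h. ?D * h)" by (rule bounded_linear_mult_right)
    fix h :: complex assume h: "norm h \<le> 1"
    define r where "r = (\<lambda>t. ?e h t - (1 + h * of_real t))"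
    have rl: "r \<in> ultra_line" unfolding r_def
      by (rule ultra_line_diff[OF ultra_line_exp ultra_line_add[OF ultra_line_1 ultra_line_cmult[OF ultra_line_id]]])
    have tMe: "(\<lambda>t. (of_real t * M t) * ?e z t) \<in> ultra_line"
      by (rule ultra_line_mult[OF ultra_line_mult[OF ultra_line_id M] ultra_line_exp])
    have ext: "(\<lambda>t. M t * ?e z t * r t) = (\<lambda>t. (M t * ?e (z + h) t - M t * ?e z t) - h * ((of_real t * M t) * ?e z t))"
      by (simp add: r_def fun_eq_iff ring_distribs exp_add)
    have "L (ext_zero a (\<lambda>t. M t * ?e z t * r t)) = ?g (z + h) - ?g z - h * ?D"
      unfolding ext line_functional(2)[OF L ultra_line_diff[OF Me Me] ultra_line_cmult[OF tMe]]
        line_functional(2)[OF L Me Me] line_functional(3)[OF L tMe] ..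
    moreover have "norm (L (ext_zero a (\<lambda>t. M t * ?e z t * r t))) \<le> K * (R\<^sup>2 * exp R * (norm h)\<^sup>2 * B)"
    proof (rule K(3)[rule_format, OF rl])
      show "0 \<le> R\<^sup>2 * exp R * (norm h)\<^sup>2 * B" using B by simp
      show "bdd_seminorm q1 (I k) (R\<^sup>2 * exp R * (norm h)\<^sup>2 * B) r" unfolding bdd_seminorm_def
      proof (intro allI ballI)
        fix j t assume t: "t \<in> I k"
        have "norm (nderiv j r t) \<le> R\<^sup>2 * exp R * (norm h)\<^sup>2" unfolding r_def
          by (rule exp_minus_affine_bound[OF h]) (use t in \<open>auto simp: R_def\<close>)
        also have "\<dots> \<le> R\<^sup>2 * exp R * (norm h)\<^sup>2 * (B * ywt \<omega> q1 j)"
          using mult_left_mono[OF B(2)[of j], of "R\<^sup>2 * exp R * (norm h)\<^sup>2"] by simp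
        finally show "norm (nderiv j r t) \<le> R\<^sup>2 * exp R * (norm h)\<^sup>2 * B * ywt \<omega> q1 j" by (simp only: mult.assoc)
      qed
    qed
    ultimately show "norm (?g (z + h) - ?g z - ?D * h) \<le> K * (R\<^sup>2 * exp R * B) * (norm h)\<^sup>2"
      by (simp add: mult_ac)
  qed
qed

end


section \<open>Fourier transforms over a bounded interval\<close>

text \<open>The sign in the exponent is opposite to that of \<open>fourier_laplace\<close> because
  \<open>conv\<close> is a correlation, with \<open>F (t + s)\<close>; with this choice its
  transform is a product, see \<open>conv_transform\<close>.\<close>

definition ftrans :: "real \<Rightarrow> real \<Rightarrow> (real \<Rightarrow> complex) \<Rightarrow> complex \<Rightarrow> complex" where
  "ftrans p r \<gamma> z = integral {p..r} (\<lambda>s. \<gamma> s * exp (\<i> * z * of_real s))"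

lemma ftrans_holomorphic:
  assumes "continuous_on UNIV \<gamma>" shows "ftrans p r \<gamma> holomorphic_on UNIV"
proof -
  have "(\<lambda>z. integral (cbox p r) (\<lambda>s. \<gamma> s * exp (\<i> * z * of_real s))) holomorphic_on UNIV"
  proof (rule leibniz_rule_holomorphic[where fx = "\<lambda>z s. \<gamma> s * (\<i> * of_real s * exp (\<i> * z * of_real s))"])
    fix z :: complex and s :: real
    show "((\<lambda>z. \<gamma> s * exp (\<i> * z * of_real s)) has_field_derivative \<gamma> s * (\<i> * of_real s * exp (\<i> * z * of_real s))) (at z within UNIV)"
      by (auto intro!: derivative_eq_intros)
  next
    fix z :: complex
    show "(\<lambda>s. \<gamma> s * exp (\<i> * z * of_real s)) integrable_on cbox p r"
      by (intro integrable_continuous continuous_intros continuous_on_subset[OF assms]) auto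
  next
    have "continuous_on (UNIV \<times> cbox p r) (\<lambda>x::complex \<times> real. \<gamma> (snd x))"
      by (rule continuous_on_compose2[OF assms continuous_on_snd[OF continuous_on_id]]) auto
    thus "continuous_on (UNIV \<times> cbox p r) (\<lambda>(z, s). \<gamma> s * (\<i> * of_real s * exp (\<i> * z * of_real s)))"
      unfolding case_prod_unfold by (intro continuous_intros)
  qed auto
  thus ?thesis by (simp add: ftrans_def[abs_def])
qed

lemma norm_ftrans_le:
  assumes \<gamma>: "continuous_on UNIV \<gamma>" and "p \<le> r" and K: "\<And>s. s \<in> {p..r} \<Longrightarrow> norm (\<gamma> s) \<le> K"
  shows "Im z \<ge> 0 \<Longrightarrow> norm (ftrans p r \<gamma> z) \<le> K * (r - p) * exp (- p * Im z)"
    "Im z \<le> 0 \<Longrightarrow> norm (ftrans p r \<gamma> z) \<le> K * (r - p) * exp (- r * Im z)"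
proof -
  have K0: "K \<ge> 0" using K[of p] \<open>p \<le> r\<close> by (auto intro: order_trans[OF norm_ge_zero])
  have *: "norm (ftrans p r \<gamma> z) \<le> K * (r - p) * E" if E: "\<And>s. s \<in> {p..r} \<Longrightarrow> exp (- s * Im z) \<le> E" for E
  proof -
    have "norm (ftrans p r \<gamma> z) \<le> (K * E) * (r - p)" unfolding ftrans_def
    proof (rule integral_bound[OF \<open>p \<le> r\<close>])
      show "continuous_on {p..r} (\<lambda>s. \<gamma> s * exp (\<i> * z * of_real s))"
        by (intro continuous_intros continuous_on_subset[OF \<gamma>]) auto
      fix s assume s: "s \<in> {p..r}"
      have "norm (exp (\<i> * z * of_real s)) = exp (- s * Im z)" by (simp add: mult.commute)
      hence "norm (exp (\<i> * z * of_real s)) \<le> E" using E[OF s] by (simp only: mult_minus_left)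
      from mult_mono[OF K[OF s] this K0 norm_ge_zero]
      show "norm (\<gamma> s * exp (\<i> * z * of_real s)) \<le> K * E" by (simp only: norm_mult)
    qed
    thus ?thesis by (simp add: mult_ac)
  qed
  show "norm (ftrans p r \<gamma> z) \<le> K * (r - p) * exp (- p * Im z)" if "Im z \<ge> 0"
  proof (rule *)
    fix s assume "s \<in> {p..r}"
    hence "p * Im z \<le> s * Im z" using that by (intro mult_right_mono) auto
    thus "exp (- s * Im z) \<le> exp (- p * Im z)" by simp
  qed
  show "norm (ftrans p r \<gamma> z) \<le> K * (r - p) * exp (- r * Im z)" if "Im z \<le> 0"
  proof (rule *)
    fix s assume "s \<in> {p..r}"
    hence "r * Im z \<le> s * Im z" using that by (intro mult_right_mono_neg) auto
    thus "exp (- s * Im z) \<le> exp (- r * Im z)" by simp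
  qed
qed

lemma ftrans_combine:
  assumes "continuous_on UNIV \<gamma>" "p \<le> m" "m \<le> r"
  shows "ftrans p r \<gamma> z = ftrans p m \<gamma> z + ftrans m r \<gamma> z"
  unfolding ftrans_def
  by (rule Henstock_Kurzweil_Integration.integral_combine[symmetric, OF assms(2,3)])
    (intro integrable_continuous_real continuous_intros continuous_on_subset[OF assms(1)], auto)

lemma ftrans_parts:
  assumes \<gamma>: "\<And>s. (\<gamma> has_vector_derivative \<gamma>1 s) (at s)" and "continuous_on UNIV \<gamma>1" "p \<le> r"
  shows "ftrans p r \<gamma>1 z = \<gamma> r * exp (\<i> * z * of_real r) - \<gamma> p * exp (\<i> * z * of_real p) - \<i> * z * ftrans p r \<gamma> z"
proof -
  let ?e = "\<lambda>s. exp (\<i> * z * of_real s)"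
  have c: "continuous_on UNIV \<gamma>"
    by (intro continuous_at_imp_continuous_on ballI) (rule has_vector_derivative_continuous[OF \<gamma>])
  have "((\<lambda>s. \<gamma> s * ?e s) has_vector_derivative \<gamma> s * (\<i> * z * ?e s) + \<gamma>1 s * ?e s) (at s)" for s
  proof (rule has_vector_derivative_mult[OF \<gamma>])
    have "((\<lambda>w. exp (\<i> * z * w)) has_field_derivative \<i> * z * ?e s) (at (of_real s))"
      by (auto intro!: derivative_eq_intros)
    from has_vector_derivative_real_field[OF this] show "(?e has_vector_derivative \<i> * z * ?e s) (at s)" .
  qed
  hence "((\<lambda>s. \<gamma> s * (\<i> * z * ?e s) + \<gamma>1 s * ?e s) has_integral \<gamma> r * ?e r - \<gamma> p * ?e p) {p..r}"
    by (rule fundamental_theorem_of_calculus[OF assms(3) has_vector_derivative_at_within])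
  moreover have "((\<lambda>s. \<gamma> s * ?e s) has_integral ftrans p r \<gamma> z) {p..r}"
    "((\<lambda>s. \<gamma>1 s * ?e s) has_integral ftrans p r \<gamma>1 z) {p..r}"
    unfolding ftrans_def
    by (rule integrable_integral, rule integrable_continuous_real,
        intro continuous_intros continuous_on_subset[OF c] continuous_on_subset[OF assms(2)] subset_UNIV)+
  hence "((\<lambda>s. \<i> * z * (\<gamma> s * ?e s) + \<gamma>1 s * ?e s) has_integral \<i> * z * ftrans p r \<gamma> z + ftrans p r \<gamma>1 z) {p..r}"
    by (rule has_integral_add[OF has_integral_mult_right])
  hence "((\<lambda>s. \<gamma> s * (\<i> * z * ?e s) + \<gamma>1 s * ?e s) has_integral \<i> * z * ftrans p r \<gamma> z + ftrans p r \<gamma>1 z) {p..r}"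
    by (simp only: mult.left_commute[of "\<gamma> _"])
  ultimately have "\<gamma> r * ?e r - \<gamma> p * ?e p = \<i> * z * ftrans p r \<gamma> z + ftrans p r \<gamma>1 z" by (rule has_integral_unique)
  thus ?thesis by (simp add: algebra_simps)
qed

lemma ftrans_zero: "(\<And>s. s \<in> {p..r} \<Longrightarrow> \<gamma> s = 0) \<Longrightarrow> ftrans p r \<gamma> z = 0"
  unfolding ftrans_def by (rule integral_unique, rule has_integral_is_0) auto

lemma ftrans_reflect: "ftrans (- r) (- p) (\<lambda>s. \<gamma> (- s)) z = ftrans p r \<gamma> (- z)"
proof -
  have "ftrans p r \<gamma> (- z) = integral {- (- p).. - (- r)} (\<lambda>s. \<gamma> s * exp (\<i> * (- z) * of_real s))" by (simp add: ftrans_def)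
  also have "\<dots> = integral {- r..- p} (\<lambda>s. \<gamma> (- s) * exp (\<i> * (- z) * of_real (- s)))"
    using Henstock_Kurzweil_Integration.integral_reflect_real[of r p "\<lambda>s. \<gamma> s * exp (\<i> * (- z) * of_real s)"]
    by simp
  finally show ?thesis by (simp add: ftrans_def)
qed

lemma continuous_bounded_on_interval:
  fixes \<gamma> :: "real \<Rightarrow> complex"
  assumes "continuous_on UNIV \<gamma>"
  obtains K where "K > 0" "\<And>s. s \<in> {p..r} \<Longrightarrow> norm (\<gamma> s) \<le> K"
proof -
  have "bounded (\<gamma> ` {p..r})"
    by (intro compact_imp_bounded compact_continuous_image continuous_on_subset[OF assms]) auto
  then obtain K where "K > 0" "\<And>y. y \<in> \<gamma> ` {p..r} \<Longrightarrow> norm y \<le> K" unfolding bounded_pos by auto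
  thus ?thesis by (intro that[of K]) auto
qed

text \<open>In the upper half plane the transform over \<open>[-R, R]\<close> is bounded by
  Phragmen-Lindelof and the one over \<open>[0, R]\<close> trivially, hence so is their difference.
  In the lower half plane the transform over \<open>[-R, 0]\<close> is bounded trivially.\<close>

lemma ftrans_half_bounded:
  assumes \<gamma>: "continuous_on UNIV \<gamma>" and R: "R > 0"
    and A: "\<And>y. y \<ge> 0 \<Longrightarrow> norm (ftrans (- R) R \<gamma> (\<i> * of_real y)) \<le> A"
  shows "\<exists>C. \<forall>z. norm (ftrans (- R) 0 \<gamma> z) \<le> C"
proof -
  obtain K where K: "K > 0" "\<And>s. s \<in> {-R..R} \<Longrightarrow> norm (\<gamma> s) \<le> K"
    using continuous_bounded_on_interval[OF \<gamma>, where p = "- R" and r = R] by blast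
  define A' where "A' = max A (K * (2 * R))"
  have f: "norm (ftrans (- R) R \<gamma> z) \<le> A'" if z: "Im z \<ge> 0" for z
  proof (rule Phragmen_Lindelof_upper[where f = "ftrans (- R) R \<gamma>" and L = R and z = z])
    show "ftrans (- R) R \<gamma> holomorphic_on UNIV" by (rule ftrans_holomorphic[OF \<gamma>])
    show "norm (ftrans (- R) R \<gamma> (\<i> * of_real y)) \<le> A'" if "y \<ge> 0" for y using A[OF that] by (simp add: A'_def)
    fix w assume w: "Im w \<ge> 0"
    have "norm (ftrans (- R) R \<gamma> w) \<le> K * (R - (- R)) * exp (- (- R) * Im w)"
      by (rule norm_ftrans_le(1)[OF \<gamma>]) (use R K w in auto)
    also have "\<dots> \<le> A' * exp (R * Im w)" unfolding A'_def by (simp add: mult_right_mono)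
    finally show "norm (ftrans (- R) R \<gamma> w) \<le> A' * exp (R * Im w)" .
  qed (use R z in auto)
  have "norm (ftrans (- R) 0 \<gamma> z) \<le> A' + K * R" for z
  proof (cases "Im z \<ge> 0")
    case True
    have "norm (ftrans 0 R \<gamma> z) \<le> K * (R - 0) * exp (- 0 * Im z)"
      by (rule norm_ftrans_le(1)[OF \<gamma>]) (use R K True in auto)
    moreover have "ftrans (- R) 0 \<gamma> z = ftrans (- R) R \<gamma> z - ftrans 0 R \<gamma> z"
      using ftrans_combine[OF \<gamma>, of "- R" 0 R z] R by simp
    ultimately show ?thesis using f[OF True] norm_triangle_ineq4[of "ftrans (- R) R \<gamma> z" "ftrans 0 R \<gamma> z"] by simp
  next
    case False
    have "norm (ftrans (- R) 0 \<gamma> z) \<le> K * (0 - (- R)) * exp (- 0 * Im z)"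
      by (rule norm_ftrans_le(2)[OF \<gamma>]) (use R K False in auto)
    moreover have "A' \<ge> 0" using mult_pos_pos[OF K(1), of "2 * R"] R unfolding A'_def by linarith
    ultimately show ?thesis by simp
  qed
  thus ?thesis by blast
qed

text \<open>The transforms over \<open>[-R, 0]\<close> of \<open>\<gamma>\<close> and its two
  derivatives are bounded and entire, and integration by parts links them with boundary terms at 0,
  so \<open>bounded_chain_imp_zero\<close> applies. In substance: a transform bounded on the
  positive imaginary axis leaves no mass on the negative half line.\<close>

lemma ftrans_bounded_imp_zero:
  assumes d: "\<And>s. (\<gamma> has_vector_derivative \<gamma>1 s) (at s)" "\<And>s. (\<gamma>1 has_vector_derivative \<gamma>2 s) (at s)"
    and c: "continuous_on UNIV \<gamma>2" and R: "R > 0" "\<gamma> (- R) = 0" "\<gamma>1 (- R) = 0"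
    and A: "\<And>y. y \<ge> 0 \<Longrightarrow> norm (ftrans (- R) R \<gamma> (\<i> * of_real y)) \<le> A"
      "\<And>y. y \<ge> 0 \<Longrightarrow> norm (ftrans (- R) R \<gamma>1 (\<i> * of_real y)) \<le> A1"
      "\<And>y. y \<ge> 0 \<Longrightarrow> norm (ftrans (- R) R \<gamma>2 (\<i> * of_real y)) \<le> A2"
  shows "\<gamma> 0 = 0"
proof -
  have c0: "continuous_on UNIV \<gamma>" "continuous_on UNIV \<gamma>1"
    by (intro continuous_at_imp_continuous_on ballI, rule has_vector_derivative_continuous[OF d(1)])
      (intro continuous_at_imp_continuous_on ballI, rule has_vector_derivative_continuous[OF d(2)])
  obtain C where C: "\<And>z. norm (ftrans (- R) 0 \<gamma> z) \<le> C" using ftrans_half_bounded[OF c0(1) R(1) A(1)] by blast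
  obtain C1 where C1: "\<And>z. norm (ftrans (- R) 0 \<gamma>1 z) \<le> C1" using ftrans_half_bounded[OF c0(2) R(1) A(2)] by blast
  obtain C2 where C2: "\<And>z. norm (ftrans (- R) 0 \<gamma>2 z) \<le> C2" using ftrans_half_bounded[OF c R(1) A(3)] by blast
  show ?thesis
  proof (rule bounded_chain_imp_zero[OF ftrans_holomorphic[OF c0(1)] ftrans_holomorphic[OF c0(2)] _ C C1 C2])
    show "- \<i> \<noteq> 0" by simp
    show "ftrans (- R) 0 \<gamma>1 z = \<gamma> 0 + - \<i> * z * ftrans (- R) 0 \<gamma> z" for z
      using ftrans_parts[OF d(1) c0(2), of "- R" 0 z] R by simp
    show "ftrans (- R) 0 \<gamma>2 z = \<gamma>1 0 + - \<i> * z * ftrans (- R) 0 \<gamma>1 z" for z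
      using ftrans_parts[OF d(2) c, of "- R" 0 z] R by simp
  qed
qed

lemma ftrans_bounded_imp_zero':
  assumes d: "\<And>s. (\<gamma> has_vector_derivative \<gamma>1 s) (at s)" "\<And>s. (\<gamma>1 has_vector_derivative \<gamma>2 s) (at s)"
    and c: "continuous_on UNIV \<gamma>2" and R: "R > 0" "\<gamma> R = 0" "\<gamma>1 R = 0"
    and A: "\<And>y. y \<ge> 0 \<Longrightarrow> norm (ftrans (- R) R \<gamma> (- (\<i> * of_real y))) \<le> A"
      "\<And>y. y \<ge> 0 \<Longrightarrow> norm (ftrans (- R) R \<gamma>1 (- (\<i> * of_real y))) \<le> A1"
      "\<And>y. y \<ge> 0 \<Longrightarrow> norm (ftrans (- R) R \<gamma>2 (- (\<i> * of_real y))) \<le> A2"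
  shows "\<gamma> 0 = 0"
proof -
  have refl: "((\<lambda>s. g (- s)) has_vector_derivative - g1 (- s)) (at s)"
    if "\<And>s. (g has_vector_derivative g1 s) (at s)" for g g1 :: "real \<Rightarrow> complex" and s
  proof -
    have "(uminus has_vector_derivative - 1) (at s)" 
      using has_vector_derivative_minus[OF has_vector_derivative_id[of "at s"]] by simp
    from vector_diff_chain_at[OF this that[of "- s"]] show ?thesis by (simp add: o_def)
  qed
  have tr: "ftrans (- R) R (\<lambda>s. g (- s)) z = ftrans (- R) R g (- z)" for g z
    using ftrans_reflect[of R "- R" g z] by simp
  have trm: "ftrans (- R) R (\<lambda>s. - g (- s)) z = - ftrans (- R) R g (- z)" for g z
    unfolding tr[symmetric] by (simp add: ftrans_def)
  have "(\<lambda>s. \<gamma> (- s)) 0 = 0"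
  proof (rule ftrans_bounded_imp_zero[where R = R and ?\<gamma>1.0 = "\<lambda>s. - \<gamma>1 (- s)" and ?\<gamma>2.0 = "\<lambda>s. \<gamma>2 (- s)"])
    show "((\<lambda>s. \<gamma> (- s)) has_vector_derivative - \<gamma>1 (- s)) (at s)" for s by (rule refl[OF d(1)])
    show "((\<lambda>s. - \<gamma>1 (- s)) has_vector_derivative \<gamma>2 (- s)) (at s)" for s
      using has_vector_derivative_minus[OF refl[OF d(2), of s]] by simp
    show "continuous_on UNIV (\<lambda>s. \<gamma>2 (- s))" by (rule continuous_on_compose2[OF c]) (auto intro: continuous_intros)
  qed (use R A in \<open>simp_all add: tr trm\<close>)
  thus ?thesis by simp
qed


section \<open>The Fourier--Laplace transform and convolution\<close>

context ultra_space
begin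

lemma fourier_laplace_eq: "fourier_laplace a L z = L (ext_zero a (\<lambda>t. exp (- \<i> * z * of_real t)))"
  by (simp add: fourier_laplace_def exp_monomial_def)

lemma ultra_line_monomial: "(\<lambda>t. of_real t ^ j * exp (\<mu> * of_real t)) \<in> ultra_line"
  by (rule ultra_line_mult[OF ultra_line_power[OF ultra_line_id] ultra_line_exp])

lemma exp_monomial_U: "exp_monomial a j \<mu> \<in> U"
  unfolding exp_monomial_def by (rule ext_zero_line[OF ultra_line_monomial])

lemma fourier_laplace_moment_derivative:
  assumes L: "bfunctional L q k C"
  shows "((\<lambda>z. (-\<i>) ^ j * L (exp_monomial a j z)) has_field_derivative (-\<i>) ^ Suc j * L (exp_monomial a (Suc j) z)) (at z)"
proof -
  let ?g = "\<lambda>w. L (ext_zero a (\<lambda>t. of_real t ^ j * exp (w * of_real t)))"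
  have "(?g has_field_derivative L (ext_zero a (\<lambda>t. (of_real t * of_real t ^ j) * exp ((-\<i> * z) * of_real t)))) (at (-\<i> * z))"
    by (rule functional_exp_derivative[OF L ultra_line_power[OF ultra_line_id]])
  moreover have "((\<lambda>z. -\<i> * z) has_field_derivative -\<i>) (at z)" by (auto intro!: derivative_eq_intros)
  ultimately have "((\<lambda>z. ?g (-\<i> * z)) has_field_derivative
      L (ext_zero a (\<lambda>t. (of_real t * of_real t ^ j) * exp ((-\<i> * z) * of_real t))) * (-\<i>)) (at z)"
    by (rule DERIV_chain2)
  from DERIV_cmult[OF this, of "(-\<i>) ^ j"]
  show ?thesis by (simp add: exp_monomial_def mult_ac)
qed

lemma fourier_laplace_deriv:
  assumes L: "bfunctional L q k C"
  shows "(deriv ^^ j) (fourier_laplace a L) z = (-\<i>) ^ j * L (exp_monomial a j z)"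
    and "fourier_laplace a L holomorphic_on UNIV"
proof -
  note d = fourier_laplace_moment_derivative[OF L]
  have "(deriv ^^ j) (fourier_laplace a L) = (\<lambda>z. (-\<i>) ^ j * L (exp_monomial a j z))"
  proof (induction j)
    case 0
    show ?case by (simp add: fourier_laplace_def fun_eq_iff)
  next
    case (Suc j)
    show ?case unfolding funpow.simps comp_def Suc using DERIV_imp_deriv[OF d[of j]] by auto
  qed
  thus "(deriv ^^ j) (fourier_laplace a L) z = (-\<i>) ^ j * L (exp_monomial a j z)" by simp
  have "fourier_laplace a L field_differentiable at z" for z
    using d[of 0] by (auto simp: field_differentiable_def fourier_laplace_def[abs_def])
  thus "fourier_laplace a L holomorphic_on UNIV" by (simp add: holomorphic_on_def)
qed

section \<open>Correlation of a functional with a function\<close>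

definition conv :: "((real \<Rightarrow> complex) \<Rightarrow> complex) \<Rightarrow> (real \<Rightarrow> complex) \<Rightarrow> real \<Rightarrow> complex" where
  "conv L F s = L (ext_zero a (\<lambda>t. F (t + s)))"

text \<open>\<open>L\<close> depends only on germs along \<open>K\<close>. In contrast to the
  support this names no smallest set: a continuous functional is carried by an interval of the
  exhaustion at once, and a functional that annihilates the functions vanishing on an interval can
  be located without computing its support.\<close>

definition carried :: "((real \<Rightarrow> complex) \<Rightarrow> complex) \<Rightarrow> real set \<Rightarrow> bool" where
  "carried L K \<longleftrightarrow> (\<forall>f\<in>U. \<forall>V. open V \<and> K \<subseteq> V \<and> (\<forall>x\<in>V. f x = 0) \<longrightarrow> L f = 0)"

lemma bfunctional_carried: "bfunctional L q k C \<Longrightarrow> carried L (I k)"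
  unfolding carried_def by (meson bfunctional_local)

lemma carriedD:
  assumes "carried L K" "F \<in> ultra_line" "open V" "K \<subseteq> V" "\<And>x. x \<in> V \<Longrightarrow> F x = 0"
  shows "L (ext_zero a F) = 0"
proof -
  have "\<forall>x\<in>V. ext_zero a F x = 0" using assms(5) by (simp add: ext_zero_def)
  thus ?thesis using assms(1) ext_zero_line[OF assms(2)] assms(3,4) unfolding carried_def by blast
qed

lemma conv_derivative:
  assumes L: "bfunctional L q k C" and F: "F \<in> ultra_line"
  shows "(conv L F has_vector_derivative conv L (nderiv 1 F) s) (at s)"
  using functional_translate_derivative[OF L ultra_line_1 F, of s] by (simp add: conv_def[abs_def])

lemma conv_continuous:
  assumes L: "bfunctional L q k C" and F: "F \<in> ultra_line"
  shows "continuous_on UNIV (conv L F)"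
  by (intro continuous_at_imp_continuous_on ballI) (rule has_vector_derivative_continuous[OF conv_derivative[OF L F]])

lemma conv_zero:
  assumes "carried L {A..B}" and F: "F \<in> ultra_line" and z: "\<And>x. x \<notin> {\<alpha>..\<beta>} \<Longrightarrow> F x = 0"
    and s: "s < \<alpha> - B \<or> s > \<beta> - A"
  shows "conv L F s = 0"
  unfolding conv_def
proof (rule carriedD[OF assms(1) ultra_line_shift[OF F], of "if s < \<alpha> - B then {..<\<alpha> - s} else {\<beta> - s<..}"])
  show "open (if s < \<alpha> - B then {..<\<alpha> - s} else {\<beta> - s<..})" by simp
  show "{A..B} \<subseteq> (if s < \<alpha> - B then {..<\<alpha> - s} else {\<beta> - s<..})" using s by auto
  show "F (x + s) = 0" if "x \<in> (if s < \<alpha> - B then {..<\<alpha> - s} else {\<beta> - s<..})" for x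
    by (rule z) (use that in \<open>auto split: if_splits\<close>)
qed

text \<open>Fubini's theorem for a functional, without vector-valued integrals. With
  \<open>Q\<close> an antiderivative of \<open>F t * exp (i w t)\<close>, the integrand
  \<open>conv L F x * exp (i w x)\<close> is the derivative of
  \<open>g x = L (exp (- i w t) Q (t + x))\<close>, so the transform is \<open>g r - g p\<close>.
  \<open>Q\<close> is constant on either side of \<open>[\<alpha>, \<beta>]\<close>, hence near the
  carrier \<open>Q (t + r) - Q (t + p)\<close> is the total integral of
  \<open>F t * exp (i w t)\<close>.\<close>

lemma conv_transform:
  assumes L: "bfunctional L q k C" and supp: "carried L {A..B}"
    and F: "F \<in> ultra_line" and z: "\<And>x. x \<notin> {\<alpha>..\<beta>} \<Longrightarrow> F x = 0"
    and le: "\<alpha> \<le> \<beta>" "A \<le> B" and pr: "p < \<alpha> - B" "r > \<beta> - A"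
  shows "ftrans p r (conv L F) w = ftrans \<alpha> \<beta> F w * fourier_laplace a L w"
proof -
  let ?e = "\<lambda>t::real. exp (\<i> * w * of_real t)" and ?e' = "\<lambda>t::real. exp ((- \<i> * w) * of_real t)"
  have Fe: "(\<lambda>t. F t * ?e t) \<in> ultra_line" by (rule ultra_line_mult[OF F ultra_line_exp])
  have cont: "continuous_on UNIV (\<lambda>t. F t * ?e t)"
    by (intro continuous_at_imp_continuous_on ballI has_vector_derivative_continuous)
      (rule smooth_has_derivative[where j = 0, simplified, OF ultra_lineD(1)[OF Fe] UNIV_I])
  obtain Q where Q: "\<And>x. (Q has_vector_derivative F x * ?e x) (at x)" using antiderivative_exists[OF cont] by blast
  note QU = ultra_line_antideriv[OF Fe Q]
  define g where "g x = L (ext_zero a (\<lambda>t. ?e' t * Q (t + x)))" for x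
  have eU: "?e' \<in> ultra_line" by (rule ultra_line_exp)
  have g: "(g has_vector_derivative conv L F x * ?e x) (at x)" for x
  proof -
    have "(g has_vector_derivative L (ext_zero a (\<lambda>t. ?e' t * (F (t + x) * ?e (t + x))))) (at x)"
      unfolding g_def[abs_def] using functional_translate_derivative[OF L eU QU(1), of x] unfolding QU(2) .
    moreover have "(\<lambda>t. ?e' t * (F (t + x) * ?e (t + x))) = (\<lambda>t. ?e x * F (t + x))"
      by (simp add: fun_eq_iff exp_minus exp_add ring_distribs)
    ultimately show ?thesis using line_functional(3)[OF L ultra_line_shift[OF F], of "?e x" x]
      by (simp add: conv_def mult.commute)
  qed
  have 1: "ftrans p r (conv L F) w = g r - g p" unfolding ftrans_def
    by (rule integral_unique, rule fundamental_theorem_of_calculus)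
      (use pr le has_vector_derivative_at_within[OF g] in auto)
  have const: "Q y = Q x" if xy: "x \<le> y" and 0: "\<And>t. t \<in> {x<..<y} \<Longrightarrow> F t = 0" for x y
  proof -
    have "((\<lambda>t. F t * ?e t) has_integral Q y - Q x) {x..y}"
      by (rule fundamental_theorem_of_calculus[OF xy has_vector_derivative_at_within[OF Q]])
    moreover have "((\<lambda>t. F t * ?e t) has_integral 0) (cbox x y)"
      by (rule has_integral_spike_interior[OF has_integral_0]) (simp add: 0)
    ultimately have "Q y - Q x = 0" unfolding box_real by (rule has_integral_unique)
    thus ?thesis by simp
  qed
  have left: "Q x = Q \<alpha>" if "x < \<alpha>" for x
    by (rule const[symmetric]) (use that z in auto)
  have right: "Q x = Q \<beta>" if "x > \<beta>" for x
    by (rule const) (use that z in auto)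
  have "ftrans \<alpha> \<beta> F w = Q \<beta> - Q \<alpha>" unfolding ftrans_def
    by (rule integral_unique, rule fundamental_theorem_of_calculus[OF le(1) has_vector_derivative_at_within[OF Q]])
  define u where "u = ftrans \<alpha> \<beta> F w"
  have u: "u = Q \<beta> - Q \<alpha>" using \<open>ftrans \<alpha> \<beta> F w = Q \<beta> - Q \<alpha>\<close> by (simp add: u_def)
  have eQ: "(\<lambda>t. ?e' t * Q (t + x)) \<in> ultra_line" for x by (rule ultra_line_mult[OF eU ultra_line_shift[OF QU(1)]])
  have d: "(\<lambda>t. ?e' t * Q (t + r) - ?e' t * Q (t + p)) \<in> ultra_line" by (rule ultra_line_diff[OF eQ eQ])
  have ue: "(\<lambda>t. u * ?e' t) \<in> ultra_line" by (rule ultra_line_cmult[OF eU])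
  have "L (ext_zero a (\<lambda>t. (?e' t * Q (t + r) - ?e' t * Q (t + p)) - u * ?e' t)) = 0"
  proof (rule carriedD[OF supp ultra_line_diff[OF d ue], of "{\<beta> - r<..<\<alpha> - p}"])
    show "{A..B} \<subseteq> {\<beta> - r<..<\<alpha> - p}" using pr by auto
    fix x assume "x \<in> {\<beta> - r<..<\<alpha> - p}"
    hence "Q (x + r) = Q \<beta>" "Q (x + p) = Q \<alpha>" using left[of "x + p"] right[of "x + r"] by auto
    thus "?e' x * Q (x + r) - ?e' x * Q (x + p) - u * ?e' x = 0" by (simp add: u algebra_simps)
  qed simp
  hence "g r - g p = u * L (ext_zero a ?e')"
    unfolding line_functional(2)[OF L d ue] line_functional(2)[OF L eQ eQ] line_functional(3)[OF L eU] g_def by simp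
  thus ?thesis unfolding 1 fourier_laplace_eq u_def .
qed

lemma nderiv1_zero_outside:
  assumes "\<And>x. x \<notin> {\<alpha>..\<beta>} \<Longrightarrow> F x = (0::complex)" "x \<notin> {\<alpha>..\<beta>}" shows "nderiv j F x = 0"
  by (rule nderiv_zero[of "- {\<alpha>..\<beta>}"]) (use assms in auto)

lemma line_continuous: "F \<in> ultra_line \<Longrightarrow> continuous_on UNIV F"
  by (intro continuous_at_imp_continuous_on ballI has_vector_derivative_continuous)
      (rule smooth_has_derivative[where j = 0, simplified, OF ultra_lineD(1) UNIV_I])

text \<open>On the imaginary axis the decay \<open>exp (- \<sigma> \<rho> y)\<close> of the
  transform of \<open>F\<close>, due to the position of its support relative to
  \<open>\<rho>\<close>, cancels the growth allowed by \<open>b\<close>. The sign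
  \<open>\<sigma>\<close> selects the half axis.\<close>

lemma transform_growth_bounded:
  assumes L: "bfunctional L q k C" and R: "- R < \<alpha> - c k" "R > \<beta> + c k"
    and F: "F \<in> ultra_line" and z: "\<And>x. x \<notin> {\<alpha>..\<beta>} \<Longrightarrow> F x = 0" and le: "\<alpha> \<le> \<beta>"
    and \<sigma>: "\<sigma> = 1 \<and> \<rho> \<le> \<alpha> \<or> \<sigma> = -1 \<and> \<beta> \<le> \<rho>"
    and b: "\<And>y. y > 0 \<Longrightarrow> norm (fourier_laplace a L (\<i> * of_real (\<sigma> * y))) \<le> D * exp (\<sigma> * \<rho> * y)"
  shows "\<exists>A. \<forall>y\<ge>0. norm (ftrans (- R) R (conv L F) (\<i> * of_real (\<sigma> * y))) \<le> A"
proof -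
  obtain K where K: "K > 0" "\<And>s. s \<in> {\<alpha>..\<beta>} \<Longrightarrow> norm (F s) \<le> K"
    using continuous_bounded_on_interval[OF line_continuous[OF F], where p = \<alpha> and r = \<beta>] by blast
  define D' where "D' = max \<bar>D\<bar> (norm (fourier_laplace a L 0))"
  have D': "norm (fourier_laplace a L (\<i> * of_real (\<sigma> * y))) \<le> D' * exp (\<sigma> * \<rho> * y)" if "y \<ge> 0" for y
  proof (cases "y = 0")
    case False
    hence "norm (fourier_laplace a L (\<i> * of_real (\<sigma> * y))) \<le> D * exp (\<sigma> * \<rho> * y)" using b that by simp
    also have "\<dots> \<le> D' * exp (\<sigma> * \<rho> * y)" by (intro mult_right_mono) (auto simp: D'_def)
    finally show ?thesis .
  qed (simp add: D'_def)
  have F': "norm (ftrans \<alpha> \<beta> F (\<i> * of_real (\<sigma> * y))) \<le> K * (\<beta> - \<alpha>) * exp (- (\<sigma> * \<rho> * y))" if y: "y \<ge> 0" for y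
    using \<sigma>
  proof (elim disjE conjE)
    assume \<sigma>: "\<sigma> = 1" "\<rho> \<le> \<alpha>"
    have "norm (ftrans \<alpha> \<beta> F (\<i> * of_real (\<sigma> * y))) \<le> K * (\<beta> - \<alpha>) * exp (- \<alpha> * y)"
      using norm_ftrans_le(1)[OF line_continuous[OF F] le K(2), of "\<i> * of_real (\<sigma> * y)"] y \<sigma> by simp
    also have "\<dots> \<le> K * (\<beta> - \<alpha>) * exp (- (\<sigma> * \<rho> * y))"
      using K(1) le \<sigma> y by (intro mult_left_mono) (auto intro: mult_right_mono)
    finally show ?thesis .
  next
    assume \<sigma>: "\<sigma> = -1" "\<beta> \<le> \<rho>"
    have "norm (ftrans \<alpha> \<beta> F (\<i> * of_real (\<sigma> * y))) \<le> K * (\<beta> - \<alpha>) * exp (\<beta> * y)"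
      using norm_ftrans_le(2)[OF line_continuous[OF F] le K(2), of "\<i> * of_real (\<sigma> * y)"] y \<sigma> by simp
    also have "\<dots> \<le> K * (\<beta> - \<alpha>) * exp (- (\<sigma> * \<rho> * y))"
      using K(1) le \<sigma> y by (intro mult_left_mono) (auto intro: mult_right_mono)
    finally show ?thesis .
  qed
  have "norm (ftrans (- R) R (conv L F) (\<i> * of_real (\<sigma> * y))) \<le> K * (\<beta> - \<alpha>) * D'" if y: "y \<ge> 0" for y
  proof -
    have "norm (ftrans (- R) R (conv L F) (\<i> * of_real (\<sigma> * y))) =
        norm (ftrans \<alpha> \<beta> F (\<i> * of_real (\<sigma> * y))) * norm (fourier_laplace a L (\<i> * of_real (\<sigma> * y)))"
      using conv_transform[OF L bfunctional_carried[OF L] F z le _ R(1), of R] R(2) c_pos[of k] by (simp add: norm_mult)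
    also have "\<dots> \<le> (K * (\<beta> - \<alpha>) * exp (- (\<sigma> * \<rho> * y))) * (D' * exp (\<sigma> * \<rho> * y))"
      by (rule mult_mono[OF F'[OF y] D'[OF y]]) (use K(1) le in auto)
    also have "\<dots> = K * (\<beta> - \<alpha>) * D'" by (simp add: exp_minus)
    finally show ?thesis .
  qed
  thus ?thesis by blast
qed

text \<open>The transform of \<open>conv L F\<close> is bounded in the upper half plane by Phragmen--Lindelof, so
  its transform over a half line is bounded and entire; the same holds for the derivatives of \<open>F\<close>.\<close>

lemma transform_growth_right:
  assumes L: "bfunctional L q k C"
    and F: "F \<in> ultra_line" and z: "\<And>x. x \<notin> {\<alpha>..\<beta>} \<Longrightarrow> F x = 0" and le: "\<alpha> \<le> \<beta>" and \<rho>: "\<rho> \<le> \<alpha>"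
    and b: "\<And>y. y > 0 \<Longrightarrow> norm (fourier_laplace a L (\<i> * of_real y)) \<le> D * exp (\<rho> * y)"
  shows "L (ext_zero a F) = 0"
proof -
  note supp = bfunctional_carried[OF L]
  define R where "R = c k + \<bar>\<alpha>\<bar> + \<bar>\<beta>\<bar> + 1"
  have R: "R > 0" "- R < \<alpha> - c k" "R > \<beta> + c k" "R > \<beta> - (- c k)" using c_pos[of k] by (auto simp: R_def)
  have bounded: "\<exists>A. \<forall>y\<ge>0. norm (ftrans (- R) R (conv L G) (\<i> * of_real y)) \<le> A"
    if "G \<in> ultra_line" "\<And>x. x \<notin> {\<alpha>..\<beta>} \<Longrightarrow> G x = 0" for G
    using transform_growth_bounded[OF L R(2,3) that le, where \<sigma> = "1" and \<rho> = \<rho> and D = D] \<rho> b by simp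
  have F1: "nderiv 1 F \<in> ultra_line" by (rule ultra_line_nderiv1[OF F])
  have F2: "nderiv 1 (nderiv 1 F) \<in> ultra_line" by (rule ultra_line_nderiv1[OF F1])
  have z1: "\<And>x. x \<notin> {\<alpha>..\<beta>} \<Longrightarrow> nderiv 1 F x = 0" by (rule nderiv1_zero_outside[OF z])
  have z2: "\<And>x. x \<notin> {\<alpha>..\<beta>} \<Longrightarrow> nderiv 1 (nderiv 1 F) x = 0" by (rule nderiv1_zero_outside[OF z1])
  obtain A0 where A0: "\<And>y. y \<ge> 0 \<Longrightarrow> norm (ftrans (- R) R (conv L F) (\<i> * of_real y)) \<le> A0"
    using bounded[OF F z] by blast
  obtain A1 where A1: "\<And>y. y \<ge> 0 \<Longrightarrow> norm (ftrans (- R) R (conv L (nderiv 1 F)) (\<i> * of_real y)) \<le> A1"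
    using bounded[OF F1 z1] by blast
  obtain A2 where A2: "\<And>y. y \<ge> 0 \<Longrightarrow> norm (ftrans (- R) R (conv L (nderiv 1 (nderiv 1 F))) (\<i> * of_real y)) \<le> A2"
    using bounded[OF F2 z2] by blast
  have "conv L F 0 = 0"
    by (rule ftrans_bounded_imp_zero[OF conv_derivative[OF L F] conv_derivative[OF L F1] conv_continuous[OF L F2] R(1) _ _ A0 A1 A2])
      (rule conv_zero[OF supp F z disjI1[OF R(2)]] conv_zero[OF supp F1 z1 disjI1[OF R(2)]], assumption)+
  thus ?thesis by (simp add: conv_def)
qed

lemma transform_growth_left:
  assumes L: "bfunctional L q k C"
    and F: "F \<in> ultra_line" and z: "\<And>x. x \<notin> {\<alpha>..\<beta>} \<Longrightarrow> F x = 0" and le: "\<alpha> \<le> \<beta>" and \<rho>: "\<beta> \<le> \<rho>"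
    and b: "\<And>y. y > 0 \<Longrightarrow> norm (fourier_laplace a L (- (\<i> * of_real y))) \<le> D * exp (- \<rho> * y)"
  shows "L (ext_zero a F) = 0"
proof -
  note supp = bfunctional_carried[OF L]
  define R where "R = c k + \<bar>\<alpha>\<bar> + \<bar>\<beta>\<bar> + 1"
  have R: "R > 0" "- R < \<alpha> - c k" "R > \<beta> + c k" "R > \<beta> - (- c k)" using c_pos[of k] by (auto simp: R_def)
  have bounded: "\<exists>A. \<forall>y\<ge>0. norm (ftrans (- R) R (conv L G) (- (\<i> * of_real y))) \<le> A"
    if "G \<in> ultra_line" "\<And>x. x \<notin> {\<alpha>..\<beta>} \<Longrightarrow> G x = 0" for G
    using transform_growth_bounded[OF L R(2,3) that le, where \<sigma> = "-1" and \<rho> = \<rho> and D = D] \<rho> b by simp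
  have F1: "nderiv 1 F \<in> ultra_line" by (rule ultra_line_nderiv1[OF F])
  have F2: "nderiv 1 (nderiv 1 F) \<in> ultra_line" by (rule ultra_line_nderiv1[OF F1])
  have z1: "\<And>x. x \<notin> {\<alpha>..\<beta>} \<Longrightarrow> nderiv 1 F x = 0" by (rule nderiv1_zero_outside[OF z])
  have z2: "\<And>x. x \<notin> {\<alpha>..\<beta>} \<Longrightarrow> nderiv 1 (nderiv 1 F) x = 0" by (rule nderiv1_zero_outside[OF z1])
  obtain A0 where A0: "\<And>y. y \<ge> 0 \<Longrightarrow> norm (ftrans (- R) R (conv L F) (- (\<i> * of_real y))) \<le> A0"
    using bounded[OF F z] by blast
  obtain A1 where A1: "\<And>y. y \<ge> 0 \<Longrightarrow> norm (ftrans (- R) R (conv L (nderiv 1 F)) (- (\<i> * of_real y))) \<le> A1"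
    using bounded[OF F1 z1] by blast
  obtain A2 where A2: "\<And>y. y \<ge> 0 \<Longrightarrow> norm (ftrans (- R) R (conv L (nderiv 1 (nderiv 1 F))) (- (\<i> * of_real y))) \<le> A2"
    using bounded[OF F2 z2] by blast
  have "conv L F 0 = 0"
    by (rule ftrans_bounded_imp_zero'[OF conv_derivative[OF L F] conv_derivative[OF L F1] conv_continuous[OF L F2] R(1) _ _ A0 A1 A2])
      (rule conv_zero[OF supp F z disjI2[OF R(4)]] conv_zero[OF supp F1 z1 disjI2[OF R(4)]], assumption)+
  thus ?thesis by (simp add: conv_def)
qed

end


section \<open>Supports and local convolution\<close>

context ultra_space
begin

lemma localize:
  assumes f: "f \<in> U" and Y: "compact Y" "Y \<subseteq> X"
  obtains F N L where "F \<in> ultra_line" "open N" "Y \<subseteq> N" "\<And>x. x \<in> N \<Longrightarrow> F x = f x" "compact L" "L \<subseteq> X" "\<And>x. x \<notin> L \<Longrightarrow> F x = 0"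
proof -
  obtain \<kappa> N L where \<kappa>: "\<kappa> \<in> ultra_line" "open N" "Y \<subseteq> N" "\<And>x. x \<in> N \<Longrightarrow> \<kappa> x = 1"
    "compact L" "L \<subseteq> X" "\<And>x. x \<notin> L \<Longrightarrow> \<kappa> x = 0"
    using cutoff_compact[OF Y(1) X_open Y(2)] by metis
  show ?thesis
  proof (rule that[OF _ \<kappa>(2,3) _ \<kappa>(5,6)])
    show "(\<lambda>x. \<kappa> x * f x) \<in> ultra_line" by (rule cut_line[OF f \<kappa>(1) \<kappa>(5,6,7)])
  qed (use \<kappa>(4,7) in auto)
qed

end

locale dual_functional = ultra_space +
  fixes S :: "(real \<Rightarrow> complex) \<Rightarrow> complex"
  assumes S_dual: "S \<in> ultradual \<omega> a c" and S_nonzero: "\<exists>f\<in>ultradiff \<omega> a c. S f \<noteq> 0"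
begin

lemma S_bounded: "\<exists>q k C. bfunctional S q k C"
  using ultradual_bounded[OF S_dual] by blast

abbreviation "supp \<equiv> usupp \<omega> a c S"

definition null_opens :: "real set set" where
  "null_opens = {V. open V \<and> V \<subseteq> X \<and> (\<forall>f\<in>U. compact (closure {x. f x \<noteq> 0}) \<and> closure {x. f x \<noteq> 0} \<subseteq> V \<longrightarrow> S f = 0)}"

lemma supp_eq: "supp = X - \<Union>null_opens"
  by (simp add: usupp_def null_opens_def)

text \<open>Induction over the cover: a cut-off that is 1 near the part of \<open>K\<close> outside
  \<open>\<Union>\<D>\<close> splits \<open>h\<close> into a piece supported in \<open>V\<close> and
  a piece supported in \<open>\<Union>\<D>\<close>.\<close>

lemma null_opens_finite_Union:
  assumes "finite \<D>" "\<D> \<subseteq> null_opens" "h \<in> ultra_line" "compact K" "K \<subseteq> \<Union>\<D>" "\<And>x. x \<notin> K \<Longrightarrow> h x = 0"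
  shows "S h = 0"
  using assms
proof (induction \<D> arbitrary: h K rule: finite_induct)
  case empty
  obtain q k C where L: "bfunctional S q k C" using S_bounded by blast
  have "h = (\<lambda>x. 0)" using empty by auto
  thus ?case using bfunctional_linear(4)[OF L] by simp
next
  case (insert V \<D>)
  obtain q k C where L: "bfunctional S q k C" using S_bounded by blast
  have V: "open V" "V \<subseteq> X" "\<And>f. f \<in> U \<Longrightarrow> compact (closure {x. f x \<noteq> 0}) \<Longrightarrow> closure {x. f x \<noteq> 0} \<subseteq> V \<Longrightarrow> S f = 0"
    using insert.prems(1) by (auto simp: null_opens_def)
  have "open (\<Union>\<D>)" using insert.prems(1) by (auto simp: null_opens_def)
  hence K1: "compact (K - \<Union>\<D>)" using insert.prems(3) by (simp add: compact_diff)
  have K1V: "K - \<Union>\<D> \<subseteq> V" using insert.prems(4) by auto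
  have DX: "\<Union>\<D> \<subseteq> X" using insert.prems(1) by (auto simp: null_opens_def)
  obtain \<kappa> N M where \<kappa>: "\<kappa> \<in> ultra_line" "open N" "K - \<Union>\<D> \<subseteq> N" "\<And>x. x \<in> N \<Longrightarrow> \<kappa> x = 1"
    "compact M" "M \<subseteq> V" "\<And>x. x \<notin> M \<Longrightarrow> \<kappa> x = 0"
    using cutoff_compact[OF K1 V(1) K1V] by metis
  have KX: "K \<subseteq> X" using insert.prems(4) V(2) DX by auto
  have h0: "h x = 0" if "x \<notin> X" for x using insert.prems(5) KX that by blast
  have h1: "(\<lambda>x. \<kappa> x * h x) \<in> ultra_line" by (rule ultra_line_mult[OF \<kappa>(1) insert.prems(2)])
  have h2: "(\<lambda>x. h x - \<kappa> x * h x) \<in> ultra_line" by (rule ultra_line_diff[OF insert.prems(2) h1])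
  have hU: "(\<lambda>x. \<kappa> x * h x) \<in> U" "(\<lambda>x. h x - \<kappa> x * h x) \<in> U"
    using ext_zero_line[OF h1] ext_zero_line[OF h2] by (simp_all add: ext_zero_id h0)
  have "S (\<lambda>x. \<kappa> x * h x) = 0"
  proof (rule V(3)[OF hU(1)])
    have "{x. \<kappa> x * h x \<noteq> 0} \<subseteq> M" using \<kappa>(7) by auto
    hence cl: "closure {x. \<kappa> x * h x \<noteq> 0} \<subseteq> M" by (simp add: closure_minimal \<kappa>(5) compact_imp_closed)
    show "closure {x. \<kappa> x * h x \<noteq> 0} \<subseteq> V" by (rule order_trans[OF cl \<kappa>(6)])
    show "compact (closure {x. \<kappa> x * h x \<noteq> 0})" using closed_Int_compact[OF closed_closure \<kappa>(5)] cl by (metis Int_absorb2)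
  qed
  moreover have "S (\<lambda>x. h x - \<kappa> x * h x) = 0"
  proof (rule insert.IH[OF _ h2])
    show "compact (K - N)" by (rule compact_diff[OF insert.prems(3) \<kappa>(2)])
    show "K - N \<subseteq> \<Union>\<D>" using \<kappa>(3) by blast
    show "h x - \<kappa> x * h x = 0" if "x \<notin> K - N" for x using that insert.prems(5)[of x] \<kappa>(4)[of x] by auto
  qed (use insert.prems(1) in blast)
  moreover have "S (\<lambda>x. \<kappa> x * h x + (h x - \<kappa> x * h x)) = S (\<lambda>x. \<kappa> x * h x) + S (\<lambda>x. h x - \<kappa> x * h x)"
    by (rule bfunctional_linear(1)[OF L hU])
  ultimately show ?case by simp
qed

text \<open>The definition of the support tests only functions with compact support. A general
  \<open>f\<close> is first cut off near \<open>I k\<close>, which does not change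
  \<open>S f\<close>; the rest lives on a compact set that finitely many members of
  \<open>null_opens\<close> cover.\<close>

lemma S_carried: "carried S supp"
  unfolding carried_def
proof (intro ballI allI impI)
  fix f V assume f: "f \<in> U" and V: "open V \<and> supp \<subseteq> V \<and> (\<forall>x\<in>V. f x = 0)"
  obtain q k C where L: "bfunctional S q k C" using S_bounded by blast
  obtain h N M where h: "h \<in> ultra_line" "open N" "I k \<subseteq> N" "\<And>x. x \<in> N \<Longrightarrow> h x = f x" "compact M" "M \<subseteq> X" "\<And>x. x \<notin> M \<Longrightarrow> h x = 0"
    using localize[OF f compact_Icc I_subset] by metis
  obtain \<kappa> N' M' where \<kappa>: "\<kappa> \<in> ultra_line" "open N'" "I k \<subseteq> N'" "\<And>x. x \<in> N' \<Longrightarrow> \<kappa> x = 1"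
    "compact M'" "M' \<subseteq> X" "\<And>x. x \<notin> M' \<Longrightarrow> \<kappa> x = 0"
    using cutoff_compact[OF compact_Icc X_open I_subset] by metis
  define g where "g = (\<lambda>x. \<kappa> x * f x)"
  have g: "g \<in> ultra_line" unfolding g_def by (rule cut_line[OF f \<kappa>(1) \<kappa>(5,6,7)])
  have gU: "g \<in> U" unfolding g_def by (rule U_line_mult[OF f \<kappa>(1)])
  have "S (\<lambda>x. f x - g x) = 0"
    by (rule bfunctional_local[OF L U_diff[OF f gU] \<kappa>(2,3)]) (simp add: g_def \<kappa>(4))
  hence Sfg: "S f = S g" using bfunctional_linear(3)[OF L f gU] by simp
  have K: "compact (M' - V)" using \<kappa>(5) V by (simp add: compact_diff)
  have cov: "M' - V \<subseteq> \<Union>null_opens" using V \<kappa>(6) unfolding supp_eq by blast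
  obtain \<D> where \<D>: "\<D> \<subseteq> null_opens" "finite \<D>" "M' - V \<subseteq> \<Union>\<D>"
    using compactE[OF K cov] by (auto simp: null_opens_def)
  have "S g = 0"
    by (rule null_opens_finite_Union[OF \<D>(2,1) g K \<D>(3)]) (use V \<kappa>(7) in \<open>auto simp: g_def\<close>)
  thus "S f = 0" using Sfg by simp
qed

lemma supp_subset_I: "bfunctional S q k C \<Longrightarrow> supp \<subseteq> I k"
proof -
  assume L: "bfunctional S q k C"
  have "X - I k \<in> null_opens" unfolding null_opens_def
  proof (intro CollectI conjI ballI impI)
    show "open (X - I k)" by (rule open_Diff[OF X_open closed_atLeastAtMost])
    fix f assume f: "f \<in> U" "compact (closure {x. f x \<noteq> 0}) \<and> closure {x. f x \<noteq> 0} \<subseteq> X - I k"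
    show "S f = 0"
      by (rule bfunctional_local[OF L f(1), of "- closure {x. f x \<noteq> 0}"])
        (use f(2) closure_subset[of "{x. f x \<noteq> 0}"] in auto)
  qed auto
  thus ?thesis unfolding supp_eq by blast
qed

lemma supp_compact: "compact supp"
proof -
  obtain q k C where L: "bfunctional S q k C" using S_bounded by blast
  have "supp = I k - \<Union>null_opens" using supp_subset_I[OF L] I_subset[of k] unfolding supp_eq by blast
  thus ?thesis by (auto intro!: compact_diff open_Union simp: null_opens_def)
qed

lemma supp_nonempty: "supp \<noteq> {}"
proof
  assume "supp = {}"
  hence "S f = 0" if "f \<in> U" for f using S_carried that unfolding carried_def by (metis empty_iff empty_subsetI open_empty)
  thus False using S_nonzero by blast
qed

definition "sl = Inf supp"
definition "sr = Sup supp"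

lemma sl_sr: "sl \<in> supp" "sr \<in> supp" "supp \<subseteq> {sl..sr}" "sl \<le> sr"
proof -
  have bd: "bounded supp" "closed supp" using supp_compact by (auto simp: compact_imp_bounded compact_imp_closed)
  hence bdd: "bdd_below supp" "bdd_above supp" by (auto intro: bounded_imp_bdd_below bounded_imp_bdd_above)
  show 1: "sl \<in> supp" "sr \<in> supp" unfolding sl_def sr_def
    using closed_contains_Inf[OF supp_nonempty bdd(1) bd(2)] closed_contains_Sup[OF supp_nonempty bdd(2) bd(2)] by auto
  show 2: "supp \<subseteq> {sl..sr}" unfolding sl_def sr_def using cInf_lower[OF _ bdd(1)] cSup_upper[OF _ bdd(2)] by auto
  show "sl \<le> sr" using 1 2 by auto
qed

lemma ch_supp_eq: "ch_supp \<omega> a c S = {sl..sr}"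
proof
  show "ch_supp \<omega> a c S \<subseteq> {sl..sr}" unfolding ch_supp_def by (rule hull_minimal[where S = convex, OF sl_sr(3) convex_real_interval(5)])
  have "closed_segment sl sr \<subseteq> convex hull supp"
    by (rule closed_segment_subset_convex_hull; rule hull_inc; rule sl_sr)
  thus "{sl..sr} \<subseteq> ch_supp \<omega> a c S" using sl_sr(4) by (simp add: ch_supp_def closed_segment_eq_real_ivl)
qed

lemma supp_X: "supp \<subseteq> X" by (auto simp: supp_eq)

lemma S_carried': "carried S {sl..sr}"
  using S_carried sl_sr(3) unfolding carried_def by (meson order_trans)

lemma nonvanishing_near:
  assumes "e \<in> supp" "\<delta> > 0"
  obtains g where "g \<in> ultra_line" "\<And>x. x \<notin> {e - \<delta>..e + \<delta>} \<Longrightarrow> g x = 0" "\<And>x. x \<notin> X \<Longrightarrow> g x = 0" "S g \<noteq> 0"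
proof -
  let ?V = "{e - \<delta><..<e + \<delta>} \<inter> X"
  have "e \<in> ?V" using assms supp_X by auto
  hence "?V \<notin> null_opens" using assms(1) unfolding supp_eq by blast
  moreover have "open ?V" using X_open by auto
  ultimately obtain g where g: "g \<in> U" "compact (closure {x. g x \<noteq> 0})" "closure {x. g x \<noteq> 0} \<subseteq> ?V" "S g \<noteq> 0"
    unfolding null_opens_def by blast
  have z: "g x = 0" if h: "x \<notin> closure {x. g x \<noteq> 0}" for x
    using contra_subsetD[OF closure_subset h] by simp
  show ?thesis
  proof (rule that[OF _ _ _ g(4)])
    show "g \<in> ultra_line" by (rule U_compact_support[OF g(1,2) _ z]) (use g(3) in blast)
    show "g x = 0" if h: "x \<notin> {e - \<delta>..e + \<delta>}" for x
    proof (rule z)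
      show "x \<notin> closure {x. g x \<noteq> 0}" using subsetD[OF g(3), of x] h by auto
    qed
    show "g x = 0" if h: "x \<notin> X" for x by (rule U_D(1)[OF g(1) h])
  qed
qed

text \<open>A smaller growth rate would, by \<open>transform_growth_right\<close> or
  \<open>transform_growth_left\<close>, make \<open>S\<close> kill every function supported near the
  end point, contrary to the definition of the support. All lower bounds for the transform of
  \<open>S\<close> rest on this one.\<close>

lemma transform_indicator:
  assumes "\<delta> > 0"
  shows "\<exists>y>0. D * exp ((sr - \<delta>) * y) < norm (fourier_laplace a S (\<i> * of_real y))"
    "\<exists>y>0. D * exp ((- sl - \<delta>) * y) < norm (fourier_laplace a S (- (\<i> * of_real y)))"
proof -
  obtain q k C where L: "bfunctional S q k C" using S_bounded by blast
  show "\<exists>y>0. D * exp ((sr - \<delta>) * y) < norm (fourier_laplace a S (\<i> * of_real y))"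
  proof (rule ccontr)
    assume n: "\<not> ?thesis"
    obtain g where g: "g \<in> ultra_line" "\<And>x. x \<notin> {sr - \<delta>..sr + \<delta>} \<Longrightarrow> g x = 0" "\<And>x. x \<notin> X \<Longrightarrow> g x = 0" "S g \<noteq> 0"
      using nonvanishing_near[OF sl_sr(2) assms] by metis
    have b: "norm (fourier_laplace a S (\<i> * of_real y)) \<le> D * exp ((sr - \<delta>) * y)" if "y > 0" for y
      using n that by (meson not_less)
    have "S (ext_zero a g) = 0"
      by (rule transform_growth_right[OF L g(1,2) _ order_refl b]) (use assms in auto)
    moreover have "ext_zero a g = g" by (rule ext_zero_id) (rule g(3))
    ultimately show False using g(4) by simp
  qed
  show "\<exists>y>0. D * exp ((- sl - \<delta>) * y) < norm (fourier_laplace a S (- (\<i> * of_real y)))"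
  proof (rule ccontr)
    assume n: "\<not> ?thesis"
    obtain g where g: "g \<in> ultra_line" "\<And>x. x \<notin> {sl - \<delta>..sl + \<delta>} \<Longrightarrow> g x = 0" "\<And>x. x \<notin> X \<Longrightarrow> g x = 0" "S g \<noteq> 0"
      using nonvanishing_near[OF sl_sr(1) assms] by metis
    have eq: "- (sl + \<delta>) = - sl - \<delta>" by simp
    have b: "norm (fourier_laplace a S (- (\<i> * of_real y))) \<le> D * exp (- (sl + \<delta>) * y)" if "y > 0" for y
      unfolding eq using n that by (meson not_less)
    have "S (ext_zero a g) = 0"
      by (rule transform_growth_left[OF L g(1,2) _ order_refl b]) (use assms in auto)
    moreover have "ext_zero a g = g" by (rule ext_zero_id) (rule g(3))
    ultimately show False using g(4) by simp
  qed
qed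

lemma transform_nonzero: "\<exists>z. fourier_laplace a S z \<noteq> 0"
proof -
  obtain y where "0 * exp ((sr - 1) * y) < norm (fourier_laplace a S (\<i> * of_real y))"
    using transform_indicator(1)[of 1 0] by auto
  thus ?thesis by auto
qed

section \<open>Local convolution as a family of continuous functionals\<close>

text \<open>Two admissible extensions agree near the support and so have the same value under
  \<open>S\<close>, which makes the description by \<open>THE\<close> unambiguous.\<close>

lemma apply_near_supp_eq:
  assumes "h \<in> U" "open V" "supp \<subseteq> V" "\<And>x. x \<in> V \<Longrightarrow> h x = g x"
  shows "apply_near_supp \<omega> a c S g = S h"
  unfolding apply_near_supp_def
proof (rule the_equality)
  show "\<exists>h'\<in>U. \<exists>V. open V \<and> supp \<subseteq> V \<and> (\<forall>x\<in>V. h' x = g x) \<and> S h = S h'" using assms by blast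
  fix v assume "\<exists>h\<in>U. \<exists>V. open V \<and> supp \<subseteq> V \<and> (\<forall>x\<in>V. h x = g x) \<and> v = S h"
  then obtain h' V' where h': "h' \<in> U" "open V'" "supp \<subseteq> V'" "\<And>x. x \<in> V' \<Longrightarrow> h' x = g x" "v = S h'" by blast
  obtain q k C where L: "bfunctional S q k C" using S_bounded by blast
  have "open (V \<inter> V') \<and> supp \<subseteq> V \<inter> V' \<and> (\<forall>x\<in>V \<inter> V'. h' x - h x = 0)" using assms h' by auto
  hence "S (\<lambda>x. h' x - h x) = 0"
    using S_carried[unfolded carried_def, rule_format, OF U_diff[OF h'(1) assms(1)], of "V \<inter> V'"] by simp
  thus "v = S h" unfolding bfunctional_linear(3)[OF L h'(1) assms(1)] h'(5) by simp
qed

lemma local_conv_eq: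
  assumes F: "F \<in> ultra_line" and N: "open N" "{y + sl..y + sr} \<subseteq> N" "\<And>x. x \<in> N \<Longrightarrow> F x = f x"
  shows "local_conv \<omega> a c S f y = conv S F y"
  unfolding local_conv_def conv_def
proof (rule apply_near_supp_eq[OF ext_zero_line[OF ultra_line_shift[OF F]]])
  show "open ((\<lambda>x. x + y) -` N \<inter> X)"
    by (rule open_Int[OF open_vimage[OF N(1)] X_open]) (intro continuous_intros)
  show "supp \<subseteq> (\<lambda>x. x + y) -` N \<inter> X" using N(2) sl_sr(3) supp_X by (auto simp: subset_iff add.commute)
  show "ext_zero a (\<lambda>t. F (t + y)) x = f (x + y)" if "x \<in> (\<lambda>x. x + y) -` N \<inter> X" for x
    using that N(3) by (auto simp: ext_zero_def)
qed

text \<open>At each point the operator is itself a continuous functional; linearity and closedness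
  of the kernel are read off from this. A cut-off makes the translate an element of the space, and
  \<open>I k1\<close> contains its support, so the translated product needs bounds only
  there.\<close>

lemma local_conv_bfunctional:
  assumes y: "{y + sl..y + sr} \<subseteq> X"
  shows "\<exists>q k C. bfunctional (\<lambda>f. local_conv \<omega> a c S f y) q k C"
proof -
  obtain q k C where L: "bfunctional S q k C" using S_bounded by blast
  have q: "q \<in> {0<..<1}" and C0: "C \<ge> 0" using L by (auto simp: bfunctional_def)
  note q' = exponent_midpoint[OF q]
  obtain \<kappa> N M where \<kappa>: "\<kappa> \<in> ultra_line" "open N" "{y + sl..y + sr} \<subseteq> N" "\<And>x. x \<in> N \<Longrightarrow> \<kappa> x = 1"
    "compact M" "M \<subseteq> X" "\<And>x. x \<notin> M \<Longrightarrow> \<kappa> x = 0"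
    using cutoff_compact[OF compact_Icc X_open y] by metis
  let ?\<Lambda> = "\<lambda>f. local_conv \<omega> a c S f y"
  have cl: "(\<lambda>x. \<kappa> x * f x) \<in> ultra_line" if "f \<in> U" for f by (rule cut_line[OF that \<kappa>(1) \<kappa>(5,6,7)])
  have eq: "?\<Lambda> f = S (ext_zero a (\<lambda>t. \<kappa> (t + y) * f (t + y)))" if "f \<in> U" for f
    using local_conv_eq[OF cl[OF that] \<kappa>(2,3), of f] \<kappa>(4) by (simp add: conv_def)
  have cs: "(\<lambda>t. \<kappa> (t + y) * f (t + y)) \<in> ultra_line" if "f \<in> U" for f
    using ultra_line_shift[OF cl[OF that]] .
  obtain k1 where k1: "M \<subseteq> {- c k1<..<c k1}" using compact_in_I[OF \<kappa>(5,6)] by blast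
  obtain C' where C': "C' > 0" "\<And>X Y f g A B. open X \<Longrightarrow> smooth_on_set X f \<Longrightarrow> smooth_on_set X g \<Longrightarrow> Y \<subseteq> X \<Longrightarrow>
     A \<ge> 0 \<Longrightarrow> B \<ge> 0 \<Longrightarrow>
     bdd_seminorm ((q + 1) / 2) Y A f \<Longrightarrow> bdd_seminorm ((q + 1) / 2) Y B g \<Longrightarrow> bdd_seminorm q Y (C' * (A * B)) (\<lambda>x. f x * g x)"
    by (rule bdd_seminorm_mult[of q "(q + 1) / 2"]) (use q q' in auto)
  obtain A where A: "A \<ge> 0" "bdd_seminorm ((q + 1) / 2) (I k1) A \<kappa>"
    by (rule ultra_line_bdd_on[OF \<kappa>(1) conjunct1[OF q'] bounded_closed_interval])
  have "bfunctional ?\<Lambda> ((q + 1) / 2) k1 (C * (C' * A))"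
    unfolding bfunctional_def
  proof (intro conjI ballI allI impI)
    show "(q + 1) / 2 \<in> {0<..<1}" using q' by blast
    show "0 \<le> C * (C' * A)" using C0 C'(1) A(1) by simp
    show "?\<Lambda> (f + g) = ?\<Lambda> f + ?\<Lambda> g" if fg: "f \<in> U" "g \<in> U" for f g
      using line_functional(1)[OF L cs[OF fg(1)] cs[OF fg(2)]]
      by (simp add: eq[OF fg(1)] eq[OF fg(2)] eq[OF U_add[OF fg]] plus_fun_def distrib_left)
    show "?\<Lambda> (cscale u f) = u * ?\<Lambda> f" if f: "f \<in> U" for u f
      using line_functional(3)[OF L cs[OF f], of u]
      by (simp add: eq[OF f] eq[OF U_cmult[OF f]] cscale_def mult.left_commute)
    fix f B assume f: "f \<in> U" and B: "0 \<le> B" "bdd_seminorm ((q + 1) / 2) (I k1) B f"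
    have bd: "bdd_seminorm q (I k1) (C' * (A * B)) (\<lambda>x. \<kappa> x * f x)"
      by (rule C'(2)[OF X_open ultra_lineD(1)[OF \<kappa>(1)] U_D(2)[OF f] I_subset A(1) B(1) A(2) B(2)])
    have "bdd_seminorm q (I k) (C' * (A * B)) (\<lambda>t. \<kappa> (t + y) * f (t + y))"
      unfolding bdd_seminorm_def
    proof (intro allI ballI)
      fix j x
      have n: "nderiv j (\<lambda>t. \<kappa> (t + y) * f (t + y)) x = nderiv j (\<lambda>x. \<kappa> x * f x) (x + y)"
        by (rule nderiv_shift(2)[where f = "\<lambda>x. \<kappa> x * f x", OF open_UNIV ultra_lineD(1)[OF cl[OF f]] UNIV_I])
      show "norm (nderiv j (\<lambda>t. \<kappa> (t + y) * f (t + y)) x) \<le> C' * (A * B) * ywt \<omega> q j"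
      proof (cases "x + y \<in> I k1")
        case True
        thus ?thesis using bd n unfolding bdd_seminorm_def by simp
      next
        case False
        have "nderiv j (\<lambda>x. \<kappa> x * f x) (x + y) = 0"
          by (rule nderiv_zero[of "- M"]) (use False \<kappa>(5,7) k1 in \<open>auto simp: compact_imp_closed open_Compl\<close>)
        thus ?thesis using n C'(1) A(1) B(1) by simp
      qed
    qed
    hence "norm (?\<Lambda> f) \<le> C * (C' * (A * B))" unfolding eq[OF f]
      by (intro line_functional(4)[OF L cs[OF f]]) (use C' A B in auto)
    thus "norm (?\<Lambda> f) \<le> C * (C' * A) * B" by (simp only: mult.assoc)
  qed
  thus ?thesis by blast
qed

end


section \<open>The kernel of a local convolution operator\<close>

lemma derivatives_vanish_iff_less_zorder:
  assumes hol: "f holomorphic_on UNIV" and nz: "f w \<noteq> 0"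
  shows "(\<forall>i\<le>j. (deriv ^^ i) f z = 0) \<longleftrightarrow> int j < zorder f z" "zorder f z \<ge> 0"
proof -
  have ex: "\<exists>i. (deriv ^^ i) f z \<noteq> 0"
  proof (rule ccontr)
    assume "\<not> ?thesis"
    hence "f w = 0"
      by (intro holomorphic_fun_eq_0_on_connected[OF hol open_UNIV connected_UNIV _ UNIV_I UNIV_I]) auto
    thus False using nz by simp
  qed
  define n where "n = (LEAST i. (deriv ^^ i) f z \<noteq> 0)"
  have n: "(deriv ^^ n) f z \<noteq> 0" "\<And>i. i < n \<Longrightarrow> (deriv ^^ i) f z = 0"
    unfolding n_def by (rule LeastI_ex[OF ex]) (use not_less_Least in blast)
  have "zorder f z = int n"
    by (rule zorder_zero_eqI[OF hol open_UNIV UNIV_I]) (use n in auto)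
  moreover have "(\<forall>i\<le>j. (deriv ^^ i) f z = 0) \<longleftrightarrow> j < n"
    using n by (metis le_less_trans not_le)
  ultimately show "(\<forall>i\<le>j. (deriv ^^ i) f z = 0) \<longleftrightarrow> int j < zorder f z" "zorder f z \<ge> 0" by auto
qed

text \<open>At an end point the derivative is determined by one-sided values, provided the interval
  is nondegenerate. This is one place where two admissible translates are needed.\<close>

lemma vector_derivative_zero_on_interval:
  fixes g :: "real \<Rightarrow> complex"
  assumes "\<And>x. (g has_vector_derivative g' x) (at x)" "\<And>x. x \<in> {p..r} \<Longrightarrow> g x = 0" "p < r" "y \<in> {p..r}"
  shows "g' y = 0"
proof -
  have "(g has_vector_derivative g' y) (at y within {p..r})"
    by (rule has_vector_derivative_at_within[OF assms(1)])
  moreover have "(g has_vector_derivative 0) (at y within {p..r})"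
    by (rule has_vector_derivative_transform[OF assms(4) _ has_vector_derivative_const[of 0]]) (use assms(2) in auto)
  moreover have "at y within {p..r} \<noteq> bot" using assms by (simp add: trivial_limit_within islimpt_Icc)
  ultimately show ?thesis using vector_derivative_unique_within by blast
qed

lemma rel_closed_interval_between:
  assumes "rel_closed_interval a J" "x \<in> J" "y \<in> J" shows "{x..y} \<subseteq> J"
proof
  fix z assume "z \<in> {x..y}"
  thus "z \<in> J" using assms mem_is_interval_1_I[of J x y z] by (auto simp: rel_closed_interval_def)
qed

context ultra_space
begin

lemma closure_subset_kernel:
  assumes L: "bfunctional L q k C" and M: "\<And>m. m \<in> M \<Longrightarrow> m \<in> U \<Longrightarrow> L m = 0"
    and f: "f \<in> ultratop \<omega> a c closure_of M"
  shows "L f = 0"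
proof -
  have q: "q \<in> {0<..<1}" and C: "C \<ge> 0" using L by (auto simp: bfunctional_def)
  have fU: "f \<in> U" and cl: "\<And>e. e > 0 \<Longrightarrow> \<exists>m\<in>M \<inter> U. useminorm \<omega> c q k (m - f) < ennreal e"
    using f q unfolding in_closure_iff by blast+
  have "norm (L f) \<le> C * e" if e: "e > 0" for e
  proof -
    obtain m where m: "m \<in> M" "m \<in> U" "useminorm \<omega> c q k (m - f) < ennreal e" using cl[OF e] by blast
    have "bdd_seminorm q (I k) e (m - f)" using useminorm_le_iff[of e q k "m - f"] less_imp_le[OF m(3)] e by simp
    hence "norm (L (\<lambda>x. m x - f x)) \<le> C * e"
      using bfunctional_linear(5)[OF L U_diff[OF m(2) fU], of e] e by (simp add: fun_diff_def)
    thus ?thesis using bfunctional_linear(3)[OF L m(2) fU] M[OF m(1,2)] by simp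
  qed
  hence "norm (L f) \<le> 0"
  proof (cases "C = 0")
    case True
    thus ?thesis using \<open>\<And>e. e > 0 \<Longrightarrow> norm (L f) \<le> C * e\<close>[of 1] by simp
  next
    case False
    show ?thesis
    proof (rule field_le_epsilon)
      fix e :: real assume "e > 0"
      thus "norm (L f) \<le> 0 + e" using \<open>\<And>e. e > 0 \<Longrightarrow> norm (L f) \<le> C * e\<close>[of "e / C"] False C by simp
    qed
  qed
  thus ?thesis by simp
qed

end

locale local_convolution = dual_functional +
  fixes J :: "real set"
  assumes J: "rel_closed_interval a J"
    and G_two: "\<exists>y1\<in>geom_diff J (ch_supp \<omega> a c S). \<exists>y2\<in>geom_diff J (ch_supp \<omega> a c S). y1 < y2"
begin

abbreviation "W \<equiv> local_conv_kernel \<omega> a c S J"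

definition "G = geom_diff J {sl..sr}"

lemma G_eq: "geom_diff J (ch_supp \<omega> a c S) = G"
  by (simp add: G_def ch_supp_eq)

lemma J_X: "J \<subseteq> X" using J closedin_imp_subset by (auto simp: rel_closed_interval_def)

lemmas J_between = rel_closed_interval_between[OF J]

lemma G_iff: "y \<in> G \<longleftrightarrow> {y + sl..y + sr} \<subseteq> J"
  by (simp add: G_def geom_diff_def image_add_atLeastAtMost add.commute)

lemma G_iff': "y \<in> G \<longleftrightarrow> y + sl \<in> J \<and> y + sr \<in> J"
  unfolding G_iff using sl_sr(4) J_between[of "y + sl" "y + sr"] by auto

lemma G_between: "y \<in> G \<Longrightarrow> y' \<in> G \<Longrightarrow> {y..y'} \<subseteq> G"
proof
  fix z assume h: "y \<in> G" "y' \<in> G" "z \<in> {y..y'}"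
  have "z + sl \<in> J" "z + sr \<in> J"
    using J_between[of "y + sl" "y' + sl"] J_between[of "y + sr" "y' + sr"] h by (auto simp: G_iff')
  thus "z \<in> G" by (simp add: G_iff')
qed

lemma G_segment:
  assumes "y \<in> G" obtains y1 y2 where "y1 \<in> G" "y2 \<in> G" "y1 < y2" "y \<in> {y1..y2}"
proof -
  obtain z1 z2 where z: "z1 \<in> G" "z2 \<in> G" "z1 < z2" using G_two unfolding G_eq by blast
  show ?thesis
  proof (cases "y < z2")
    case True
    thus ?thesis using that[of y z2] assms z by auto
  next
    case False
    thus ?thesis using that[of z1 y] assms z by auto
  qed
qed

lemma W_iff: "f \<in> W \<longleftrightarrow> f \<in> U \<and> (\<forall>y\<in>G. local_conv \<omega> a c S f y = 0)"
  by (simp add: local_conv_kernel_def G_eq)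

lemma localize_segment:
  assumes f: "f \<in> U" and y: "y1 \<in> G" "y2 \<in> G" "y1 \<le> y2"
  obtains F N where "F \<in> ultra_line" "open N" "{y1 + sl..y2 + sr} \<subseteq> N" "\<And>x. x \<in> N \<Longrightarrow> F x = f x"
    "\<And>z. z \<in> {y1..y2} \<Longrightarrow> local_conv \<omega> a c S f z = conv S F z"
proof -
  have "{y1 + sl..y2 + sr} \<subseteq> X" using y J_X J_between[of "y1 + sl" "y2 + sr"] by (auto simp: G_iff')
  then obtain F N L where F: "F \<in> ultra_line" "open N" "{y1 + sl..y2 + sr} \<subseteq> N" "\<And>x. x \<in> N \<Longrightarrow> F x = f x"
    using localize[OF f compact_Icc] by metis
  show ?thesis
  proof (rule that[OF F])
    fix z assume "z \<in> {y1..y2}"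
    hence "{z + sl..z + sr} \<subseteq> N" by (intro order_trans[OF _ F(3)]) auto
    thus "local_conv \<omega> a c S f z = conv S F z" by (rule local_conv_eq[OF F(1,2) _ F(4)])
  qed
qed

lemma G_bfunctional: "y \<in> G \<Longrightarrow> \<exists>q k C. bfunctional (\<lambda>f. local_conv \<omega> a c S f y) q k C"
  by (rule local_conv_bfunctional) (use J_X in \<open>auto simp: G_iff\<close>)

lemma W_subspace: "cfun_subspace W"
  unfolding cfun.subspace_def
proof (intro conjI ballI allI)
  show "0 \<in> W" unfolding W_iff
  proof (intro conjI ballI U_fun_ops)
    fix y assume "y \<in> G"
    then obtain q k C where "bfunctional (\<lambda>f. local_conv \<omega> a c S f y) q k C" using G_bfunctional by blast
    from bfunctional_linear(4)[OF this] show "local_conv \<omega> a c S 0 y = 0" by (simp add: zero_fun_def)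
  qed
  fix f assume f: "f \<in> W"
  show "f + g \<in> W" if g: "g \<in> W" for g unfolding W_iff
  proof (intro conjI ballI)
    show "f + g \<in> U" using f g by (simp add: W_iff U_fun_ops)
    fix y assume "y \<in> G"
    then obtain q k C where "bfunctional (\<lambda>f. local_conv \<omega> a c S f y) q k C" using G_bfunctional by blast
    thus "local_conv \<omega> a c S (f + g) y = 0" using f g \<open>y \<in> G\<close> by (auto simp: W_iff bfunctional_def)
  qed
  show "cscale u f \<in> W" for u unfolding W_iff
  proof (intro conjI ballI)
    show "cscale u f \<in> U" using f by (simp add: W_iff U_fun_ops)
    fix y assume "y \<in> G"
    then obtain q k C where "bfunctional (\<lambda>f. local_conv \<omega> a c S f y) q k C" using G_bfunctional by blast
    thus "local_conv \<omega> a c S (cscale u f) y = 0" using f \<open>y \<in> G\<close> by (auto simp: W_iff bfunctional_def)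
  qed
qed

lemma W_closure: "ultratop \<omega> a c closure_of W \<subseteq> W"
proof
  fix f assume f: "f \<in> ultratop \<omega> a c closure_of W"
  show "f \<in> W" unfolding W_iff
  proof (intro conjI ballI)
    show "f \<in> U" using f in_closure_iff by blast
    fix y assume y: "y \<in> G"
    then obtain q k C where "bfunctional (\<lambda>f. local_conv \<omega> a c S f y) q k C" using G_bfunctional by blast
    thus "local_conv \<omega> a c S f y = 0" by (rule closure_subset_kernel[OF _ _ f]) (use y in \<open>simp add: W_iff\<close>)
  qed
qed

lemma W_closed: "closedin (ultratop \<omega> a c) W"
proof -
  have "W \<subseteq> topspace (ultratop \<omega> a c)" unfolding topspace_ultratop by (auto simp: W_iff)
  thus ?thesis using W_closure closure_of_subset_eq[of W "ultratop \<omega> a c"] by blast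
qed

text \<open>\<open>conv\<close> commutes with differentiation, and \<open>conv S F\<close> vanishes
  on a nondegenerate segment around or next to \<open>y\<close>, so its derivative vanishes there
  too.\<close>

lemma W_derivative:
  assumes f: "f \<in> W" shows "ext_zero a (\<lambda>x. vector_derivative f (at x)) \<in> W"
proof -
  have eq: "(\<lambda>x. vector_derivative f (at x)) = nderiv 1 f" by (simp add: nderiv_def)
  have fU: "f \<in> U" using f by (simp add: W_iff)
  show ?thesis unfolding eq W_iff
  proof (intro conjI ballI)
    show "ext_zero a (nderiv 1 f) \<in> U" by (rule deriv_U[OF fU])
    fix y assume y: "y \<in> G"
    obtain y1 y2 where y12: "y1 \<in> G" "y2 \<in> G" "y1 < y2" "y \<in> {y1..y2}" by (rule G_segment[OF y])
    obtain F N where F: "F \<in> ultra_line" "open N" "{y1 + sl..y2 + sr} \<subseteq> N" "\<And>x. x \<in> N \<Longrightarrow> F x = f x"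
      "\<And>z. z \<in> {y1..y2} \<Longrightarrow> local_conv \<omega> a c S f z = conv S F z"
      using localize_segment[OF fU y12(1,2) less_imp_le[OF y12(3)]] by metis
    obtain q k C where L: "bfunctional S q k C" using S_bounded by blast
    have z0: "conv S F z = 0" if z: "z \<in> {y1..y2}" for z
      using F(5)[OF z] f G_between[OF y12(1,2)] z by (auto simp: W_iff)
    have d0: "conv S (nderiv 1 F) y = 0"
      by (rule vector_derivative_zero_on_interval[OF conv_derivative[OF L F(1)] z0 y12(3,4)])
    have "local_conv \<omega> a c S (ext_zero a (nderiv 1 f)) y = conv S (nderiv 1 F) y"
    proof (rule local_conv_eq[OF ultra_line_nderiv1[OF F(1)] open_Int[OF F(2) X_open]])
      have "{y + sl..y + sr} \<subseteq> N" by (rule order_trans[OF _ F(3)]) (use y12 in auto)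
      moreover have "{y + sl..y + sr} \<subseteq> X" using y J_X by (auto simp: G_iff)
      ultimately show "{y + sl..y + sr} \<subseteq> N \<inter> X" by blast
      fix x assume x: "x \<in> N \<inter> X"
      have "nderiv 1 F x = nderiv 1 f x"
        by (rule smooth_cong(2)[OF open_Int[OF F(2) X_open]])
          (use x F(4) smooth_on_set_subset[OF U_D(2)[OF fU], of "N \<inter> X"] in auto)
      thus "nderiv 1 F x = ext_zero a (nderiv 1 f) x" using x by (simp add: ext_zero_def)
    qed
    thus "local_conv \<omega> a c S (ext_zero a (nderiv 1 f)) y = 0" using d0 by simp
  qed
qed

lemma W_invariant: "D_invariant \<omega> a c W"
  unfolding D_invariant_def using W_subspace W_closed W_derivative by blast

section \<open>The residual interval\<close>

text \<open>\<open>f\<close> vanishes on \<open>J\<close> but perhaps not near it, and a translate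
  of the support may touch an end of \<open>J\<close>. For \<open>y\<close> inside a segment of
  \<open>G\<close>, \<open>f\<close> does vanish near the translated support; the ends of the
  segment follow by continuity.\<close>

lemma vanishing_subset_W: "vanishing_on \<omega> a c J \<subseteq> W"
proof
  fix f assume "f \<in> vanishing_on \<omega> a c J"
  hence fU: "f \<in> U" and f0: "\<And>x. x \<in> J \<Longrightarrow> f x = 0" by (auto simp: vanishing_on_def)
  show "f \<in> W" unfolding W_iff
  proof (intro conjI ballI fU)
    fix y assume y: "y \<in> G"
    obtain y1 y2 where y12: "y1 \<in> G" "y2 \<in> G" "y1 < y2" "y \<in> {y1..y2}" by (rule G_segment[OF y])
    obtain F N where F: "F \<in> ultra_line" "open N" "{y1 + sl..y2 + sr} \<subseteq> N" "\<And>x. x \<in> N \<Longrightarrow> F x = f x"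
      "\<And>z. z \<in> {y1..y2} \<Longrightarrow> local_conv \<omega> a c S f z = conv S F z"
      using localize_segment[OF fU y12(1,2) less_imp_le[OF y12(3)]] by metis
    obtain q k C where L: "bfunctional S q k C" using S_bounded by blast
    have JJ: "{y1 + sl..y2 + sr} \<subseteq> J" using J_between[of "y1 + sl" "y2 + sr"] y12 by (auto simp: G_iff')
    have z0: "conv S F z = 0" if z: "z \<in> {y1<..<y2}" for z
      unfolding conv_def
    proof (rule carriedD[OF S_carried' ultra_line_shift[OF F(1)], of "{y1 - z + sl<..<y2 - z + sr}"])
      show "F (x + z) = 0" if "x \<in> {y1 - z + sl<..<y2 - z + sr}" for x
      proof -
        have "x + z \<in> {y1 + sl..y2 + sr}" using that by auto
        thus ?thesis using F(3,4) f0 JJ by (metis subsetD)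
      qed
    qed (use z in auto)
    have "conv S F y = 0"
    proof (rule continuous_constant_on_closure[of "{y1<..<y2}" "conv S F"])
      show "continuous_on (closure {y1<..<y2}) (conv S F)" by (rule continuous_on_subset[OF conv_continuous[OF L F(1)]]) simp
      show "y \<in> closure {y1<..<y2}" using y12 by simp
    qed (rule z0)
    thus "local_conv \<omega> a c S f y = 0" using F(5)[OF y12(4)] by simp
  qed
qed

text \<open>Some admissible translate puts \<open>sl\<close> or \<open>sr\<close> outside
  \<open>J'\<close>; a function near that end point which \<open>S\<close> does not kill, moved by
  this translate, vanishes on \<open>J'\<close> and lies outside \<open>W\<close>. Sets
  \<open>J'\<close> that are not contained in \<open>J\<close> are included because uniqueness of
  the residual interval needs them.\<close>

lemma not_vanishing_subset_W:
  assumes J': "rel_closed_interval a J'" and sub: "\<not> J \<subseteq> J'"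
  shows "vanishing_on \<omega> a c J' - W \<noteq> {}"
proof -
  obtain x where x: "x \<in> J" "x \<notin> J'" using sub by blast
  note iv = rel_closed_interval_between[OF J']
  obtain y where y: "y \<in> G" using G_two unfolding G_eq by blast
  have yJ: "y + sl \<in> J" "y + sr \<in> J" using y by (auto simp: G_iff')
  have "\<exists>y0\<in>G. \<exists>e\<in>{sl, sr}. y0 + e \<notin> J'"
  proof -
    consider "x \<le> y + sl" | "y + sr \<le> x" | "y + sl < x" "x < y + sr" by linarith
    thus ?thesis
    proof cases
      case 1
      have "x - sl + sr \<in> J" using J_between[OF x(1) yJ(2)] 1 sl_sr(4) by auto
      hence "x - sl \<in> G" using x by (simp add: G_iff')
      thus ?thesis using x by (intro bexI[of _ "x - sl"] bexI[of _ sl]) auto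
    next
      case 2
      have "x - sr + sl \<in> J" using J_between[OF yJ(1) x(1)] 2 sl_sr(4) by auto
      hence "x - sr \<in> G" using x by (simp add: G_iff')
      thus ?thesis using x by (intro bexI[of _ "x - sr"] bexI[of _ sr]) auto
    next
      \<comment> \<open>\<open>x\<close> lies strictly between the two ends of the translate, so an
        interval that misses \<open>x\<close> misses one of them.\<close>
      case 3
      have "y + sl \<notin> J' \<or> y + sr \<notin> J'" 
        using subsetD[OF iv[of "y + sl" "y + sr"], of x] x(2) 3 by auto
      thus ?thesis using y by blast
    qed
  qed
  then obtain y0 e where y0: "y0 \<in> G" "e \<in> supp" "y0 + e \<notin> J'" "y0 + e \<in> J"
    using sl_sr(1,2) by (auto simp: G_iff')
  obtain T where T: "closed T" "J' = X \<inter> T" using J' by (auto simp: rel_closed_interval_def closedin_closed)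
  have "y0 + e \<in> X - T" using y0 T J_X by auto
  moreover have "open (X - T)" using X_open T(1) by (rule open_Diff)
  ultimately obtain \<delta> where \<delta>: "\<delta> > 0" "cball (y0 + e) \<delta> \<subseteq> X - T" by (meson open_contains_cball)
  obtain g where g: "g \<in> ultra_line" "\<And>x. x \<notin> {e - \<delta>..e + \<delta>} \<Longrightarrow> g x = 0" "\<And>x. x \<notin> X \<Longrightarrow> g x = 0" "S g \<noteq> 0"
    using nonvanishing_near[OF y0(2) \<delta>(1)] by metis
  define f where "f x = g (x + (- y0))" for x
  have fl: "f \<in> ultra_line" unfolding f_def[abs_def] by (rule ultra_line_shift[OF g(1)])
  have f0: "f x = 0" if "x \<notin> X - T" for x
  proof -
    have "x \<notin> cball (y0 + e) \<delta>" using \<delta>(2) that by blast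
    hence "x + - y0 \<notin> {e - \<delta>..e + \<delta>}" by (auto simp: dist_real_def abs_le_iff)
    thus ?thesis unfolding f_def by (rule g(2))
  qed
  have "ext_zero a f = f" by (rule ext_zero_id) (rule f0, blast)
  hence fU: "f \<in> U" using ext_zero_line[OF fl] by simp
  have "local_conv \<omega> a c S f y0 = conv S f y0"
    by (rule local_conv_eq[OF fl open_UNIV]) auto
  also have "\<dots> = S (ext_zero a g)" by (simp add: conv_def f_def)
  also have "ext_zero a g = g" by (rule ext_zero_id) (rule g(3))
  finally have "f \<notin> W" using y0(1) g(4) unfolding W_iff by (metis (no_types))
  moreover have "f \<in> vanishing_on \<omega> a c J'" using fU f0 T by (auto simp: vanishing_on_def)
  ultimately show ?thesis by blast
qed

lemma W_residual: "is_residual_interval \<omega> a c W J" "residual_interval \<omega> a c W = J"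
proof -
  show 1: "is_residual_interval \<omega> a c W J" unfolding is_residual_interval_def
  proof (intro conjI allI impI)
    fix J' assume "rel_closed_interval a J' \<and> J' \<subset> J"
    thus "vanishing_on \<omega> a c J' - W \<noteq> {}" by (intro not_vanishing_subset_W) auto
  qed (use J vanishing_subset_W in auto)
  show "residual_interval \<omega> a c W = J" unfolding residual_interval_def
  proof (rule the_equality[of "is_residual_interval \<omega> a c W", OF 1])
    fix J' assume J': "is_residual_interval \<omega> a c W J'"
    hence "J \<subseteq> J'" using not_vanishing_subset_W[of J'] by (auto simp: is_residual_interval_def)
    moreover have "\<not> J \<subset> J'" using J' J vanishing_subset_W by (auto simp: is_residual_interval_def)
    ultimately show "J' = J" by blast
  qed
qed

section \<open>Exponential monomials in the kernel\<close>

lemma local_conv_monomial: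
  assumes y: "y \<in> G"
  shows "local_conv \<omega> a c S (exp_monomial a j \<mu>) y =
    exp (- \<i> * \<mu> * of_real y) * (\<Sum>i\<le>j. (of_nat (j choose i) * S (exp_monomial a i \<mu>)) * of_real y ^ (j - i))"
proof -
  obtain q k C where L: "bfunctional S q k C" using S_bounded by blast
  define F where "F j t = of_real t ^ j * exp ((- \<i> * \<mu>) * of_real t)" for j and t :: real
  have F: "F j \<in> ultra_line" for j unfolding F_def[abs_def] by (rule ultra_line_monomial)
  have e: "exp_monomial a j \<mu> = ext_zero a (F j)" for j by (simp add: exp_monomial_def F_def[abs_def])
  have "local_conv \<omega> a c S (exp_monomial a j \<mu>) y = conv S (F j) y" unfolding e
    by (rule local_conv_eq[OF F X_open]) (use y J_X in \<open>auto simp: G_iff ext_zero_def\<close>)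
  also have "(\<lambda>t. F j (t + y)) = (\<lambda>t. \<Sum>i\<le>j. (exp (- \<i> * \<mu> * of_real y) * (of_nat (j choose i) * of_real y ^ (j - i))) * F i t)"
    by (simp add: F_def fun_eq_iff binomial_ring ring_distribs exp_add exp_diff exp_minus sum_distrib_left sum_distrib_right field_simps)
  hence "conv S (F j) y = S (ext_zero a (\<lambda>t. \<Sum>i\<le>j. (exp (- \<i> * \<mu> * of_real y) * (of_nat (j choose i) * of_real y ^ (j - i))) * F i t))"
    by (simp add: conv_def)
  also have "ext_zero a (\<lambda>t. \<Sum>i\<le>j. (exp (- \<i> * \<mu> * of_real y) * (of_nat (j choose i) * of_real y ^ (j - i))) * F i t)
     = (\<lambda>t. \<Sum>i\<le>j. (exp (- \<i> * \<mu> * of_real y) * (of_nat (j choose i) * of_real y ^ (j - i))) * exp_monomial a i \<mu> t)"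
    by (auto simp: ext_zero_def e fun_eq_iff)
  also have "S \<dots> = (\<Sum>i\<le>j. S (\<lambda>t. (exp (- \<i> * \<mu> * of_real y) * (of_nat (j choose i) * of_real y ^ (j - i))) * exp_monomial a i \<mu> t))"
    by (intro bfunctional_sum[OF L, THEN conjunct2] U_cmult exp_monomial_U) auto
  also have "\<dots> = (\<Sum>i\<le>j. (exp (- \<i> * \<mu> * of_real y) * (of_nat (j choose i) * of_real y ^ (j - i))) * S (exp_monomial a i \<mu>))"
    by (intro sum.cong refl bfunctional_linear(2)[OF L] exp_monomial_U)
  finally show ?thesis by (simp add: sum_distrib_left mult_ac)
qed

lemma monomial_in_W_iff: "exp_monomial a j \<mu> \<in> W \<longleftrightarrow> (\<forall>i\<le>j. (deriv ^^ i) (fourier_laplace a S) \<mu> = 0)"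
proof -
  obtain q k C where L: "bfunctional S q k C" using S_bounded by blast
  have der: "(deriv ^^ i) (fourier_laplace a S) \<mu> = 0 \<longleftrightarrow> S (exp_monomial a i \<mu>) = 0" for i
    unfolding fourier_laplace_deriv(1)[OF L] by simp
  have "exp_monomial a j \<mu> \<in> W \<longleftrightarrow> (\<forall>y\<in>G. (\<Sum>i\<le>j. (of_nat (j choose i) * S (exp_monomial a i \<mu>)) * of_real y ^ (j - i)) = 0)"
    unfolding W_iff using exp_monomial_U by (auto simp: local_conv_monomial)
  also have "\<dots> \<longleftrightarrow> (\<forall>i\<le>j. S (exp_monomial a i \<mu>) = 0)"
  proof
    assume h: "\<forall>y\<in>G. (\<Sum>i\<le>j. (of_nat (j choose i) * S (exp_monomial a i \<mu>)) * of_real y ^ (j - i)) = 0"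
    define d where "d i = of_nat (j choose (j - i)) * S (exp_monomial a (j - i) \<mu>)" for i
    have d: "(\<Sum>i\<le>j. d i * of_real y ^ i) = 0" if "y \<in> G" for y
    proof -
      have "(\<Sum>i\<le>j. d i * of_real y ^ i) = (\<Sum>i\<le>j. (of_nat (j choose i) * S (exp_monomial a i \<mu>)) * of_real y ^ (j - i))"
        by (rule sum.reindex_bij_witness[of _ "\<lambda>i. j - i" "\<lambda>i. j - i"]) (auto simp: d_def)
      thus ?thesis using h that by simp
    qed
    \<comment> \<open>Two points of \<open>G\<close> give a whole segment, hence infinitely many
      roots, so every coefficient of the polynomial vanishes.\<close>
    obtain y1 y2 where y: "y1 \<in> G" "y2 \<in> G" "y1 < y2" using G_two unfolding G_eq by blast
    have "infinite (complex_of_real ` {y1..y2})"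
      using infinite_Icc[OF y(3)] by (simp add: finite_image_iff inj_on_def)
    moreover have "complex_of_real ` {y1..y2} \<subseteq> {z. (\<Sum>i\<le>j. d i * z ^ i) = 0}"
      using d G_between[OF y(1,2)] by auto
    ultimately have "infinite {z. (\<Sum>i\<le>j. d i * z ^ i) = 0}" using infinite_super by blast
    hence "\<forall>i\<le>j. d i = 0" using polyfun_finite_roots[of d j] by blast
    hence "d (j - i) = 0" for i by simp
    show "\<forall>i\<le>j. S (exp_monomial a i \<mu>) = 0"
    proof (intro allI impI)
      fix i assume "i \<le> j"
      thus "S (exp_monomial a i \<mu>) = 0" using \<open>d (j - i) = 0\<close> by (simp add: d_def)
    qed
  qed auto
  finally show ?thesis by (simp add: der)
qed

lemma W_exponents: "exponents a W (zero_set (fourier_laplace a S))"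
proof -
  let ?\<phi> = "fourier_laplace a S"
  obtain q k C where L: "bfunctional S q k C" using S_bounded by blast
  obtain w where w: "?\<phi> w \<noteq> 0" using transform_nonzero by blast
  note hol = fourier_laplace_deriv(2)[OF L]
  note zo = derivatives_vanish_iff_less_zorder[OF hol w]
  have inj: "inj_on fst (zero_set ?\<phi>)" by (auto simp: inj_on_def zero_set_def)
  have "countable {z. ?\<phi> z = 0}"
  proof (rule ccontr)
    assume "uncountable {z. ?\<phi> z = 0}"
    hence "?\<phi> = (\<lambda>z. 0)" using holomorphic_countable_equal_UNIV[OF hol, of "\<lambda>z. 0"] by simp
    thus False using w by (simp add: fun_eq_iff)
  qed
  hence "countable (fst ` zero_set ?\<phi>)" by (rule countable_subset[rotated]) (auto simp: zero_set_def)
  hence cnt: "countable (zero_set ?\<phi>)" using inj by (simp add: countable_image_inj_eq)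
  have pos: "1 \<le> m" if "(\<mu>, m) \<in> zero_set ?\<phi>" for \<mu> m
    using that zo(1)[of 0 \<mu>] by (auto simp: zero_set_def)
  have iff: "exp_monomial a j \<mu> \<in> W \<longleftrightarrow> (\<exists>m. (\<mu>, m) \<in> zero_set ?\<phi> \<and> j < m)" for j \<mu>
  proof -
    have "exp_monomial a j \<mu> \<in> W \<longleftrightarrow> int j < zorder ?\<phi> \<mu>" unfolding monomial_in_W_iff zo(1) ..
    also have "\<dots> \<longleftrightarrow> (\<exists>m. (\<mu>, m) \<in> zero_set ?\<phi> \<and> j < m)"
    proof
      assume j: "int j < zorder ?\<phi> \<mu>"
      hence "?\<phi> \<mu> = 0" using zo(1)[of 0 \<mu>] by simp
      thus "\<exists>m. (\<mu>, m) \<in> zero_set ?\<phi> \<and> j < m" using j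
        by (intro exI[of _ "nat (zorder ?\<phi> \<mu>)"]) (auto simp: zero_set_def)
    qed (auto simp: zero_set_def)
    finally show ?thesis .
  qed
  have "Exp_of a W = {exp_monomial a j \<mu> | j \<mu> m. (\<mu>, m) \<in> zero_set ?\<phi> \<and> j < m}"
    unfolding Exp_of_def using iff by blast
  thus ?thesis unfolding exponents_def using cnt inj pos by auto
qed

end


section \<open>Weak spectral synthesis\<close>

context ultra_space
begin

text \<open>A real-valued seminorm for the Hahn-Banach theorem. It is faithful on \<open>U\<close>,
  where \<open>useminorm\<close> is finite; elsewhere \<open>enn2real\<close> may turn infinity into
  0.\<close>

definition sn :: "real \<Rightarrow> nat \<Rightarrow> (real \<Rightarrow> complex) \<Rightarrow> real" where
  "sn q k f = enn2real (useminorm \<omega> c q k f)"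

lemma useminorm_sn:
  assumes "f \<in> U" "q \<in> {0<..<1}" shows "useminorm \<omega> c q k f = ennreal (sn q k f)" "sn q k f \<ge> 0"
proof -
  have "useminorm \<omega> c q k f < \<infinity>" using U_D(3)[OF assms, of k] useminorm_finite_iff by blast
  thus "useminorm \<omega> c q k f = ennreal (sn q k f)" "sn q k f \<ge> 0" by (auto simp: sn_def less_top)
qed

lemma sn_le_iff:
  assumes "f \<in> U" "q \<in> {0<..<1}" "B \<ge> 0" shows "sn q k f \<le> B \<longleftrightarrow> bdd_seminorm q (I k) B f"
  using useminorm_le_iff[OF assms(3), of q k f] useminorm_sn[OF assms(1,2), of k] assms(3) by simp

lemma sn_triangle:
  assumes "f \<in> U" "g \<in> U" "q \<in> {0<..<1}" shows "sn q k (f + g) \<le> sn q k f + sn q k g"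
  using useminorm_triangle[OF assms, of k] useminorm_sn[OF _ assms(3), of _ k] assms U_fun_ops(1)[OF assms(1,2)]
  by (simp flip: ennreal_plus)

lemma sn_scale:
  assumes f: "f \<in> U" and q: "q \<in> {0<..<1}" shows "sn q k (cscale u f) = norm u * sn q k f"
proof -
  have le: "sn q k (cscale u f) \<le> norm u * sn q k f" if f: "f \<in> U" for u f
  proof -
    have "bdd_seminorm q (I k) (sn q k f) f" using sn_le_iff[OF f q useminorm_sn(2)[OF f q]] by blast
    hence "bdd_seminorm q (I k) (norm u * sn q k f) (\<lambda>x. u * f x)"
      by (rule bdd_seminorm_cmult[OF X_open U_D(2)[OF f] I_subset])
    thus ?thesis using sn_le_iff[OF U_fun_ops(2)[OF f] q, of "norm u * sn q k f" k u] useminorm_sn(2)[OF f q]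
      by (simp add: cscale_def)
  qed
  show ?thesis
  proof (cases "u = 0")
    case True
    thus ?thesis using le[OF f, of u] useminorm_sn(2)[OF U_fun_ops(2)[OF f] q, of k u] by simp
  next
    case False
    have "cscale (1 / u) (cscale u f) = f" using False by (simp add: cscale_def)
    hence "sn q k f \<le> norm (1 / u) * sn q k (cscale u f)" using le[OF U_fun_ops(2)[OF f], of "1 / u" u] by simp
    hence "norm u * sn q k f \<le> sn q k (cscale u f)" using False by (simp add: norm_divide field_simps)
    thus ?thesis using le[OF f, of u] by simp
  qed
qed

lemma closure_if_annihilated:
  assumes M: "cfun_subspace M" "M \<subseteq> U" and f: "f \<in> U"
    and ann: "\<And>T q k C. bfunctional T q k C \<Longrightarrow> (\<And>m. m \<in> M \<Longrightarrow> T m = 0) \<Longrightarrow> T f = 0"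
  shows "f \<in> ultratop \<omega> a c closure_of M"
proof (rule ccontr)
  assume "\<not> ?thesis"
  then obtain q k e where q: "q \<in> {0<..<1}" and e: "e > 0" and far: "\<And>m. m \<in> M \<inter> U \<Longrightarrow> \<not> useminorm \<omega> c q k (m - f) < ennreal e"
    using f unfolding in_closure_iff by blast
  interpret complex_vector_space cscale U
    by unfold_locales (use U_subspace in \<open>simp add: cfun_subspace_def\<close>)
  obtain T where T: "\<And>x y. x \<in> U \<Longrightarrow> y \<in> U \<Longrightarrow> T (x + y) = T x + T y"
    "\<And>x u. x \<in> U \<Longrightarrow> T (cscale u x) = u * T x" "\<And>x. x \<in> U \<Longrightarrow> norm (T x) \<le> sn q k x"
    "\<And>x. x \<in> M \<Longrightarrow> T x = 0" "T f \<noteq> (0::complex)"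
  proof (rule Hahn_Banach_separation[where p = "sn q k" and M = M and f = f and e = e])
    show "0 \<le> sn q k x" if "x \<in> U" for x by (rule useminorm_sn(2)[OF that q])
    show "sn q k (x + y) \<le> sn q k x + sn q k y" if "x \<in> U" "y \<in> U" for x y by (rule sn_triangle[OF that q])
    show "sn q k (cscale u x) = norm u * sn q k x" if "x \<in> U" for x u by (rule sn_scale[OF that q])
    show "cfun_subspace M" by (rule M(1))
    show "e \<le> sn q k (m - f)" if m: "m \<in> M" for m
    proof -
      have mU: "m - f \<in> U" using m M(2) f U_fun_ops(3) by blast
      have "\<not> ennreal (sn q k (m - f)) < ennreal e" using far[of m] m M(2) useminorm_sn(1)[OF mU q, of k] by auto
      thus ?thesis using e by (simp add: ennreal_less_iff[OF useminorm_sn(2)[OF mU q]] not_less)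
    qed
  qed (use M f e in auto)
  have bd: "norm (T g) \<le> 1 * B" if "g \<in> U" "B \<ge> 0" "bdd_seminorm q (I k) B g" for g B
    using order_trans[OF T(3)[OF that(1)] sn_le_iff[OF that(1) q that(2), THEN iffD2, OF that(3)]] by simp
  have "bfunctional T q k 1" unfolding bfunctional_def using q T(1,2) bd by auto
  thus False using ann[of T q k 1] T(4,5) by blast
qed

section \<open>Functionals that annihilate the monomials and the functions vanishing on the
  interval\<close>

text \<open>The transform of \<open>L\<close> alone may grow along the real axis. Times the
  transform of \<open>F\<close> it is the transform of the continuous function
  \<open>conv L F\<close> over a bounded interval, hence bounded on the real axis, at the price of
  \<open>\<epsilon>\<close> in the exponents.\<close>

lemma transform_multiplier_bounds:
  assumes L: "bfunctional L q k C" and supp: "carried L {A..B}" and AB: "A \<le> B"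
    and F: "F \<in> ultra_line" and z: "\<And>x. x \<notin> {-\<delta>..\<delta>} \<Longrightarrow> F x = 0" and \<delta>: "0 < \<delta>" "\<delta> < \<epsilon>"
  shows "\<exists>K>0. \<forall>w. (Im w \<ge> 0 \<longrightarrow> norm (fourier_laplace a L w * ftrans (-\<delta>) \<delta> F w) \<le> K * exp ((B + \<epsilon>) * Im w)) \<and>
     (Im w \<le> 0 \<longrightarrow> norm (fourier_laplace a L w * ftrans (-\<delta>) \<delta> F w) \<le> K * exp ((A - \<epsilon>) * Im w))"
proof -
  have eq: "fourier_laplace a L w * ftrans (-\<delta>) \<delta> F w = ftrans (- \<epsilon> - B) (\<epsilon> - A) (conv L F) w" for w
    using conv_transform[OF L supp F z, where p = "- \<epsilon> - B" and r = "\<epsilon> - A" and w = w] AB \<delta> by (simp add: mult.commute)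
  note cc = conv_continuous[OF L F]
  obtain K where K: "K > 0" "\<And>s. s \<in> {- \<epsilon> - B..\<epsilon> - A} \<Longrightarrow> norm (conv L F s) \<le> K"
    using continuous_bounded_on_interval[OF cc, where p = "- \<epsilon> - B" and r = "\<epsilon> - A"] by blast
  have le: "- \<epsilon> - B \<le> \<epsilon> - A" using AB \<delta> by simp
  have e: "- (- \<epsilon> - B) = B + \<epsilon>" "- (\<epsilon> - A) = A - \<epsilon>" by simp_all
  show ?thesis
  proof (intro exI[of _ "K * (\<epsilon> - A - (- \<epsilon> - B))"] conjI allI impI)
    show "K * (\<epsilon> - A - (- \<epsilon> - B)) > 0" using K AB \<delta> by simp
  qed (use norm_ftrans_le[OF cc le K(2)] in \<open>simp_all only: eq e\<close>)
qed

text \<open>On the imaginary axis the integrand is nonnegative, so nothing cancels, and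
  \<open>exp (- y s) \<ge> exp (- \<delta> |y|)\<close> on the interval of integration.\<close>

lemma ftrans_bump_lower_bound:
  assumes f: "\<And>x. f x \<ge> (0::real)" "f 0 > 0" "continuous_on UNIV f" and \<delta>: "\<delta> > 0"
  shows "\<exists>b>0. \<forall>y. b * exp (- \<delta> * \<bar>y\<bar>) \<le> norm (ftrans (-\<delta>) \<delta> (\<lambda>x. of_real (f x)) (\<i> * of_real y))"
proof -
  define b where "b = integral {-\<delta>..\<delta>} f"
  have int: "f integrable_on {-\<delta>..\<delta>}" by (rule integrable_continuous_real[OF continuous_on_subset[OF f(3)]]) simp
  have b0: "b \<ge> 0" unfolding b_def by (rule integral_nonneg[OF int]) (use f(1) in auto)
  moreover have "b \<noteq> 0"
  proof
    assume "b = 0"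
    hence "f 0 = 0" unfolding b_def
      using integral_eq_0_iff[of "-\<delta>" \<delta> f] continuous_on_subset[OF f(3)] f(1) \<delta> by auto
    thus False using f(2) by simp
  qed
  ultimately have "b > 0" by simp
  moreover have "b * exp (- \<delta> * \<bar>y\<bar>) \<le> norm (ftrans (-\<delta>) \<delta> (\<lambda>x. of_real (f x)) (\<i> * of_real y))" for y
  proof -
    have c: "continuous_on {-\<delta>..\<delta>} (\<lambda>s. f s * exp (- y * s))"
      by (intro continuous_intros continuous_on_subset[OF f(3)]) auto
    have "ftrans (-\<delta>) \<delta> (\<lambda>x. of_real (f x)) (\<i> * of_real y) = integral {-\<delta>..\<delta>} (\<lambda>s. complex_of_real (f s * exp (- y * s)))"
      unfolding ftrans_def by (intro integral_cong) (simp add: exp_of_real[symmetric] mult.assoc[symmetric])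
    also have "\<dots> = of_real (integral {-\<delta>..\<delta>} (\<lambda>s. f s * exp (- y * s)))"
      using has_integral_of_real[OF integrable_integral[OF integrable_continuous_real[OF c]]]
      by (rule integral_unique)
    finally have eq: "ftrans (-\<delta>) \<delta> (\<lambda>x. of_real (f x)) (\<i> * of_real y) = of_real (integral {-\<delta>..\<delta>} (\<lambda>s. f s * exp (- y * s)))" .
    have "b * exp (- \<delta> * \<bar>y\<bar>) = integral {-\<delta>..\<delta>} (\<lambda>s. f s * exp (- \<delta> * \<bar>y\<bar>))"
      by (simp add: b_def)
    also have "\<dots> \<le> integral {-\<delta>..\<delta>} (\<lambda>s. f s * exp (- y * s))"
    proof (rule integral_le)
      show "(\<lambda>s. f s * exp (- \<delta> * \<bar>y\<bar>)) integrable_on {-\<delta>..\<delta>}" by (rule integrable_on_mult_left[OF int])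
      show "(\<lambda>s. f s * exp (- y * s)) integrable_on {-\<delta>..\<delta>}" by (rule integrable_continuous_real[OF c])
      fix s assume s: "s \<in> {-\<delta>..\<delta>}"
      have "y * s \<le> \<bar>y\<bar> * \<bar>s\<bar>" by (metis abs_ge_self abs_mult)
      also have "\<dots> \<le> \<bar>y\<bar> * \<delta>" using s by (intro mult_left_mono) auto
      finally have "- \<delta> * \<bar>y\<bar> \<le> - y * s" by (simp add: mult.commute)
      thus "f s * exp (- \<delta> * \<bar>y\<bar>) \<le> f s * exp (- y * s)" using f(1) by (intro mult_left_mono) auto
    qed
    also have "\<dots> \<le> norm (ftrans (-\<delta>) \<delta> (\<lambda>x. of_real (f x)) (\<i> * of_real y))" unfolding eq by simp
    finally show ?thesis .
  qed
  ultimately show ?thesis by blast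
qed

end

context local_convolution
begin

text \<open>A cut-off that is 1 near \<open>I k\<close> and supported inside \<open>I k1\<close>
  turns \<open>f\<close> into a function vanishing on all of \<open>J\<close>, without changing
  \<open>T f\<close>. The strict inequality \<open>c k < c k1\<close> leaves room for it. Only
  values of \<open>f\<close> on \<open>J \<inter> I k1\<close> matter, not its germs.\<close>

lemma annihilator_carried:
  assumes T: "bfunctional T q k C" and ann: "\<And>f. f \<in> vanishing_on \<omega> a c J \<Longrightarrow> T f = 0"
    and k1: "c k < c k1" and f: "f \<in> U" "\<And>x. x \<in> J \<inter> I k1 \<Longrightarrow> f x = 0"
  shows "T f = 0"
proof -
  have "I k \<subseteq> {- c k1<..<c k1}" using k1 by auto
  then obtain \<kappa> N M where \<kappa>: "\<kappa> \<in> ultra_line" "open N" "I k \<subseteq> N" "\<And>x. x \<in> N \<Longrightarrow> \<kappa> x = 1"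
    "compact M" "M \<subseteq> {- c k1<..<c k1}" "\<And>x. x \<notin> M \<Longrightarrow> \<kappa> x = 0"
    using cutoff_compact[OF compact_Icc open_greaterThanLessThan] by metis
  have g: "(\<lambda>x. \<kappa> x * f x) \<in> U" by (rule U_line_mult[OF f(1) \<kappa>(1)])
  have "\<kappa> x * f x = 0" if "x \<in> J" for x
  proof (cases "x \<in> M")
    case True
    hence "x \<in> I k1" using \<kappa>(6) by auto
    thus ?thesis using f(2) that by simp
  qed (simp add: \<kappa>(7))
  hence "T (\<lambda>x. \<kappa> x * f x) = 0" by (intro ann) (use g in \<open>simp add: vanishing_on_def\<close>)
  moreover have "T (\<lambda>x. f x - \<kappa> x * f x) = 0"
    by (rule bfunctional_local[OF T U_diff[OF f(1) g] \<kappa>(2,3)]) (simp add: \<kappa>(4))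
  ultimately show ?thesis using bfunctional_linear(3)[OF T f(1) g] by simp
qed

text \<open>The moments of \<open>T\<close> that vanish by hypothesis are, up to powers of - i, the
  derivatives of its transform below the order of each zero of the transform of
  \<open>S\<close>.\<close>

lemma annihilator_quotient:
  assumes T: "bfunctional T q k C" and ann: "\<And>j \<mu>. exp_monomial a j \<mu> \<in> W \<Longrightarrow> T (exp_monomial a j \<mu>) = 0"
  obtains \<theta> where "\<theta> holomorphic_on UNIV" "\<And>z. fourier_laplace a T z = fourier_laplace a S z * \<theta> z"
proof -
  let ?\<phi> = "fourier_laplace a S"
  obtain q0 k0 C0 where L: "bfunctional S q0 k0 C0" using S_bounded by blast
  obtain w where w: "?\<phi> w \<noteq> 0" using transform_nonzero by blast
  have van: "(deriv ^^ j) (fourier_laplace a T) z = 0" if "j < nat (zorder ?\<phi> z)" for j z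
  proof -
    have "exp_monomial a j z \<in> W" unfolding monomial_in_W_iff
      using derivatives_vanish_iff_less_zorder(1)[OF fourier_laplace_deriv(2)[OF L] w, of j z] that by simp
    thus ?thesis unfolding fourier_laplace_deriv(1)[OF T] by (simp add: ann)
  qed
  show ?thesis
    using entire_division[OF fourier_laplace_deriv(2)[OF T] fourier_laplace_deriv(2)[OF L] w] van that by metis
qed

text \<open>\<open>bounded_of_quotient\<close> is used with \<open>t = sr\<close>,
  \<open>s = sl\<close>, \<open>q = r\<close>. As \<open>sr + r = ir\<close> and
  \<open>sl + p = il\<close>, the exponents it asks of \<open>\<phi> \<theta> M\<close> are those of
  a functional carried by \<open>{il..ir}\<close>, which \<open>T\<close> is. The piece over
  \<open>{p..r}\<close> drops out of the transform of \<open>conv S F\<close> because that function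
  vanishes there.\<close>

lemma annihilator_transform_bounded:
  assumes T: "bfunctional T q k C" and Tc: "carried T {il..ir}" and ilr: "il \<le> ir"
    and \<theta>: "\<theta> holomorphic_on UNIV" "\<And>z. fourier_laplace a T z = fourier_laplace a S z * \<theta> z"
    and pr: "p = il - sl" "r = ir - sr" "p < r"
    and F: "F \<in> ultra_line" "\<And>x. x \<notin> {\<alpha>..\<beta>} \<Longrightarrow> F x = 0" "\<alpha> \<le> \<beta>"
    and R: "- R < p" "r < R" "0 < R" "- R < \<alpha> - sr" "R > \<beta> - sl" "- R < \<alpha> - ir" "R > \<beta> - il"
    and zero: "\<And>s. s \<in> {p..r} \<Longrightarrow> conv S F s = 0"
  shows "\<exists>D. \<forall>z. norm (ftrans 0 R (conv T F) z - \<theta> z * ftrans r R (conv S F) z) \<le> D"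
proof -
  obtain q0 k0 C0 where L: "bfunctional S q0 k0 C0" using S_bounded by blast
  let ?\<phi> = "fourier_laplace a S"
  note cT = conv_continuous[OF T F(1)] and cS = conv_continuous[OF L F(1)]
  obtain K1 where K1: "K1 > 0" "\<And>s. s \<in> {-R..R} \<Longrightarrow> norm (conv T F s) \<le> K1"
    using continuous_bounded_on_interval[OF cT, where p = "- R" and r = R] by blast
  obtain K2 where K2: "K2 > 0" "\<And>s. s \<in> {-R..R} \<Longrightarrow> norm (conv S F s) \<le> K2"
    using continuous_bounded_on_interval[OF cS, where p = "- R" and r = R] by blast
  define D where "D = (K1 + K2) * (2 * R)"
  have D: "D > 0" using K1 K2 R by (simp add: D_def)
  have mD: "u * l \<le> D" if "0 \<le> u" "u \<le> K1 + K2" "0 \<le> l" "l \<le> 2 * R" for u l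
    unfolding D_def by (rule mult_mono) (use that K1 K2 in auto)
  show ?thesis
  proof (rule bounded_of_quotient[where \<phi> = ?\<phi> and \<theta> = \<theta> and p = p and q = r and s = sl and t = sr and ?C0.0 = D
        and hm = "ftrans (-R) 0 (conv T F)" and gm = "ftrans (-R) p (conv S F)"])
    show "?\<phi> holomorphic_on UNIV" by (rule fourier_laplace_deriv(2)[OF L])
    show "\<theta> holomorphic_on UNIV" by (rule \<theta>(1))
    show "ftrans 0 R (conv T F) holomorphic_on UNIV" "ftrans r R (conv S F) holomorphic_on UNIV"
      by (rule ftrans_holomorphic[OF cT] ftrans_holomorphic[OF cS])+
    show "p < r" "D > 0" by (fact pr D)+
    show "\<exists>y>0. E * exp ((sr - \<delta>) * y) < norm (?\<phi> (\<i> * of_real y))" if "\<delta> > 0" for \<delta> E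
      by (rule transform_indicator(1)[OF that])
    show "\<exists>y>0. E * exp ((- sl - \<delta>) * y) < norm (?\<phi> (- (\<i> * of_real y)))" if "\<delta> > 0" for \<delta> E
      by (rule transform_indicator(2)[OF that])
    fix z
    show "ftrans 0 R (conv T F) z + ftrans (- R) 0 (conv T F) z = \<theta> z * (ftrans r R (conv S F) z + ftrans (- R) p (conv S F) z)"
    proof -
      have "ftrans (- R) 0 (conv T F) z + ftrans 0 R (conv T F) z = ftrans (- R) R (conv T F) z"
        by (rule ftrans_combine[OF cT, symmetric]) (use R in auto)
      also have "\<dots> = ftrans \<alpha> \<beta> F z * fourier_laplace a T z"
        by (rule conv_transform[OF T Tc F(1,2,3) ilr R(6,7)])
      also have "\<dots> = \<theta> z * (ftrans \<alpha> \<beta> F z * ?\<phi> z)" by (simp add: \<theta>(2))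
      also have "ftrans \<alpha> \<beta> F z * ?\<phi> z = ftrans (- R) R (conv S F) z"
        by (rule conv_transform[OF L S_carried' F(1,2,3) sl_sr(4) R(4,5), symmetric])
      also have "\<dots> = ftrans (- R) p (conv S F) z + ftrans p R (conv S F) z"
        by (rule ftrans_combine[OF cS]) (use R pr in auto)
      also have "ftrans p R (conv S F) z = ftrans p r (conv S F) z + ftrans r R (conv S F) z"
        by (rule ftrans_combine[OF cS]) (use R pr in auto)
      also have "ftrans p r (conv S F) z = 0" by (rule ftrans_zero[OF zero])
      finally show ?thesis by (simp add: add.commute)
    qed
    show "norm (ftrans 0 R (conv T F) z) \<le> D" if z: "Im z \<ge> 0"
    proof -
      have "norm (ftrans 0 R (conv T F) z) \<le> K1 * (R - 0) * exp (- 0 * Im z)"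
        by (rule norm_ftrans_le(1)[OF cT _ _ z]) (use R K1 in auto)
      also have "\<dots> = K1 * R" by simp
      also have "\<dots> \<le> D" by (rule mD) (use K1 K2 R in auto)
      finally show ?thesis .
    qed
    show "norm (ftrans r R (conv S F) z) \<le> D * exp (- r * Im z)" if z: "Im z \<ge> 0"
    proof -
      have "norm (ftrans r R (conv S F) z) \<le> K2 * (R - r) * exp (- r * Im z)"
        by (rule norm_ftrans_le(1)[OF cS _ _ z]) (use R K2 pr in auto)
      also have "\<dots> \<le> D * exp (- r * Im z)"
        by (rule mult_right_mono[OF mD]) (use K1 K2 R pr in auto)
      finally show ?thesis .
    qed
    show "norm (ftrans (- R) 0 (conv T F) z) \<le> D" if z: "Im z \<le> 0"
    proof -
      have "norm (ftrans (- R) 0 (conv T F) z) \<le> K1 * (0 - (- R)) * exp (- 0 * Im z)"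
        by (rule norm_ftrans_le(2)[OF cT _ _ z]) (use R K1 in auto)
      also have "\<dots> = K1 * R" by simp
      also have "\<dots> \<le> D" by (rule mD) (use K1 K2 R in auto)
      finally show ?thesis .
    qed
    show "norm (ftrans (- R) p (conv S F) z) \<le> D * exp (- p * Im z)" if z: "Im z \<le> 0"
    proof -
      have "norm (ftrans (- R) p (conv S F) z) \<le> K2 * (p - (- R)) * exp (- p * Im z)"
        by (rule norm_ftrans_le(2)[OF cS _ _ z]) (use R K2 pr in auto)
      also have "\<dots> \<le> D * exp (- p * Im z)"
        by (rule mult_right_mono[OF mD]) (use K1 K2 R pr in auto)
      finally show ?thesis .
    qed
  next
    fix \<delta> :: real assume \<delta>: "\<delta> > 0"
    have \<delta>2: "\<delta> / 2 > 0" "\<delta> / 2 < \<delta>" using \<delta> by auto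
    \<comment> \<open>Radius \<open>\<delta> / 2\<close>, because
      \<open>transform_multiplier_bounds\<close> loses strictly more than the radius of the bump,
      and only \<open>\<delta>\<close> may be lost.\<close>
    obtain f :: "real \<Rightarrow> real" where f: "\<And>x. f x \<ge> 0" "\<And>x. \<bar>x\<bar> \<ge> \<delta> / 2 \<Longrightarrow> f x = 0" "f 0 > 0"
      "continuous_on UNIV f" "(\<lambda>x. of_real (f x)) \<in> ultra_line" using bump_exists[OF \<delta>2(1)] by metis
    let ?B = "\<lambda>x. complex_of_real (f x)"
    have Bz: "?B x = 0" if "x \<notin> {- (\<delta> / 2)..\<delta> / 2}" for x using that by (intro of_real_eq_0_iff[THEN iffD2] f(2)) auto
    define M where "M = ftrans (- (\<delta> / 2)) (\<delta> / 2) ?B"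
    obtain b where b: "b > 0" "\<And>y. b * exp (- (\<delta> / 2) * \<bar>y\<bar>) \<le> norm (M (\<i> * of_real y))"
      using ftrans_bump_lower_bound[OF f(1,3,4) \<delta>2(1)] unfolding M_def by blast
    obtain E1 where E1: "E1 > 0"
      "\<And>w. Im w \<ge> 0 \<Longrightarrow> norm (?\<phi> w * M w) \<le> E1 * exp ((sr + \<delta>) * Im w)"
      "\<And>w. Im w \<le> 0 \<Longrightarrow> norm (?\<phi> w * M w) \<le> E1 * exp ((sl - \<delta>) * Im w)"
      using transform_multiplier_bounds[OF L S_carried' sl_sr(4) f(5) Bz \<delta>2] unfolding M_def by blast
    obtain E2 where E2: "E2 > 0"
      "\<And>w. Im w \<ge> 0 \<Longrightarrow> norm (fourier_laplace a T w * M w) \<le> E2 * exp ((ir + \<delta>) * Im w)"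
      "\<And>w. Im w \<le> 0 \<Longrightarrow> norm (fourier_laplace a T w * M w) \<le> E2 * exp ((il - \<delta>) * Im w)"
      using transform_multiplier_bounds[OF T Tc ilr f(5) Bz \<delta>2] unfolding M_def by blast
    define E where "E = E1 + E2 + 1 / b"
    have E: "E > 0" "E1 \<le> E" "E2 \<le> E" "1 / b \<le> E" 
      using E1(1) E2(1) divide_pos_pos[OF zero_less_one b(1)] unfolding E_def by linarith+
    have srr: "sr + r + \<delta> = ir + \<delta>" "sl + p - \<delta> = il - \<delta>" using pr by simp_all
    have up: "u \<le> E * exp x" if "u \<le> E' * exp x" "E' \<le> E" for u E' x
      by (rule order_trans[OF that(1)]) (use that(2) in \<open>simp add: mult_right_mono\<close>)
    show "\<exists>M C. M holomorphic_on UNIV \<and> C > 0 \<and>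
       (\<forall>y. exp (- \<delta> * \<bar>y\<bar>) \<le> C * norm (M (\<i> * of_real y))) \<and>
       (\<forall>z. Im z \<ge> 0 \<longrightarrow> norm (?\<phi> z * M z) \<le> C * exp ((sr + \<delta>) * Im z) \<and>
                         norm (?\<phi> z * \<theta> z * M z) \<le> C * exp ((sr + r + \<delta>) * Im z)) \<and>
       (\<forall>z. Im z \<le> 0 \<longrightarrow> norm (?\<phi> z * M z) \<le> C * exp ((sl - \<delta>) * Im z) \<and>
                         norm (?\<phi> z * \<theta> z * M z) \<le> C * exp ((sl + p - \<delta>) * Im z))"
      unfolding srr \<theta>(2)[symmetric]
    proof (intro exI[of _ M] exI[of _ E] conjI allI impI)
      show "M holomorphic_on UNIV" unfolding M_def by (rule ftrans_holomorphic[OF line_continuous[OF f(5)]])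
      show "exp (- \<delta> * \<bar>y\<bar>) \<le> E * norm (M (\<i> * of_real y))" for y
      proof -
        have "\<delta> / 2 * \<bar>y\<bar> \<le> \<delta> * \<bar>y\<bar>" using \<delta> by (intro mult_right_mono) auto
        hence "exp (- \<delta> * \<bar>y\<bar>) \<le> exp (- (\<delta> / 2) * \<bar>y\<bar>)" by simp
        also have "\<dots> = (1 / b) * (b * exp (- (\<delta> / 2) * \<bar>y\<bar>))" using b(1) by simp
        also have "\<dots> \<le> E * norm (M (\<i> * of_real y))"
          by (rule mult_mono[OF E(4) b(2)]) (use E(1) b(1) in auto)
        finally show ?thesis .
      qed
      show "norm (?\<phi> z * M z) \<le> E * exp ((sr + \<delta>) * Im z)" if "Im z \<ge> 0" for z
        by (rule up[OF E1(2)[OF that] E(2)])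
      show "norm (fourier_laplace a T z * M z) \<le> E * exp ((ir + \<delta>) * Im z)" if "Im z \<ge> 0" for z
        by (rule up[OF E2(2)[OF that] E(3)])
      show "norm (?\<phi> z * M z) \<le> E * exp ((sl - \<delta>) * Im z)" if "Im z \<le> 0" for z
        by (rule up[OF E1(3)[OF that] E(2)])
      show "norm (fourier_laplace a T z * M z) \<le> E * exp ((il - \<delta>) * Im z)" if "Im z \<le> 0" for z
        by (rule up[OF E2(3)[OF that] E(3)])
    qed (rule E(1))
  qed
qed

lemma annihilator_kills_W:
  assumes T: "bfunctional T q k C" and ann_exp: "\<And>j \<mu>. exp_monomial a j \<mu> \<in> W \<Longrightarrow> T (exp_monomial a j \<mu>) = 0"
    and ann_van: "\<And>f. f \<in> vanishing_on \<omega> a c J \<Longrightarrow> T f = 0" and f: "f \<in> W"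
  shows "T f = 0"
proof -
  obtain q0 k0 C0 where L: "bfunctional S q0 k0 C0" using S_bounded by blast
  have fU: "f \<in> U" using f by (simp add: W_iff)
  obtain \<theta> where \<theta>: "\<theta> holomorphic_on UNIV" "\<And>z. fourier_laplace a T z = fourier_laplace a S z * \<theta> z"
    using annihilator_quotient[OF T ann_exp] by metis
  obtain y1 y2 where y: "y1 \<in> G" "y2 \<in> G" "y1 < y2" using G_two unfolding G_eq by blast
  have yJ: "y1 + sl \<in> J" "y1 + sr \<in> J" "y2 + sl \<in> J" "y2 + sr \<in> J" using y by (auto simp: G_iff')
  \<comment> \<open>\<open>k1\<close> must give \<open>c k < c k1\<close> for the cut-off, and
    \<open>I k1\<close> must contain the hull of the support moved by \<open>y1\<close> and by
    \<open>y2\<close>; the latter yields \<open>p \<le> y1 < y2 \<le> r\<close>.\<close>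
  have "{c k, y1 + sl, y1 + sr, y2 + sl, y2 + sr} \<subseteq> X" using yJ J_X I_subset[of k] c_pos[of k] by auto
  then obtain k1 where "{c k, y1 + sl, y1 + sr, y2 + sl, y2 + sr} \<subseteq> {- c k1<..<c k1}"
    using compact_in_I[of "{c k, y1 + sl, y1 + sr, y2 + sl, y2 + sr}"] by (auto simp: finite_imp_compact)
  hence k1: "c k < c k1" "y1 + sl \<in> I k1" "y1 + sr \<in> I k1" "y2 + sl \<in> I k1" "y2 + sr \<in> I k1" by auto
  obtain J0 where J0: "closed J0" "J = X \<inter> J0" using J by (auto simp: rel_closed_interval_def closedin_closed)
  have "J \<inter> I k1 = J0 \<inter> I k1" using J0(2) I_subset[of k1] by auto
  hence "compact (J \<inter> I k1)" using closed_Int_compact[OF J0(1) compact_Icc] by simp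
  moreover have "connected (J \<inter> I k1)"
    using J by (intro is_interval_connected is_interval_Int) (auto simp: rel_closed_interval_def)
  ultimately obtain il ir where il_ir: "J \<inter> I k1 = {il..ir}" using connected_compact_interval_1 by blast
  have mem: "x \<in> {il..ir} \<longleftrightarrow> x \<in> J \<and> x \<in> I k1" for x using il_ir by blast
  have yi: "y1 + sl \<in> {il..ir}" "y1 + sr \<in> {il..ir}" "y2 + sl \<in> {il..ir}" "y2 + sr \<in> {il..ir}"
    using yJ k1 mem by blast+
  hence le: "il \<le> ir" by simp
  define p where "p = il - sl"
  define r where "r = ir - sr"
  have pr: "p \<le> y1" "y2 \<le> r" "p < r" using yi y(3) by (auto simp: p_def r_def)
  have sub: "{s + sl..s + sr} \<subseteq> {il..ir}" if "s \<in> {p..r}" for s using that by (auto simp: p_def r_def)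
  have inG: "s \<in> G" if "s \<in> {p..r}" for s using sub[OF that] mem unfolding G_iff by blast
  have ilX: "{il..ir} \<subseteq> X" using mem J_X by blast
  obtain F N M where F: "F \<in> ultra_line" "open N" "{il..ir} \<subseteq> N" "\<And>x. x \<in> N \<Longrightarrow> F x = f x" "compact M" "M \<subseteq> X" "\<And>x. x \<notin> M \<Longrightarrow> F x = 0"
    using localize[OF fU compact_Icc ilX] by metis
  obtain k2 where k2: "M \<subseteq> {- c k2<..<c k2}" using compact_in_I[OF F(5,6)] by blast
  define \<alpha> where "\<alpha> = - c k2"
  define \<beta> where "\<beta> = c k2"
  have \<alpha>\<beta>: "\<alpha> \<le> \<beta>" using c_pos[of k2] by (simp add: \<alpha>_def \<beta>_def)
  have F0: "F x = 0" if "x \<notin> {\<alpha>..\<beta>}" for x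
  proof (rule F(7))
    show "x \<notin> M" using subsetD[OF k2, of x] that by (auto simp: \<alpha>_def \<beta>_def)
  qed
  have Tc: "carried T {il..ir}" unfolding carried_def
  proof (intro ballI allI impI)
    fix g V assume g: "g \<in> U" "open V \<and> {il..ir} \<subseteq> V \<and> (\<forall>x\<in>V. g x = 0)"
    show "T g = 0"
    proof (rule annihilator_carried[OF T ann_van k1(1) g(1)])
      fix x assume "x \<in> J \<inter> I k1"
      hence "x \<in> V" using g(2) unfolding il_ir by blast
      thus "g x = 0" using g(2) by blast
    qed
  qed
  \<comment> \<open>\<open>f\<close> and its cut-off agree on \<open>J \<inter> I k1\<close>, and by
    \<open>annihilator_carried\<close> that is all \<open>T\<close> sees.\<close>
  have Tf: "T f = conv T F 0"
  proof -
    have FU: "ext_zero a F \<in> U" by (rule ext_zero_line[OF F(1)])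
    have "T (\<lambda>x. f x - ext_zero a F x) = 0"
    proof (rule annihilator_carried[OF T ann_van k1(1) U_diff[OF fU FU]])
      fix x assume "x \<in> J \<inter> I k1"
      hence "x \<in> {il..ir}" using mem by blast
      hence "x \<in> N" "x \<in> X" using F(3) ilX by blast+
      thus "f x - ext_zero a F x = 0" by (simp add: ext_zero_def F(4))
    qed
    thus ?thesis using bfunctional_linear(3)[OF T fU FU] by (simp add: conv_def)
  qed
  define F1 where "F1 = nderiv 1 F"
  define F2 where "F2 = nderiv 1 F1"
  have FU: "F1 \<in> ultra_line" "F2 \<in> ultra_line" unfolding F2_def F1_def by (intro ultra_line_nderiv1 F(1))+
  have F10: "F1 x = 0" if "x \<notin> {\<alpha>..\<beta>}" for x unfolding F1_def by (rule nderiv1_zero_outside[OF F0 that])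
  have F20: "F2 x = 0" if "x \<notin> {\<alpha>..\<beta>}" for x unfolding F2_def by (rule nderiv1_zero_outside[OF F10 that])
  have dT: "(conv T F has_vector_derivative conv T F1 s) (at s)" "(conv T F1 has_vector_derivative conv T F2 s) (at s)" for s
    unfolding F2_def using conv_derivative[OF T F(1)] conv_derivative[OF T FU(1)] by (simp_all add: F1_def)
  have dS: "(conv S F has_vector_derivative conv S F1 s) (at s)" "(conv S F1 has_vector_derivative conv S F2 s) (at s)" for s
    unfolding F2_def using conv_derivative[OF L F(1)] conv_derivative[OF L FU(1)] by (simp_all add: F1_def)
  have zero: "conv S F s = 0" if "s \<in> {p..r}" for s
  proof -
    have "local_conv \<omega> a c S f s = conv S F s"
      by (rule local_conv_eq[OF F(1,2) order_trans[OF sub[OF that] F(3)] F(4)])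
    thus ?thesis using f inG[OF that] by (simp add: W_iff)
  qed
  have zero1: "conv S F1 s = 0" if "s \<in> {p..r}" for s
    by (rule vector_derivative_zero_on_interval[OF dS(1) zero pr(3) that])
  have zero2: "conv S F2 s = 0" if "s \<in> {p..r}" for s
    by (rule vector_derivative_zero_on_interval[OF dS(2) zero1 pr(3) that])
  define R where "R = \<bar>\<alpha>\<bar> + \<bar>\<beta>\<bar> + \<bar>p\<bar> + \<bar>r\<bar> + \<bar>sl\<bar> + \<bar>sr\<bar> + \<bar>il\<bar> + \<bar>ir\<bar> + 1"
  have R: "- R < p" "r < R" "0 < R" "- R < \<alpha> - sr" "R > \<beta> - sl" "- R < \<alpha> - ir" "R > \<beta> - il" by (auto simp: R_def)
  define E where "E H z = ftrans 0 R (conv T H) z - \<theta> z * ftrans r R (conv S H) z" for H z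
  obtain D0 where D0: "\<And>z. norm (E F z) \<le> D0" unfolding E_def
    using annihilator_transform_bounded[OF T Tc le \<theta> p_def r_def pr(3) F(1) F0 \<alpha>\<beta> R zero] by blast
  obtain D1 where D1: "\<And>z. norm (E F1 z) \<le> D1" unfolding E_def
    using annihilator_transform_bounded[OF T Tc le \<theta> p_def r_def pr(3) FU(1) F10 \<alpha>\<beta> R zero1] by blast
  obtain D2 where D2: "\<And>z. norm (E F2 z) \<le> D2" unfolding E_def
    using annihilator_transform_bounded[OF T Tc le \<theta> p_def r_def pr(3) FU(2) F20 \<alpha>\<beta> R zero2] by blast
  have hol: "E H holomorphic_on UNIV" if "H \<in> ultra_line" for H unfolding E_def
    by (intro holomorphic_intros \<theta>(1) ftrans_holomorphic conv_continuous[OF T that] conv_continuous[OF L that])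
  \<comment> \<open>Integration by parts on both half lines. At \<open>R\<close> the boundary terms
    vanish by the supports, at \<open>r\<close> because \<open>conv S H\<close> is 0 there; only the
    term of \<open>conv T H\<close> at 0 is left.\<close>
  have step: "E H' z = - conv T H 0 + - \<i> * z * E H z"
    if d: "\<And>s. (conv T H has_vector_derivative conv T H' s) (at s)" "\<And>s. (conv S H has_vector_derivative conv S H' s) (at s)"
      and H: "H \<in> ultra_line" "H' \<in> ultra_line" and H0: "\<And>x. x \<notin> {\<alpha>..\<beta>} \<Longrightarrow> H x = 0" and Hr: "conv S H r = 0" for H H' z
  proof -
    have "conv T H R = 0" by (rule conv_zero[OF Tc H(1) H0 disjI2[OF R(7)]])
    hence 1: "ftrans 0 R (conv T H') z = - conv T H 0 - \<i> * z * ftrans 0 R (conv T H) z"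
      using ftrans_parts[OF d(1) conv_continuous[OF T H(2)], of 0 R z] R by simp
    have "conv S H R = 0" by (rule conv_zero[OF S_carried' H(1) H0 disjI2[OF R(5)]])
    hence 2: "ftrans r R (conv S H') z = - (\<i> * z * ftrans r R (conv S H) z)"
      using ftrans_parts[OF d(2) conv_continuous[OF L H(2)], of r R z] R Hr by simp
    show ?thesis unfolding E_def 1 2 by (simp add: algebra_simps)
  qed
  have "- conv T F 0 = 0"
  proof (rule bounded_chain_imp_zero[OF hol[OF F(1)] hol[OF FU(1)] _ D0 D1 D2])
    show "- \<i> \<noteq> 0" by simp
    show "E F1 z = - conv T F 0 + - \<i> * z * E F z" for z
      by (rule step[OF dT(1) dS(1) F(1) FU(1) F0 zero]) (use pr in auto)
    show "E F2 z = - conv T F1 0 + - \<i> * z * E F1 z" for z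
      by (rule step[OF dT(2) dS(2) FU(1) FU(2) F10 zero1]) (use pr in auto)
  qed
  thus ?thesis using Tf by simp
qed

lemma W_synthesis: "weak_spectral_synthesis \<omega> a c W"
proof -
  let ?M = "{f + g | f g. f \<in> cfun_span (Exp_of a W) \<and> g \<in> vanishing_on \<omega> a c J}"
  have van: "cfun_subspace (vanishing_on \<omega> a c J)"
    unfolding cfun.subspace_def vanishing_on_def using U_fun_ops by (auto simp: cscale_def)
  have ExpW: "cfun_span (Exp_of a W) \<subseteq> W"
    by (rule cfun.span_minimal[OF _ W_subspace]) (auto simp: Exp_of_def)
  have MW: "?M \<subseteq> W" using ExpW vanishing_subset_W W_subspace by (auto simp: cfun.subspace_def)
  have Msub: "cfun_subspace ?M" by (rule cfun.subspace_sums[OF cfun.subspace_span van])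
  have "W = ultratop \<omega> a c closure_of ?M"
  proof
    show "ultratop \<omega> a c closure_of ?M \<subseteq> W" using closure_of_mono[OF MW] W_closure by blast
    show "W \<subseteq> ultratop \<omega> a c closure_of ?M"
    proof
      fix f assume f: "f \<in> W"
      show "f \<in> ultratop \<omega> a c closure_of ?M"
      proof (rule closure_if_annihilated[OF Msub])
        show "?M \<subseteq> U" by (rule order_trans[OF MW]) (auto simp: W_iff)
        show "f \<in> U" using f by (simp add: W_iff)
        fix T q k C assume T: "bfunctional T q k C" and ann: "\<And>m. m \<in> ?M \<Longrightarrow> T m = 0"
        show "T f = 0"
        proof (rule annihilator_kills_W[OF T _ _ f])
          fix j \<mu> assume "exp_monomial a j \<mu> \<in> W"
          hence "exp_monomial a j \<mu> \<in> cfun_span (Exp_of a W)" by (intro cfun.span_base) (auto simp: Exp_of_def)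
          moreover have "0 \<in> vanishing_on \<omega> a c J" using cfun.subspace_0[OF van] .
          moreover have "exp_monomial a j \<mu> = exp_monomial a j \<mu> + 0" by simp
          ultimately have "exp_monomial a j \<mu> \<in> ?M" by blast
          thus "T (exp_monomial a j \<mu>) = 0" by (rule ann)
        next
          fix g assume g: "g \<in> vanishing_on \<omega> a c J"
          have "g = 0 + g" by simp
          hence "g \<in> ?M" using g cfun.span_zero by blast
          thus "T g = 0" by (rule ann)
        qed
      qed
    qed
  qed
  thus ?thesis unfolding weak_spectral_synthesis_def W_residual(2) .
qed

end

section \<open>The theorem\<close>

text \<open>The conditions that \<open>S\<close> is nonzero and that the geometric difference is not
  a single point exclude genuine failures. For \<open>S = 0\<close> the kernel is the whole space,
  whose residual interval is empty whatever \<open>I\<close> is. For the point evaluation at 0 and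
  \<open>I = {0}\<close> the geometric difference is \<open>{0}\<close>, and the kernel consists of
  the \<open>f\<close> with \<open>f 0 = 0\<close>, which is not invariant under
  differentiation.\<close>

theorem corollary3p5:
  fixes \<omega> :: "real \<Rightarrow> real" and a :: ereal and c :: "nat \<Rightarrow> real"
    and S :: "(real \<Rightarrow> complex) \<Rightarrow> complex" and I :: "real set"
  assumes "weight \<omega>" and "0 < a" and "exhausting a c"
    and "S \<in> ultradual \<omega> a c" and "\<exists>f\<in>ultradiff \<omega> a c. S f \<noteq> 0"
    and "rel_closed_interval a I"
    and "geom_diff I (ch_supp \<omega> a c S) \<noteq> {}"
    and "\<not> is_singleton (geom_diff I (ch_supp \<omega> a c S))"
  defines "W \<equiv> local_conv_kernel \<omega> a c S I"
  shows "D_invariant \<omega> a c W \<and> weak_spectral_synthesis \<omega> a c W \<and>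
         is_residual_interval \<omega> a c W I \<and> residual_interval \<omega> a c W = I \<and>
         exponents a W (zero_set (fourier_laplace a S))"
proof -
  have "\<exists>y1\<in>geom_diff I (ch_supp \<omega> a c S). \<exists>y2\<in>geom_diff I (ch_supp \<omega> a c S). y1 < y2"
  proof -
    obtain y where y: "y \<in> geom_diff I (ch_supp \<omega> a c S)" using assms(7) by blast
    obtain y' where y': "y' \<in> geom_diff I (ch_supp \<omega> a c S)" "y' \<noteq> y"
    proof -
      have "geom_diff I (ch_supp \<omega> a c S) \<noteq> {y}" using assms(8) by (auto simp: is_singleton_def)
      thus ?thesis using y that by blast
    qed
    show ?thesis using y y' by (cases "y < y'") (auto simp: not_less order.order_iff_strict)
  qed
  then interpret local_convolution \<omega> a c S I
    by unfold_locales (use assms in auto)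
  show ?thesis unfolding W_def
    using W_invariant W_synthesis W_residual W_exponents by blast
qed

end
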